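(* Let $E$ be a number field and let $M$ be a Betti--de Rham system of realizations over $\mathbb{Q}$ of rank $2n$ over $E$, with coefficients in $E$. If the weight of $M$ is even, assume $M$ has vanishing middle Hodge number. Let $L$ be a rank-one system over $\mathbb{Q}$ with coefficients in $E$, and suppose $M$ is equipped with one of the following structures: (symplectic case) a nondegenerate alternating $E$-bilinear morphism of systems $B:M\otimes_E M\to L$; (orthogonal case) a nondegenerate symmetric $E$-bilinear morphism of systems $B:M\otimes_E M\to L$, together with an isomorphism of $\det(M)\otimes_E L^{\otimes -n}$ with the unit object (with coefficients in $E$) whose tensor square is the trivialization of $(\det(M)\otimes L^{\otimes-n})^{\otimes2}$ induced by $\det(B):\det(M)^{\otimes 2}\to L^{\otimes 2n}$. Assume the multiplier of $\mathsf{F}_\infty$ is $1$, i.e. $\mathsf{F}_\infty$ acts trivially on $L_{\mathrm B}$. Then $c^+_E(M)=c^-_E(M)$ in $(E\otimes\mathbb{C})^*/E^*$.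
   Context: A Betti--de Rham system $N$ over $\mathbb{Q}$ of weight $w$ with coefficients in $E$ consists of: - a finite-dimensional $E$-vector space $N_{\mathrm B}$ with $E$-linear involution $\mathsf{F}_\infty$ and eigenspaces $N^\pm$; - a finite-dimensional $E$-vector space $N_{\mathrm{dR}}$ with a finite decreasing filtration $\mathcal{F}$; - an $E\otimes\mathbb{C}$-linear isomorphism $N_{\mathrm B}\otimes_{\mathbb{Q}}\mathbb{C}\to N_{\mathrm{dR}}\otimes_{\mathbb{Q}}\mathbb{C}$ carrying $\mathsf{F}_\infty\circ(\text{complex conjugation})$ to complex conjugation, such that $N_{\mathrm B}\otimes\mathbb{C}=\bigoplus_{p+q=w}N^{p,q}$ with $N^{p,q}=\mathcal{F}^p\cap\overline{\mathcal{F}}^q$. Morphisms, tensor products over $E$, exterior powers (so $\det(M)=\wedge^{2n}_E M$) and duals are defined componentwise; the unit object has both realizations equal to $E$, trivial $\mathsf{F}_\infty$, and filtration concentrated in degree $0$. Nondegeneracy of $B$ refers to its Betti realization. Vanishing middle Hodge number: $w$ odd, or $w=2k$ with $N^{k,k}=0$. In that case $c^\pm_E(N)$ is the determinant, in $E$-bases, of the isomorphism $N^\pm\otimes\mathbb{C}\to(N_{\mathrm{dR}}/\mathcal{F}^{\lfloor w/2\rfloor+1})\otimes\mathbb{C}$ induced by the comparison, well defined in $(E\otimes\mathbb{C})^*/E^*$.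
   Formalization: A morphism of systems is also required to respect weight (it is zero between systems of different weights), so that a nonzero form B forces L to have twice the weight of M; with mismatched weights the claim can fail. *)

theory Defs
  imports "Jordan_Normal_Form.VS_Connect" "HOL-Algebra.AbelCoset" "HOL-Library.Poly_Mapping"
begin

section \<open>Number fields\<close>

class number_field = field_char_0 +
  assumes finite_over_rat:
    "\<exists>B. finite B \<and> (\<forall>x. \<exists>c :: 'a \<Rightarrow> rat. x = (\<Sum>b\<in>B. of_rat (c b) * b))"

section \<open>Modules by generators and relations\<close>

text \<open>A vector space over a field \<open>'k\<close> is a HOL-Algebra module record over \<^const>\<open>class_ring\<close>.
  The ring multiplication and unit of a module record play no role.\<close>

definition scalar_mod :: "('k :: field, 'k) module" where
  "scalar_mod = \<lparr>carrier = UNIV, monoid.mult = (*), one = 1, zero = 0, add = (+), smult = (*)\<rparr>"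

definition restrict_scalars :: "('q \<Rightarrow> 'k) \<Rightarrow> ('k, 'v) module \<Rightarrow> ('q, 'v) module" where
  "restrict_scalars h V = \<lparr>carrier = carrier V, monoid.mult = undefined, one = undefined,
     zero = \<zero>\<^bsub>V\<^esub>, add = add V, smult = (\<lambda>c. smult V (h c))\<rparr>"

definition quot_mod :: "('k, 'v) module \<Rightarrow> 'v set \<Rightarrow> ('k, 'v set) module" where
  "quot_mod V W = \<lparr>carrier = a_rcosets\<^bsub>V\<^esub> W, monoid.mult = undefined, one = undefined,
     zero = W, add = set_add V, smult = (\<lambda>c X. \<Union>x\<in>X. W +>\<^bsub>V\<^esub> (c \<odot>\<^bsub>V\<^esub> x))\<rparr>"

definition free_mod :: "'g set \<Rightarrow> ('k :: field, 'g \<Rightarrow>\<^sub>0 'k) module" where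
  "free_mod G = \<lparr>carrier = {p. Poly_Mapping.keys p \<subseteq> G}, monoid.mult = undefined, one = undefined,
     zero = 0, add = (+), smult = (\<lambda>c. Poly_Mapping.map ((*) c))\<rparr>"

definition rel_span :: "'g set \<Rightarrow> ('g \<Rightarrow>\<^sub>0 'k :: field) set \<Rightarrow> ('g \<Rightarrow>\<^sub>0 'k) set" where
  "rel_span G R = LinearCombinations.module.span class_ring (free_mod G) R"

definition presented_mod ::
  "'g set \<Rightarrow> ('g \<Rightarrow>\<^sub>0 'k :: field) set \<Rightarrow> ('k, ('g \<Rightarrow>\<^sub>0 'k) set) module" where
  "presented_mod G R = quot_mod (free_mod G) (rel_span G R)"

definition generator ::
  "'g set \<Rightarrow> ('g \<Rightarrow>\<^sub>0 'k :: field) set \<Rightarrow> 'g \<Rightarrow> ('g \<Rightarrow>\<^sub>0 'k) set" where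
  "generator G R g = rel_span G R +>\<^bsub>free_mod G\<^esub> Poly_Mapping.single g 1"

text \<open>The linear map into \<open>N\<close>, defined on a module given by generators and relations, with
  prescribed values \<open>f\<close> on the generators.  It does not depend on the representative \<open>p\<close> of the
  class \<open>X\<close> as soon as \<open>f\<close> respects the relations, which is the case in every use below.\<close>

definition extend_lin ::
  "('k :: field, 'n) module \<Rightarrow> ('g \<Rightarrow> 'n) \<Rightarrow> ('g \<Rightarrow>\<^sub>0 'k) set \<Rightarrow> 'n" where
  "extend_lin N f X = (let p = (SOME p. p \<in> X) in
     \<Oplus>\<^bsub>N\<^esub>g\<in>Poly_Mapping.keys p. Poly_Mapping.lookup p g \<odot>\<^bsub>N\<^esub> f g)"

subsection \<open>Tensor products of two spaces\<close>

definition bilinear_rels ::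
  "('k :: field, 'v) module \<Rightarrow> ('k, 'w) module \<Rightarrow> ('v \<times> 'w \<Rightarrow>\<^sub>0 'k) set" where
  "bilinear_rels V W =
     {Poly_Mapping.single (x \<oplus>\<^bsub>V\<^esub> x', y) 1 - Poly_Mapping.single (x, y) 1 - Poly_Mapping.single (x', y) 1
        | x x' y. x \<in> carrier V \<and> x' \<in> carrier V \<and> y \<in> carrier W}
   \<union> {Poly_Mapping.single (x, y \<oplus>\<^bsub>W\<^esub> y') 1 - Poly_Mapping.single (x, y) 1 - Poly_Mapping.single (x, y') 1
        | x y y'. x \<in> carrier V \<and> y \<in> carrier W \<and> y' \<in> carrier W}
   \<union> {Poly_Mapping.single (c \<odot>\<^bsub>V\<^esub> x, y) 1 - Poly_Mapping.single (x, y) c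
        | c x y. x \<in> carrier V \<and> y \<in> carrier W}
   \<union> {Poly_Mapping.single (x, c \<odot>\<^bsub>W\<^esub> y) 1 - Poly_Mapping.single (x, y) c
        | c x y. x \<in> carrier V \<and> y \<in> carrier W}"

definition tensor_mod ::
  "('k :: field, 'v) module \<Rightarrow> ('k, 'w) module \<Rightarrow> ('k, ('v \<times> 'w \<Rightarrow>\<^sub>0 'k) set) module" where
  "tensor_mod V W = presented_mod (carrier V \<times> carrier W) (bilinear_rels V W)"

definition tensor_elt ::
  "('k :: field, 'v) module \<Rightarrow> ('k, 'w) module \<Rightarrow> 'v \<Rightarrow> 'w \<Rightarrow> ('v \<times> 'w \<Rightarrow>\<^sub>0 'k) set" where
  "tensor_elt V W x y = generator (carrier V \<times> carrier W) (bilinear_rels V W) (x, y)"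

text \<open>\<open>f \<otimes> g\<close>, with target \<open>V \<otimes> W\<close>.\<close>

definition tensor_map ::
  "('k :: field, 'v) module \<Rightarrow> ('k, 'w) module \<Rightarrow> ('a \<Rightarrow> 'v) \<Rightarrow> ('b \<Rightarrow> 'w)
     \<Rightarrow> ('a \<times> 'b \<Rightarrow>\<^sub>0 'k) set \<Rightarrow> ('v \<times> 'w \<Rightarrow>\<^sub>0 'k) set" where
  "tensor_map V W f g = extend_lin (tensor_mod V W) (\<lambda>(x, y). tensor_elt V W (f x) (g y))"

subsection \<open>Tensor and exterior powers\<close>

definition tuples :: "('k, 'v) module \<Rightarrow> nat \<Rightarrow> 'v list set" where
  "tuples V k = {xs. length xs = k \<and> set xs \<subseteq> carrier V}"

definition multilinear_rels :: "('k :: field, 'v) module \<Rightarrow> nat \<Rightarrow> ('v list \<Rightarrow>\<^sub>0 'k) set" where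
  "multilinear_rels V k =
     {Poly_Mapping.single (xs[i := a \<oplus>\<^bsub>V\<^esub> b]) 1 - Poly_Mapping.single (xs[i := a]) 1
          - Poly_Mapping.single (xs[i := b]) 1
        | xs i a b. xs \<in> tuples V k \<and> i < k \<and> a \<in> carrier V \<and> b \<in> carrier V}
   \<union> {Poly_Mapping.single (xs[i := c \<odot>\<^bsub>V\<^esub> a]) 1 - Poly_Mapping.single (xs[i := a]) c
        | xs i c a. xs \<in> tuples V k \<and> i < k \<and> a \<in> carrier V}"

definition alternating_rels :: "('k :: field, 'v) module \<Rightarrow> nat \<Rightarrow> ('v list \<Rightarrow>\<^sub>0 'k) set" where
  "alternating_rels V k = {Poly_Mapping.single xs 1 | xs. xs \<in> tuples V k \<and> \<not> distinct xs}"

text \<open>With \<open>alt\<close> false this is the \<open>k\<close>-th tensor power of \<open>V\<close>, with \<open>alt\<close> true the \<open>k\<close>-th exterior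
  power.\<close>

definition power_rels ::
  "bool \<Rightarrow> ('k :: field, 'v) module \<Rightarrow> nat \<Rightarrow> ('v list \<Rightarrow>\<^sub>0 'k) set" where
  "power_rels alt V k = multilinear_rels V k \<union> (if alt then alternating_rels V k else {})"

definition power_mod ::
  "bool \<Rightarrow> ('k :: field, 'v) module \<Rightarrow> nat \<Rightarrow> ('k, ('v list \<Rightarrow>\<^sub>0 'k) set) module" where
  "power_mod alt V k = presented_mod (tuples V k) (power_rels alt V k)"

definition power_elt ::
  "bool \<Rightarrow> ('k :: field, 'v) module \<Rightarrow> nat \<Rightarrow> 'v list \<Rightarrow> ('v list \<Rightarrow>\<^sub>0 'k) set" where
  "power_elt alt V k xs = generator (tuples V k) (power_rels alt V k) xs"

subsection \<open>Duals\<close>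

definition dual_mod :: "('k :: field, 'v) module \<Rightarrow> ('k, 'v \<Rightarrow> 'k) module" where
  "dual_mod V = \<lparr>carrier = LinearCombinations.module_hom class_ring V scalar_mod \<inter> extensional (carrier V),
     monoid.mult = undefined, one = undefined,
     zero = restrict (\<lambda>x. 0) (carrier V),
     add = (\<lambda>f g. restrict (\<lambda>x. f x + g x) (carrier V)),
     smult = (\<lambda>c f. restrict (\<lambda>x. c * f x) (carrier V))\<rparr>"

section \<open>Extension of scalars from \<open>\<rat>\<close> to \<open>\<complex>\<close>\<close>

type_synonym 'v cx = "('v \<times> complex \<Rightarrow>\<^sub>0 rat) set"

definition complex_mod :: "(rat, complex) module" where
  "complex_mod = restrict_scalars of_rat scalar_mod"

text \<open>\<open>V \<otimes>\<^sub>\<rat> \<complex>\<close> as a vector space over \<open>\<rat>\<close>, and the map \<open>f \<otimes> h\<close> into it.\<close>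

definition cxQ :: "('e :: field_char_0, 'v) module \<Rightarrow> (rat, 'v cx) module" where
  "cxQ V = tensor_mod (restrict_scalars of_rat V) complex_mod"

definition cx_elt :: "('e :: field_char_0, 'v) module \<Rightarrow> 'v \<Rightarrow> complex \<Rightarrow> 'v cx" where
  "cx_elt V x z = tensor_elt (restrict_scalars of_rat V) complex_mod x z"

definition cx_map ::
  "('e :: field_char_0, 'v) module \<Rightarrow> ('a \<Rightarrow> 'v) \<Rightarrow> (complex \<Rightarrow> complex) \<Rightarrow> 'a cx \<Rightarrow> 'v cx" where
  "cx_map V f h = tensor_map (restrict_scalars of_rat V) complex_mod f h"

text \<open>The action of \<open>E \<otimes> \<complex>\<close> on \<open>V \<otimes> \<complex>\<close>, given by \<open>(e \<otimes> z) \<odot> (x \<otimes> w) = (e \<odot> x) \<otimes> (z w)\<close>.\<close>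

definition cx_smult :: "('e :: field_char_0, 'v) module \<Rightarrow> 'e cx \<Rightarrow> 'v cx \<Rightarrow> 'v cx" where
  "cx_smult V a X = extend_lin (cxQ V)
     (\<lambda>(e, z). extend_lin (cxQ V) (\<lambda>(x, w). cx_elt V (e \<odot>\<^bsub>V\<^esub> x) (z * w)) X) a"

definition EC :: "('e :: field_char_0) cx ring" where
  "EC = \<lparr>carrier = carrier (cxQ (scalar_mod :: ('e, 'e) module)),
     monoid.mult = cx_smult scalar_mod, one = cx_elt scalar_mod 1 1,
     zero = \<zero>\<^bsub>cxQ (scalar_mod :: ('e, 'e) module)\<^esub>, add = add (cxQ (scalar_mod :: ('e, 'e) module))\<rparr>"

definition cx :: "('e :: field_char_0, 'v) module \<Rightarrow> ('e cx, 'v cx) module" where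
  "cx V = \<lparr>carrier = carrier (cxQ V), monoid.mult = undefined, one = undefined,
     zero = \<zero>\<^bsub>cxQ V\<^esub>, add = add (cxQ V), smult = cx_smult V\<rparr>"

definition cxE :: "('e :: field_char_0, 'v) module \<Rightarrow> ('e, 'v cx) module" where
  "cxE V = restrict_scalars (\<lambda>e. cx_elt scalar_mod e 1) (cx V)"

text \<open>The \<open>E \<otimes> \<complex>\<close>-linear extension to \<open>U \<otimes> \<complex>\<close> of an \<open>E\<close>-linear map \<open>h : U \<rightarrow> V \<otimes> \<complex>\<close>.\<close>

definition cx_extend :: "('e :: field_char_0, 'v) module \<Rightarrow> ('u \<Rightarrow> 'v cx) \<Rightarrow> 'u cx \<Rightarrow> 'v cx" where
  "cx_extend V h = extend_lin (cxQ V) (\<lambda>(u, z). cx_smult V (cx_elt scalar_mod 1 z) (h u))"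

text \<open>The canonical products \<open>(V \<otimes> \<complex>) \<times> (W \<otimes> \<complex>) \<rightarrow> (V \<otimes>\<^sub>E W) \<otimes> \<complex>\<close> and
  \<open>(V \<otimes> \<complex>) \<times> \<dots> \<times> (V \<otimes> \<complex>) \<rightarrow> T \<otimes> \<complex>\<close>, for \<open>T\<close> a tensor or exterior power of \<open>V\<close>.\<close>

definition cx_tensor ::
  "('e :: field_char_0, 'v) module \<Rightarrow> ('e, 'w) module \<Rightarrow> 'v cx \<Rightarrow> 'w cx
     \<Rightarrow> (('v \<times> 'w \<Rightarrow>\<^sub>0 'e) set) cx" where
  "cx_tensor V W X Y = extend_lin (cxQ (tensor_mod V W))
     (\<lambda>(x, z). extend_lin (cxQ (tensor_mod V W))
        (\<lambda>(y, w). cx_elt (tensor_mod V W) (tensor_elt V W x y) (z * w)) Y) X"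

primrec expand_list ::
  "(rat, 't) module \<Rightarrow> ('v list \<Rightarrow> complex \<Rightarrow> 't) \<Rightarrow> 'v cx list \<Rightarrow> 't" where
  "expand_list T g [] = g [] 1"
| "expand_list T g (X # Xs) =
     extend_lin T (\<lambda>(x, z). expand_list T (\<lambda>ys w. g (x # ys) (z * w)) Xs) X"

definition cx_power ::
  "bool \<Rightarrow> ('e :: field_char_0, 'v) module \<Rightarrow> nat \<Rightarrow> 'v cx list \<Rightarrow> (('v list \<Rightarrow>\<^sub>0 'e) set) cx" where
  "cx_power alt V k = expand_list (cxQ (power_mod alt V k))
     (\<lambda>xs z. cx_elt (power_mod alt V k) (power_elt alt V k xs) z)"

definition cx_eval :: "('v \<Rightarrow> 'e :: field_char_0) cx \<Rightarrow> 'v cx \<Rightarrow> 'e cx" where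
  "cx_eval F X = extend_lin (cxQ scalar_mod)
     (\<lambda>(f, z). extend_lin (cxQ scalar_mod) (\<lambda>(x, w). cx_elt scalar_mod (f x) (z * w)) X) F"

section \<open>Betti--de Rham systems\<close>

record ('e, 'b, 'd) bdr =
  weight :: int
  betti :: "('e, 'b) module"
  Finf :: "'b \<Rightarrow> 'b"
  derham :: "('e, 'd) module"
  fil :: "int \<Rightarrow> 'd set"
  comparison :: "'b cx \<Rightarrow> 'd cx"

text \<open>\<open>\<F>\<^sup>p \<otimes> \<complex>\<close> as a subset of \<open>N\<^sub>d\<^sub>R \<otimes> \<complex>\<close>.\<close>

definition fil_cx :: "('e :: field_char_0, 'b, 'd) bdr \<Rightarrow> int \<Rightarrow> 'd cx set" where
  "fil_cx N p = cx_map (derham N) (\<lambda>x. x) (\<lambda>z. z) ` carrier (cx ((derham N)\<lparr>carrier := fil N p\<rparr>))"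

text \<open>\<open>\<F>\<^sup>p\<close> inside \<open>N\<^sub>B \<otimes> \<complex>\<close>; the bar in \<open>N\<^sup>p\<^sup>q\<close> is complex conjugation with respect to \<open>N\<^sub>B\<close>.\<close>

definition betti_fil :: "('e :: field_char_0, 'b, 'd) bdr \<Rightarrow> int \<Rightarrow> 'b cx set" where
  "betti_fil N p = {X \<in> carrier (cx (betti N)). comparison N X \<in> fil_cx N p}"

definition hodge :: "('e :: field_char_0, 'b, 'd) bdr \<Rightarrow> int \<Rightarrow> int \<Rightarrow> 'b cx set" where
  "hodge N p q = betti_fil N p \<inter> cx_map (betti N) (\<lambda>x. x) cnj ` betti_fil N q"

definition hodge_decomposition :: "('e :: field_char_0, 'b, 'd) bdr \<Rightarrow> bool" where
  "hodge_decomposition N \<longleftrightarrow> (\<forall>X \<in> carrier (cx (betti N)). \<exists>!f.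
     (\<forall>p. f p \<in> hodge N p (weight N - p)) \<and> finite {p. f p \<noteq> \<zero>\<^bsub>cx (betti N)\<^esub>} \<and>
     X = (\<Oplus>\<^bsub>cx (betti N)\<^esub>p\<in>{p. f p \<noteq> \<zero>\<^bsub>cx (betti N)\<^esub>}. f p))"

definition betti_de_rham :: "('e :: number_field, 'b, 'd) bdr \<Rightarrow> bool" where
  "betti_de_rham N \<longleftrightarrow>
     vectorspace class_ring (betti N) \<and> vectorspace.fin_dim class_ring (betti N) \<and>
     Finf N \<in> LinearCombinations.module_hom class_ring (betti N) (betti N) \<and>
     (\<forall>x \<in> carrier (betti N). Finf N (Finf N x) = x) \<and>
     vectorspace class_ring (derham N) \<and> vectorspace.fin_dim class_ring (derham N) \<and>
     (\<forall>p. VectorSpace.subspace class_ring (fil N p) (derham N)) \<and>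
     (\<forall>p q. p \<le> q \<longrightarrow> fil N q \<subseteq> fil N p) \<and>
     (\<exists>p. fil N p = carrier (derham N)) \<and> (\<exists>p. fil N p = {\<zero>\<^bsub>derham N\<^esub>}) \<and>
     comparison N \<in> LinearCombinations.module_hom EC (cx (betti N)) (cx (derham N)) \<and>
     bij_betw (comparison N) (carrier (cx (betti N))) (carrier (cx (derham N))) \<and>
     (\<forall>X \<in> carrier (cx (betti N)).
        comparison N (cx_map (betti N) (Finf N) cnj X)
          = cx_map (derham N) (\<lambda>x. x) cnj (comparison N X)) \<and>
     hodge_decomposition N"

text \<open>A morphism is a pair of realizations \<open>(f, g)\<close>.  Systems are pure: between systems of
  different weights there is only the zero morphism.\<close>

definition bdr_hom ::
  "('e :: number_field, 'b, 'd) bdr \<Rightarrow> ('e, 'b', 'd') bdr \<Rightarrow> ('b \<Rightarrow> 'b') \<Rightarrow> ('d \<Rightarrow> 'd') \<Rightarrow> bool" where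
  "bdr_hom M N f g \<longleftrightarrow>
     f \<in> LinearCombinations.module_hom class_ring (betti M) (betti N) \<and>
     g \<in> LinearCombinations.module_hom class_ring (derham M) (derham N) \<and>
     (\<forall>x \<in> carrier (betti M). f (Finf M x) = Finf N (f x)) \<and>
     (\<forall>p. g ` fil M p \<subseteq> fil N p) \<and>
     (\<forall>X \<in> carrier (cx (betti M)).
        comparison N (cx_map (betti N) f (\<lambda>z. z) X)
          = cx_map (derham N) g (\<lambda>z. z) (comparison M X)) \<and>
     (weight M \<noteq> weight N \<longrightarrow>
        (\<forall>x \<in> carrier (betti M). f x = \<zero>\<^bsub>betti N\<^esub>) \<and>
        (\<forall>y \<in> carrier (derham M). g y = \<zero>\<^bsub>derham N\<^esub>))"

definition bdr_iso ::
  "('e :: number_field, 'b, 'd) bdr \<Rightarrow> ('e, 'b', 'd') bdr \<Rightarrow> ('b \<Rightarrow> 'b') \<Rightarrow> ('d \<Rightarrow> 'd') \<Rightarrow> bool" where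
  "bdr_iso M N f g \<longleftrightarrow> bdr_hom M N f g \<and>
     (\<exists>f' g'. bdr_hom N M f' g' \<and>
        (\<forall>x \<in> carrier (betti M). f' (f x) = x) \<and> (\<forall>x \<in> carrier (betti N). f (f' x) = x) \<and>
        (\<forall>y \<in> carrier (derham M). g' (g y) = y) \<and> (\<forall>y \<in> carrier (derham N). g (g' y) = y))"

definition unit_sys :: "('e :: number_field, 'e, 'e) bdr" where
  "unit_sys = \<lparr>weight = 0, betti = scalar_mod, Finf = (\<lambda>x. x), derham = scalar_mod,
     fil = (\<lambda>p. if p \<le> 0 then UNIV else {0}), comparison = (\<lambda>X. X)\<rparr>"

definition tensor_sys ::
  "('e :: number_field, 'b, 'd) bdr \<Rightarrow> ('e, 'b', 'd') bdr
     \<Rightarrow> ('e, ('b \<times> 'b' \<Rightarrow>\<^sub>0 'e) set, ('d \<times> 'd' \<Rightarrow>\<^sub>0 'e) set) bdr" where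
  "tensor_sys M N =
     \<lparr>weight = weight M + weight N,
      betti = tensor_mod (betti M) (betti N),
      Finf = tensor_map (betti M) (betti N) (Finf M) (Finf N),
      derham = tensor_mod (derham M) (derham N),
      fil = (\<lambda>r. LinearCombinations.module.span class_ring (tensor_mod (derham M) (derham N))
               {tensor_elt (derham M) (derham N) x y | x y p q.
                  x \<in> fil M p \<and> y \<in> fil N q \<and> p + q = r}),
      comparison = cx_extend (tensor_mod (derham M) (derham N))
        (extend_lin (cxE (tensor_mod (derham M) (derham N)))
          (\<lambda>(x, y). cx_tensor (derham M) (derham N)
             (comparison M (cx_elt (betti M) x 1)) (comparison N (cx_elt (betti N) y 1))))\<rparr>"

definition power_sys ::
  "bool \<Rightarrow> nat \<Rightarrow> ('e :: number_field, 'b, 'd) bdr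
     \<Rightarrow> ('e, ('b list \<Rightarrow>\<^sub>0 'e) set, ('d list \<Rightarrow>\<^sub>0 'e) set) bdr" where
  "power_sys alt k N =
     \<lparr>weight = int k * weight N,
      betti = power_mod alt (betti N) k,
      Finf = extend_lin (power_mod alt (betti N) k)
               (\<lambda>xs. power_elt alt (betti N) k (map (Finf N) xs)),
      derham = power_mod alt (derham N) k,
      fil = (\<lambda>r. LinearCombinations.module.span class_ring (power_mod alt (derham N) k)
               {power_elt alt (derham N) k xs | xs ps.
                  length xs = k \<and> list_all2 (\<lambda>x p. x \<in> fil N p) xs ps \<and> sum_list ps = r}),
      comparison = cx_extend (power_mod alt (derham N) k)
        (extend_lin (cxE (power_mod alt (derham N) k))
          (\<lambda>xs. cx_power alt (derham N) k (map (\<lambda>x. comparison N (cx_elt (betti N) x 1)) xs)))\<rparr>"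

abbreviation tensor_power_sys :: "nat \<Rightarrow> ('e :: number_field, 'b, 'd) bdr
    \<Rightarrow> ('e, ('b list \<Rightarrow>\<^sub>0 'e) set, ('d list \<Rightarrow>\<^sub>0 'e) set) bdr" where
  "tensor_power_sys \<equiv> power_sys False"

abbreviation ext_power_sys :: "nat \<Rightarrow> ('e :: number_field, 'b, 'd) bdr
    \<Rightarrow> ('e, ('b list \<Rightarrow>\<^sub>0 'e) set, ('d list \<Rightarrow>\<^sub>0 'e) set) bdr" where
  "ext_power_sys \<equiv> power_sys True"

text \<open>\<open>\<F>\<^sup>p\<close> of the dual consists of the functionals that map \<open>\<F>\<^sup>q\<close> into \<open>\<F>\<^sup>p\<^sup>+\<^sup>q\<close> of the unit object
  for all \<open>q\<close>, that is, that vanish on \<open>\<F>\<^sup>q\<close> for \<open>p + q > 0\<close>.\<close>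

definition dual_sys ::
  "('e :: number_field, 'b, 'd) bdr \<Rightarrow> ('e, 'b \<Rightarrow> 'e, 'd \<Rightarrow> 'e) bdr" where
  "dual_sys N =
     \<lparr>weight = - weight N,
      betti = dual_mod (betti N),
      Finf = (\<lambda>f. restrict (\<lambda>x. f (Finf N x)) (carrier (betti N))),
      derham = dual_mod (derham N),
      fil = (\<lambda>p. {f \<in> carrier (dual_mod (derham N)). \<forall>q > - p. \<forall>y \<in> fil N q. f y = 0}),
      comparison = (\<lambda>F. THE G. G \<in> carrier (cx (dual_mod (derham N))) \<and>
        (\<forall>X \<in> carrier (cx (betti N)). cx_eval G (comparison N X) = cx_eval F X))\<rparr>"

section \<open>Periods\<close>

definition betti_eigen :: "('e :: field, 'b, 'd) bdr \<Rightarrow> 'e \<Rightarrow> ('e, 'b) module" where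
  "betti_eigen N s = (betti N)\<lparr>carrier := {x \<in> carrier (betti N). Finf N x = s \<odot>\<^bsub>betti N\<^esub> x}\<rparr>"

definition middle_fil :: "('e, 'b, 'd) bdr \<Rightarrow> 'd set" where
  "middle_fil N = fil N (weight N div 2 + 1)"

definition derham_quot :: "('e, 'b, 'd) bdr \<Rightarrow> ('e, 'd set) module" where
  "derham_quot N = quot_mod (derham N) (middle_fil N)"

text \<open>The map \<open>N\<^sup>s \<otimes> \<complex> \<rightarrow> N\<^sub>B \<otimes> \<complex> \<rightarrow> N\<^sub>d\<^sub>R \<otimes> \<complex> \<rightarrow> (N\<^sub>d\<^sub>R / \<F>) \<otimes> \<complex>\<close>.\<close>

definition period_map :: "('e :: field_char_0, 'b, 'd) bdr \<Rightarrow> 'b cx \<Rightarrow> 'd set cx" where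
  "period_map N X =
     cx_map (derham_quot N) (\<lambda>y. middle_fil N +>\<^bsub>derham N\<^esub> y) (\<lambda>z. z)
       (comparison N (cx_map (betti N) (\<lambda>x. x) (\<lambda>z. z) X))"

definition ordered_basis :: "('k :: field, 'v) module \<Rightarrow> 'v list \<Rightarrow> bool" where
  "ordered_basis V bs \<longleftrightarrow> distinct bs \<and> vectorspace.basis class_ring V (set bs)"

definition ring_det :: "'r ring \<Rightarrow> nat \<Rightarrow> (nat \<Rightarrow> nat \<Rightarrow> 'r) \<Rightarrow> 'r" where
  "ring_det R r A = (\<Oplus>\<^bsub>R\<^esub>\<sigma>\<in>{\<sigma>. \<sigma> permutes {..<r}}.
     let t = (\<Otimes>\<^bsub>R\<^esub>i\<in>{..<r}. A i (\<sigma> i)) in if evenperm \<sigma> then t else \<ominus>\<^bsub>R\<^esub> t)"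

text \<open>\<open>\<delta>\<close> is the determinant, with respect to some \<open>E\<close>-bases of \<open>V\<close> and \<open>W\<close>, of the
  \<open>E \<otimes> \<complex>\<close>-linear map \<open>f : V \<otimes> \<complex> \<rightarrow> W \<otimes> \<complex>\<close>.\<close>

definition is_det ::
  "('e :: field_char_0, 'v) module \<Rightarrow> ('e, 'w) module \<Rightarrow> ('v cx \<Rightarrow> 'w cx) \<Rightarrow> 'e cx \<Rightarrow> bool" where
  "is_det V W f \<delta> \<longleftrightarrow> (\<exists>bs ds A. ordered_basis V bs \<and> ordered_basis W ds \<and> length bs = length ds \<and>
     (\<forall>i < length ds. \<forall>j < length bs. A i j \<in> carrier EC) \<and>
     (\<forall>j < length bs. f (cx_elt V (bs ! j) 1)
        = (\<Oplus>\<^bsub>cx W\<^esub>i\<in>{..<length ds}. A i j \<odot>\<^bsub>cx W\<^esub> cx_elt W (ds ! i) 1)) \<and>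
     \<delta> = ring_det EC (length bs) A)"

text \<open>The image of \<open>E\<^sup>*\<close> in \<open>(E \<otimes> \<complex>)\<^sup>*\<close>, and the class in \<open>(E \<otimes> \<complex>)\<^sup>* / E\<^sup>*\<close> of the determinant,
  as a coset; it does not depend on the bases.\<close>

definition E_units :: "('e :: field_char_0) cx set" where
  "E_units = {cx_elt scalar_mod e 1 | e. e \<noteq> 0}"

definition period_class :: "('e :: field_char_0, 'b, 'd) bdr \<Rightarrow> 'e \<Rightarrow> 'e cx set" where
  "period_class N s = E_units #>\<^bsub>units_of EC\<^esub>
     (SOME \<delta>. is_det (betti_eigen N s) (derham_quot N) (period_map N) \<delta>)"

definition c_plus :: "('e :: field_char_0, 'b, 'd) bdr \<Rightarrow> 'e cx set" where
  "c_plus N = period_class N 1"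

definition c_minus :: "('e :: field_char_0, 'b, 'd) bdr \<Rightarrow> 'e cx set" where
  "c_minus N = period_class N (- 1)"

definition vanishing_middle :: "('e :: field_char_0, 'b, 'd) bdr \<Rightarrow> bool" where
  "vanishing_middle N \<longleftrightarrow> odd (weight N) \<or>
     (\<exists>k. weight N = 2 * k \<and> hodge N k k = {\<zero>\<^bsub>cx (betti N)\<^esub>})"

section \<open>Symplectic and orthogonal structures\<close>

definition pairing ::
  "('e :: field, 'v) module \<Rightarrow> (('v \<times> 'v \<Rightarrow>\<^sub>0 'e) set \<Rightarrow> 'l) \<Rightarrow> 'v \<Rightarrow> 'v \<Rightarrow> 'l" where
  "pairing V B x y = B (tensor_elt V V x y)"

definition alternating_form ::
  "('e :: field, 'v) module \<Rightarrow> ('e, 'l) module \<Rightarrow> (('v \<times> 'v \<Rightarrow>\<^sub>0 'e) set \<Rightarrow> 'l) \<Rightarrow> bool" where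
  "alternating_form V L B \<longleftrightarrow> (\<forall>x \<in> carrier V. pairing V B x x = \<zero>\<^bsub>L\<^esub>)"

definition symmetric_form ::
  "('e :: field, 'v) module \<Rightarrow> (('v \<times> 'v \<Rightarrow>\<^sub>0 'e) set \<Rightarrow> 'l) \<Rightarrow> bool" where
  "symmetric_form V B \<longleftrightarrow> (\<forall>x \<in> carrier V. \<forall>y \<in> carrier V. pairing V B x y = pairing V B y x)"

definition nondegenerate_form ::
  "('e :: field, 'v) module \<Rightarrow> ('e, 'l) module \<Rightarrow> (('v \<times> 'v \<Rightarrow>\<^sub>0 'e) set \<Rightarrow> 'l) \<Rightarrow> bool" where
  "nondegenerate_form V L B \<longleftrightarrow>
     (\<forall>x \<in> carrier V. (\<forall>y \<in> carrier V. pairing V B x y = \<zero>\<^bsub>L\<^esub>) \<longrightarrow> x = \<zero>\<^bsub>V\<^esub>) \<and>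
     (\<forall>y \<in> carrier V. (\<forall>x \<in> carrier V. pairing V B x y = \<zero>\<^bsub>L\<^esub>) \<longrightarrow> y = \<zero>\<^bsub>V\<^esub>)"

text \<open>\<open>det(B)\<close> on the \<open>k\<close>-th exterior power:
  \<open>(x\<^sub>1 \<and> \<dots> \<and> x\<^sub>k, y\<^sub>1 \<and> \<dots> \<and> y\<^sub>k) \<mapsto> det (B(x\<^sub>i, y\<^sub>j))\<close>, with values in the \<open>k\<close>-th tensor power of \<open>L\<close>.\<close>

definition det_form ::
  "('e :: field, 'v) module \<Rightarrow> ('e, 'l) module \<Rightarrow> (('v \<times> 'v \<Rightarrow>\<^sub>0 'e) set \<Rightarrow> 'l) \<Rightarrow> nat
     \<Rightarrow> ('v list \<Rightarrow>\<^sub>0 'e) set \<Rightarrow> ('v list \<Rightarrow>\<^sub>0 'e) set \<Rightarrow> ('l list \<Rightarrow>\<^sub>0 'e) set" where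
  "det_form V L B k s t = extend_lin (power_mod False L k)
     (\<lambda>xs. extend_lin (power_mod False L k)
       (\<lambda>ys. \<Oplus>\<^bsub>power_mod False L k\<^esub>\<sigma>\<in>{\<sigma>. \<sigma> permutes {..<k}}.
          of_int (sign \<sigma>) \<odot>\<^bsub>power_mod False L k\<^esub>
            power_elt False L k (map (\<lambda>i. pairing V B (xs ! i) (ys ! \<sigma> i)) [0..<k])) t) s"

text \<open>The contraction \<open>L\<^sup>2\<^sup>n \<otimes> (L\<^sup>-\<^sup>n \<otimes> L\<^sup>-\<^sup>n) \<rightarrow> E\<close>.\<close>

definition contract ::
  "('l list \<Rightarrow>\<^sub>0 'e :: field) set \<Rightarrow> (('l \<Rightarrow> 'e) list \<Rightarrow>\<^sub>0 'e) set
     \<Rightarrow> (('l \<Rightarrow> 'e) list \<Rightarrow>\<^sub>0 'e) set \<Rightarrow> 'e" where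
  "contract l \<mu> \<nu> = extend_lin scalar_mod
     (\<lambda>ls. extend_lin scalar_mod
       (\<lambda>fs. extend_lin scalar_mod
         (\<lambda>gs. \<Prod>i<length ls. ((fs @ gs) ! i) (ls ! i)) \<nu>) \<mu>) l"

text \<open>The trivialization of the tensor square of \<open>det(V) \<otimes> L\<^sup>-\<^sup>n\<close> induced by \<open>det(B)\<close>:
  \<open>(\<omega> \<otimes> \<mu>) \<otimes> (\<omega>' \<otimes> \<nu>) \<mapsto> \<langle>det(B)(\<omega>, \<omega>'), \<mu> \<otimes> \<nu>\<rangle>\<close>.\<close>

definition disc_trivialization where
  "disc_trivialization V L B n = extend_lin scalar_mod
     (\<lambda>(s, t). extend_lin scalar_mod
       (\<lambda>(\<omega>, \<mu>). extend_lin scalar_mod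
         (\<lambda>(\<omega>', \<nu>). contract (det_form V L B (2 * n) \<omega> \<omega>') \<mu> \<nu>) t) s)"

definition disc_mod ::
  "nat \<Rightarrow> ('e :: field, 'v) module \<Rightarrow> ('e, 'l) module \<Rightarrow>
     ('e, ((('v list \<Rightarrow>\<^sub>0 'e) set \<times> (('l \<Rightarrow> 'e) list \<Rightarrow>\<^sub>0 'e) set) \<Rightarrow>\<^sub>0 'e) set) module" where
  "disc_mod n V L = tensor_mod (power_mod True V (2 * n)) (power_mod False (dual_mod L) n)"

definition squares_to_disc where
  "squares_to_disc n V L B \<tau> \<longleftrightarrow>
     (\<forall>X \<in> carrier (tensor_mod (disc_mod n V L) (disc_mod n V L)).
        extend_lin scalar_mod (\<lambda>(s, t). \<tau> s * \<tau> t) X = disc_trivialization V L B n X)"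

definition symplectic_structure ::
  "('e :: number_field, 'b, 'd) bdr \<Rightarrow> ('e, 'l, 'm) bdr
     \<Rightarrow> (('b \<times> 'b \<Rightarrow>\<^sub>0 'e) set \<Rightarrow> 'l) \<Rightarrow> (('d \<times> 'd \<Rightarrow>\<^sub>0 'e) set \<Rightarrow> 'm) \<Rightarrow> bool" where
  "symplectic_structure M L B BdR \<longleftrightarrow>
     bdr_hom (tensor_sys M M) L B BdR \<and>
     nondegenerate_form (betti M) (betti L) B \<and>
     alternating_form (betti M) (betti L) B \<and>
     alternating_form (derham M) (derham L) BdR"

definition orthogonal_structure ::
  "nat \<Rightarrow> ('e :: number_field, 'b, 'd) bdr \<Rightarrow> ('e, 'l, 'm) bdr
     \<Rightarrow> (('b \<times> 'b \<Rightarrow>\<^sub>0 'e) set \<Rightarrow> 'l) \<Rightarrow> (('d \<times> 'd \<Rightarrow>\<^sub>0 'e) set \<Rightarrow> 'm) \<Rightarrow> bool" where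
  "orthogonal_structure n M L B BdR \<longleftrightarrow>
     bdr_hom (tensor_sys M M) L B BdR \<and>
     nondegenerate_form (betti M) (betti L) B \<and>
     symmetric_form (betti M) B \<and> symmetric_form (derham M) BdR \<and>
     (\<exists>\<tau> \<tau>dR.
        bdr_iso (tensor_sys (ext_power_sys (2 * n) M) (tensor_power_sys n (dual_sys L)))
          unit_sys \<tau> \<tau>dR \<and>
        squares_to_disc n (betti M) (betti L) B \<tau> \<and>
        squares_to_disc n (derham M) (derham L) BdR \<tau>dR)"

end

theory Submission
  imports Defs "Jordan_Normal_Form.Determinant"
begin

text \<open>
  Let \<open>\<F>\<close> be the middle step of the de Rham filtration. The Hodge decomposition makes both period maps
  \<open>M\<^sup>\<plusminus> \<otimes> \<complex> \<rightarrow> (M\<^sub>d\<^sub>R / \<F>) \<otimes> \<complex>\<close> bijective, with matrices \<open>A\<^sub>1\<close> and \<open>A\<^sub>2\<close> say, so \<open>M\<^sup>+\<close> and \<open>M\<^sup>-\<close> both have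
  rank \<open>n\<close>. They are orthogonal for \<open>B\<close> because the involution is trivial on \<open>L\<^sub>B\<close>, and \<open>\<F>\<close> is isotropic for the de Rham pairing
  because \<open>L\<close> has only one Hodge number. In adapted bases the full period matrix \<open>P\<close> of \<open>M\<close>, the period \<open>\<lambda>\<close> of
  \<open>L\<close> and the Gram matrices \<open>G\<close>, \<open>D\<close> satisfy \<open>P\<^sup>T G P = \<lambda> D\<close> with \<open>D\<close> block diagonal and the lower right block of
  \<open>G\<close> zero. Block elimination gives \<open>det P \<cdot> det Y' = (- \<lambda>)\<^sup>n \<cdot> det (A\<^sub>1\<^sup>-\<^sup>1 A\<^sub>2) \<cdot> det D\<^sup>+\<close>, where \<open>Y'\<close> and \<open>D\<^sup>+\<close> are
  blocks of \<open>G\<close> and \<open>D\<close>, hence have determinants in \<open>E\<close>. So it is enough that \<open>det P\<close> lies in \<open>\<lambda>\<^sup>n E\<^sup>*\<close>.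
  In the symplectic case this follows by taking Pfaffians in \<open>P\<^sup>T G P = \<lambda> D\<close>. In the orthogonal case the given
  trivialization of \<open>det(M) \<otimes> L\<^sup>-\<^sup>n\<close> is compatible with the comparison isomorphism, which is multiplication by
  \<open>det P \<cdot> \<lambda>\<^sup>-\<^sup>n\<close> in rational bases.\<close>

section \<open>Presented modules and the universal properties of quotients, tensor products and
  exterior powers\<close>

section \<open>Linear algebra over modules given by generators and relations\<close>

text \<open>Taking determinants in \<open>P\<^sup>T G P = \<lambda> D\<close> shows only that the
  square of \<open>det P / \<lambda>\<^sup>n\<close> lies in E, and a square root in E \<otimes>
  \<complex> of an element of E need not lie in E. This obstacle separates the two cases: a Pfaffian
  is a rational square root of the determinant of an alternating matrix, whereas for a symmetric
  matrix the root has to be supplied by the trivialization of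
  \<open>det(M) \<otimes> L\<^sup>-\<^sup>n\<close>. The matrix \<phi> =
  \<open>A\<^sub>1\<^sup>-\<^sup>1 A\<^sub>2\<close> enters because \<F>, after extension to
  \<complex>, is a graph over \<open>M\<^sup>-\<close>: it consists of all x - \<phi> x. One
  isotropic subspace thus encodes both period matrices, and pairing it with \<open>M\<^sup>+\<close>
  extracts det \<phi>, the ratio of the two period determinants. A second obstacle is that E
  \<otimes> \<complex> is in general not a field. Ranks over it are compared through traces of
  products of mutually inverse matrices, invertibility is always witnessed by an explicit inverse,
  and nonvanishing is tested in E and carried over by the embedding of E.\<close>

abbreviation lin_hom where "lin_hom \<equiv> LinearCombinations.module_hom class_ring"

text \<open>Scalars range over a commutative ring because E \<otimes> \<complex> is usually not a
  field; \<open>lin_space\<close> below is the case of a field.\<close>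

locale rmod =
  fixes V :: "('k :: comm_ring_1, 'v) module"
  assumes md: "Module.module class_ring V"
begin

sublocale M: Module.module class_ring V by (rule md)

lemma zero_closed [simp, intro]: "\<zero>\<^bsub>V\<^esub> \<in> carrier V" by simp

lemma add_closed [simp, intro]: "x \<in> carrier V \<Longrightarrow> y \<in> carrier V \<Longrightarrow> x \<oplus>\<^bsub>V\<^esub> y \<in> carrier V" by simp

lemma smult_closed [simp, intro]: "x \<in> carrier V \<Longrightarrow> c \<odot>\<^bsub>V\<^esub> x \<in> carrier V"
  using M.smult_closed by (simp add: class_ring_simps)

lemma smult_add_left: "x \<in> carrier V \<Longrightarrow> (a + b) \<odot>\<^bsub>V\<^esub> x = a \<odot>\<^bsub>V\<^esub> x \<oplus>\<^bsub>V\<^esub> b \<odot>\<^bsub>V\<^esub> x"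
  using M.smult_l_distr by (simp add: class_ring_simps)

lemma smult_add_right:
  "x \<in> carrier V \<Longrightarrow> y \<in> carrier V \<Longrightarrow> a \<odot>\<^bsub>V\<^esub> (x \<oplus>\<^bsub>V\<^esub> y) = a \<odot>\<^bsub>V\<^esub> x \<oplus>\<^bsub>V\<^esub> a \<odot>\<^bsub>V\<^esub> y"
  using M.smult_r_distr by (simp add: class_ring_simps)

lemma smult_smult: "x \<in> carrier V \<Longrightarrow> a \<odot>\<^bsub>V\<^esub> (b \<odot>\<^bsub>V\<^esub> x) = (a * b) \<odot>\<^bsub>V\<^esub> x"
  using M.smult_assoc1 by (simp add: class_ring_simps)

lemma smult_one [simp]: "x \<in> carrier V \<Longrightarrow> 1 \<odot>\<^bsub>V\<^esub> x = x"
  using M.smult_one by (simp add: class_ring_simps)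

lemma smult_zero_left [simp]: "x \<in> carrier V \<Longrightarrow> 0 \<odot>\<^bsub>V\<^esub> x = \<zero>\<^bsub>V\<^esub>"
  using M.lmult_0 by (simp add: class_ring_simps)

lemma smult_zero_right [simp]: "a \<odot>\<^bsub>V\<^esub> \<zero>\<^bsub>V\<^esub> = \<zero>\<^bsub>V\<^esub>"
  using M.rmult_0 by (simp add: class_ring_simps)

lemma smult_neg_left: "x \<in> carrier V \<Longrightarrow> (- a) \<odot>\<^bsub>V\<^esub> x = \<ominus>\<^bsub>V\<^esub> (a \<odot>\<^bsub>V\<^esub> x)"
  using M.smult_l_minus[of a x] by (simp add: class_ring_simps)

lemma neg_zero [simp]: "\<ominus>\<^bsub>V\<^esub> \<zero>\<^bsub>V\<^esub> = \<zero>\<^bsub>V\<^esub>"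
  using smult_neg_left[of "\<zero>\<^bsub>V\<^esub>" 1] by simp

lemma minus_self [simp]: "x \<in> carrier V \<Longrightarrow> x \<ominus>\<^bsub>V\<^esub> x = \<zero>\<^bsub>V\<^esub>"
  by (simp add: a_minus_def M.r_neg)

lemma minus_eq_zero_iff:
  "x \<in> carrier V \<Longrightarrow> y \<in> carrier V \<Longrightarrow> x \<ominus>\<^bsub>V\<^esub> y = \<zero>\<^bsub>V\<^esub> \<longleftrightarrow> x = y"
  by (auto simp: a_minus_def M.r_neg) (metis M.add.inv_closed M.add.inv_inv M.minus_equality)

lemma smult_finsum:
  "f \<in> A \<rightarrow> carrier V \<Longrightarrow> finite A \<Longrightarrow> c \<odot>\<^bsub>V\<^esub> finsum V f A = (\<Oplus>\<^bsub>V\<^esub>x\<in>A. c \<odot>\<^bsub>V\<^esub> f x)"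
  using M.finsum_smult[of c f A] by (simp add: class_ring_simps)

end

locale lin_space =
  fixes V :: "('k :: field, 'v) module"
  assumes vs: "vectorspace class_ring V"
begin

sublocale rmod V
  using vs by (intro rmod.intro) (simp add: vectorspace_def)

sublocale VS: vectorspace class_ring V by (rule vs)

lemma rmod: "rmod V" by (rule rmod_axioms)

end

lemma lin_homI:
  assumes "\<And>x. x \<in> carrier V \<Longrightarrow> f x \<in> carrier W"
    and "\<And>x y. x \<in> carrier V \<Longrightarrow> y \<in> carrier V \<Longrightarrow> f (x \<oplus>\<^bsub>V\<^esub> y) = f x \<oplus>\<^bsub>W\<^esub> f y"
    and "\<And>c x. x \<in> carrier V \<Longrightarrow> f (c \<odot>\<^bsub>V\<^esub> x) = c \<odot>\<^bsub>W\<^esub> f x"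
  shows "f \<in> lin_hom V W"
  using assms unfolding LinearCombinations.module_hom_def by auto

lemma lin_hom_closed: "f \<in> lin_hom V W \<Longrightarrow> x \<in> carrier V \<Longrightarrow> f x \<in> carrier W"
  unfolding LinearCombinations.module_hom_def by auto

lemma lin_hom_add:
  "f \<in> lin_hom V W \<Longrightarrow> x \<in> carrier V \<Longrightarrow> y \<in> carrier V \<Longrightarrow> f (x \<oplus>\<^bsub>V\<^esub> y) = f x \<oplus>\<^bsub>W\<^esub> f y"
  unfolding LinearCombinations.module_hom_def by auto

lemma lin_hom_smult:
  "f \<in> lin_hom V W \<Longrightarrow> x \<in> carrier V \<Longrightarrow> f (c \<odot>\<^bsub>V\<^esub> x) = c \<odot>\<^bsub>W\<^esub> f x"
  unfolding LinearCombinations.module_hom_def by (auto simp: class_ring_simps)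

lemmas lin_hom = lin_hom_closed lin_hom_add lin_hom_smult

lemma rmod_hom_zero:
  assumes "rmod V" "rmod W" "f \<in> lin_hom V W"
  shows "f \<zero>\<^bsub>V\<^esub> = \<zero>\<^bsub>W\<^esub>"
proof -
  interpret V: rmod V by fact
  interpret W: rmod W by fact
  have "f \<zero>\<^bsub>V\<^esub> = f (0 \<odot>\<^bsub>V\<^esub> \<zero>\<^bsub>V\<^esub>)" by simp
  also have "\<dots> = 0 \<odot>\<^bsub>W\<^esub> f \<zero>\<^bsub>V\<^esub>" by (rule lin_hom_smult[OF assms(3)]) simp
  also have "\<dots> = \<zero>\<^bsub>W\<^esub>" using lin_hom_closed[OF assms(3)] by simp
  finally show ?thesis .
qed

lemmas lin_hom_zero = rmod_hom_zero[OF lin_space.rmod lin_space.rmod]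

lemma lin_hom_finsum:
  assumes "rmod V" "rmod W" "f \<in> lin_hom V W" "finite A" "g \<in> A \<rightarrow> carrier V"
  shows "f (finsum V g A) = (\<Oplus>\<^bsub>W\<^esub>i\<in>A. f (g i))"
proof -
  interpret V: rmod V by fact
  interpret W: rmod W by fact
  show ?thesis using assms(4,5)
    by (induction rule: finite_induct)
      (auto simp: rmod_hom_zero[OF assms(1-3)] lin_hom_add[OF assms(3)] lin_hom_closed[OF assms(3)] Pi_iff)
qed

lemma lin_hom_comp:
  "f \<in> lin_hom U V \<Longrightarrow> g \<in> lin_hom V W \<Longrightarrow> (\<lambda>x. g (f x)) \<in> lin_hom U W"
  by (rule lin_homI) (auto simp: lin_hom)

lemma rmodI:
  fixes V :: "('k :: comm_ring_1, 'v) module"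
  assumes "\<zero>\<^bsub>V\<^esub> \<in> carrier V"
    and "\<And>x y. x \<in> carrier V \<Longrightarrow> y \<in> carrier V \<Longrightarrow> x \<oplus>\<^bsub>V\<^esub> y \<in> carrier V"
    and "\<And>c x. x \<in> carrier V \<Longrightarrow> c \<odot>\<^bsub>V\<^esub> x \<in> carrier V"
    and "\<And>x y. x \<in> carrier V \<Longrightarrow> y \<in> carrier V \<Longrightarrow> x \<oplus>\<^bsub>V\<^esub> y = y \<oplus>\<^bsub>V\<^esub> x"
    and "\<And>x y z. x \<in> carrier V \<Longrightarrow> y \<in> carrier V \<Longrightarrow> z \<in> carrier V \<Longrightarrow>
      (x \<oplus>\<^bsub>V\<^esub> y) \<oplus>\<^bsub>V\<^esub> z = x \<oplus>\<^bsub>V\<^esub> (y \<oplus>\<^bsub>V\<^esub> z)"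
    and "\<And>x. x \<in> carrier V \<Longrightarrow> x \<oplus>\<^bsub>V\<^esub> \<zero>\<^bsub>V\<^esub> = x"
    and "\<And>a b x. x \<in> carrier V \<Longrightarrow> (a * b) \<odot>\<^bsub>V\<^esub> x = a \<odot>\<^bsub>V\<^esub> (b \<odot>\<^bsub>V\<^esub> x)"
    and "\<And>x. x \<in> carrier V \<Longrightarrow> 1 \<odot>\<^bsub>V\<^esub> x = x"
    and "\<And>x. x \<in> carrier V \<Longrightarrow> 0 \<odot>\<^bsub>V\<^esub> x = \<zero>\<^bsub>V\<^esub>"
    and "\<And>a b x. x \<in> carrier V \<Longrightarrow> (a + b) \<odot>\<^bsub>V\<^esub> x = a \<odot>\<^bsub>V\<^esub> x \<oplus>\<^bsub>V\<^esub> b \<odot>\<^bsub>V\<^esub> x"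
    and "\<And>a x y. x \<in> carrier V \<Longrightarrow> y \<in> carrier V \<Longrightarrow>
      a \<odot>\<^bsub>V\<^esub> (x \<oplus>\<^bsub>V\<^esub> y) = a \<odot>\<^bsub>V\<^esub> x \<oplus>\<^bsub>V\<^esub> a \<odot>\<^bsub>V\<^esub> y"
  shows "rmod V"
proof (rule rmod.intro)
  have neg: "\<exists>y\<in>carrier V. x \<oplus>\<^bsub>V\<^esub> y = \<zero>\<^bsub>V\<^esub>" if x: "x \<in> carrier V" for x
  proof
    show "(-1) \<odot>\<^bsub>V\<^esub> x \<in> carrier V" using assms(3) x by blast
    have "x \<oplus>\<^bsub>V\<^esub> (-1) \<odot>\<^bsub>V\<^esub> x = 1 \<odot>\<^bsub>V\<^esub> x \<oplus>\<^bsub>V\<^esub> (-1) \<odot>\<^bsub>V\<^esub> x" using x assms(8) by simp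
    also have "\<dots> = (1 + -1) \<odot>\<^bsub>V\<^esub> x" using assms(10)[OF x, of 1 "-1"] by (rule sym)
    finally show "x \<oplus>\<^bsub>V\<^esub> (-1) \<odot>\<^bsub>V\<^esub> x = \<zero>\<^bsub>V\<^esub>" using assms(9) x by simp
  qed
  show "Module.module class_ring V"
    by (rule module_criteria)
      (use neg assms in \<open>auto simp: class_ring_simps class_cring.cring_axioms\<close>)
qed

lemma lin_spaceI:
  fixes V :: "('k :: field, 'v) module"
  assumes "\<zero>\<^bsub>V\<^esub> \<in> carrier V"
    and "\<And>x y. x \<in> carrier V \<Longrightarrow> y \<in> carrier V \<Longrightarrow> x \<oplus>\<^bsub>V\<^esub> y \<in> carrier V"
    and "\<And>c x. x \<in> carrier V \<Longrightarrow> c \<odot>\<^bsub>V\<^esub> x \<in> carrier V"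
    and "\<And>x y. x \<in> carrier V \<Longrightarrow> y \<in> carrier V \<Longrightarrow> x \<oplus>\<^bsub>V\<^esub> y = y \<oplus>\<^bsub>V\<^esub> x"
    and "\<And>x y z. x \<in> carrier V \<Longrightarrow> y \<in> carrier V \<Longrightarrow> z \<in> carrier V \<Longrightarrow>
      (x \<oplus>\<^bsub>V\<^esub> y) \<oplus>\<^bsub>V\<^esub> z = x \<oplus>\<^bsub>V\<^esub> (y \<oplus>\<^bsub>V\<^esub> z)"
    and "\<And>x. x \<in> carrier V \<Longrightarrow> x \<oplus>\<^bsub>V\<^esub> \<zero>\<^bsub>V\<^esub> = x"
    and "\<And>a b x. x \<in> carrier V \<Longrightarrow> (a * b) \<odot>\<^bsub>V\<^esub> x = a \<odot>\<^bsub>V\<^esub> (b \<odot>\<^bsub>V\<^esub> x)"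
    and "\<And>x. x \<in> carrier V \<Longrightarrow> 1 \<odot>\<^bsub>V\<^esub> x = x"
    and "\<And>x. x \<in> carrier V \<Longrightarrow> 0 \<odot>\<^bsub>V\<^esub> x = \<zero>\<^bsub>V\<^esub>"
    and "\<And>a b x. x \<in> carrier V \<Longrightarrow> (a + b) \<odot>\<^bsub>V\<^esub> x = a \<odot>\<^bsub>V\<^esub> x \<oplus>\<^bsub>V\<^esub> b \<odot>\<^bsub>V\<^esub> x"
    and "\<And>a x y. x \<in> carrier V \<Longrightarrow> y \<in> carrier V \<Longrightarrow>
      a \<odot>\<^bsub>V\<^esub> (x \<oplus>\<^bsub>V\<^esub> y) = a \<odot>\<^bsub>V\<^esub> x \<oplus>\<^bsub>V\<^esub> a \<odot>\<^bsub>V\<^esub> y"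
  shows "lin_space V"
proof (rule lin_space.intro)
  interpret rmod V by (rule rmodI) (use assms in auto)
  show "vectorspace class_ring V"
    using M.module_axioms class_field by (auto simp: vectorspace_def)
qed

lemma lookup_map_mult [simp]:
  "Poly_Mapping.lookup (Poly_Mapping.map ((*) c) p) x = c * Poly_Mapping.lookup (p :: 'g \<Rightarrow>\<^sub>0 'k :: field) x"
  by (simp add: Poly_Mapping.map.rep_eq when_def)

lemma lin_space_free: "lin_space (free_mod G :: ('k :: field, 'g \<Rightarrow>\<^sub>0 'k) module)"
proof (rule lin_spaceI)
  fix x y :: "'g \<Rightarrow>\<^sub>0 'k"
  assume "x \<in> carrier (free_mod G)" "y \<in> carrier (free_mod G)"
  thus "x \<oplus>\<^bsub>free_mod G\<^esub> y \<in> carrier (free_mod G)"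
    using Poly_Mapping.keys_add[of x y] by (auto simp: free_mod_def)
next
  fix c and x :: "'g \<Rightarrow>\<^sub>0 'k"
  assume "x \<in> carrier (free_mod G)"
  thus "c \<odot>\<^bsub>free_mod G\<^esub> x \<in> carrier (free_mod G)"
    by (auto simp: free_mod_def in_keys_iff)
qed (auto simp: free_mod_def poly_mapping_eq_iff fun_eq_iff lookup_add algebra_simps)

subsection \<open>Quotients\<close>

lemma lin_space_submodule:
  fixes V :: "('k :: field, 'v) module"
  assumes "VectorSpace.subspace class_ring W V"
  shows "abelian_subgroup W V" "\<And>c x. x \<in> W \<Longrightarrow> c \<odot>\<^bsub>V\<^esub> x \<in> W" "W \<subseteq> carrier V" "\<zero>\<^bsub>V\<^esub> \<in> W"
    "lin_space V"
proof -
  have sub: "submodule class_ring W V" and vs: "vectorspace class_ring V"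
    using assms unfolding subspace_def by auto
  interpret V: lin_space V by (rule lin_space.intro) fact
  interpret W: submodule class_ring W V by fact
  show "lin_space V" by (rule lin_space.intro) fact
  show "W \<subseteq> carrier V" by (rule W.subset)
  show z: "\<zero>\<^bsub>V\<^esub> \<in> W" by simp
  show sm: "\<And>c x. x \<in> W \<Longrightarrow> c \<odot>\<^bsub>V\<^esub> x \<in> W" using W.smult_closed by (auto simp: class_ring_simps)
  have "subgroup W (add_monoid V)"
  proof (rule group.subgroupI[OF V.M.a_group])
    fix x assume "x \<in> W"
    hence "(-1) \<odot>\<^bsub>V\<^esub> x \<in> W" and x: "x \<in> carrier V" using sm W.subset by auto
    thus "inv\<^bsub>add_monoid V\<^esub> x \<in> W"
      using V.smult_neg_left[OF x, of 1] x by (simp add: a_inv_def)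
  next
    show "W \<noteq> {}" using z by blast
  qed (use W.subset in auto)
  thus "abelian_subgroup W V"
    by (intro abelian_subgroupI3 additive_subgroup.intro V.M.abelian_group_axioms) auto
qed

lemma
  assumes W: "VectorSpace.subspace class_ring W (V :: ('k :: field, 'v) module)"
  shows quot_carrier: "carrier (quot_mod V W) = (\<lambda>x. W +>\<^bsub>V\<^esub> x) ` carrier V"
    and quot_add: "x \<in> carrier V \<Longrightarrow> y \<in> carrier V \<Longrightarrow>
      (W +>\<^bsub>V\<^esub> x) \<oplus>\<^bsub>quot_mod V W\<^esub> (W +>\<^bsub>V\<^esub> y) = W +>\<^bsub>V\<^esub> (x \<oplus>\<^bsub>V\<^esub> y)"
    and quot_smult: "x \<in> carrier V \<Longrightarrow> c \<odot>\<^bsub>quot_mod V W\<^esub> (W +>\<^bsub>V\<^esub> x) = W +>\<^bsub>V\<^esub> (c \<odot>\<^bsub>V\<^esub> x)"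
    and quot_zero: "\<zero>\<^bsub>quot_mod V W\<^esub> = W +>\<^bsub>V\<^esub> \<zero>\<^bsub>V\<^esub>"
    and quot_eq_iff: "x \<in> carrier V \<Longrightarrow> y \<in> carrier V \<Longrightarrow>
      W +>\<^bsub>V\<^esub> x = W +>\<^bsub>V\<^esub> y \<longleftrightarrow> x \<ominus>\<^bsub>V\<^esub> y \<in> W"
    and quot_rep: "x \<in> carrier V \<Longrightarrow> y \<in> W +>\<^bsub>V\<^esub> x \<longleftrightarrow> y \<in> carrier V \<and> y \<ominus>\<^bsub>V\<^esub> x \<in> W"
    and lin_space_quot: "lin_space (quot_mod V W)"
proof -
  note W' = lin_space_submodule[OF W]
  interpret V: lin_space V by (rule W')
  interpret W: abelian_subgroup W V by (rule W')
  have a_minus: "x \<ominus>\<^bsub>V\<^esub> y = x \<oplus>\<^bsub>V\<^esub> \<ominus>\<^bsub>V\<^esub> y" for x y by (simp add: a_minus_def)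
  show rep: "y \<in> W +>\<^bsub>V\<^esub> x \<longleftrightarrow> y \<in> carrier V \<and> y \<ominus>\<^bsub>V\<^esub> x \<in> W" if "x \<in> carrier V" for x y
  proof
    assume "y \<in> W +>\<^bsub>V\<^esub> x"
    then obtain w where w: "w \<in> W" "y = w \<oplus>\<^bsub>V\<^esub> x" by (auto simp: a_r_coset_def')
    hence "w \<in> carrier V" using W'(3) by auto
    thus "y \<in> carrier V \<and> y \<ominus>\<^bsub>V\<^esub> x \<in> W" using w that
      by (simp add: a_minus V.M.a_assoc V.M.r_neg)
  next
    assume "y \<in> carrier V \<and> y \<ominus>\<^bsub>V\<^esub> x \<in> W"
    thus "y \<in> W +>\<^bsub>V\<^esub> x" using that unfolding a_r_coset_def'
      by (intro UN_I[of "y \<ominus>\<^bsub>V\<^esub> x"]) (auto simp: a_minus V.M.a_assoc V.M.l_neg)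
  qed
  show eq: "W +>\<^bsub>V\<^esub> x = W +>\<^bsub>V\<^esub> y \<longleftrightarrow> x \<ominus>\<^bsub>V\<^esub> y \<in> W"
    if "x \<in> carrier V" "y \<in> carrier V" for x y
  proof
    assume "W +>\<^bsub>V\<^esub> x = W +>\<^bsub>V\<^esub> y"
    moreover have "x \<in> W +>\<^bsub>V\<^esub> x" using that W'(4) by (simp add: rep a_minus V.M.r_neg)
    ultimately show "x \<ominus>\<^bsub>V\<^esub> y \<in> W" using rep that by auto
  next
    assume "x \<ominus>\<^bsub>V\<^esub> y \<in> W"
    hence "x \<in> W +>\<^bsub>V\<^esub> y" using rep that by auto
    from W.a_repr_independence'[OF this that(2)]
    show "W +>\<^bsub>V\<^esub> x = W +>\<^bsub>V\<^esub> y" by (rule sym)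
  qed
  show car: "carrier (quot_mod V W) = (\<lambda>x. W +>\<^bsub>V\<^esub> x) ` carrier V"
    by (auto simp: quot_mod_def A_RCOSETS_def')
  show add: "(W +>\<^bsub>V\<^esub> x) \<oplus>\<^bsub>quot_mod V W\<^esub> (W +>\<^bsub>V\<^esub> y) = W +>\<^bsub>V\<^esub> (x \<oplus>\<^bsub>V\<^esub> y)"
    if "x \<in> carrier V" "y \<in> carrier V" for x y
    using that by (simp add: quot_mod_def W.a_rcos_sum)
  show sm: "c \<odot>\<^bsub>quot_mod V W\<^esub> (W +>\<^bsub>V\<^esub> x) = W +>\<^bsub>V\<^esub> (c \<odot>\<^bsub>V\<^esub> x)" if x: "x \<in> carrier V" for x c
  proof -
    \<comment> \<open>Scalar multiplication in \<open>quot_mod\<close> is a union over all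
      representatives of the coset. Each member of the union turns out to be the same coset, so the
      union is that coset.\<close>
    have *: "W +>\<^bsub>V\<^esub> (c \<odot>\<^bsub>V\<^esub> y) = W +>\<^bsub>V\<^esub> (c \<odot>\<^bsub>V\<^esub> x)" if "y \<in> W +>\<^bsub>V\<^esub> x" for y
    proof -
      have y: "y \<in> carrier V" "y \<ominus>\<^bsub>V\<^esub> x \<in> W" using iffD1[OF rep[OF x] that] by blast+
      have n: "\<ominus>\<^bsub>V\<^esub> x = (-1) \<odot>\<^bsub>V\<^esub> x" "\<ominus>\<^bsub>V\<^esub> (c \<odot>\<^bsub>V\<^esub> x) = (- c) \<odot>\<^bsub>V\<^esub> x"
        by (simp_all only: V.smult_neg_left[OF x] V.smult_one[OF x])
      have "c \<odot>\<^bsub>V\<^esub> y \<ominus>\<^bsub>V\<^esub> c \<odot>\<^bsub>V\<^esub> x = c \<odot>\<^bsub>V\<^esub> (y \<ominus>\<^bsub>V\<^esub> x)"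
        using V.smult_smult[OF x, of c "-1"] x y(1)
        by (simp add: a_minus n V.smult_add_right[OF y(1) V.smult_closed[OF x]])
      hence "c \<odot>\<^bsub>V\<^esub> y \<ominus>\<^bsub>V\<^esub> c \<odot>\<^bsub>V\<^esub> x \<in> W" using W'(2)[OF y(2)] by simp
      thus ?thesis by (rule iffD2[OF eq[OF V.smult_closed[OF y(1)] V.smult_closed[OF x]]])
    qed
    have "W +>\<^bsub>V\<^esub> x \<noteq> {}" using W.a_rcos_self[OF x] by blast
    hence "(\<Union>y\<in>W +>\<^bsub>V\<^esub> x. W +>\<^bsub>V\<^esub> (c \<odot>\<^bsub>V\<^esub> y)) = W +>\<^bsub>V\<^esub> (c \<odot>\<^bsub>V\<^esub> x)"
      by (subst SUP_cong[OF refl *]) auto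
    thus ?thesis unfolding quot_mod_def by simp
  qed
  show zero: "\<zero>\<^bsub>quot_mod V W\<^esub> = W +>\<^bsub>V\<^esub> \<zero>\<^bsub>V\<^esub>"
    using V.M.a_coset_add_zero W'(3) by (simp add: quot_mod_def)
  show "lin_space (quot_mod V W)"
    by (rule lin_spaceI)
      (auto simp: car add sm zero V.M.a_ac V.smult_add_left V.smult_add_right V.smult_smult)
qed

lemma quot_proj_hom:
  fixes V :: "('k :: field, 'v) module"
  assumes "VectorSpace.subspace class_ring W V"
  shows "(\<lambda>x. W +>\<^bsub>V\<^esub> x) \<in> lin_hom V (quot_mod V W)"
  by (rule lin_homI) (use quot_carrier[OF assms] quot_add[OF assms] quot_smult[OF assms] in auto)

subsection \<open>The universal property of a presentation\<close>

text \<open>The linear extension of \<open>f\<close> to formal sums; \<open>extend_lin N f X\<close>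
  is its value at a chosen representative of the class \<open>X\<close>.\<close>

definition free_lift ::
  "('k :: field, 'n) module \<Rightarrow> ('g \<Rightarrow> 'n) \<Rightarrow> ('g \<Rightarrow>\<^sub>0 'k) \<Rightarrow> 'n" where
  "free_lift N f p = (\<Oplus>\<^bsub>N\<^esub>g\<in>Poly_Mapping.keys p. Poly_Mapping.lookup p g \<odot>\<^bsub>N\<^esub> f g)"

text \<open>For additivity, two formal sums and their total must be summed over one finite set,
  since cancellation can shrink the support.\<close>

lemma free_lift_superset:
  assumes "lin_space N" "finite S" "Poly_Mapping.keys p \<subseteq> S" "f \<in> S \<rightarrow> carrier N"
  shows "free_lift N f p = (\<Oplus>\<^bsub>N\<^esub>g\<in>S. Poly_Mapping.lookup p g \<odot>\<^bsub>N\<^esub> f g)"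
proof -
  interpret N: lin_space N by fact
  show ?thesis unfolding free_lift_def
    using assms
    by (intro N.M.add.finprod_mono_neutral_cong_left) (auto simp: in_keys_iff Pi_iff)
qed

lemma free_lift_hom:
  fixes N :: "('k :: field, 'n) module" and f :: "'g \<Rightarrow> 'n"
  assumes "lin_space N" "f \<in> G \<rightarrow> carrier N"
  shows "free_lift N f \<in> lin_hom (free_mod G) N"
proof (rule lin_homI)
  interpret N: lin_space N by fact
  interpret F: lin_space "free_mod G" by (rule lin_space_free)
  fix p q :: "'g \<Rightarrow>\<^sub>0 'k" assume pq: "p \<in> carrier (free_mod G)" "q \<in> carrier (free_mod G)"
  let ?S = "Poly_Mapping.keys p \<union> Poly_Mapping.keys q"
  have S: "f \<in> ?S \<rightarrow> carrier N" using assms(2) pq by (auto simp: free_mod_def)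
  have "free_lift N f (p \<oplus>\<^bsub>free_mod G\<^esub> q) = (\<Oplus>\<^bsub>N\<^esub>g\<in>?S. Poly_Mapping.lookup (p + q) g \<odot>\<^bsub>N\<^esub> f g)"
    using S assms(1) Poly_Mapping.keys_add[of p q] by (subst free_lift_superset[of _ ?S]) (auto simp: free_mod_def)
  also have "\<dots> = (\<Oplus>\<^bsub>N\<^esub>g\<in>?S. Poly_Mapping.lookup p g \<odot>\<^bsub>N\<^esub> f g \<oplus>\<^bsub>N\<^esub> Poly_Mapping.lookup q g \<odot>\<^bsub>N\<^esub> f g)"
    using S by (intro N.M.add.finprod_cong') (auto simp: lookup_add intro!: N.smult_add_left)
  also have "\<dots> = (\<Oplus>\<^bsub>N\<^esub>g\<in>?S. Poly_Mapping.lookup p g \<odot>\<^bsub>N\<^esub> f g) \<oplus>\<^bsub>N\<^esub> (\<Oplus>\<^bsub>N\<^esub>g\<in>?S. Poly_Mapping.lookup q g \<odot>\<^bsub>N\<^esub> f g)"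
    using S by (intro N.M.finsum_addf) auto
  also have "\<dots> = free_lift N f p \<oplus>\<^bsub>N\<^esub> free_lift N f q"
    using S assms(1) by (simp add: free_lift_superset[of N ?S])
  finally show "free_lift N f (p \<oplus>\<^bsub>free_mod G\<^esub> q) = free_lift N f p \<oplus>\<^bsub>N\<^esub> free_lift N f q" .
next
  interpret N: lin_space N by fact
  fix c :: 'k and p :: "'g \<Rightarrow>\<^sub>0 'k" assume p: "p \<in> carrier (free_mod G)"
  let ?S = "Poly_Mapping.keys p"
  have S: "f \<in> ?S \<rightarrow> carrier N" using assms(2) p by (auto simp: free_mod_def)
  show "free_lift N f p \<in> carrier N"
    unfolding free_lift_def using S by (intro N.M.finsum_closed) auto
  have "free_lift N f (c \<odot>\<^bsub>free_mod G\<^esub> p) = (\<Oplus>\<^bsub>N\<^esub>g\<in>?S. Poly_Mapping.lookup (Poly_Mapping.map ((*) c) p) g \<odot>\<^bsub>N\<^esub> f g)"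
    using S assms(1) by (subst free_lift_superset[of _ ?S]) (auto simp: free_mod_def in_keys_iff)
  also have "\<dots> = (\<Oplus>\<^bsub>N\<^esub>g\<in>?S. c \<odot>\<^bsub>N\<^esub> (Poly_Mapping.lookup p g \<odot>\<^bsub>N\<^esub> f g))"
    using S by (intro N.M.add.finprod_cong') (auto intro!: N.smult_smult[symmetric])
  also have "\<dots> = c \<odot>\<^bsub>N\<^esub> free_lift N f p"
    unfolding free_lift_def using S by (intro N.smult_finsum[symmetric]) auto
  finally show "free_lift N f (c \<odot>\<^bsub>free_mod G\<^esub> p) = c \<odot>\<^bsub>N\<^esub> free_lift N f p" .
qed

lemma free_lift_single:
  assumes "lin_space N" "f g \<in> carrier N"
  shows "free_lift N f (Poly_Mapping.single g c) = c \<odot>\<^bsub>N\<^esub> f g"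
proof -
  interpret N: lin_space N by fact
  show ?thesis using assms by (cases "c = 0") (auto simp: free_lift_def N.M.finsum_insert)
qed

lemma free_lift_diff:
  assumes "lin_space N" "f \<in> G \<rightarrow> carrier N" "p \<in> carrier (free_mod G)" "q \<in> carrier (free_mod G)"
  shows "p - q \<in> carrier (free_mod G)"
    and "free_lift N f (p - q) = free_lift N f p \<ominus>\<^bsub>N\<^esub> free_lift N f q"
proof -
  interpret N: lin_space N by fact
  interpret F: lin_space "free_mod G" by (rule lin_space_free)
  have eq: "p - q = p \<oplus>\<^bsub>free_mod G\<^esub> (-1) \<odot>\<^bsub>free_mod G\<^esub> q"
    by (auto simp: free_mod_def poly_mapping_eq_iff fun_eq_iff lookup_add lookup_minus)
  show "p - q \<in> carrier (free_mod G)" unfolding eq using assms by auto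
  note h = free_lift_hom[OF assms(1,2)]
  show "free_lift N f (p - q) = free_lift N f p \<ominus>\<^bsub>N\<^esub> free_lift N f q"
    unfolding eq using assms(3,4) lin_hom_closed[OF h]
    by (simp add: lin_hom_add[OF h] lin_hom_smult[OF h] a_minus_def N.smult_neg_left)
qed

lemma single_in_free [simp]: "g \<in> G \<Longrightarrow> Poly_Mapping.single g c \<in> carrier (free_mod G)"
  by (auto simp: free_mod_def)

lemma rel_span_subspace:
  assumes "R \<subseteq> carrier (free_mod G)"
  shows "VectorSpace.subspace class_ring (rel_span G R) (free_mod G)" "R \<subseteq> rel_span G R"
proof -
  interpret F: lin_space "free_mod G" by (rule lin_space_free)
  show "VectorSpace.subspace class_ring (rel_span G R) (free_mod G)"
    unfolding rel_span_def by (rule F.VS.span_is_subspace[OF assms])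
  show "R \<subseteq> rel_span G R" unfolding rel_span_def by (rule F.M.in_own_span[OF assms])
qed

lemma lin_space_presented: "R \<subseteq> carrier (free_mod G) \<Longrightarrow> lin_space (presented_mod G R)"
  unfolding presented_mod_def by (rule lin_space_quot[OF rel_span_subspace(1)])

lemma generator_closed:
  "R \<subseteq> carrier (free_mod G) \<Longrightarrow> g \<in> G \<Longrightarrow> generator G R g \<in> carrier (presented_mod G R)"
  unfolding presented_mod_def generator_def
  using quot_carrier[OF rel_span_subspace(1), of R G] by auto

text \<open>A representative has finite support, and one term at a time is peeled off it.\<close>

lemma presented_induct [consumes 2, case_names zero gen add]:
  assumes R: "R \<subseteq> carrier (free_mod G :: ('k :: field, 'g \<Rightarrow>\<^sub>0 'k) module)"
    and X: "X \<in> carrier (presented_mod G R)"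
    and zero: "P \<zero>\<^bsub>presented_mod G R\<^esub>"
    and gen: "\<And>g c. g \<in> G \<Longrightarrow> P (c \<odot>\<^bsub>presented_mod G R\<^esub> generator G R g)"
    and add: "\<And>X Y. X \<in> carrier (presented_mod G R) \<Longrightarrow> Y \<in> carrier (presented_mod G R) \<Longrightarrow>
      P X \<Longrightarrow> P Y \<Longrightarrow> P (X \<oplus>\<^bsub>presented_mod G R\<^esub> Y)"
  shows "P X"
proof -
  interpret F: lin_space "free_mod G" by (rule lin_space_free)
  interpret Q: lin_space "presented_mod G R" by (rule lin_space_presented[OF R])
  note W = rel_span_subspace(1)[OF R]
  let ?c = "\<lambda>p. rel_span G R +>\<^bsub>free_mod G\<^esub> p"
  have "finite S \<Longrightarrow> Poly_Mapping.keys p \<subseteq> S \<Longrightarrow> S \<subseteq> G \<Longrightarrow> P (?c p)" for S and p :: "'g \<Rightarrow>\<^sub>0 'k"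
  proof (induction S arbitrary: p rule: finite_induct)
    case empty
    hence "p = \<zero>\<^bsub>free_mod G\<^esub>" by (simp add: free_mod_def)
    thus ?case using zero quot_zero[OF W] by (simp add: presented_mod_def)
  next
    case (insert g S)
    let ?q = "p - Poly_Mapping.single g (Poly_Mapping.lookup p g)"
    let ?s = "Poly_Mapping.single g (Poly_Mapping.lookup p g)"
    have q: "Poly_Mapping.keys ?q \<subseteq> S"
      using insert.prems by (auto simp: in_keys_iff lookup_minus lookup_single when_def split: if_splits)
    have qc: "?q \<in> carrier (free_mod G)" using q insert.prems by (auto simp: free_mod_def)
    have g: "g \<in> G" using insert by auto
    have s: "?s = Poly_Mapping.lookup p g \<odot>\<^bsub>free_mod G\<^esub> Poly_Mapping.single g 1"
      by (auto simp: free_mod_def poly_mapping_eq_iff fun_eq_iff lookup_single when_def)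
    have "p = ?q \<oplus>\<^bsub>free_mod G\<^esub> ?s" by (simp add: free_mod_def)
    hence "?c p = ?c ?q \<oplus>\<^bsub>presented_mod G R\<^esub> ?c ?s"
      using quot_add[OF W qc single_in_free[OF g]] unfolding presented_mod_def by metis
    moreover have "?c ?s = Poly_Mapping.lookup p g \<odot>\<^bsub>presented_mod G R\<^esub> generator G R g"
      unfolding presented_mod_def generator_def quot_smult[OF W single_in_free[OF g]] s ..
    moreover have "P (?c ?q)" using insert.IH[OF q] insert.prems by auto
    moreover have "?c ?q \<in> carrier (presented_mod G R)" using qc quot_carrier[OF W]
      by (auto simp: presented_mod_def)
    ultimately show ?case
      using add[of "?c ?q" "?c ?s"] gen[OF g] generator_closed[OF R g] by simp
  qed
  moreover obtain p where "X = ?c p" "p \<in> carrier (free_mod G)"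
    using X quot_carrier[OF W] by (auto simp: presented_mod_def)
  moreover from this(2) have "Poly_Mapping.keys p \<subseteq> G" by (simp add: free_mod_def)
  ultimately show ?thesis by (metis Poly_Mapping.finite_keys order_refl)
qed

text \<open>The kernel of \<open>free_lift N f\<close> is a submodule containing the relations,
  hence it contains their span; so the value at a representative picked by \<open>SOME\<close>
  depends only on the class.\<close>

lemma
  fixes f :: "'g \<Rightarrow> 'n" and N :: "('k :: field, 'n) module"
  assumes N: "lin_space N" and R: "R \<subseteq> carrier (free_mod G)" and f: "\<And>g. g \<in> G \<Longrightarrow> f g \<in> carrier N"
    and rel: "\<And>r. r \<in> R \<Longrightarrow> free_lift N f r = \<zero>\<^bsub>N\<^esub>"
  shows extend_lin_hom: "extend_lin N f \<in> lin_hom (presented_mod G R) N"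
    and extend_lin_generator: "g \<in> G \<Longrightarrow> extend_lin N f (generator G R g) = f g"
proof -
  interpret N: lin_space N by fact
  interpret F: lin_space "free_mod G" by (rule lin_space_free)
  note W = rel_span_subspace(1)[OF R]
  let ?c = "\<lambda>p. rel_span G R +>\<^bsub>free_mod G\<^esub> p"
  have f': "f \<in> G \<rightarrow> carrier N" using f by auto
  note L = free_lift_hom[OF N f']
  interpret L: mod_hom class_ring "free_mod G" N "free_lift N f"
    by (intro mod_hom.intro mod_hom_axioms.intro L F.M.module_axioms N.M.module_axioms)
  have "rel_span G R \<subseteq> L.ker"
    unfolding rel_span_def using R rel
    by (intro F.M.span_is_subset L.ker_is_submodule) (auto simp: L.ker_def)
  hence ker: "free_lift N f r = \<zero>\<^bsub>N\<^esub>" if "r \<in> rel_span G R" for r using that by (auto simp: L.ker_def)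
  have ext: "extend_lin N f (?c p) = free_lift N f p" if p: "p \<in> carrier (free_mod G)" for p
  proof -
    define q where "q = (SOME q. q \<in> ?c p)"
    have "p \<in> ?c p" using p lin_space_submodule(4)[OF W]
      by (simp add: quot_rep[OF W] a_minus_def F.M.r_neg)
    hence "q \<in> ?c p" unfolding q_def by (rule someI)
    hence q: "q \<in> carrier (free_mod G)" "q \<ominus>\<^bsub>free_mod G\<^esub> p \<in> rel_span G R" using quot_rep[OF W p] by auto
    have "q = (q \<ominus>\<^bsub>free_mod G\<^esub> p) \<oplus>\<^bsub>free_mod G\<^esub> p"
      using p q by (simp add: a_minus_def F.M.a_assoc F.M.l_neg)
    hence "free_lift N f q = free_lift N f (q \<ominus>\<^bsub>free_mod G\<^esub> p) \<oplus>\<^bsub>N\<^esub> free_lift N f p"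
      using lin_hom_add[OF L, of "q \<ominus>\<^bsub>free_mod G\<^esub> p" p] p q by simp
    hence "free_lift N f q = free_lift N f p" using ker[OF q(2)] lin_hom_closed[OF L p] by simp
    thus ?thesis unfolding extend_lin_def Let_def q_def[symmetric] free_lift_def[symmetric] .
  qed
  show "extend_lin N f \<in> lin_hom (presented_mod G R) N"
    by (rule lin_homI)
      (auto simp: presented_mod_def quot_carrier[OF W] quot_add[OF W] quot_smult[OF W] ext lin_hom[OF L])
  show "extend_lin N f (generator G R g) = f g" if "g \<in> G"
    unfolding generator_def using that f by (subst ext) (auto simp: free_lift_single[where f=f, OF N])
qed

lemma presented_class_hom:
  assumes R: "R \<subseteq> carrier (free_mod G)"
  shows "(\<lambda>p. rel_span G R +>\<^bsub>free_mod G\<^esub> p) \<in> lin_hom (free_mod G) (presented_mod G R)"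
  unfolding presented_mod_def by (rule quot_proj_hom[OF rel_span_subspace(1)[OF R]])

lemma presented_class_single:
  assumes R: "R \<subseteq> carrier (free_mod G)" and g: "g \<in> G"
  shows "rel_span G R +>\<^bsub>free_mod G\<^esub> Poly_Mapping.single g c = c \<odot>\<^bsub>presented_mod G R\<^esub> generator G R g"
proof -
  have "Poly_Mapping.single g c = c \<odot>\<^bsub>free_mod G\<^esub> Poly_Mapping.single g 1"
    by (auto simp: free_mod_def poly_mapping_eq_iff fun_eq_iff lookup_single when_def)
  thus ?thesis using lin_hom_smult[OF presented_class_hom[OF R] single_in_free[OF g]]
    unfolding generator_def by metis
qed

lemma presented_class_rel:
  assumes R: "R \<subseteq> carrier (free_mod G)" and r: "r \<in> R"
  shows "rel_span G R +>\<^bsub>free_mod G\<^esub> r = \<zero>\<^bsub>presented_mod G R\<^esub>"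
proof -
  interpret F: lin_space "free_mod G" by (rule lin_space_free)
  note W = rel_span_subspace[OF R]
  have "r \<ominus>\<^bsub>free_mod G\<^esub> \<zero>\<^bsub>free_mod G\<^esub> \<in> rel_span G R"
    using r W(2) subsetD[OF R r] by (simp add: a_minus_def subsetD)
  thus ?thesis using r R unfolding presented_mod_def quot_zero[OF W(1)]
    by (subst quot_eq_iff[OF W(1)]) auto
qed

lemma generator_add:
  assumes R: "R \<subseteq> carrier (free_mod G)" and g: "a \<in> G" "b \<in> G" "c \<in> G"
    and r: "Poly_Mapping.single a 1 - Poly_Mapping.single b 1 - Poly_Mapping.single c 1 \<in> R" (is "?r \<in> R")
  shows "generator G R a = generator G R b \<oplus>\<^bsub>presented_mod G R\<^esub> generator G R c"
proof -
  interpret Q: lin_space "presented_mod G R" by (rule lin_space_presented[OF R])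
  note h = presented_class_hom[OF R] and c = generator_closed[OF R]
  let ?s = "Poly_Mapping.single b 1 \<oplus>\<^bsub>free_mod G\<^esub> Poly_Mapping.single c 1"
  have s: "?s \<in> carrier (free_mod G)"
    by (rule rmod.add_closed[OF lin_space.rmod[OF lin_space_free] single_in_free[OF g(2)] single_in_free[OF g(3)]])
  have "Poly_Mapping.single a 1 = ?r \<oplus>\<^bsub>free_mod G\<^esub> ?s" by (simp add: free_mod_def)
  hence "generator G R a = rel_span G R +>\<^bsub>free_mod G\<^esub> (?r \<oplus>\<^bsub>free_mod G\<^esub> ?s)"
    unfolding generator_def by simp
  also have "\<dots> = \<zero>\<^bsub>presented_mod G R\<^esub> \<oplus>\<^bsub>presented_mod G R\<^esub>
      (generator G R b \<oplus>\<^bsub>presented_mod G R\<^esub> generator G R c)"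
    unfolding lin_hom_add[OF h subsetD[OF R r] s] presented_class_rel[OF R r] generator_def
      lin_hom_add[OF h single_in_free[OF g(2)] single_in_free[OF g(3)]] ..
  finally show ?thesis using c g by simp
qed

lemma generator_smult:
  assumes R: "R \<subseteq> carrier (free_mod G)" and g: "a \<in> G" "b \<in> G"
    and r: "Poly_Mapping.single a 1 - Poly_Mapping.single b k \<in> R" (is "?r \<in> R")
  shows "generator G R a = k \<odot>\<^bsub>presented_mod G R\<^esub> generator G R b"
proof -
  interpret Q: lin_space "presented_mod G R" by (rule lin_space_presented[OF R])
  note h = presented_class_hom[OF R] and c = generator_closed[OF R]
  have "Poly_Mapping.single a 1 = ?r \<oplus>\<^bsub>free_mod G\<^esub> Poly_Mapping.single b k"
    by (simp add: free_mod_def)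
  hence "generator G R a = \<zero>\<^bsub>presented_mod G R\<^esub> \<oplus>\<^bsub>presented_mod G R\<^esub>
      k \<odot>\<^bsub>presented_mod G R\<^esub> generator G R b"
    using lin_hom_add[OF h, of ?r "Poly_Mapping.single b k"] presented_class_single[OF R g(2)]
      single_in_free[OF g(2)] presented_class_rel[OF R r] r R
    unfolding generator_def by (metis subsetD)
  thus ?thesis using c g by simp
qed

lemma generator_zero:
  assumes R: "R \<subseteq> carrier (free_mod G)" and r: "Poly_Mapping.single a 1 \<in> R"
  shows "generator G R a = \<zero>\<^bsub>presented_mod G R\<^esub>"
  unfolding generator_def by (rule presented_class_rel[OF R r])

lemma free_lift_add_rel:
  assumes N: "lin_space N" and c: "f a = f b \<oplus>\<^bsub>N\<^esub> f c" "f b \<in> carrier N" "f c \<in> carrier N"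
  shows "free_lift N f (Poly_Mapping.single a 1 - Poly_Mapping.single b 1 - Poly_Mapping.single c 1) = \<zero>\<^bsub>N\<^esub>"
proof -
  interpret N: lin_space N by fact
  have f: "f \<in> {a, b, c} \<rightarrow> carrier N" using c by auto
  note s = single_in_free[of _ "{a, b, c}"]
  have "free_lift N f (Poly_Mapping.single a 1 - Poly_Mapping.single b 1 - Poly_Mapping.single c 1)
    = (f a \<ominus>\<^bsub>N\<^esub> f b) \<ominus>\<^bsub>N\<^esub> f c"
    using c by (subst free_lift_diff(2)[OF N f], force intro!: free_lift_diff(1)[OF N f] s, force intro!: s,
      subst free_lift_diff(2)[OF N f], force intro!: s, force intro!: s) (simp add: free_lift_single[OF N])
  also have "f a \<ominus>\<^bsub>N\<^esub> f b = f c" unfolding c(1) N.M.a_comm[OF c(2,3)] using c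
    by (simp add: a_minus_def N.M.a_assoc N.M.r_neg)
  also have "f c \<ominus>\<^bsub>N\<^esub> f c = \<zero>\<^bsub>N\<^esub>" using c by simp
  finally show ?thesis .
qed

lemma free_lift_smult_rel:
  assumes N: "lin_space N" and c: "f a = k \<odot>\<^bsub>N\<^esub> f b" "f b \<in> carrier N"
  shows "free_lift N f (Poly_Mapping.single a 1 - Poly_Mapping.single b k) = \<zero>\<^bsub>N\<^esub>"
proof -
  interpret N: lin_space N by fact
  have f: "f \<in> {a, b} \<rightarrow> carrier N" using c by auto
  note s = single_in_free[of _ "{a, b}"]
  show ?thesis
    using c by (subst free_lift_diff(2)[OF N f], force intro!: s, force intro!: s)
      (simp add: free_lift_single[OF N] a_minus_def N.M.r_neg)
qed

subsection \<open>Tensor products\<close>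

definition bilin :: "('k :: field, 'v) module \<Rightarrow> ('k, 'w) module \<Rightarrow> ('k, 'n) module \<Rightarrow> ('v \<Rightarrow> 'w \<Rightarrow> 'n) \<Rightarrow> bool" where
  "bilin V W N f \<longleftrightarrow> (\<forall>x\<in>carrier V. f x \<in> lin_hom W N) \<and> (\<forall>y\<in>carrier W. (\<lambda>x. f x y) \<in> lin_hom V N)"

lemma bilinI:
  assumes "\<And>x. x \<in> carrier V \<Longrightarrow> f x \<in> lin_hom W N" "\<And>y. y \<in> carrier W \<Longrightarrow> (\<lambda>x. f x y) \<in> lin_hom V N"
  shows "bilin V W N f"
  using assms by (simp add: bilin_def)

lemma bilinD:
  assumes "bilin V W N f"
  shows "x \<in> carrier V \<Longrightarrow> f x \<in> lin_hom W N" "y \<in> carrier W \<Longrightarrow> (\<lambda>x. f x y) \<in> lin_hom V N"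
  using assms by (auto simp: bilin_def)

lemma bilinear_rels_memI:
  shows "x \<in> carrier V \<Longrightarrow> x' \<in> carrier V \<Longrightarrow> y \<in> carrier W \<Longrightarrow>
    Poly_Mapping.single (x \<oplus>\<^bsub>V\<^esub> x', y) 1 - Poly_Mapping.single (x, y) 1 - Poly_Mapping.single (x', y) 1
      \<in> bilinear_rels V W"
    and "x \<in> carrier V \<Longrightarrow> y \<in> carrier W \<Longrightarrow> y' \<in> carrier W \<Longrightarrow>
    Poly_Mapping.single (x, y \<oplus>\<^bsub>W\<^esub> y') 1 - Poly_Mapping.single (x, y) 1 - Poly_Mapping.single (x, y') 1
      \<in> bilinear_rels V W"
    and "x \<in> carrier V \<Longrightarrow> y \<in> carrier W \<Longrightarrow>
    Poly_Mapping.single (c \<odot>\<^bsub>V\<^esub> x, y) 1 - Poly_Mapping.single (x, y) c \<in> bilinear_rels V W"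
    and "x \<in> carrier V \<Longrightarrow> y \<in> carrier W \<Longrightarrow>
    Poly_Mapping.single (x, c \<odot>\<^bsub>W\<^esub> y) 1 - Poly_Mapping.single (x, y) c \<in> bilinear_rels V W"
  unfolding bilinear_rels_def by blast+

lemma bilinear_rels_free:
  fixes V :: "('k :: field, 'v) module" and W :: "('k, 'w) module"
  assumes "lin_space V" "lin_space W"
  shows "bilinear_rels V W \<subseteq> carrier (free_mod (carrier V \<times> carrier W))"
proof -
  interpret V: lin_space V by fact
  interpret W: lin_space W by fact
  have d: "p - q \<in> carrier (free_mod G)" if "p \<in> carrier (free_mod G)" "q \<in> carrier (free_mod G)"
    for p q :: "'v \<times> 'w \<Rightarrow>\<^sub>0 'k" and G
    using that Poly_Mapping.keys_diff[of p q] by (auto simp: free_mod_def)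
  show ?thesis unfolding bilinear_rels_def by (safe intro!: d single_in_free) auto
qed

context
  fixes V :: "('k :: field, 'v) module" and W :: "('k, 'w) module"
  assumes VW: "lin_space V" "lin_space W"
begin

interpretation V: lin_space V by (rule VW(1))
interpretation W: lin_space W by (rule VW(2))

lemma lin_space_tensor: "lin_space (tensor_mod V W)"
  unfolding tensor_mod_def by (rule lin_space_presented[OF bilinear_rels_free[OF VW]])

lemma tensor_elt_closed: "x \<in> carrier V \<Longrightarrow> y \<in> carrier W \<Longrightarrow> tensor_elt V W x y \<in> carrier (tensor_mod V W)"
  unfolding tensor_elt_def tensor_mod_def by (rule generator_closed[OF bilinear_rels_free[OF VW]]) simp

lemma tensor_elt_bilin: "bilin V W (tensor_mod V W) (tensor_elt V W)"
  unfolding bilin_def tensor_elt_def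
proof (safe)
  note R = bilinear_rels_free[OF VW]
  fix x assume x: "x \<in> carrier V"
  show "(\<lambda>y. generator (carrier V \<times> carrier W) (bilinear_rels V W) (x, y)) \<in> lin_hom W (tensor_mod V W)"
    unfolding tensor_mod_def using x
    by (intro lin_homI generator_closed[OF R] generator_add[OF R] generator_smult[OF R]
        bilinear_rels_memI) auto
next
  note R = bilinear_rels_free[OF VW]
  fix y assume y: "y \<in> carrier W"
  show "(\<lambda>x. generator (carrier V \<times> carrier W) (bilinear_rels V W) (x, y)) \<in> lin_hom V (tensor_mod V W)"
    unfolding tensor_mod_def using y
    by (intro lin_homI generator_closed[OF R] generator_add[OF R] generator_smult[OF R]
        bilinear_rels_memI) auto
qed

lemmas tensor_elt_left = lin_hom[OF bilinD(2)[OF tensor_elt_bilin]]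

text \<open>No scalars occur in the case of a pure tensor, because a scalar can be moved into the
  left factor.\<close>

lemma tensor_induct [consumes 1, case_names zero elt add]:
  assumes X: "X \<in> carrier (tensor_mod V W)"
    and zero: "P \<zero>\<^bsub>tensor_mod V W\<^esub>"
    and elt: "\<And>x y. x \<in> carrier V \<Longrightarrow> y \<in> carrier W \<Longrightarrow> P (tensor_elt V W x y)"
    and add: "\<And>X Y. X \<in> carrier (tensor_mod V W) \<Longrightarrow> Y \<in> carrier (tensor_mod V W) \<Longrightarrow>
      P X \<Longrightarrow> P Y \<Longrightarrow> P (X \<oplus>\<^bsub>tensor_mod V W\<^esub> Y)"
  shows "P X"
proof (rule presented_induct[OF bilinear_rels_free[OF VW], of X P])
  fix g :: "'v \<times> 'w" and c assume g: "g \<in> carrier V \<times> carrier W"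
  obtain x y where xy: "g = (x, y)" "x \<in> carrier V" "y \<in> carrier W" using g by auto
  have "P (tensor_elt V W (c \<odot>\<^bsub>V\<^esub> x) y)" using xy by (intro elt) auto
  thus "P (c \<odot>\<^bsub>presented_mod (carrier V \<times> carrier W) (bilinear_rels V W)\<^esub>
            generator (carrier V \<times> carrier W) (bilinear_rels V W) g)"
    using tensor_elt_left(3)[OF xy(3,2)] xy by (simp add: tensor_elt_def tensor_mod_def)
qed (use X zero add in \<open>simp_all add: tensor_mod_def\<close>)

lemma
  assumes N: "lin_space N" and f: "bilin V W N f"
  shows tensor_lift_hom: "extend_lin N (\<lambda>(x, y). f x y) \<in> lin_hom (tensor_mod V W) N"
    and tensor_lift_elt: "x \<in> carrier V \<Longrightarrow> y \<in> carrier W \<Longrightarrow>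
      extend_lin N (\<lambda>(x, y). f x y) (tensor_elt V W x y) = f x y"
proof -
  let ?f = "\<lambda>(x, y). f x y"
  have c: "?f g \<in> carrier N" if "g \<in> carrier V \<times> carrier W" for g
    using that bilinD(1)[OF f] by (auto intro: lin_hom_closed)
  have r: "free_lift N ?f r = \<zero>\<^bsub>N\<^esub>" if "r \<in> bilinear_rels V W" for r
    using that unfolding bilinear_rels_def
    by (safe intro!: free_lift_add_rel[OF N] free_lift_smult_rel[OF N])
      (use lin_hom[OF bilinD(1)[OF f]] lin_hom[OF bilinD(2)[OF f]] in simp_all)
  show "extend_lin N ?f \<in> lin_hom (tensor_mod V W) N"
    unfolding tensor_mod_def by (rule extend_lin_hom[OF N bilinear_rels_free[OF VW] c r])
  show "extend_lin N (\<lambda>(x, y). f x y) (tensor_elt V W x y) = f x y" if "x \<in> carrier V" "y \<in> carrier W"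
    unfolding tensor_elt_def using extend_lin_generator[OF N bilinear_rels_free[OF VW] c r, of "(x, y)"] that
    by auto
qed

lemma tensor_hom_eqI:
  assumes N: "lin_space N" and f: "f \<in> lin_hom (tensor_mod V W) N" and g: "g \<in> lin_hom (tensor_mod V W) N"
    and eq: "\<And>x y. x \<in> carrier V \<Longrightarrow> y \<in> carrier W \<Longrightarrow> f (tensor_elt V W x y) = g (tensor_elt V W x y)"
    and X: "X \<in> carrier (tensor_mod V W)"
  shows "f X = g X"
  using X
proof (induction rule: tensor_induct)
  case zero
  show ?case using lin_hom_zero[OF lin_space_tensor N f] lin_hom_zero[OF lin_space_tensor N g] by simp
next
  case (add X Y)
  thus ?case using lin_hom_add[OF f] lin_hom_add[OF g] by simp
qed (rule eq)

end

subsection \<open>Families of bilinear maps\<close>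

text \<open>In an iterated extension, the bilinear map inside \<open>extend_lin\<close> depends on a
  further variable. Linearity in that variable is checked on pure tensors.\<close>

lemma tensor_lift_param:
  assumes P: "lin_space P" and V: "lin_space V" and W: "lin_space W" and N: "lin_space N"
    and F: "\<And>p. p \<in> carrier P \<Longrightarrow> bilin V W N (F p)"
    and lin: "\<And>x y. x \<in> carrier V \<Longrightarrow> y \<in> carrier W \<Longrightarrow> (\<lambda>p. F p x y) \<in> lin_hom P N"
    and X: "X \<in> carrier (tensor_mod V W)"
  shows "(\<lambda>p. extend_lin N (\<lambda>(x, y). F p x y) X) \<in> lin_hom P N"
proof -
  interpret P: lin_space P by fact
  interpret N: lin_space N by fact
  let ?E = "\<lambda>p. extend_lin N (\<lambda>(x, y). F p x y)"
  have h: "?E p \<in> lin_hom (tensor_mod V W) N" if "p \<in> carrier P" for p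
    by (rule tensor_lift_hom[OF V W N F[OF that]])
  have e: "?E p (tensor_elt V W x y) = F p x y" if "p \<in> carrier P" "x \<in> carrier V" "y \<in> carrier W" for p x y
    by (rule tensor_lift_elt[OF V W N F[OF that(1)] that(2,3)])
  have z: "?E p \<zero>\<^bsub>tensor_mod V W\<^esub> = \<zero>\<^bsub>N\<^esub>" if "p \<in> carrier P" for p
    by (rule lin_hom_zero[OF lin_space_tensor[OF V W] N h[OF that]])
  show ?thesis
  proof (rule lin_homI)
    show "?E p X \<in> carrier N" if "p \<in> carrier P" for p by (rule lin_hom_closed[OF h[OF that] X])
    fix p q assume p: "p \<in> carrier P" and q: "q \<in> carrier P"
    note pq = P.add_closed[OF p q]
    show "?E (p \<oplus>\<^bsub>P\<^esub> q) X = ?E p X \<oplus>\<^bsub>N\<^esub> ?E q X"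
      using X
    proof (induction rule: tensor_induct[OF V W, consumes 1, case_names zero elt add])
      case zero
      show ?case using z pq p q by simp
    next
      case (elt x y)
      thus ?case using e p q pq lin_hom_add[OF lin] by simp
    next
      case (add X Y)
      thus ?case using p q lin_hom_add[OF h[OF p]] lin_hom_add[OF h[OF q]] lin_hom_add[OF h[OF pq]]
          lin_hom_closed[OF h[OF p]] lin_hom_closed[OF h[OF q]]
        by (simp add: N.M.a_ac)
    qed
  next
    fix c p assume p: "p \<in> carrier P"
    note cp = P.smult_closed[OF p, of c]
    show "?E (c \<odot>\<^bsub>P\<^esub> p) X = c \<odot>\<^bsub>N\<^esub> ?E p X"
      using X
    proof (induction rule: tensor_induct[OF V W, consumes 1, case_names zero elt add])
      case zero
      show ?case using z p cp by simp
    next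
      case (elt x y)
      thus ?case using e p cp lin_hom_smult[OF lin] by simp
    next
      case (add X Y)
      thus ?case using p lin_hom_add[OF h[OF p]] lin_hom_add[OF h[OF cp]] lin_hom_closed[OF h[OF p]]
        by (simp add: N.smult_add_right)
    qed
  qed
qed

subsection \<open>Tensor and exterior powers\<close>

definition multilin :: "('k :: field, 'v) module \<Rightarrow> nat \<Rightarrow> ('k, 'n) module \<Rightarrow> ('v list \<Rightarrow> 'n) \<Rightarrow> bool" where
  "multilin V k N f \<longleftrightarrow> (\<forall>xs\<in>tuples V k. f xs \<in> carrier N) \<and>
     (\<forall>xs\<in>tuples V k. \<forall>i<k. (\<lambda>a. f (xs[i := a])) \<in> lin_hom V N)"

definition alternating :: "('k :: field, 'v) module \<Rightarrow> nat \<Rightarrow> ('k, 'n) module \<Rightarrow> ('v list \<Rightarrow> 'n) \<Rightarrow> bool" where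
  "alternating V k N f \<longleftrightarrow> (\<forall>xs\<in>tuples V k. \<not> distinct xs \<longrightarrow> f xs = \<zero>\<^bsub>N\<^esub>)"

lemma tuples_update: "xs \<in> tuples V k \<Longrightarrow> a \<in> carrier V \<Longrightarrow> xs[i := a] \<in> tuples V k"
  unfolding tuples_def using set_update_subset_insert[of xs i a] by auto

lemma power_rels_memI:
  shows "xs \<in> tuples V k \<Longrightarrow> i < k \<Longrightarrow> a \<in> carrier V \<Longrightarrow> b \<in> carrier V \<Longrightarrow>
    Poly_Mapping.single (xs[i := a \<oplus>\<^bsub>V\<^esub> b]) 1 - Poly_Mapping.single (xs[i := a]) 1
          - Poly_Mapping.single (xs[i := b]) 1 \<in> power_rels alt V k"
    and "xs \<in> tuples V k \<Longrightarrow> i < k \<Longrightarrow> a \<in> carrier V \<Longrightarrow>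
    Poly_Mapping.single (xs[i := c \<odot>\<^bsub>V\<^esub> a]) 1 - Poly_Mapping.single (xs[i := a]) c \<in> power_rels alt V k"
    and "xs \<in> tuples V k \<Longrightarrow> \<not> distinct xs \<Longrightarrow> alt \<Longrightarrow> Poly_Mapping.single xs 1 \<in> power_rels alt V k"
  unfolding power_rels_def multilinear_rels_def alternating_rels_def by (blast, blast, auto)

lemma power_rels_cases:
  assumes "r \<in> power_rels alt V k"
  obtains (add) xs i a b where "xs \<in> tuples V k" "i < k" "a \<in> carrier V" "b \<in> carrier V"
      "r = Poly_Mapping.single (xs[i := a \<oplus>\<^bsub>V\<^esub> b]) 1 - Poly_Mapping.single (xs[i := a]) 1
          - Poly_Mapping.single (xs[i := b]) 1"
    | (smult) xs i c a where "xs \<in> tuples V k" "i < k" "a \<in> carrier V"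
      "r = Poly_Mapping.single (xs[i := c \<odot>\<^bsub>V\<^esub> a]) 1 - Poly_Mapping.single (xs[i := a]) c"
    | (alt) xs where "alt" "xs \<in> tuples V k" "\<not> distinct xs" "r = Poly_Mapping.single xs 1"
  using assms unfolding power_rels_def multilinear_rels_def alternating_rels_def
  by (auto split: if_splits)

context
  fixes V :: "('k :: field, 'v) module"
  assumes V: "lin_space V"
begin

interpretation V: lin_space V by (rule V)

lemma power_rels_free: "power_rels alt V k \<subseteq> carrier (free_mod (tuples V k))"
proof
  have d: "p - q \<in> carrier (free_mod G)" if "p \<in> carrier (free_mod G)" "q \<in> carrier (free_mod G)"
    for p q :: "'v list \<Rightarrow>\<^sub>0 'k" and G
    using that Poly_Mapping.keys_diff[of p q] by (auto simp: free_mod_def)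
  fix r assume "r \<in> power_rels alt V k"
  thus "r \<in> carrier (free_mod (tuples V k))"
    by (cases rule: power_rels_cases) (auto intro!: d single_in_free tuples_update)
qed

lemma lin_space_power: "lin_space (power_mod alt V k)"
  unfolding power_mod_def by (rule lin_space_presented[OF power_rels_free])

lemma power_elt_closed: "xs \<in> tuples V k \<Longrightarrow> power_elt alt V k xs \<in> carrier (power_mod alt V k)"
  unfolding power_mod_def power_elt_def by (rule generator_closed[OF power_rels_free])

lemma power_elt_multilin: "multilin V k (power_mod alt V k) (power_elt alt V k)"
  unfolding multilin_def
proof (intro conjI ballI allI impI)
  fix xs i assume xs: "xs \<in> tuples V k" and i: "i < k"
  show "(\<lambda>a. power_elt alt V k (xs[i := a])) \<in> lin_hom V (power_mod alt V k)"
    unfolding power_mod_def power_elt_def using xs i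
    by (intro lin_homI generator_closed[OF power_rels_free] generator_add[OF power_rels_free]
        generator_smult[OF power_rels_free] power_rels_memI tuples_update) auto
qed (rule power_elt_closed)

lemma power_elt_alternating: "alternating V k (power_mod True V k) (power_elt True V k)"
  unfolding alternating_def power_mod_def power_elt_def
  by (intro ballI impI generator_zero[OF power_rels_free] power_rels_memI(3)) simp_all

lemma
  assumes N: "lin_space N" and f: "multilin V k N f" and a: "alt \<Longrightarrow> alternating V k N f"
  shows power_lift_hom: "extend_lin N f \<in> lin_hom (power_mod alt V k) N"
    and power_lift_elt: "xs \<in> tuples V k \<Longrightarrow> extend_lin N f (power_elt alt V k xs) = f xs"
proof -
  have c: "f g \<in> carrier N" if "g \<in> tuples V k" for g
    using that f by (auto simp: multilin_def)
  have r: "free_lift N f r = \<zero>\<^bsub>N\<^esub>" if "r \<in> power_rels alt V k" for r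
    using that
  proof (cases rule: power_rels_cases)
    case (add xs i a b)
    have h: "(\<lambda>a. f (xs[i := a])) \<in> lin_hom V N" using f add by (simp add: multilin_def)
    show ?thesis unfolding add(5) using lin_hom[OF h] add by (intro free_lift_add_rel[OF N]) auto
  next
    case (smult xs i c a)
    have h: "(\<lambda>a. f (xs[i := a])) \<in> lin_hom V N" using f smult by (simp add: multilin_def)
    show ?thesis unfolding smult(4) using lin_hom[OF h] smult by (intro free_lift_smult_rel[OF N]) auto
  next
    case (alt xs)
    interpret N: lin_space N by (rule N)
    have "f xs = \<zero>\<^bsub>N\<^esub>" using a[OF alt(1)] alt by (simp add: alternating_def)
    thus ?thesis unfolding alt(4) using free_lift_single[OF N, of f xs 1] by simp
  qed
  show "extend_lin N f \<in> lin_hom (power_mod alt V k) N"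
    unfolding power_mod_def by (rule extend_lin_hom[OF N power_rels_free c r])
  show "extend_lin N f (power_elt alt V k xs) = f xs" if "xs \<in> tuples V k"
    unfolding power_elt_def by (rule extend_lin_generator[OF N power_rels_free c r that])
qed

text \<open>Polarization: put u + v into both slots, expand, and drop the two terms with equal
  entries.\<close>

lemma alternating_transpose:
  assumes N: "lin_space N" and f: "multilin V k N f" and alt: "alternating V k N f"
    and w: "\<And>i. i < k \<Longrightarrow> w i \<in> carrier V" and ab: "a < k" "b < k" "a \<noteq> b"
  shows "f (map (w \<circ> Transposition.transpose a b) [0..<k]) = \<ominus>\<^bsub>N\<^esub> f (map w [0..<k])"
proof -
  interpret N: lin_space N by fact
  define g where "g u v = f ((map w [0..<k])[a := u, b := v])" for u v
  have t: "map w [0..<k] \<in> tuples V k" using w by (auto simp: tuples_def)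
  have tu: "(map w [0..<k])[a := u, b := v] \<in> tuples V k" if "u \<in> carrier V" "v \<in> carrier V" for u v
    by (intro tuples_update t that)
  have h1: "g u \<in> lin_hom V N" if "u \<in> carrier V" for u
    unfolding g_def[abs_def] using f tuples_update[OF t that, of a] ab by (simp add: multilin_def)
  have "(\<lambda>u. f ((map w [0..<k])[b := v, a := u])) \<in> lin_hom V N" if "v \<in> carrier V" for v
    using f tuples_update[OF t that, of b] ab by (simp add: multilin_def)
  hence h2: "(\<lambda>u. g u v) \<in> lin_hom V N" if "v \<in> carrier V" for v
    using that by (simp add: g_def list_update_swap[OF ab(3)])
  have g0: "g u u = \<zero>\<^bsub>N\<^esub>" if "u \<in> carrier V" for u
  proof -
    let ?xs = "(map w [0..<k])[a := u, b := u]"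
    have "?xs ! a = ?xs ! b" "a < length ?xs" "b < length ?xs" using ab by auto
    hence "\<not> distinct ?xs" using ab(3) nth_eq_iff_index_eq by blast
    thus ?thesis using alt tu[OF that that] by (simp add: alternating_def g_def)
  qed
  let ?u = "w a" and ?v = "w b"
  have uv: "?u \<in> carrier V" "?v \<in> carrier V" using w ab by auto
  note gc = lin_hom_closed[OF h1]
  have "\<zero>\<^bsub>N\<^esub> = g (?u \<oplus>\<^bsub>V\<^esub> ?v) (?u \<oplus>\<^bsub>V\<^esub> ?v)" using g0 uv by simp
  also have "\<dots> = g ?v ?u \<oplus>\<^bsub>N\<^esub> g ?u ?v"
    using uv gc by (simp add: lin_hom_add[OF h1] lin_hom_add[OF h2] g0[OF uv(1)] g0[OF uv(2)])
  finally have "g ?v ?u = \<ominus>\<^bsub>N\<^esub> g ?u ?v"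
    using gc uv by (intro N.M.minus_equality[symmetric]) auto
  moreover have "g ?u ?v = f (map w [0..<k])"
    unfolding g_def using ab by (intro arg_cong[of _ _ f] nth_equalityI) (auto simp: nth_list_update)
  moreover have "g ?v ?u = f (map (w \<circ> Transposition.transpose a b) [0..<k])"
    unfolding g_def using ab
    by (intro arg_cong[of _ _ f] nth_equalityI) (auto simp: nth_list_update Transposition.transpose_def)
  ultimately show ?thesis by simp
qed

lemma alternating_permute:
  assumes N: "lin_space N" and f: "multilin V k N f" and alt: "alternating V k N f"
    and p: "p permutes {..<k}" and w: "\<And>i. i < k \<Longrightarrow> w i \<in> carrier V"
  shows "f (map (w \<circ> p) [0..<k]) = of_int (sign p) \<odot>\<^bsub>N\<^esub> f (map w [0..<k])"
  using p finite_lessThan w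
proof (induction arbitrary: w rule: permutes_induct)
  case id
  interpret N: lin_space N by fact
  have "map w [0..<k] \<in> tuples V k" using id by (auto simp: tuples_def)
  hence "f (map w [0..<k]) \<in> carrier N" using f by (simp add: multilin_def)
  thus ?case by simp
next
  case (swap a b p)
  interpret N: lin_space N by fact
  have "map w [0..<k] \<in> tuples V k" using swap.prems by (auto simp: tuples_def)
  hence c: "f (map w [0..<k]) \<in> carrier N" using f by (simp add: multilin_def)
  have w': "i < k \<Longrightarrow> (w \<circ> Transposition.transpose a b) i \<in> carrier V" for i
    using swap by (auto simp: Transposition.transpose_def)
  \<comment> \<open>The transposition is absorbed into the family \<open>w\<close>, which is why the
    induction leaves \<open>w\<close> arbitrary.\<close>
  have "f (map (w \<circ> (Transposition.transpose a b \<circ> p)) [0..<k])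
      = f (map ((w \<circ> Transposition.transpose a b) \<circ> p) [0..<k])" by (simp add: o_assoc)
  also have "\<dots> = of_int (sign p) \<odot>\<^bsub>N\<^esub> f (map (w \<circ> Transposition.transpose a b) [0..<k])"
    by (rule swap.IH) (rule w')
  also have "f (map (w \<circ> Transposition.transpose a b) [0..<k]) = \<ominus>\<^bsub>N\<^esub> f (map w [0..<k])"
    using swap by (intro alternating_transpose[OF N f alt]) auto
  also have "\<dots> = (-1) \<odot>\<^bsub>N\<^esub> f (map w [0..<k])" using c by (simp add: N.smult_neg_left)
  finally have "f (map (w \<circ> (Transposition.transpose a b \<circ> p)) [0..<k])
      = (- of_int (sign p)) \<odot>\<^bsub>N\<^esub> f (map w [0..<k])" using c by (simp only: N.smult_smult) simp
  moreover have "sign (Transposition.transpose a b \<circ> p) = - sign p"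
    using swap by (subst sign_compose) (auto simp: sign_swap_id permutes_imp_permutation[of "{..<k}"] permutation_swap_id)
  ultimately show ?case by (simp only: of_int_minus)
qed

end

subsection \<open>Scalars, restriction of scalars and duals\<close>

lemma scalar_mod_simps [simp]:
  "carrier scalar_mod = UNIV" "\<zero>\<^bsub>scalar_mod\<^esub> = 0" "x \<oplus>\<^bsub>scalar_mod\<^esub> y = x + y" "c \<odot>\<^bsub>scalar_mod\<^esub> x = c * x"
  by (simp_all add: scalar_mod_def)

lemma lin_space_scalar: "lin_space scalar_mod"
  by (rule lin_spaceI) (auto simp: algebra_simps)

lemma restrict_scalars_simps [simp]:
  "carrier (restrict_scalars h V) = carrier V" "\<zero>\<^bsub>restrict_scalars h V\<^esub> = \<zero>\<^bsub>V\<^esub>"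
  "x \<oplus>\<^bsub>restrict_scalars h V\<^esub> y = x \<oplus>\<^bsub>V\<^esub> y" "c \<odot>\<^bsub>restrict_scalars h V\<^esub> x = h c \<odot>\<^bsub>V\<^esub> x"
  by (simp_all add: restrict_scalars_def)

lemma lin_space_restrict_of_rat:
  fixes V :: "('k :: field_char_0, 'v) module"
  assumes "lin_space V"
  shows "lin_space (restrict_scalars of_rat V)"
proof -
  interpret V: lin_space V by fact
  show ?thesis
    by (rule lin_spaceI)
      (auto simp: V.M.a_ac of_rat_mult of_rat_add V.smult_add_left V.smult_add_right V.smult_smult)
qed

lemma lin_hom_restrict: "f \<in> lin_hom V W \<Longrightarrow> f \<in> lin_hom (restrict_scalars h V) (restrict_scalars h W)"
  by (rule lin_homI) (auto simp: lin_hom)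

lemma complex_mod_simps [simp]:
  "carrier complex_mod = UNIV" "\<zero>\<^bsub>complex_mod\<^esub> = 0" "x \<oplus>\<^bsub>complex_mod\<^esub> y = x + y"
  "c \<odot>\<^bsub>complex_mod\<^esub> x = of_rat c * x"
  by (simp_all add: complex_mod_def)

lemma lin_space_complex: "lin_space complex_mod"
  unfolding complex_mod_def by (rule lin_space_restrict_of_rat[OF lin_space_scalar])

lemma dual_mod_simps [simp]:
  "carrier (dual_mod V) = lin_hom V scalar_mod \<inter> extensional (carrier V)"
  "\<zero>\<^bsub>dual_mod V\<^esub> = restrict (\<lambda>x. 0) (carrier V)"
  "f \<oplus>\<^bsub>dual_mod V\<^esub> g = restrict (\<lambda>x. f x + g x) (carrier V)"
  "c \<odot>\<^bsub>dual_mod V\<^esub> f = restrict (\<lambda>x. c * f x) (carrier V)"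
  by (simp_all add: dual_mod_def)

lemma lin_space_dual:
  assumes "lin_space V"
  shows "lin_space (dual_mod V)"
proof -
  interpret V: lin_space V by fact
  show ?thesis
    by (rule lin_spaceI)
      (auto intro!: lin_homI simp: lin_hom extensional_def fun_eq_iff algebra_simps restrict_def)
qed

lemma dual_restrict: "f \<in> lin_hom V scalar_mod \<Longrightarrow> lin_space V \<Longrightarrow> restrict f (carrier V) \<in> carrier (dual_mod V)"
proof -
  assume f: "f \<in> lin_hom V scalar_mod" and "lin_space V"
  interpret V: lin_space V by fact
  show ?thesis using f by (auto intro!: lin_homI simp: lin_hom)
qed

section \<open>Base change to E \<otimes> \<complex>: the ring, its modules and their linear
  maps\<close>

section \<open>Extension of scalars to the complex numbers\<close>

abbreviation restrict_rat where "restrict_rat \<equiv> restrict_scalars (of_rat :: rat \<Rightarrow> 'e :: field_char_0)"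

context
  fixes V :: "('e :: field_char_0, 'v) module"
  assumes V: "lin_space V"
begin

interpretation V: lin_space V by (rule V)

private lemma Q: "lin_space (restrict_rat V)" by (rule lin_space_restrict_of_rat[OF V])

lemma lin_space_cxQ: "lin_space (cxQ V)"
  unfolding cxQ_def by (rule lin_space_tensor[OF Q lin_space_complex])

lemma cx_elt_closed [simp]: "x \<in> carrier V \<Longrightarrow> cx_elt V x z \<in> carrier (cxQ V)"
  unfolding cxQ_def cx_elt_def by (rule tensor_elt_closed[OF Q lin_space_complex]) auto

lemma cx_elt_hom_right: "x \<in> carrier V \<Longrightarrow> cx_elt V x \<in> lin_hom complex_mod (cxQ V)"
  unfolding cx_elt_def[abs_def] cxQ_def by (rule bilinD(1)[OF tensor_elt_bilin[OF Q lin_space_complex]]) simp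

lemma cx_elt_hom_left: "(\<lambda>x. cx_elt V x z) \<in> lin_hom (restrict_rat V) (cxQ V)"
  unfolding cx_elt_def[abs_def] cxQ_def by (rule bilinD(2)[OF tensor_elt_bilin[OF Q lin_space_complex]]) simp

lemma cx_elt_add_left:
  "x \<in> carrier V \<Longrightarrow> y \<in> carrier V \<Longrightarrow> cx_elt V (x \<oplus>\<^bsub>V\<^esub> y) z = cx_elt V x z \<oplus>\<^bsub>cxQ V\<^esub> cx_elt V y z"
  using lin_hom_add[OF cx_elt_hom_left, of x y] by simp

lemma cx_elt_rat_left:
  "x \<in> carrier V \<Longrightarrow> cx_elt V (of_rat q \<odot>\<^bsub>V\<^esub> x) z = q \<odot>\<^bsub>cxQ V\<^esub> cx_elt V x z"
  using lin_hom_smult[OF cx_elt_hom_left, of x q] by simp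

lemma cx_elt_add_right:
  "x \<in> carrier V \<Longrightarrow> cx_elt V x (z + w) = cx_elt V x z \<oplus>\<^bsub>cxQ V\<^esub> cx_elt V x w"
  using lin_hom_add[OF cx_elt_hom_right, of x z w] by simp

lemma cx_elt_rat_right:
  "x \<in> carrier V \<Longrightarrow> cx_elt V x (of_rat q * z) = q \<odot>\<^bsub>cxQ V\<^esub> cx_elt V x z"
  using lin_hom_smult[OF cx_elt_hom_right, of x z q] by simp

lemma cx_elt_zero_left: "cx_elt V \<zero>\<^bsub>V\<^esub> z = \<zero>\<^bsub>cxQ V\<^esub>"
  using lin_hom_zero[OF Q lin_space_cxQ cx_elt_hom_left] by simp

lemma cx_induct [consumes 1, case_names zero elt add]:
  assumes "X \<in> carrier (cxQ V)"
    and "P \<zero>\<^bsub>cxQ V\<^esub>"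
    and "\<And>x z. x \<in> carrier V \<Longrightarrow> P (cx_elt V x z)"
    and "\<And>X Y. X \<in> carrier (cxQ V) \<Longrightarrow> Y \<in> carrier (cxQ V) \<Longrightarrow> P X \<Longrightarrow> P Y \<Longrightarrow> P (X \<oplus>\<^bsub>cxQ V\<^esub> Y)"
  shows "P X"
  using assms unfolding cxQ_def cx_elt_def
  by (rule tensor_induct[OF Q lin_space_complex, of X P]) auto

lemma
  assumes N: "lin_space N" and f: "bilin (restrict_rat V) complex_mod N f"
  shows cx_lift_hom: "extend_lin N (\<lambda>(x, z). f x z) \<in> lin_hom (cxQ V) N"
    and cx_lift_elt: "x \<in> carrier V \<Longrightarrow> extend_lin N (\<lambda>(x, z). f x z) (cx_elt V x z) = f x z"
  unfolding cxQ_def cx_elt_def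
  using tensor_lift_hom[OF Q lin_space_complex N f] tensor_lift_elt[OF Q lin_space_complex N f] by auto

lemma cx_lift_param:
  assumes P: "lin_space P" and N: "lin_space N"
    and F: "\<And>p. p \<in> carrier P \<Longrightarrow> bilin (restrict_rat V) complex_mod N (F p)"
    and lin: "\<And>x z. x \<in> carrier V \<Longrightarrow> (\<lambda>p. F p x z) \<in> lin_hom P N"
    and X: "X \<in> carrier (cxQ V)"
  shows "(\<lambda>p. extend_lin N (\<lambda>(x, z). F p x z) X) \<in> lin_hom P N"
  by (rule tensor_lift_param[OF P Q lin_space_complex N F]) (use lin X in \<open>auto simp: cxQ_def\<close>)

lemma cx_hom_eqI:
  assumes N: "lin_space N" and f: "f \<in> lin_hom (cxQ V) N" and g: "g \<in> lin_hom (cxQ V) N"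
    and eq: "\<And>x z. x \<in> carrier V \<Longrightarrow> f (cx_elt V x z) = g (cx_elt V x z)"
    and X: "X \<in> carrier (cxQ V)"
  shows "f X = g X"
  by (rule tensor_hom_eqI[OF Q lin_space_complex N]) (use assms in \<open>auto simp: cxQ_def cx_elt_def\<close>)

end

lemma
  assumes A: "lin_space A" and V: "lin_space V" and f: "f \<in> lin_hom A V" and h: "h \<in> lin_hom complex_mod complex_mod"
  shows cx_map_hom: "cx_map V f h \<in> lin_hom (cxQ A) (cxQ V)"
    and cx_map_elt: "x \<in> carrier A \<Longrightarrow> cx_map V f h (cx_elt A x z) = cx_elt V (f x) (h z)"
proof -
  have b: "bilin (restrict_rat A) complex_mod (cxQ V) (\<lambda>x z. cx_elt V (f x) (h z))"
  proof (rule bilinI)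
    fix x assume x: "x \<in> carrier (restrict_rat A)"
    show "(\<lambda>z. cx_elt V (f x) (h z)) \<in> lin_hom complex_mod (cxQ V)"
      by (rule lin_hom_comp[OF h cx_elt_hom_right[OF V]]) (use lin_hom_closed[OF f] x in simp)
  next
    fix z
    show "(\<lambda>x. cx_elt V (f x) (h z)) \<in> lin_hom (restrict_rat A) (cxQ V)"
      by (rule lin_hom_comp[OF lin_hom_restrict[OF f] cx_elt_hom_left[OF V]])
  qed
  have eq: "cx_map V f h = extend_lin (cxQ V) (\<lambda>(x, z). cx_elt V (f x) (h z))"
    by (simp add: cx_map_def tensor_map_def cxQ_def cx_elt_def)
  show "cx_map V f h \<in> lin_hom (cxQ A) (cxQ V)"
    unfolding eq by (rule cx_lift_hom[OF A lin_space_cxQ[OF V] b])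
  show "cx_map V f h (cx_elt A x z) = cx_elt V (f x) (h z)" if "x \<in> carrier A"
    unfolding eq by (rule cx_lift_elt[OF A lin_space_cxQ[OF V] b that])
qed

abbreviation scalarE :: "('e :: field_char_0, 'e) module" where "scalarE \<equiv> scalar_mod"

text \<open>The action of one pure tensor e \<otimes> z. The full action \<open>cx_smult\<close> is
  its bilinear extension in e and z, so the two levels can be lifted separately.\<close>

definition act_elt :: "('e :: field_char_0, 'v) module \<Rightarrow> 'e \<Rightarrow> complex \<Rightarrow> 'v cx \<Rightarrow> 'v cx" where
  "act_elt V e z X = extend_lin (cxQ V) (\<lambda>(x, w). cx_elt V (e \<odot>\<^bsub>V\<^esub> x) (z * w)) X"

context
  fixes V :: "('e :: field_char_0, 'v) module"
  assumes V: "lin_space V"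
begin

interpretation V: lin_space V by (rule V)
interpretation VQ: lin_space "cxQ V" by (rule lin_space_cxQ[OF V])

private lemma b: "bilin (restrict_rat V) complex_mod (cxQ V) (\<lambda>x w. cx_elt V (e \<odot>\<^bsub>V\<^esub> x) (z * w))"
proof (rule bilinI)
  fix x assume x: "x \<in> carrier (restrict_rat V)"
  have "(\<lambda>w. z * w) \<in> lin_hom complex_mod complex_mod" by (rule lin_homI) (auto simp: algebra_simps)
  thus "(\<lambda>w. cx_elt V (e \<odot>\<^bsub>V\<^esub> x) (z * w)) \<in> lin_hom complex_mod (cxQ V)"
    by (rule lin_hom_comp[OF _ cx_elt_hom_right[OF V]]) (use x in simp)
next
  fix w
  have "(\<lambda>x. e \<odot>\<^bsub>V\<^esub> x) \<in> lin_hom (restrict_rat V) (restrict_rat V)"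
    by (rule lin_hom_restrict, rule lin_homI) (auto simp: V.smult_add_right V.smult_smult mult.commute)
  thus "(\<lambda>x. cx_elt V (e \<odot>\<^bsub>V\<^esub> x) (z * w)) \<in> lin_hom (restrict_rat V) (cxQ V)"
    by (rule lin_hom_comp[OF _ cx_elt_hom_left[OF V]])
qed

lemma act_elt_hom: "act_elt V e z \<in> lin_hom (cxQ V) (cxQ V)"
  unfolding act_elt_def[abs_def] by (rule cx_lift_hom[OF V lin_space_cxQ[OF V] b])

lemma act_elt_elt: "x \<in> carrier V \<Longrightarrow> act_elt V e z (cx_elt V x w) = cx_elt V (e \<odot>\<^bsub>V\<^esub> x) (z * w)"
  unfolding act_elt_def by (rule cx_lift_elt[OF V lin_space_cxQ[OF V] b])

private lemma act_elt_left: "X \<in> carrier (cxQ V) \<Longrightarrow> (\<lambda>e. act_elt V e z X) \<in> lin_hom (restrict_rat scalarE) (cxQ V)"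
  unfolding act_elt_def
  by (rule cx_lift_param[OF V lin_space_restrict_of_rat[OF lin_space_scalar] lin_space_cxQ[OF V] b], rule lin_homI)
    (auto simp: V.smult_add_left cx_elt_add_left[OF V] V.smult_smult[symmetric] cx_elt_rat_left[OF V]
      cx_elt_closed[OF V])

private lemma act_elt_right: "X \<in> carrier (cxQ V) \<Longrightarrow> (\<lambda>z. act_elt V e z X) \<in> lin_hom complex_mod (cxQ V)"
  unfolding act_elt_def
  by (rule cx_lift_param[OF V lin_space_complex lin_space_cxQ[OF V] b], rule lin_homI)
    (auto simp: distrib_right mult.assoc cx_elt_add_right[OF V] cx_elt_rat_right[OF V] cx_elt_closed[OF V])

private lemma b2: "X \<in> carrier (cxQ V) \<Longrightarrow> bilin (restrict_rat scalarE) complex_mod (cxQ V) (\<lambda>e z. act_elt V e z X)"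
  by (rule bilinI) (auto intro: act_elt_left act_elt_right)

private lemma cx_smult_eq: "cx_smult V a X = extend_lin (cxQ V) (\<lambda>(e, z). act_elt V e z X) a"
  by (simp add: cx_smult_def act_elt_def)

lemma cx_smult_hom_left: "X \<in> carrier (cxQ V) \<Longrightarrow> (\<lambda>a. cx_smult V a X) \<in> lin_hom (cxQ scalarE) (cxQ V)"
  unfolding cx_smult_eq by (rule cx_lift_hom[OF lin_space_scalar lin_space_cxQ[OF V] b2])

lemma cx_smult_elt_left: "X \<in> carrier (cxQ V) \<Longrightarrow> cx_smult V (cx_elt scalarE e z) X = act_elt V e z X"
  unfolding cx_smult_eq by (rule cx_lift_elt[OF lin_space_scalar lin_space_cxQ[OF V] b2]) auto

lemma cx_smult_hom_right: "a \<in> carrier (cxQ scalarE) \<Longrightarrow> cx_smult V a \<in> lin_hom (cxQ V) (cxQ V)"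
  unfolding cx_smult_eq[abs_def]
  by (rule cx_lift_param[OF lin_space_scalar lin_space_cxQ[OF V] lin_space_cxQ[OF V] b2]) (use act_elt_hom in auto)

lemma cx_smult_elt:
  "x \<in> carrier V \<Longrightarrow> cx_smult V (cx_elt scalarE e z) (cx_elt V x w) = cx_elt V (e \<odot>\<^bsub>V\<^esub> x) (z * w)"
  by (simp add: cx_smult_elt_left act_elt_elt cx_elt_closed[OF V])

end

lemma cx_smult_closed:
  "lin_space V \<Longrightarrow> a \<in> carrier (cxQ scalarE) \<Longrightarrow> X \<in> carrier (cxQ V) \<Longrightarrow> cx_smult V a X \<in> carrier (cxQ V)"
  by (rule lin_hom_closed[OF cx_smult_hom_right])

lemma cx_smult_one:
  assumes V: "lin_space V" and X: "X \<in> carrier (cxQ V)"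
  shows "cx_smult V (cx_elt scalarE 1 1) X = X"
proof -
  interpret V: lin_space V by fact
  have "(\<lambda>X. X) \<in> lin_hom (cxQ V) (cxQ V)" by (rule lin_homI) auto
  from cx_hom_eqI[OF V lin_space_cxQ[OF V] cx_smult_hom_right[OF V cx_elt_closed[OF lin_space_scalar]] this _ X]
  show ?thesis by (simp add: cx_smult_elt[OF V])
qed

text \<open>The three arguments are reduced to pure tensors in turn, first \<open>X\<close>, then
  \<open>b\<close>, then \<open>a\<close>, each time by comparing two linear maps on
  generators.\<close>

lemma cx_smult_assoc:
  assumes V: "lin_space V" and a: "a \<in> carrier (cxQ scalarE)" and b: "b \<in> carrier (cxQ scalarE)"
    and X: "X \<in> carrier (cxQ V)"
  shows "cx_smult V (cx_smult scalarE a b) X = cx_smult V a (cx_smult V b X)"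
proof -
  interpret V: lin_space V by fact
  note S = lin_space_scalar and VQ = lin_space_cxQ[OF V] and eS = cx_elt_closed[OF lin_space_scalar]
  have 1: "cx_smult V (cx_smult scalarE (cx_elt scalarE e z) (cx_elt scalarE e' z')) X
      = cx_smult V (cx_elt scalarE e z) (cx_smult V (cx_elt scalarE e' z') X)" for e z e' z'
    by (rule cx_hom_eqI[OF V VQ cx_smult_hom_right[OF V] lin_hom_comp[OF cx_smult_hom_right[OF V] cx_smult_hom_right[OF V]] _ X])
      (auto simp: cx_smult_elt[OF V] cx_smult_elt[OF S] V.smult_smult mult.assoc eS intro!: cx_smult_closed[OF S])
  have 2: "cx_smult V (cx_smult scalarE (cx_elt scalarE e z) b) X
      = cx_smult V (cx_elt scalarE e z) (cx_smult V b X)" for e z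
    by (rule cx_hom_eqI[OF S VQ lin_hom_comp[OF cx_smult_hom_right[OF S] cx_smult_hom_left[OF V X]]
          lin_hom_comp[OF cx_smult_hom_left[OF V X] cx_smult_hom_right[OF V]] _ b])
      (auto simp: 1 eS)
  show ?thesis
    by (rule cx_hom_eqI[OF S VQ lin_hom_comp[OF cx_smult_hom_left[OF S b] cx_smult_hom_left[OF V X]]
          cx_smult_hom_left[OF V cx_smult_closed[OF V b X]] _ a])
      (auto simp: 2)
qed

lemma cx_smult_commute:
  assumes a: "a \<in> carrier (cxQ scalarE)" and b: "b \<in> carrier (cxQ scalarE)"
  shows "cx_smult scalarE a b = cx_smult scalarE b a"
proof -
  note S = lin_space_scalar and eS = cx_elt_closed[OF lin_space_scalar]
  have 1: "cx_smult scalarE (cx_elt scalarE e z) b = cx_smult scalarE b (cx_elt scalarE e z)" for e z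
    by (rule cx_hom_eqI[OF S lin_space_cxQ[OF S] cx_smult_hom_right[OF S] cx_smult_hom_left[OF S] _ b])
      (auto simp: cx_smult_elt[OF S] eS mult.commute)
  show ?thesis
    by (rule cx_hom_eqI[OF S lin_space_cxQ[OF S] cx_smult_hom_left[OF S b] cx_smult_hom_right[OF S b] _ a]) (rule 1)
qed

subsection \<open>The ring \<open>E \<otimes> \<complex>\<close> as a type\<close>

text \<open>As a type of class \<open>comm_ring_1\<close>, E \<otimes> \<complex> can serve as the
  entry ring of matrices and determinants.\<close>

typedef (overloaded) 'e ec = "carrier (cxQ (scalar_mod :: ('e :: field_char_0, 'e) module))"
  using lin_space.rmod[OF lin_space_cxQ[OF lin_space_scalar]] by (meson rmod.zero_closed)

setup_lifting type_definition_ec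

interpretation SQ: lin_space "cxQ scalarE" by (rule lin_space_cxQ[OF lin_space_scalar])

text \<open>A \<open>\<rat>\<close>-linear functional on \<open>E\<close> with value \<open>1\<close> at \<open>1\<close> induces a map \<open>E \<otimes> \<complex> \<rightarrow> \<complex>\<close>
  that separates \<open>0\<close> from \<open>1\<close>.\<close>

lemma cx_elt_one_nonzero: "cx_elt scalarE (1 :: 'e :: field_char_0) 1 \<noteq> \<zero>\<^bsub>cxQ scalarE\<^esub>"
proof
  assume eq: "cx_elt scalarE (1 :: 'e) 1 = \<zero>\<^bsub>cxQ scalarE\<^esub>"
  interpret Q: vector_space "\<lambda>(q :: rat) (x :: 'e). of_rat q * x"
    by unfold_locales (auto simp: algebra_simps of_rat_add of_rat_mult)
  have ind: "Q.independent {1 :: 'e}" by (subst Q.independent_insert) (auto simp: Q.independent_empty)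
  define B where "B = Q.extend_basis {1 :: 'e}"
  have B: "Q.independent B" "Q.span B = UNIV" "1 \<in> B"
    unfolding B_def using Q.independent_extend_basis[OF ind] Q.span_extend_basis[OF ind]
      Q.extend_basis_superset[OF ind] by auto
  define f :: "'e \<Rightarrow> rat" where "f x = Q.representation B x 1" for x
  have f: "f (x + y) = f x + f y" "f (of_rat q * x) = q * f x" "f 1 = 1" for x y q
    unfolding f_def using B
    by (auto simp: Q.representation_add Q.representation_scale Q.representation_basis)
  have b: "bilin (restrict_rat scalarE) complex_mod complex_mod (\<lambda>e z. of_rat (f e) * z)"
    by (intro bilinI lin_homI) (auto simp: f of_rat_add of_rat_mult distrib_left distrib_right)
  let ?g = "extend_lin complex_mod (\<lambda>(e, z). of_rat (f e) * z)"
  note S = lin_space_scalar and C = lin_space_complex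
  have "?g (cx_elt scalarE 1 1) = 1" using cx_lift_elt[OF S C b, of 1 1] by (simp add: f)
  moreover have "?g \<zero>\<^bsub>cxQ scalarE\<^esub> = 0"
    using lin_hom_zero[OF lin_space_cxQ[OF S] C cx_lift_hom[OF S C b]] by simp
  ultimately show False using eq by simp
qed

instantiation ec :: (field_char_0) comm_ring_1
begin

lift_definition zero_ec :: "'a ec" is "\<zero>\<^bsub>cxQ scalarE\<^esub>" by simp
lift_definition one_ec :: "'a ec" is "cx_elt scalarE 1 1" by (simp add: cx_elt_closed[OF lin_space_scalar])
lift_definition plus_ec :: "'a ec \<Rightarrow> 'a ec \<Rightarrow> 'a ec" is "add (cxQ scalarE)" by simp
lift_definition uminus_ec :: "'a ec \<Rightarrow> 'a ec" is "a_inv (cxQ scalarE)" by simp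
lift_definition minus_ec :: "'a ec \<Rightarrow> 'a ec \<Rightarrow> 'a ec" is "a_minus (cxQ scalarE)" by simp
lift_definition times_ec :: "'a ec \<Rightarrow> 'a ec \<Rightarrow> 'a ec" is "cx_smult scalarE"
  by (rule cx_smult_closed[OF lin_space_scalar])

instance
proof
  note S = lin_space_scalar
  fix a b c :: "'a ec"
  show "a + b + c = a + (b + c)" by transfer (rule SQ.M.a_assoc)
  show "a + b = b + a" by transfer (rule SQ.M.a_comm)
  show "0 + a = a" by transfer simp
  show "- a + a = 0" by transfer (rule SQ.M.l_neg)
  show "a - b = a + - b" by transfer (simp add: a_minus_def)
  show "a * b * c = a * (b * c)" by transfer (rule cx_smult_assoc[OF S])
  show "a * b = b * a" by transfer (rule cx_smult_commute)
  show "1 * a = a" by transfer (rule cx_smult_one[OF S])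
  show "(a + b) * c = a * c + b * c" by transfer (rule lin_hom_add[OF cx_smult_hom_left[OF S]])
  show "(0 :: 'a ec) \<noteq> 1" by transfer (use cx_elt_one_nonzero in metis)
qed

end

lift_definition tens :: "'e :: field_char_0 \<Rightarrow> complex \<Rightarrow> 'e ec" is "cx_elt scalarE"
  by (simp add: cx_elt_closed[OF lin_space_scalar])

definition emb :: "'e :: field_char_0 \<Rightarrow> 'e ec" where "emb e = tens e 1"

lemma tens_add: "tens (a + b) z = tens a z + tens b z" "tens a (z + w) = tens a z + tens a w"
  by (transfer; simp add: cx_elt_add_left[OF lin_space_scalar, simplified] cx_elt_add_right[OF lin_space_scalar])+

lemma tens_mult: "tens a z * tens b w = tens (a * b) (z * w)"
  by transfer (simp add: cx_smult_elt[OF lin_space_scalar])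

lemma tens_rat: "tens a (of_rat q * z) = tens (of_rat q * a) z"
  by transfer (simp add: cx_elt_rat_left[OF lin_space_scalar, simplified] cx_elt_rat_right[OF lin_space_scalar])

lemma tens_one [simp]: "tens 1 1 = 1"
  by transfer simp

lemma emb_add: "emb (a + b) = emb a + emb b" and emb_mult: "emb (a * b) = emb a * emb b"
  and emb_one [simp]: "emb 1 = 1"
  by (simp_all add: emb_def tens_add tens_mult)

lemma emb_zero [simp]: "emb 0 = 0" using emb_add[of 0 0] by simp

lemma tens_eq: "tens e z = emb e * tens 1 z" by (simp add: emb_def tens_mult)

interpretation emb: comm_ring_hom emb by unfold_locales (auto simp: emb_add emb_mult)

lemma emb_eq_0_iff [simp]: "emb e = 0 \<longleftrightarrow> e = 0"
proof
  show "e = 0" if "emb e = 0"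
  proof (rule ccontr)
    assume "e \<noteq> 0"
    hence "1 = emb (inverse e) * emb e" by (simp flip: emb_mult)
    thus False using that by simp
  qed
qed simp

lemma of_nat_ec: "(of_nat n :: 'e :: field_char_0 ec) = emb (of_nat n)"
  by (induction n) (auto simp: emb_add)

text \<open>Characteristic zero lets a rank over E \<otimes> \<complex> be read off from the trace
  of an identity matrix.\<close>

instance ec :: (field_char_0) ring_char_0
proof (standard, rule injI)
  fix m n :: nat assume "(of_nat m :: 'a ec) = of_nat n"
  hence "emb (of_nat m - of_nat n :: 'a) = 0" by (simp add: of_nat_ec emb.hom_minus)
  thus "m = n" by simp
qed

subsection \<open>The module \<open>V \<otimes> \<complex>\<close> over \<open>E \<otimes> \<complex>\<close>\<close>

lemma tens_rat_mult: "tens 1 (of_rat q * z) = emb (of_rat q) * tens 1 z"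
  unfolding tens_rat using tens_eq[of "of_rat q * 1" z] by simp

text \<open>The module \<open>cx V\<close> with scalars in the type \<open>ec\<close> instead of the
  carrier of \<open>EC\<close>, so that it becomes a module over \<open>class_ring\<close>.\<close>

definition cxR :: "('e :: field_char_0, 'v) module \<Rightarrow> ('e ec, 'v cx) module" where
  "cxR V = \<lparr>carrier = carrier (cxQ V), monoid.mult = undefined, one = undefined,
     zero = \<zero>\<^bsub>cxQ V\<^esub>, add = add (cxQ V), smult = (\<lambda>a. cx_smult V (Rep_ec a))\<rparr>"

lemma cxQ_simps [simp]:
  "carrier (cxQ V) = carrier (cxR V)" "\<zero>\<^bsub>cxQ V\<^esub> = \<zero>\<^bsub>cxR V\<^esub>" "X \<oplus>\<^bsub>cxQ V\<^esub> Y = X \<oplus>\<^bsub>cxR V\<^esub> Y"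
  by (simp_all add: cxR_def)

lemma cx_simps [simp]:
  "carrier (cx V) = carrier (cxR V)" "\<zero>\<^bsub>cx V\<^esub> = \<zero>\<^bsub>cxR V\<^esub>" "X \<oplus>\<^bsub>cx V\<^esub> Y = X \<oplus>\<^bsub>cxR V\<^esub> Y"
  by (simp_all add: cxR_def cx_def del: cxQ_simps)

lemma cxE_simps [simp]:
  "carrier (cxE V) = carrier (cxR V)" "\<zero>\<^bsub>cxE V\<^esub> = \<zero>\<^bsub>cxR V\<^esub>" "X \<oplus>\<^bsub>cxE V\<^esub> Y = X \<oplus>\<^bsub>cxR V\<^esub> Y"
  "e \<odot>\<^bsub>cxE V\<^esub> X = emb e \<odot>\<^bsub>cxR V\<^esub> X"
  by (simp_all add: cxE_def) (simp add: cxR_def cx_def emb_def tens.rep_eq del: cxQ_simps cx_simps)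

lemma cxR_smult: "a \<odot>\<^bsub>cxR V\<^esub> X = cx_smult V (Rep_ec a) X"
  by (simp add: cxR_def del: cxQ_simps)

lemma finsum_cong_record:
  assumes "carrier G = carrier H" "\<zero>\<^bsub>G\<^esub> = \<zero>\<^bsub>H\<^esub>" "\<And>x y. x \<oplus>\<^bsub>G\<^esub> y = x \<oplus>\<^bsub>H\<^esub> y"
  shows "finsum G f A = finsum H f A"
proof -
  have "add G = add H" using assms(3) by (intro ext)
  thus ?thesis by (simp add: finsum_def finprod_def assms(1,2))
qed

lemma finsum_cx [simp]: "finsum (cx V) f A = finsum (cxR V) f A"
  by (rule finsum_cong_record) auto

lemma Rep_ec_closed: "Rep_ec a \<in> carrier (cxQ scalarE)"
  using Rep_ec .

lemma cx_smult_Abs: "a \<in> carrier (cxR scalarE) \<Longrightarrow> cx_smult V a X = Abs_ec a \<odot>\<^bsub>cxR V\<^esub> X"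
  by (simp add: cxR_smult Abs_ec_inverse)

lemma Abs_cx_elt: "Abs_ec (cx_elt scalarE e z) = tens e z"
  by (metis Rep_ec_inverse tens.rep_eq)

lemma Abs_ec_zero: "Abs_ec \<zero>\<^bsub>cxR scalarE\<^esub> = 0" by (simp add: zero_ec_def)

context
  fixes V :: "('e :: field_char_0, 'v) module"
  assumes V: "lin_space V"
begin

interpretation VQ: lin_space "cxQ V" by (rule lin_space_cxQ[OF V])

lemma rmod_cxR: "rmod (cxR V)"
proof (rule rmodI)
  note [simp] = cxR_smult and [simp del] = cxQ_simps
  have [simp]: "carrier (cxR V) = carrier (cxQ V)" "\<zero>\<^bsub>cxR V\<^esub> = \<zero>\<^bsub>cxQ V\<^esub>" "X \<oplus>\<^bsub>cxR V\<^esub> Y = X \<oplus>\<^bsub>cxQ V\<^esub> Y" for X Y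
    by (simp_all add: cxQ_simps)
  note r = Rep_ec_closed
  fix a b :: "'e ec" and X Y Z assume X: "X \<in> carrier (cxR V)"
  hence X': "X \<in> carrier (cxQ V)" by simp
  show "(a * b) \<odot>\<^bsub>cxR V\<^esub> X = a \<odot>\<^bsub>cxR V\<^esub> (b \<odot>\<^bsub>cxR V\<^esub> X)"
    using cx_smult_assoc[OF V r r X'] by (simp add: times_ec.rep_eq)
  show "1 \<odot>\<^bsub>cxR V\<^esub> X = X" using cx_smult_one[OF V X'] by (simp add: one_ec.rep_eq)
  show "a \<odot>\<^bsub>cxR V\<^esub> X \<in> carrier (cxR V)" using cx_smult_closed[OF V r X'] by simp
  show "0 \<odot>\<^bsub>cxR V\<^esub> X = \<zero>\<^bsub>cxR V\<^esub>"
    using lin_hom_zero[OF lin_space_cxQ[OF lin_space_scalar] lin_space_cxQ[OF V] cx_smult_hom_left[OF V X']]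
    by (simp add: zero_ec.rep_eq)
  show "(a + b) \<odot>\<^bsub>cxR V\<^esub> X = a \<odot>\<^bsub>cxR V\<^esub> X \<oplus>\<^bsub>cxR V\<^esub> b \<odot>\<^bsub>cxR V\<^esub> X"
    using lin_hom_add[OF cx_smult_hom_left[OF V X'] r r] by (simp add: plus_ec.rep_eq)
  assume Y: "Y \<in> carrier (cxR V)"
  show "a \<odot>\<^bsub>cxR V\<^esub> (X \<oplus>\<^bsub>cxR V\<^esub> Y) = a \<odot>\<^bsub>cxR V\<^esub> X \<oplus>\<^bsub>cxR V\<^esub> a \<odot>\<^bsub>cxR V\<^esub> Y"
    using lin_hom_add[OF cx_smult_hom_right[OF V r]] X Y by simp
  show "X \<oplus>\<^bsub>cxR V\<^esub> Y \<in> carrier (cxR V)" "X \<oplus>\<^bsub>cxR V\<^esub> Y = Y \<oplus>\<^bsub>cxR V\<^esub> X" using X Y by (simp_all add: VQ.M.a_comm)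
  assume Z: "Z \<in> carrier (cxR V)"
  show "X \<oplus>\<^bsub>cxR V\<^esub> Y \<oplus>\<^bsub>cxR V\<^esub> Z = X \<oplus>\<^bsub>cxR V\<^esub> (Y \<oplus>\<^bsub>cxR V\<^esub> Z)" using X Y Z by (simp add: VQ.M.a_assoc)
qed (use VQ.zero_closed VQ.M.r_zero in simp_all)

interpretation VR: rmod "cxR V" by (rule rmod_cxR)

lemma cxR_elt_closed [simp]: "x \<in> carrier V \<Longrightarrow> cx_elt V x z \<in> carrier (cxR V)"
  using cx_elt_closed[OF V] by simp

lemma tens_smult_elt: "x \<in> carrier V \<Longrightarrow> tens e z \<odot>\<^bsub>cxR V\<^esub> cx_elt V x w = cx_elt V (e \<odot>\<^bsub>V\<^esub> x) (z * w)"
  by (simp add: cxR_smult tens.rep_eq cx_smult_elt[OF V])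

lemma cx_elt_eq: "x \<in> carrier V \<Longrightarrow> cx_elt V x z = tens 1 z \<odot>\<^bsub>cxR V\<^esub> cx_elt V x 1"
  using lin_space.rmod[OF V, THEN rmod.smult_one] by (simp add: tens_smult_elt)

lemma emb_smult_elt: "x \<in> carrier V \<Longrightarrow> emb e \<odot>\<^bsub>cxR V\<^esub> cx_elt V x 1 = cx_elt V (e \<odot>\<^bsub>V\<^esub> x) 1"
  by (simp add: emb_def tens_smult_elt)

lemma cxR_induct [consumes 1, case_names zero elt add]:
  assumes "X \<in> carrier (cxR V)"
    and "P \<zero>\<^bsub>cxR V\<^esub>"
    and "\<And>x z. x \<in> carrier V \<Longrightarrow> P (cx_elt V x z)"
    and "\<And>X Y. X \<in> carrier (cxR V) \<Longrightarrow> Y \<in> carrier (cxR V) \<Longrightarrow> P X \<Longrightarrow> P Y \<Longrightarrow> P (X \<oplus>\<^bsub>cxR V\<^esub> Y)"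
  shows "P X"
  by (rule cx_induct[OF V, of X P]) (use assms in auto)

lemma lin_space_cxE: "lin_space (cxE V)"
  by (rule lin_spaceI)
    (auto simp: VR.M.a_ac emb_mult emb_add VR.smult_smult VR.smult_add_left VR.smult_add_right)

lemma cx_elt_hom_cxE: "(\<lambda>x. cx_elt V x 1) \<in> lin_hom V (cxE V)"
  using cx_elt_add_left[OF V] by (intro lin_homI) (auto simp: emb_smult_elt)

end

text \<open>The elements x \<otimes> 1 generate V \<otimes> \<complex> over E \<otimes> \<complex>,
  since x \<otimes> z is 1 \<otimes> z times x \<otimes> 1.\<close>

lemma cxR_hom_eqI:
  assumes V: "lin_space V" and N: "rmod N" and f: "f \<in> lin_hom (cxR V) N" and g: "g \<in> lin_hom (cxR V) N"
    and eq: "\<And>x. x \<in> carrier V \<Longrightarrow> f (cx_elt V x 1) = g (cx_elt V x 1)"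
    and X: "X \<in> carrier (cxR V)"
  shows "f X = g X"
  using X
proof (induction rule: cxR_induct[OF V, consumes 1, case_names zero elt add])
  case zero
  show ?case using rmod_hom_zero[OF rmod_cxR[OF V] N f] rmod_hom_zero[OF rmod_cxR[OF V] N g] by simp
next
  case (elt x z)
  show ?case
    unfolding cx_elt_eq[OF V elt, of z] lin_hom_smult[OF f cxR_elt_closed[OF V elt]]
      lin_hom_smult[OF g cxR_elt_closed[OF V elt]] eq[OF elt] ..
next
  case (add X Y)
  thus ?case using lin_hom_add[OF f] lin_hom_add[OF g] by simp
qed

text \<open>An \<open>extend_lin\<close> into V \<otimes> \<complex> is at first only linear over
  the rationals. The form required of \<open>F\<close> makes it commute with pure tensors of E
  \<otimes> \<complex>, and additivity in the scalar gives the rest.\<close>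

lemma
  assumes U: "lin_space U" and V: "lin_space V" and h: "h \<in> lin_hom U (cxE V)"
    and F: "\<And>x z. x \<in> carrier U \<Longrightarrow> F x z = tens 1 z \<odot>\<^bsub>cxR V\<^esub> h x"
  shows cxR_lift_hom: "extend_lin (cxQ V) (\<lambda>(x, z). F x z) \<in> lin_hom (cxR U) (cxR V)" (is "?E \<in> _")
    and cxR_lift_elt: "x \<in> carrier U \<Longrightarrow> extend_lin (cxQ V) (\<lambda>(x, z). F x z) (cx_elt U x z) = tens 1 z \<odot>\<^bsub>cxR V\<^esub> h x"
proof -
  interpret VR: rmod "cxR V" by (rule rmod_cxR[OF V])
  interpret UR: rmod "cxR U" by (rule rmod_cxR[OF U])
  interpret U: lin_space U by (rule U)
  have hc: "h x \<in> carrier (cxR V)" if "x \<in> carrier U" for x using lin_hom_closed[OF h that] by simp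
  have q: "q \<odot>\<^bsub>cxQ V\<^esub> X = emb (of_rat q) \<odot>\<^bsub>cxR V\<^esub> X" if "X \<in> carrier (cxR V)" for q X
    using that
  proof (induction rule: cxR_induct[OF V, consumes 1, case_names zero elt add])
    case zero
    show ?case using rmod.smult_zero_right[OF lin_space.rmod[OF lin_space_cxQ[OF V]]] by simp
  next
    case (elt x z)
    thus ?case using cx_elt_rat_left[OF V elt] by (simp add: emb_def tens_smult_elt[OF V])
  next
    case (add X Y)
    thus ?case using rmod.smult_add_right[OF lin_space.rmod[OF lin_space_cxQ[OF V]]]
      by (simp add: VR.smult_add_right)
  qed
  have b: "bilin (restrict_rat U) complex_mod (cxQ V) F"
  proof (intro bilinI lin_homI)
    fix c z x assume "x \<in> carrier (restrict_rat U)"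
    thus "F x (c \<odot>\<^bsub>complex_mod\<^esub> z) = c \<odot>\<^bsub>cxQ V\<^esub> F x z"
      by (simp add: F q hc VR.smult_smult tens_rat_mult)
  next
    fix c z x assume "x \<in> carrier (restrict_rat U)"
    thus "F (c \<odot>\<^bsub>restrict_rat U\<^esub> x) z = c \<odot>\<^bsub>cxQ V\<^esub> F x z"
      using lin_hom_smult[OF h, of x "of_rat c"] by (simp add: F q hc VR.smult_smult mult.commute)
  qed (use lin_hom_add[OF h] in \<open>auto simp: F hc tens_add VR.smult_add_left VR.smult_add_right\<close>)
  note E = cx_lift_hom[OF U lin_space_cxQ[OF V] b]
  have e: "?E (cx_elt U x z) = tens 1 z \<odot>\<^bsub>cxR V\<^esub> h x" if "x \<in> carrier U" for x z
    using cx_lift_elt[OF U lin_space_cxQ[OF V] b that] F[OF that] by simp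
  show "x \<in> carrier U \<Longrightarrow> ?E (cx_elt U x z) = tens 1 z \<odot>\<^bsub>cxR V\<^esub> h x" by (rule e)
  have Ec: "?E X \<in> carrier (cxR V)" if "X \<in> carrier (cxR U)" for X using lin_hom_closed[OF E] that by simp
  have Ea: "?E (X \<oplus>\<^bsub>cxR U\<^esub> Y) = ?E X \<oplus>\<^bsub>cxR V\<^esub> ?E Y" if "X \<in> carrier (cxR U)" "Y \<in> carrier (cxR U)" for X Y
    using lin_hom_add[OF E] that by simp
  have Ez: "?E \<zero>\<^bsub>cxR U\<^esub> = \<zero>\<^bsub>cxR V\<^esub>" using lin_hom_zero[OF lin_space_cxQ[OF U] lin_space_cxQ[OF V] E] by simp
  have Et: "?E (tens a w \<odot>\<^bsub>cxR U\<^esub> X) = tens a w \<odot>\<^bsub>cxR V\<^esub> ?E X" if "X \<in> carrier (cxR U)" for a w X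
    using that
  proof (induction rule: cxR_induct[OF U, consumes 1, case_names zero elt add])
    case (elt x z)
    thus ?case using lin_hom_smult[OF h elt, of a]
      by (simp add: tens_smult_elt[OF U] e VR.smult_smult hc) (simp add: tens_mult emb_def mult.commute)
  next
    case (add X Y)
    thus ?case by (simp add: UR.smult_add_right VR.smult_add_right Ea Ec)
  qed (simp add: Ez)
  have Es: "?E (a \<odot>\<^bsub>cxR U\<^esub> X) = a \<odot>\<^bsub>cxR V\<^esub> ?E X" if X: "X \<in> carrier (cxR U)" for a X
  proof -
    have "?E (Abs_ec A \<odot>\<^bsub>cxR U\<^esub> X) = Abs_ec A \<odot>\<^bsub>cxR V\<^esub> ?E X" if "A \<in> carrier (cxR scalarE)" for A
      using that
    proof (induction rule: cxR_induct[OF lin_space_scalar, consumes 1, case_names zero elt add])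
      case zero
      show ?case using X by (simp add: Abs_ec_zero Ez Ec)
    next
      case (elt x z)
      show ?case unfolding Abs_cx_elt by (rule Et[OF X])
    next
      case (add A B)
      hence "Abs_ec (A \<oplus>\<^bsub>cxR scalarE\<^esub> B) = Abs_ec A + Abs_ec B"
        by (subst plus_ec.abs_eq) (auto simp: eq_onp_def)
      thus ?case using X add by (simp add: UR.smult_add_left VR.smult_add_left Ea Ec)
    qed
    from this[of "Rep_ec a"] show ?thesis using Rep_ec_closed[of a] by (simp add: Rep_ec_inverse)
  qed
  show "?E \<in> lin_hom (cxR U) (cxR V)" by (rule lin_homI) (auto simp: Ec Ea Es)
qed

lemma cxR_lift_param:
  assumes U: "lin_space U" and V: "lin_space V" and P: "rmod P"
    and h: "\<And>p. p \<in> carrier P \<Longrightarrow> h p \<in> lin_hom U (cxE V)"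
    and F: "\<And>p x z. p \<in> carrier P \<Longrightarrow> x \<in> carrier U \<Longrightarrow> F p x z = tens 1 z \<odot>\<^bsub>cxR V\<^esub> h p x"
    and hp: "\<And>x. x \<in> carrier U \<Longrightarrow> (\<lambda>p. h p x) \<in> lin_hom P (cxR V)"
    and X: "X \<in> carrier (cxR U)"
  shows "(\<lambda>p. extend_lin (cxQ V) (\<lambda>(x, z). F p x z) X) \<in> lin_hom P (cxR V)"
proof -
  interpret VR: rmod "cxR V" by (rule rmod_cxR[OF V])
  interpret P: rmod P by (rule P)
  let ?E = "\<lambda>p. extend_lin (cxQ V) (\<lambda>(x, z). F p x z)"
  have H: "?E p \<in> lin_hom (cxR U) (cxR V)" if "p \<in> carrier P" for p
    by (rule cxR_lift_hom[OF U V h[OF that] F[OF that]])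
  have e: "?E p (cx_elt U x z) = tens 1 z \<odot>\<^bsub>cxR V\<^esub> h p x" if "p \<in> carrier P" "x \<in> carrier U" for p x z
    by (rule cxR_lift_elt[OF U V h[OF that(1)] F[OF that(1)] that(2)])
  have z: "?E p \<zero>\<^bsub>cxR U\<^esub> = \<zero>\<^bsub>cxR V\<^esub>" if "p \<in> carrier P" for p
    by (rule rmod_hom_zero[OF rmod_cxR[OF U] rmod_cxR[OF V] H[OF that]])
  note c = lin_hom_closed[OF H] and a = lin_hom_add[OF H]
  show ?thesis
  proof (rule lin_homI)
    show "?E p X \<in> carrier (cxR V)" if "p \<in> carrier P" for p using c that X by blast
  next
    fix p q assume p: "p \<in> carrier P" "q \<in> carrier P"
    note pq = P.add_closed[OF p]
    show "?E (p \<oplus>\<^bsub>P\<^esub> q) X = ?E p X \<oplus>\<^bsub>cxR V\<^esub> ?E q X" using X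
    proof (induction rule: cxR_induct[OF U, consumes 1, case_names zero elt add])
      case (add X Y)
      thus ?case using p pq c by (simp add: a VR.M.a_ac)
    qed (use p pq lin_hom[OF hp] in \<open>auto simp: z e VR.smult_add_right\<close>)
  next
    fix k p assume p: "p \<in> carrier P"
    note kp = P.smult_closed[OF p, of k]
    show "?E (k \<odot>\<^bsub>P\<^esub> p) X = k \<odot>\<^bsub>cxR V\<^esub> ?E p X" using X
    proof (induction rule: cxR_induct[OF U, consumes 1, case_names zero elt add])
      case (add X Y)
      thus ?case using p kp c by (simp add: a VR.smult_add_right)
    qed (use p kp lin_hom[OF hp] in \<open>auto simp: z e VR.smult_smult mult.commute\<close>)
  qed
qed

text \<open>The counterpart of \<open>scalar_mod\<close> over a commutative ring; it is the target
  of the coordinate functionals on V \<otimes> \<complex>.\<close>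

definition self_mod :: "('k :: comm_ring_1, 'k) module" where
  "self_mod = \<lparr>carrier = UNIV, monoid.mult = (*), one = 1, zero = 0, add = (+), smult = (*)\<rparr>"

lemma self_mod_simps [simp]:
  "carrier self_mod = UNIV" "\<zero>\<^bsub>self_mod\<^esub> = 0" "x \<oplus>\<^bsub>self_mod\<^esub> y = x + y" "c \<odot>\<^bsub>self_mod\<^esub> x = c * x"
  by (simp_all add: self_mod_def)

lemma rmod_self: "rmod self_mod"
  by (rule rmodI) (auto simp: algebra_simps)

lemma finsum_self_mod [simp]: "finsum self_mod f A = sum (f :: 'i \<Rightarrow> 'k :: comm_ring_1) A"
proof -
  interpret rmod "self_mod :: ('k, 'k) module" by (rule rmod_self)
  show ?thesis by (induction A rule: infinite_finite_induct) auto
qed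

lemma finsum_scalar_mod [simp]: "finsum scalar_mod f A = sum f A"
  using finsum_cong_record[of scalar_mod self_mod f A] by simp

lemma Rep_ec_closed_cxR [simp]: "Rep_ec a \<in> carrier (cxR scalarE)"
  using Rep_ec_closed by simp

lemma self_hom_scalarE: "(\<lambda>X. Abs_ec X) \<in> lin_hom (cxR scalarE) self_mod"
proof (rule lin_homI)
  fix A B :: "'a cx" assume "A \<in> carrier (cxR scalarE)" "B \<in> carrier (cxR scalarE)"
  thus "Abs_ec (A \<oplus>\<^bsub>cxR scalarE\<^esub> B) = Abs_ec A \<oplus>\<^bsub>self_mod\<^esub> Abs_ec B"
    by (simp, subst plus_ec.abs_eq) (auto simp: eq_onp_def)
next
  fix c and A :: "'a cx" assume A: "A \<in> carrier (cxR scalarE)"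
  have "c \<odot>\<^bsub>cxR scalarE\<^esub> A = Rep_ec (c * Abs_ec A)"
    using A by (simp add: cxR_smult times_ec.rep_eq Abs_ec_inverse)
  thus "Abs_ec (c \<odot>\<^bsub>cxR scalarE\<^esub> A) = c \<odot>\<^bsub>self_mod\<^esub> Abs_ec A" by (simp add: Rep_ec_inverse)
qed simp

lemma id_hom_complex: "(\<lambda>z. z) \<in> lin_hom complex_mod complex_mod"
  by (rule lin_homI) auto

lemma cnj_hom_complex: "cnj \<in> lin_hom complex_mod complex_mod"
proof -
  have "cnj (of_rat q) = of_rat q" for q by (cases q) (simp add: of_rat_rat)
  thus ?thesis by (intro lin_homI) auto
qed

lemma id_hom: "(\<lambda>x. x) \<in> lin_hom V V"
  by (rule lin_homI) auto

abbreviation cxm :: "('e :: field_char_0, 'v) module \<Rightarrow> ('a \<Rightarrow> 'v) \<Rightarrow> 'a cx \<Rightarrow> 'v cx" where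
  "cxm V f \<equiv> cx_map V f (\<lambda>z. z)"

lemma
  assumes A: "lin_space A" and V: "lin_space V" and f: "f \<in> lin_hom A V"
  shows cxm_hom: "cxm V f \<in> lin_hom (cxR A) (cxR V)"
    and cxm_elt: "x \<in> carrier A \<Longrightarrow> cxm V f (cx_elt A x z) = cx_elt V (f x) z"
proof -
  show e: "x \<in> carrier A \<Longrightarrow> cxm V f (cx_elt A x z) = cx_elt V (f x) z" for x z
    by (rule cx_map_elt[OF A V f id_hom_complex])
  have h: "(\<lambda>x. cx_elt V (f x) 1) \<in> lin_hom A (cxE V)"
    by (rule lin_hom_comp[OF f cx_elt_hom_cxE[OF V]])
  have F: "cx_elt V (f x) z = tens 1 z \<odot>\<^bsub>cxR V\<^esub> cx_elt V (f x) 1" if "x \<in> carrier A" for x z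
    by (rule cx_elt_eq[OF V lin_hom_closed[OF f that]])
  have eq: "cx_map V f (\<lambda>z. z) = extend_lin (cxQ V) (\<lambda>(x, z). cx_elt V (f x) z)"
    by (simp only: cx_map_def tensor_map_def cxQ_def cx_elt_def)
  show "cxm V f \<in> lin_hom (cxR A) (cxR V)" unfolding eq by (rule cxR_lift_hom[OF A V h F])
qed

lemma cxm_comp:
  assumes A: "lin_space A" and V: "lin_space V" and W: "lin_space W" and f: "f \<in> lin_hom A V" and g: "g \<in> lin_hom V W"
    and X: "X \<in> carrier (cxR A)"
  shows "cxm W g (cxm V f X) = cxm W (\<lambda>x. g (f x)) X"
  by (rule cxR_hom_eqI[OF A rmod_cxR[OF W] lin_hom_comp[OF cxm_hom[OF A V f] cxm_hom[OF V W g]]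
        cxm_hom[OF A W lin_hom_comp[OF f g]] _ X])
    (simp add: cxm_elt[OF A V f] cxm_elt[OF V W g] cxm_elt[OF A W lin_hom_comp[OF f g]] lin_hom_closed[OF f])

lemma cxm_cong_id:
  assumes V: "lin_space V" and f: "f \<in> lin_hom V V" and i: "\<And>x. x \<in> carrier V \<Longrightarrow> f x = x"
    and X: "X \<in> carrier (cxR V)"
  shows "cxm V f X = X"
  by (rule cxR_hom_eqI[OF V rmod_cxR[OF V] cxm_hom[OF V V f] id_hom _ X]) (simp add: cxm_elt[OF V V f] i)

lemma
  assumes A: "lin_space A" and V: "lin_space V" and h: "h \<in> lin_hom A (cxE V)"
  shows cx_extend_hom: "cx_extend V h \<in> lin_hom (cxR A) (cxR V)"
    and cx_extend_elt: "x \<in> carrier A \<Longrightarrow> cx_extend V h (cx_elt A x 1) = h x"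
proof -
  interpret VR: rmod "cxR V" by (rule rmod_cxR[OF V])
  have F: "cx_smult V (cx_elt scalarE 1 z) (h x) = tens 1 z \<odot>\<^bsub>cxR V\<^esub> h x" for x z
    by (simp add: cxR_smult tens.rep_eq)
  show "cx_extend V h \<in> lin_hom (cxR A) (cxR V)"
    unfolding cx_extend_def by (rule cxR_lift_hom[OF A V h F])
  show "cx_extend V h (cx_elt A x 1) = h x" if "x \<in> carrier A"
    unfolding cx_extend_def using cxR_lift_elt[OF A V h F that, of 1] lin_hom_closed[OF h that] by simp
qed

lemma tensor_elt_lin_right: "lin_space V \<Longrightarrow> lin_space W \<Longrightarrow> x \<in> carrier V \<Longrightarrow> tensor_elt V W x \<in> lin_hom W (tensor_mod V W)"
  by (rule bilinD(1)[OF tensor_elt_bilin])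

lemma tensor_elt_lin_left: "lin_space V \<Longrightarrow> lin_space W \<Longrightarrow> y \<in> carrier W \<Longrightarrow> (\<lambda>x. tensor_elt V W x y) \<in> lin_hom V (tensor_mod V W)"
  by (rule bilinD(2)[OF tensor_elt_bilin])

text \<open>The inner extension in the definition of \<open>cx_tensor\<close> is 1 \<otimes> z times
  the base change of the map y \<mapsto> x \<otimes> y. This exhibits the outer extension as the
  lift of a map linear in x, so both variables are linear over E \<otimes> \<complex>.\<close>

lemma
  assumes V: "lin_space V" and W: "lin_space W"
  shows cx_tensor_hom_left: "Y \<in> carrier (cxR W) \<Longrightarrow> (\<lambda>X. cx_tensor V W X Y) \<in> lin_hom (cxR V) (cxR (tensor_mod V W))"
    and cx_tensor_hom_right: "X \<in> carrier (cxR V) \<Longrightarrow> cx_tensor V W X \<in> lin_hom (cxR W) (cxR (tensor_mod V W))"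
    and cx_tensor_elt: "x \<in> carrier V \<Longrightarrow> y \<in> carrier W \<Longrightarrow>
      cx_tensor V W (cx_elt V x 1) (cx_elt W y 1) = cx_elt (tensor_mod V W) (tensor_elt V W x y) 1"
proof -
  let ?T = "tensor_mod V W"
  interpret V: lin_space V by fact
  have T: "lin_space ?T" by (rule lin_space_tensor[OF V W])
  interpret TR: rmod "cxR ?T" by (rule rmod_cxR[OF T])
  let ?t = "tensor_elt V W"
  note tr = tensor_elt_lin_right[OF V W] and tl = tensor_elt_lin_left[OF V W]
  have tc: "?t x y \<in> carrier ?T" if "x \<in> carrier V" "y \<in> carrier W" for x y
    by (rule tensor_elt_closed[OF V W that])
  define I where "I x z Y = extend_lin (cxQ ?T) (\<lambda>(y, w). cx_elt ?T (?t x y) (z * w)) Y" for x z Y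
  define h where "h x Y = cxm ?T (?t x) Y" for x Y
  have F: "cx_elt ?T (?t x y) (z * w) = tens 1 w \<odot>\<^bsub>cxR ?T\<^esub> (tens 1 z \<odot>\<^bsub>cxR ?T\<^esub> cx_elt ?T (?t x y) 1)"
    if "x \<in> carrier V" "y \<in> carrier W" for x y z w
    using tc[OF that] lin_space.rmod[OF T, THEN rmod.smult_one] by (simp add: tens_smult_elt[OF T] mult.commute)
  have h1: "(\<lambda>y. tens 1 z \<odot>\<^bsub>cxR ?T\<^esub> cx_elt ?T (?t x y) 1) \<in> lin_hom W (cxE ?T)" if "x \<in> carrier V" for x z
    using lin_hom[OF lin_hom_comp[OF tr[OF that] cx_elt_hom_cxE[OF T]]]
    by (intro lin_homI) (auto simp: TR.smult_add_right TR.smult_smult mult.commute)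
  have hx: "h x \<in> lin_hom (cxR W) (cxR ?T)" if "x \<in> carrier V" for x
    unfolding h_def[abs_def] by (rule cxm_hom[OF W T tr[OF that]])
  have I: "I x z Y = tens 1 z \<odot>\<^bsub>cxR ?T\<^esub> h x Y" if x: "x \<in> carrier V" and Y: "Y \<in> carrier (cxR W)" for x z Y
  proof -
    have c: "(\<lambda>Y. tens 1 z \<odot>\<^bsub>cxR ?T\<^esub> h x Y) \<in> lin_hom (cxR W) (cxR ?T)"
      using lin_hom[OF hx[OF x]] by (intro lin_homI) (auto simp: TR.smult_add_right TR.smult_smult mult.commute)
    have "I x z \<in> lin_hom (cxR W) (cxR ?T)"
      unfolding I_def[abs_def] by (rule cxR_lift_hom[OF W T h1[OF x] F[OF x]])
    from cxR_hom_eqI[OF W rmod_cxR[OF T] this c _ Y] show ?thesis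
      unfolding I_def h_def using x tc
      by (simp add: cxR_lift_elt[OF W T h1[OF x] F[OF x]] cxm_elt[OF W T tr[OF x]] cxR_elt_closed[OF T])
  qed
  have hl: "(\<lambda>x. h x Y) \<in> lin_hom V (cxE ?T)" if Y: "Y \<in> carrier (cxR W)" for Y
  proof (rule lin_homI)
    show "h x Y \<in> carrier (cxE ?T)" if "x \<in> carrier V" for x using lin_hom_closed[OF hx[OF that] Y] by simp
  next
    fix x y assume xy: "x \<in> carrier V" "y \<in> carrier V"
    note s = V.add_closed[OF xy]
    have "h (x \<oplus>\<^bsub>V\<^esub> y) Y = h x Y \<oplus>\<^bsub>cxR ?T\<^esub> h y Y" using Y
    proof (induction rule: cxR_induct[OF W, consumes 1, case_names zero elt add])
      case zero
      show ?case using rmod_hom_zero[OF rmod_cxR[OF W] rmod_cxR[OF T] hx] xy s by simp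
    next
      case (elt w z)
      thus ?case unfolding h_def using xy s lin_hom_add[OF tl[OF elt] xy] cx_elt_add_left[OF T]
        by (simp add: cxm_elt[OF W T tr] tc)
    next
      case (add Y Z)
      thus ?case using lin_hom_closed[OF hx] xy s by (simp add: lin_hom_add[OF hx] TR.M.a_ac)
    qed
    thus "h (x \<oplus>\<^bsub>V\<^esub> y) Y = h x Y \<oplus>\<^bsub>cxE ?T\<^esub> h y Y" by simp
  next
    fix k x assume x: "x \<in> carrier V"
    note s = V.smult_closed[OF x, of k]
    have "h (k \<odot>\<^bsub>V\<^esub> x) Y = emb k \<odot>\<^bsub>cxR ?T\<^esub> h x Y" using Y
    proof (induction rule: cxR_induct[OF W, consumes 1, case_names zero elt add])
      case zero
      show ?case using rmod_hom_zero[OF rmod_cxR[OF W] rmod_cxR[OF T] hx] x s by simp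
    next
      case (elt w z)
      thus ?case unfolding h_def using x s lin_hom_smult[OF tl[OF elt] x, of k]
        by (simp add: cxm_elt[OF W T tr] tc emb_def tens_smult_elt[OF T])
    next
      case (add Y Z)
      thus ?case using lin_hom_closed[OF hx] x s by (simp add: lin_hom_add[OF hx] TR.smult_add_right)
    qed
    thus "h (k \<odot>\<^bsub>V\<^esub> x) Y = k \<odot>\<^bsub>cxE ?T\<^esub> h x Y" by simp
  qed
  have eq: "cx_tensor V W X Y = extend_lin (cxQ ?T) (\<lambda>(x, z). I x z Y) X" for X Y
    by (simp add: cx_tensor_def I_def)
  show l: "(\<lambda>X. cx_tensor V W X Y) \<in> lin_hom (cxR V) (cxR ?T)" if Y: "Y \<in> carrier (cxR W)" for Y
    unfolding eq using I[OF _ Y] by (intro cxR_lift_hom[OF V T hl[OF Y]]) auto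
  show "cx_tensor V W X \<in> lin_hom (cxR W) (cxR ?T)" if "X \<in> carrier (cxR V)" for X
    unfolding eq[abs_def]
    by (rule cxR_lift_param[OF V T rmod_cxR[OF W] hl]) (use I hx that in auto)
  show "cx_tensor V W (cx_elt V x 1) (cx_elt W y 1) = cx_elt ?T (?t x y) 1"
    if x: "x \<in> carrier V" and y: "y \<in> carrier W" for x y
    unfolding eq using cxR_lift_elt[OF V T hl[OF cxR_elt_closed[OF W y]] I[OF _ cxR_elt_closed[OF W y]] x, of 1 1] x y tc
    by (simp add: h_def cxm_elt[OF W T tr[OF x]] cxR_elt_closed[OF T])
qed

lemma EC_hom_cxR:
  fixes A :: "('e :: field_char_0, 'a) module" and V :: "('e, 'v) module"
  assumes "f \<in> LinearCombinations.module_hom EC (cx A) (cx V)"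
  shows "f \<in> lin_hom (cxR A) (cxR V)"
proof (rule lin_homI)
  fix a :: "'e ec" and X assume "X \<in> carrier (cxR A)"
  thus "f (a \<odot>\<^bsub>cxR A\<^esub> X) = a \<odot>\<^bsub>cxR V\<^esub> f X"
    using assms Rep_ec_closed_cxR[of a] unfolding LinearCombinations.module_hom_def
    by (simp add: EC_def cxR_smult) (simp add: cx_def)
qed (use assms in \<open>auto simp: LinearCombinations.module_hom_def\<close>)

section \<open>Bases with dual coordinate functionals, before and after base change\<close>

section \<open>Coordinates\<close>

text \<open>A finite basis together with its dual basis. Keeping the coordinate functionals as data
  makes base change immediate: their extensions \<open>coord\<close> are the coordinates on V
  \<otimes> \<complex>.\<close>

definition frame :: "('e :: field, 'v) module \<Rightarrow> nat \<Rightarrow> (nat \<Rightarrow> 'v) \<Rightarrow> (nat \<Rightarrow> 'v \<Rightarrow> 'e) \<Rightarrow> bool" where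
  "frame V r b c \<longleftrightarrow> lin_space V \<and> (\<forall>i<r. b i \<in> carrier V) \<and> (\<forall>i<r. c i \<in> lin_hom V scalar_mod) \<and>
     (\<forall>i<r. \<forall>j<r. c i (b j) = (if i = j then 1 else 0)) \<and>
     (\<forall>x\<in>carrier V. (\<forall>i<r. c i x = 0) \<longrightarrow> x = \<zero>\<^bsub>V\<^esub>)"

definition coord :: "('v \<Rightarrow> 'e :: field_char_0) \<Rightarrow> 'v cx \<Rightarrow> 'e ec" where
  "coord c X = Abs_ec (cxm scalarE c X)"

lemma
  assumes V: "lin_space V" and c: "c \<in> lin_hom V scalar_mod"
  shows coord_hom: "coord c \<in> lin_hom (cxR V) self_mod"
    and coord_elt: "x \<in> carrier V \<Longrightarrow> coord c (cx_elt V x z) = tens (c x) z"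
  unfolding coord_def[abs_def]
  using lin_hom_comp[OF cxm_hom[OF V lin_space_scalar c] self_hom_scalarE]
  by (auto simp: cxm_elt[OF V lin_space_scalar c] Abs_cx_elt)

locale framed =
  fixes V :: "('e :: field_char_0, 'v) module" and r :: nat and b :: "nat \<Rightarrow> 'v" and c :: "nat \<Rightarrow> 'v \<Rightarrow> 'e"
  assumes fr: "frame V r b c"
begin

lemma V: "lin_space V" using fr by (simp add: frame_def)

sublocale lin_space V by (rule V)
sublocale C: rmod "cxR V" by (rule rmod_cxR[OF V])

lemma b_closed [simp]: "i < r \<Longrightarrow> b i \<in> carrier V" using fr by (simp add: frame_def)
lemma c_hom: "i < r \<Longrightarrow> c i \<in> lin_hom V scalar_mod" using fr by (simp add: frame_def)
lemma c_b: "i < r \<Longrightarrow> j < r \<Longrightarrow> c i (b j) = (if i = j then 1 else 0)" using fr by (simp add: frame_def)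
lemma c_zero: "x \<in> carrier V \<Longrightarrow> (\<And>i. i < r \<Longrightarrow> c i x = 0) \<Longrightarrow> x = \<zero>\<^bsub>V\<^esub>" using fr by (simp add: frame_def)

lemma eqI:
  assumes x: "x \<in> carrier V" and y: "y \<in> carrier V" and eq: "\<And>i. i < r \<Longrightarrow> c i x = c i y"
  shows "x = y"
proof -
  have "x \<oplus>\<^bsub>V\<^esub> (-1) \<odot>\<^bsub>V\<^esub> y = \<zero>\<^bsub>V\<^esub>"
    using x y eq by (intro c_zero) (auto simp: lin_hom_add[OF c_hom] lin_hom_smult[OF c_hom])
  thus ?thesis using x y minus_eq_zero_iff[OF x y] by (simp add: a_minus_def smult_neg_left)
qed

lemma c_sum:
  assumes "i < r"
  shows "c i (\<Oplus>\<^bsub>V\<^esub>j\<in>{..<r}. a j \<odot>\<^bsub>V\<^esub> b j) = a i"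
proof -
  have "c i (\<Oplus>\<^bsub>V\<^esub>j\<in>{..<r}. a j \<odot>\<^bsub>V\<^esub> b j) = (\<Oplus>\<^bsub>scalar_mod\<^esub>j\<in>{..<r}. c i (a j \<odot>\<^bsub>V\<^esub> b j))"
    using assms by (intro lin_hom_finsum rmod_axioms lin_space.rmod[OF lin_space_scalar] c_hom) auto
  also have "\<dots> = (\<Sum>j<r. if i = j then a j else 0)"
    using assms unfolding finsum_scalar_mod by (intro sum.cong) (auto simp: lin_hom_smult[OF c_hom] c_b)
  also have "\<dots> = a i" using assms by (subst sum.delta') auto
  finally show ?thesis .
qed

lemma expand:
  assumes "x \<in> carrier V"
  shows "x = (\<Oplus>\<^bsub>V\<^esub>j\<in>{..<r}. c j x \<odot>\<^bsub>V\<^esub> b j)"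
  by (rule eqI) (use assms c_sum in \<open>auto intro!: M.finsum_closed\<close>)

abbreviation "e i \<equiv> cx_elt V (b i) 1"

lemma e_closed [simp]: "i < r \<Longrightarrow> e i \<in> carrier (cxR V)" by (simp add: cxR_elt_closed[OF V])

lemma coord_e: "i < r \<Longrightarrow> j < r \<Longrightarrow> coord (c i) (e j) = (if i = j then 1 else 0)"
  using coord_elt[OF V c_hom, of i "b j" 1] c_b[of i j] by (auto simp: emb_def[symmetric])

text \<open>Both sides are linear over E \<otimes> \<complex>, so it is enough to treat x \<otimes>
  1, where the expansion of x in V applies. Hence a frame of V stays a basis after base
  change.\<close>

lemma cx_expand:
  assumes X: "X \<in> carrier (cxR V)"
  shows "X = (\<Oplus>\<^bsub>cxR V\<^esub>j\<in>{..<r}. coord (c j) X \<odot>\<^bsub>cxR V\<^esub> e j)" (is "_ = ?h X")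
proof -
  have h: "?h \<in> lin_hom (cxR V) (cxR V)"
  proof (rule lin_homI)
    fix X Y assume XY: "X \<in> carrier (cxR V)" "Y \<in> carrier (cxR V)"
    have "?h (X \<oplus>\<^bsub>cxR V\<^esub> Y) = (\<Oplus>\<^bsub>cxR V\<^esub>j\<in>{..<r}. coord (c j) X \<odot>\<^bsub>cxR V\<^esub> e j \<oplus>\<^bsub>cxR V\<^esub> coord (c j) Y \<odot>\<^bsub>cxR V\<^esub> e j)"
      using XY by (intro C.M.finsum_cong') (auto simp: lin_hom_add[OF coord_hom[OF V c_hom]] C.smult_add_left)
    also have "\<dots> = ?h X \<oplus>\<^bsub>cxR V\<^esub> ?h Y" by (rule C.M.finsum_addf) auto
    finally show "?h (X \<oplus>\<^bsub>cxR V\<^esub> Y) = ?h X \<oplus>\<^bsub>cxR V\<^esub> ?h Y" .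
  next
    fix k X assume X: "X \<in> carrier (cxR V)"
    have "?h (k \<odot>\<^bsub>cxR V\<^esub> X) = (\<Oplus>\<^bsub>cxR V\<^esub>j\<in>{..<r}. k \<odot>\<^bsub>cxR V\<^esub> (coord (c j) X \<odot>\<^bsub>cxR V\<^esub> e j))"
      using X by (intro C.M.finsum_cong') (auto simp: lin_hom_smult[OF coord_hom[OF V c_hom]] C.smult_smult)
    also have "\<dots> = k \<odot>\<^bsub>cxR V\<^esub> ?h X" by (rule C.smult_finsum[symmetric]) auto
    finally show "?h (k \<odot>\<^bsub>cxR V\<^esub> X) = k \<odot>\<^bsub>cxR V\<^esub> ?h X" .
  qed (auto intro!: C.M.finsum_closed)
  have "cx_elt V x 1 = ?h (cx_elt V x 1)" if x: "x \<in> carrier V" for x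
  proof -
    have "?h (cx_elt V x 1) = (\<Oplus>\<^bsub>cxE V\<^esub>j\<in>{..<r}. cx_elt V (c j x \<odot>\<^bsub>V\<^esub> b j) 1)"
      unfolding finsum_cong_record[of "cxE V" "cxR V", simplified]
      using x by (intro C.M.finsum_cong')
        (auto simp: coord_elt[OF V c_hom] emb_smult_elt[OF V] cxR_elt_closed[OF V] simp flip: emb_def)
    also have "\<dots> = cx_elt V (\<Oplus>\<^bsub>V\<^esub>j\<in>{..<r}. c j x \<odot>\<^bsub>V\<^esub> b j) 1"
      by (rule lin_hom_finsum[OF rmod_axioms lin_space.rmod[OF lin_space_cxE[OF V]] cx_elt_hom_cxE[OF V], symmetric]) auto
    finally show ?thesis using expand[OF x] by simp
  qed
  from cxR_hom_eqI[OF V C.rmod_axioms id_hom h this X] show ?thesis .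
qed

lemma hom_expand:
  assumes N: "rmod N" and f: "f \<in> lin_hom (cxR V) N" and X: "X \<in> carrier (cxR V)"
  shows "f X = (\<Oplus>\<^bsub>N\<^esub>j\<in>{..<r}. coord (c j) X \<odot>\<^bsub>N\<^esub> f (e j))"
proof -
  interpret N: rmod N by (rule N)
  have "f X = f (\<Oplus>\<^bsub>cxR V\<^esub>j\<in>{..<r}. coord (c j) X \<odot>\<^bsub>cxR V\<^esub> e j)" using cx_expand[OF X] by simp
  also have "\<dots> = (\<Oplus>\<^bsub>N\<^esub>j\<in>{..<r}. f (coord (c j) X \<odot>\<^bsub>cxR V\<^esub> e j))"
    by (rule lin_hom_finsum[OF C.rmod_axioms N f]) auto
  also have "\<dots> = (\<Oplus>\<^bsub>N\<^esub>j\<in>{..<r}. coord (c j) X \<odot>\<^bsub>N\<^esub> f (e j))"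
    by (rule N.M.finsum_cong') (auto simp: lin_hom_smult[OF f] lin_hom_closed[OF f])
  finally show ?thesis .
qed

lemma coord_sum:
  assumes "i < r"
  shows "coord (c i) (\<Oplus>\<^bsub>cxR V\<^esub>j\<in>{..<r}. a j \<odot>\<^bsub>cxR V\<^esub> e j) = a i"
proof -
  note h = coord_hom[OF V c_hom[OF assms]]
  have "coord (c i) (\<Oplus>\<^bsub>cxR V\<^esub>j\<in>{..<r}. a j \<odot>\<^bsub>cxR V\<^esub> e j) = (\<Sum>j<r. coord (c i) (a j \<odot>\<^bsub>cxR V\<^esub> e j))"
    by (subst lin_hom_finsum[OF C.rmod_axioms rmod_self h]) auto
  also have "\<dots> = (\<Sum>j<r. if i = j then a j else 0)"
    using assms by (intro sum.cong) (auto simp: lin_hom_smult[OF h] coord_e)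
  also have "\<dots> = a i" using assms by (subst sum.delta') auto
  finally show ?thesis .
qed

lemma cx_eqI:
  assumes "X \<in> carrier (cxR V)" "Y \<in> carrier (cxR V)" "\<And>i. i < r \<Longrightarrow> coord (c i) X = coord (c i) Y"
  shows "X = Y"
proof -
  have "X = (\<Oplus>\<^bsub>cxR V\<^esub>j\<in>{..<r}. coord (c j) X \<odot>\<^bsub>cxR V\<^esub> e j)" by (rule cx_expand) fact
  also have "\<dots> = (\<Oplus>\<^bsub>cxR V\<^esub>j\<in>{..<r}. coord (c j) Y \<odot>\<^bsub>cxR V\<^esub> e j)"
    using assms(3) by (intro C.M.finsum_cong') auto
  also have "\<dots> = Y" by (rule cx_expand[symmetric]) fact
  finally show ?thesis .
qed

end

section \<open>Pfaffians: behaviour under congruence, and nonvanishing on nondegenerate alternating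
  matrices\<close>

section \<open>Determinants and Pfaffians\<close>

lemma permutes_lt: "p permutes {0..<k} \<Longrightarrow> i < (k :: nat) \<Longrightarrow> p i < k"
  using permutes_in_image[of p "{0..<k}" i] by simp

lemma permutes_bij_PiE:
  "bij_betw (\<lambda>p. restrict p {0..<k}) {p. p permutes {0..<k}}
     {f \<in> {0..<k} \<rightarrow>\<^sub>E {0..<k}. inj_on f {0..<(k :: nat)}}"
  unfolding bij_betw_def
proof (intro conjI inj_onI equalityI subsetI)
  fix p q assume "p \<in> {p. p permutes {0..<k}}" "q \<in> {p. p permutes {0..<k}}"
    and eq: "restrict p {0..<k} = restrict q {0..<k}"
  hence p: "p permutes {0..<k}" "q permutes {0..<k}" by auto
  show "p = q"
  proof
    fix x show "p x = q x"
      using fun_cong[OF eq, of x] p by (cases "x \<in> {0..<k}") (auto simp: permutes_not_in)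
  qed
next
  fix f assume "f \<in> (\<lambda>p. restrict p {0..<k}) ` {p. p permutes {0..<k}}"
  then obtain p where p: "p permutes {0..<k}" "f = restrict p {0..<k}" by auto
  show "f \<in> {f \<in> {0..<k} \<rightarrow>\<^sub>E {0..<k}. inj_on f {0..<k}}"
    unfolding p(2) using permutes_in_image[OF p(1)] permutes_inj_on[OF p(1)]
    by (auto simp: inj_on_def)
next
  fix f assume "f \<in> {f \<in> {0..<k} \<rightarrow>\<^sub>E {0..<k}. inj_on f {0..<k}}"
  hence f: "f \<in> {0..<k} \<rightarrow>\<^sub>E {0..<k}" "inj_on f {0..<k}" by auto
  define p where "p x = (if x \<in> {0..<k} then f x else x)" for x
  have "inj_on p {0..<k}" using f(2) by (simp add: p_def inj_on_def)
  moreover have "p x \<in> {0..<k}" if "x \<in> {0..<k}" for x using PiE_mem[OF f(1) that] that by (simp add: p_def)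
  ultimately have "p permutes {0..<k}" by (intro inj_imp_permutes) (simp_all add: p_def)
  moreover have "f = restrict p {0..<k}" using f by (auto simp: p_def fun_eq_iff PiE_def extensional_def)
  ultimately show "f \<in> (\<lambda>p. restrict p {0..<k}) ` {p. p permutes {0..<k}}" by blast
qed

text \<open>Expanding a product of k sums gives a sum over all index functions; the terms with a
  repeated index vanish, and a Leibniz sum over permutations remains.\<close>

lemma sum_PiE_permutes:
  fixes T :: "(nat \<Rightarrow> nat) \<Rightarrow> 'a :: comm_monoid_add"
  assumes "\<And>f. f \<in> {0..<k} \<rightarrow>\<^sub>E {0..<k} \<Longrightarrow> \<not> inj_on f {0..<k} \<Longrightarrow> T f = 0"
  shows "(\<Sum>f\<in>{0..<k} \<rightarrow>\<^sub>E {0..<k}. T f) = (\<Sum>p | p permutes {0..<k}. T (restrict p {0..<k}))"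
proof -
  have "(\<Sum>f\<in>{0..<k} \<rightarrow>\<^sub>E {0..<k}. T f) = (\<Sum>f\<in>{f \<in> {0..<k} \<rightarrow>\<^sub>E {0..<k}. inj_on f {0..<k}}. T f)"
    by (rule sum.mono_neutral_right) (auto intro: finite_PiE assms)
  also have "\<dots> = (\<Sum>p | p permutes {0..<k}. T (restrict p {0..<k}))"
    by (rule sum.reindex_bij_betw[symmetric]) (rule permutes_bij_PiE)
  finally show ?thesis .
qed

definition fdet :: "nat \<Rightarrow> (nat \<Rightarrow> nat \<Rightarrow> 'a :: comm_ring_1) \<Rightarrow> 'a" where
  "fdet k A = det (mat k k (\<lambda>(i, j). A i j))"

lemma fdet_leibniz: "fdet k A = (\<Sum>p | p permutes {0..<k}. of_int (sign p) * (\<Prod>i=0..<k. A i (p i)))"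
  unfolding fdet_def
  by (subst det_def'[of _ k]) (auto intro!: sum.cong prod.cong simp: permutes_lt)

lemma fdet_rows:
  assumes f: "f \<in> {0..<k} \<rightarrow>\<^sub>E {0..<k}" and ninj: "\<not> inj_on f {0..<k}"
  shows "fdet k (\<lambda>i j. P (f i) j) = 0"
proof -
  obtain i j where ij: "i < k" "j < k" "i \<noteq> j" "f i = f j" using ninj by (auto simp: inj_on_def)
  show ?thesis unfolding fdet_def
    by (rule det_identical_rows[of _ k i j]) (use ij in \<open>auto simp: row_def\<close>)
qed

lemma fdet_permute_rows:
  assumes p: "p permutes {0..<k}"
  shows "fdet k (\<lambda>i j. P (restrict p {0..<k} i) j) = of_int (sign p) * fdet k P"
proof -
  have "mat k k (\<lambda>(i, j). P (restrict p {0..<k} i) j) = mat k k (\<lambda>(i, j). mat k k (\<lambda>(i, j). P i j) $$ (p i, j))"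
    using permutes_lt[OF p] by (auto intro!: eq_matI)
  thus ?thesis unfolding fdet_def using det_permute_rows[of "mat k k (\<lambda>(i, j). P i j)" k p] p by simp
qed

text \<open>Up to sign and the factor \<open>2\<^sup>n n!\<close>, this is the Pfaffian of the alternating part of the \<open>2n \<times> 2n\<close>
  matrix \<open>A\<close>, with \<open>i\<close> paired to \<open>n + i\<close>; the normalization plays no role.\<close>

definition pfaff :: "nat \<Rightarrow> (nat \<Rightarrow> nat \<Rightarrow> 'a :: comm_ring_1) \<Rightarrow> 'a" where
  "pfaff n A = (\<Sum>p | p permutes {0..<2*n}. of_int (sign p) * (\<Prod>i=0..<n. A (p i) (p (n + i))))"

lemma prod_double:
  fixes h :: "nat \<Rightarrow> 'a :: comm_monoid_mult"
  shows "(\<Prod>k=0..<2*n. h k) = (\<Prod>i=0..<n. h i) * (\<Prod>i=0..<n. h (n + i))"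
proof -
  have "{0..<2*n} = {0..<n} \<union> {n..<n+n}" by auto
  hence "(\<Prod>k=0..<2*n. h k) = (\<Prod>i=0..<n. h i) * (\<Prod>i=n..<n+n. h i)"
    by (simp add: prod.union_disjoint)
  also have "(\<Prod>i=n..<n+n. h i) = (\<Prod>i=0..<n. h (n + i))"
    using prod.shift_bounds_nat_ivl[of h 0 n n] by (simp add: add.commute)
  finally show ?thesis .
qed

text \<open>Each of the n factors of a Pfaffian term carries a pair of indices. The pairs are
  regrouped into one index function on 2n places, with i and n + i belonging together.\<close>

lemma sum_pairs_PiE:
  fixes F :: "(nat \<Rightarrow> nat) \<Rightarrow> 'a :: comm_monoid_add"
  shows "(\<Sum>g\<in>{0..<n} \<rightarrow>\<^sub>E S \<times> S. F (\<lambda>k\<in>{0..<2*n}. if k < n then fst (g k) else snd (g (k - n))))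
    = (\<Sum>f\<in>{0..<2*n} \<rightarrow>\<^sub>E S. F f)"
proof (rule sum.reindex_bij_witness[where j = "\<lambda>g. \<lambda>k\<in>{0..<2*n}. if k < n then fst (g k) else snd (g (k - n))"
      and i = "\<lambda>f. \<lambda>i\<in>{0..<n}. (f i, f (n + i))"])
  fix g assume g: "g \<in> {0..<n} \<rightarrow>\<^sub>E S \<times> S"
  show "(\<lambda>i\<in>{0..<n}. ((\<lambda>k\<in>{0..<2*n}. if k < n then fst (g k) else snd (g (k - n))) i,
      (\<lambda>k\<in>{0..<2*n}. if k < n then fst (g k) else snd (g (k - n))) (n + i))) = g"
    using g by (auto simp: fun_eq_iff PiE_def extensional_def)
  have "g k \<in> S \<times> S" if "k < n" for k using PiE_mem[OF g, of k] that by simp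
  hence "fst (g k) \<in> S" "snd (g k) \<in> S" if "k < n" for k using that by (metis mem_Times_iff)+
  thus "(\<lambda>k\<in>{0..<2*n}. if k < n then fst (g k) else snd (g (k - n))) \<in> {0..<2*n} \<rightarrow>\<^sub>E S"
    by auto
next
  fix f assume f: "f \<in> {0..<2*n} \<rightarrow>\<^sub>E S"
  show "(\<lambda>i\<in>{0..<n}. (f i, f (n + i))) \<in> {0..<n} \<rightarrow>\<^sub>E S \<times> S" using f by auto
  show "(\<lambda>k\<in>{0..<2*n}. if k < n then fst ((\<lambda>i\<in>{0..<n}. (f i, f (n + i))) k)
      else snd ((\<lambda>i\<in>{0..<n}. (f i, f (n + i))) (k - n))) = f"
    using f by (auto simp: fun_eq_iff PiE_def extensional_def)
qed simp

text \<open>Expand the product of double sums into index functions f. For fixed f, summing over p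
  gives the determinant of the matrix formed by the rows f of P: it vanishes for a repeated index
  and is otherwise the sign of f times det P.\<close>

lemma pfaff_congruence:
  fixes A P :: "nat \<Rightarrow> nat \<Rightarrow> 'a :: comm_ring_1"
  shows "pfaff n (\<lambda>i j. \<Sum>a=0..<2*n. \<Sum>b=0..<2*n. P a i * A a b * P b j) = fdet (2*n) P * pfaff n A"
proof -
  let ?S = "{0..<2*n}"
  let ?w = "\<lambda>f. \<Prod>i=0..<n. A (f i) (f (n + i))"
  have e: "(\<Prod>i=0..<n. \<Sum>a\<in>?S. \<Sum>b\<in>?S. P a (p i) * A a b * P b (p (n + i)))
      = (\<Sum>f\<in>?S \<rightarrow>\<^sub>E ?S. ?w f * (\<Prod>k\<in>?S. P (f k) (p k)))" for p
  proof -
    have "(\<Prod>i=0..<n. \<Sum>a\<in>?S. \<Sum>b\<in>?S. P a (p i) * A a b * P b (p (n + i)))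
        = (\<Prod>i=0..<n. \<Sum>x\<in>?S \<times> ?S. P (fst x) (p i) * A (fst x) (snd x) * P (snd x) (p (n + i)))"
      by (simp add: sum.cartesian_product case_prod_unfold)
    also have "\<dots> = (\<Sum>g\<in>{0..<n} \<rightarrow>\<^sub>E ?S \<times> ?S. \<Prod>i=0..<n.
        P (fst (g i)) (p i) * A (fst (g i)) (snd (g i)) * P (snd (g i)) (p (n + i)))"
      by (rule prod_sum_PiE) auto
    also have "\<dots> = (\<Sum>g\<in>{0..<n} \<rightarrow>\<^sub>E ?S \<times> ?S.
        (\<lambda>f. ?w f * (\<Prod>k\<in>?S. P (f k) (p k))) (\<lambda>k\<in>?S. if k < n then fst (g k) else snd (g (k - n))))"
      unfolding prod_double prod.distrib[symmetric] by (intro sum.cong prod.cong refl) (simp add: mult_ac)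
    also have "\<dots> = (\<Sum>f\<in>?S \<rightarrow>\<^sub>E ?S. ?w f * (\<Prod>k\<in>?S. P (f k) (p k)))"
      by (rule sum_pairs_PiE)
    finally show ?thesis .
  qed
  have "pfaff n (\<lambda>i j. \<Sum>a\<in>?S. \<Sum>b\<in>?S. P a i * A a b * P b j)
      = (\<Sum>p | p permutes ?S. \<Sum>f\<in>?S \<rightarrow>\<^sub>E ?S. ?w f * (of_int (sign p) * (\<Prod>k\<in>?S. P (f k) (p k))))"
    unfolding pfaff_def e by (simp add: sum_distrib_left mult_ac)
  also have "\<dots> = (\<Sum>f\<in>?S \<rightarrow>\<^sub>E ?S. ?w f * fdet (2*n) (\<lambda>i j. P (f i) j))"
    by (subst sum.swap) (simp add: fdet_leibniz sum_distrib_left)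
  also have "\<dots> = (\<Sum>p | p permutes ?S. ?w (restrict p ?S) * fdet (2*n) (\<lambda>i j. P (restrict p ?S i) j))"
    by (rule sum_PiE_permutes) (simp add: fdet_rows)
  also have "\<dots> = (\<Sum>p | p permutes ?S. fdet (2*n) P * (of_int (sign p) * (\<Prod>i=0..<n. A (p i) (p (n + i)))))"
  proof (intro sum.cong refl)
    fix p assume "p \<in> {p. p permutes ?S}"
    hence p: "p permutes ?S" by simp
    have "?w (restrict p ?S) = (\<Prod>i=0..<n. A (p i) (p (n + i)))" by (intro prod.cong) auto
    thus "?w (restrict p ?S) * fdet (2*n) (\<lambda>i j. P (restrict p ?S i) j)
        = fdet (2*n) P * (of_int (sign p) * (\<Prod>i=0..<n. A (p i) (p (n + i))))"
      unfolding fdet_permute_rows[OF p] by (simp only: mult_ac)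
  qed
  finally show ?thesis by (simp add: pfaff_def sum_distrib_left)
qed

subsection \<open>The Pfaffian of a nondegenerate alternating matrix\<close>

text \<open>The Gram matrix of the standard symplectic form, with basis vectors i and n + i forming
  a hyperbolic pair.\<close>

definition std_sympl :: "nat \<Rightarrow> nat \<Rightarrow> nat \<Rightarrow> 'a :: comm_ring_1" where
  "std_sympl n i j = (if j = n + i then 1 else if i = n + j then -1 else 0)"

text \<open>The product of the transpositions of i and n + i for i in \<open>I\<close>.\<close>

definition block_swap :: "nat \<Rightarrow> nat set \<Rightarrow> nat \<Rightarrow> nat" where
  "block_swap n I k = (if k < n \<and> k \<in> I then n + k else if n \<le> k \<and> k - n \<in> I \<and> k < 2*n then k - n else k)"

lemma block_swap_sign:
  assumes "finite I" "I \<subseteq> {0..<n}"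
  shows "block_swap n I permutes {0..<2*n} \<and> sign (block_swap n I) = (-1) ^ card I"
  using assms
proof (induction rule: finite_induct)
  case empty
  have "block_swap n {} = id" by (auto simp: block_swap_def)
  thus ?case by (metis card.empty permutes_id power_0 sign_id)
next
  case (insert x I)
  have eq: "block_swap n (insert x I) = Transposition.transpose x (n + x) \<circ> block_swap n I"
    using insert by (auto simp: block_swap_def Transposition.transpose_def fun_eq_iff)
  have p: "block_swap n I permutes {0..<2*n}" and t: "Transposition.transpose x (n + x) permutes {0..<2*n}"
    using insert by (auto intro: permutes_swap_id)
  have "sign (block_swap n (insert x I)) = - sign (block_swap n I)"
    unfolding eq using insert.prems permutes_imp_permutation[OF _ p] permutes_imp_permutation[OF _ t]
    by (subst sign_compose) (auto simp: sign_swap_id)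
  moreover have "block_swap n (insert x I) permutes {0..<2*n}"
    unfolding eq by (rule permutes_compose[OF p t])
  ultimately show ?case using insert by simp
qed

text \<open>Such a p acts on both halves by one permutation a. With c the exchange of the halves, p
  is a composed with c a c, so every sign occurs twice.\<close>

lemma sign_block_diagonal:
  fixes n :: nat
  assumes p: "p permutes {0..<2*n}" and pi: "\<And>i. i < n \<Longrightarrow> p i < n \<and> p (n + i) = n + p i"
  shows "sign p = 1"
proof -
  define a where "a k = (if k < n then p k else k)" for k
  define c where "c = block_swap n {0..<n}"
  have c: "c permutes {0..<2*n}" unfolding c_def using block_swap_sign[of "{0..<n}" n] by simp
  have inj: "inj p" using p by (rule permutes_inj)
  have "a permutes {0..<n}"
    by (rule inj_imp_permutes) (use pi inj in \<open>auto simp: a_def inj_on_def\<close>)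
  hence a: "a permutes {0..<2*n}" by (rule permutes_subset) auto
  have eq: "p = a \<circ> (c \<circ> a \<circ> c)"
  proof
    fix k
    consider "k < n" | "n \<le> k" "k < 2*n" | "2*n \<le> k" by linarith
    thus "p k = (a \<circ> (c \<circ> a \<circ> c)) k"
    proof cases
      case 1 thus ?thesis by (simp add: a_def c_def block_swap_def)
    next
      case 2
      hence "k = n + (k - n)" "k - n < n" by auto
      hence q: "p k = n + p (k - n)" "p (k - n) < n" using pi by metis+
      have "c k = k - n" "a (k - n) = p (k - n)" using 2 by (auto simp: a_def c_def block_swap_def)
      moreover have "c (p (k - n)) = n + p (k - n)" "a (n + p (k - n)) = n + p (k - n)"
        using q(2) by (auto simp: a_def c_def block_swap_def)
      ultimately show ?thesis unfolding q(1) by (simp only: o_apply)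
    next
      case 3 thus ?thesis using permutes_not_in[OF p, of k] by (simp add: a_def c_def block_swap_def)
    qed
  qed
  note pp = permutes_imp_permutation[of "{0..<2*n}"]
  have ca: "c \<circ> a permutes {0..<2*n}" by (rule permutes_compose[OF a c])
  have cac: "c \<circ> a \<circ> c permutes {0..<2*n}" by (rule permutes_compose[OF c ca])
  have f: "finite {0..<2*n}" by simp
  have "sign p = sign a * sign (c \<circ> a \<circ> c)" by (subst eq) (rule sign_compose[OF pp[OF f a] pp[OF f cac]])
  also have "sign (c \<circ> a \<circ> c) = sign (c \<circ> a) * sign c" by (rule sign_compose[OF pp[OF f ca] pp[OF f c]])
  also have "sign (c \<circ> a) = sign c * sign a" by (rule sign_compose[OF pp[OF f c] pp[OF f a]])
  also have "sign a * (sign c * sign a * sign c) = (sign a * sign a) * (sign c * sign c)" by (simp only: mult_ac)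
  also have "\<dots> = 1" by (simp only: sign_idempotent mult_1)
  finally show ?thesis .
qed

text \<open>If the product is nonzero, p carries each pair i, n + i to such a pair. Let I collect
  the i whose pair is reversed. Swapping these pairs back makes p block diagonal, so the sign of p
  is -1 to the size of I, and the matrix entries contribute the same sign.\<close>

lemma std_sympl_term:
  assumes p: "p permutes {0..<2*n}"
  shows "sign p * (\<Prod>i=0..<n. std_sympl n (p i) (p (n + i))) \<in> {0, 1 :: int}"
proof (cases "\<exists>i<n. std_sympl n (p i) (p (n + i)) = (0 :: int)")
  case True
  hence "(\<Prod>i=0..<n. std_sympl n (p i) (p (n + i))) = (0 :: int)" by auto
  thus ?thesis by simp
next
  case False
  define I where "I = {i. i < n \<and> n \<le> p i}"
  let ?c = "block_swap n I"
  have I: "finite I" "I \<subseteq> {0..<n}" by (auto simp: I_def)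
  have c: "?c permutes {0..<2*n}" "sign ?c = (-1) ^ card I" using block_swap_sign[OF I] by auto
  have lt: "p k < 2*n" if "k < 2*n" for k using permutes_lt[OF p that] .
  have cases: "(p i < n \<and> p (n + i) = n + p i) \<or> (n \<le> p i \<and> p i = n + p (n + i))" if "i < n" for i
  proof -
    have "p (n + i) < 2*n" "p i < 2*n" using lt that by auto
    thus ?thesis using False that by (auto simp: std_sympl_def split: if_splits)
  qed
  have s: "sign (p \<circ> ?c) = 1"
  proof (rule sign_block_diagonal[OF permutes_compose[OF c(1) p]])
    fix i assume i: "i < n"
    show "(p \<circ> ?c) i < n \<and> (p \<circ> ?c) (n + i) = n + (p \<circ> ?c) i"
      using cases[OF i] i lt[of "n + i"] lt[of i] by (auto simp: block_swap_def I_def)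
  qed
  have "sign (p \<circ> ?c) = sign p * (-1) ^ card I"
    using p c by (simp add: sign_compose permutes_imp_permutation[of "{0..<2*n}"])
  moreover have "(\<Prod>i=0..<n. std_sympl n (p i) (p (n + i))) = ((-1) ^ card I :: int)"
  proof -
    have "(\<Prod>i=0..<n. std_sympl n (p i) (p (n + i))) = (\<Prod>i=0..<n. if i \<in> I then -1 else (1 :: int))"
    proof (intro prod.cong refl)
      fix i assume "i \<in> {0..<n}"
      thus "std_sympl n (p i) (p (n + i)) = (if i \<in> I then -1 else (1 :: int))"
        using cases[of i] by (auto simp: std_sympl_def I_def)
    qed
    also have "\<dots> = (\<Prod>i\<in>I. -1) " using I by (intro prod.mono_neutral_cong_right) auto
    finally show ?thesis by simp
  qed
  ultimately show ?thesis using s by simp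
qed

text \<open>No term is negative and the identity contributes 1, so nothing has to be
  counted.\<close>

lemma pfaff_std_sympl_pos: "pfaff n (std_sympl n) > (0 :: int)"
proof -
  let ?t = "\<lambda>p. sign p * (\<Prod>i=0..<n. std_sympl n (p i) (p (n + i))) :: int"
  have "?t id = 1" by (simp add: std_sympl_def)
  moreover have "0 \<le> ?t p" if "p permutes {0..<2*n}" for p using std_sympl_term[OF that]
    by (metis empty_iff insert_iff order_refl zero_le_one)
  hence "?t id \<le> (\<Sum>p | p permutes {0..<2*n}. ?t p)"
    by (intro member_le_sum) (auto simp only: permutes_id finite_permutations mem_Collect_eq finite_atLeastLessThan)
  ultimately show ?thesis by (simp add: pfaff_def)
qed

lemma pfaff_std_sympl_nonzero: "pfaff n (std_sympl n) \<noteq> (0 :: 'a :: field_char_0)"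
proof -
  have "pfaff n (std_sympl n) = (of_int (pfaff n (std_sympl n)) :: 'a)"
    by (simp add: pfaff_def) (intro sum.cong refl arg_cong2[of _ _ _ _ "(*)"] prod.cong, auto simp: std_sympl_def)
  thus ?thesis using pfaff_std_sympl_pos[of n] by (metis less_irrefl of_int_eq_0_iff)
qed

lemma fdet_transpose: "fdet k (\<lambda>i j. A j i) = fdet k A"
proof -
  have "mat k k (\<lambda>(i, j). A j i) = transpose_mat (mat k k (\<lambda>(i, j). A i j))" by (auto intro!: eq_matI)
  hence "fdet k (\<lambda>i j. A j i) = det (transpose_mat (mat k k (\<lambda>(i, j). A i j)))"
    unfolding fdet_def by (rule arg_cong)
  also have "\<dots> = fdet k A" unfolding fdet_def by (rule det_transpose[of _ k]) simp
  finally show ?thesis .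
qed

lemma fdet_eq_0_iff:
  fixes A :: "nat \<Rightarrow> nat \<Rightarrow> 'a :: field"
  shows "fdet k A = 0 \<longleftrightarrow> (\<exists>u. (\<exists>i<k. u i \<noteq> 0) \<and> (\<forall>i<k. (\<Sum>j=0..<k. A i j * u j) = 0))"
proof
  let ?A = "mat k k (\<lambda>(i, j). A i j)"
  assume "fdet k A = 0"
  then obtain v where v: "v \<in> carrier_vec k" "v \<noteq> 0\<^sub>v k" "?A *\<^sub>v v = 0\<^sub>v k"
    unfolding fdet_def using det_0_iff_vec_prod_zero_field[of ?A k] by auto
  have "\<exists>i<k. v $ i \<noteq> 0" using v(1,2) by (auto simp: vec_eq_iff)
  moreover have "(\<Sum>j=0..<k. A i j * v $ j) = 0" if "i < k" for i
    using arg_cong[OF v(3), of "\<lambda>w. w $ i"] that v(1) by (simp add: scalar_prod_def)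
  ultimately show "\<exists>u. (\<exists>i<k. u i \<noteq> 0) \<and> (\<forall>i<k. (\<Sum>j=0..<k. A i j * u j) = 0)"
    by (intro exI[of _ "\<lambda>i. v $ i"]) auto
next
  let ?A = "mat k k (\<lambda>(i, j). A i j)"
  assume "\<exists>u. (\<exists>i<k. u i \<noteq> 0) \<and> (\<forall>i<k. (\<Sum>j=0..<k. A i j * u j) = 0)"
  then obtain u i where u: "i < k" "u i \<noteq> 0" "\<And>i. i < k \<Longrightarrow> (\<Sum>j=0..<k. A i j * u j) = 0" by auto
  let ?v = "vec k u"
  have "?v \<noteq> 0\<^sub>v k" using u(1,2) by (auto simp: vec_eq_iff)
  moreover have "?A *\<^sub>v ?v = 0\<^sub>v k" using u(3) by (auto intro!: eq_vecI simp: scalar_prod_def)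
  ultimately show "fdet k A = 0"
    unfolding fdet_def by (intro iffD2[OF det_0_iff_vec_prod_zero_field[of _ k]] exI[of _ ?v] conjI) auto
qed

lemma fdet_zero_row:
  assumes "i < k" "\<And>j. j < k \<Longrightarrow> A i j = 0"
  shows "fdet k A = 0"
proof -
  have "(\<Prod>i=0..<k. A i (p i)) = 0" if "p permutes {0..<k}" for p
    using assms permutes_lt[OF that assms(1)] by (intro prod_zero bexI[of _ i]) auto
  thus ?thesis by (simp add: fdet_leibniz)
qed

lemma pfaff_cong:
  assumes "\<And>i j. i < 2*n \<Longrightarrow> j < 2*n \<Longrightarrow> A i j = B i j"
  shows "pfaff n A = pfaff n B"
proof -
  have "(\<Prod>i=0..<n. A (p i) (p (n + i))) = (\<Prod>i=0..<n. B (p i) (p (n + i)))" if "p permutes {0..<2*n}" for p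
    by (rule prod.cong[OF refl], rule assms) (use permutes_lt[OF that] in auto)
  thus ?thesis unfolding pfaff_def by (intro sum.cong refl) auto
qed

definition bilin_form :: "nat \<Rightarrow> (nat \<Rightarrow> nat \<Rightarrow> 'a) \<Rightarrow> (nat \<Rightarrow> 'a) \<Rightarrow> (nat \<Rightarrow> 'a) \<Rightarrow> 'a :: comm_ring_1" where
  "bilin_form N D u v = (\<Sum>a=0..<N. \<Sum>b=0..<N. u a * D a b * v b)"

context
  fixes N :: nat and D :: "nat \<Rightarrow> nat \<Rightarrow> 'a :: field_char_0"
  assumes alt: "\<And>i j. i < N \<Longrightarrow> j < N \<Longrightarrow> D i j = - D j i"
    and nd: "fdet N D \<noteq> 0"
begin

abbreviation "bform \<equiv> bilin_form N D"

lemmas bform_def = bilin_form_def[of N D]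

lemma bform_skew: "bform u v = - bform v u"
proof -
  have "bform u v = (\<Sum>a=0..<N. \<Sum>b=0..<N. - (v b * D b a * u a))"
    unfolding bform_def
  proof (intro sum.cong refl)
    fix a b assume "a \<in> {0..<N}" "b \<in> {0..<N}"
    hence "D a b = - D b a" by (intro alt) simp_all
    thus "u a * D a b * v b = - (v b * D b a * u a)" by (simp only: mult_minus_left mult_minus_right mult_ac)
  qed
  also have "\<dots> = - bform v u" unfolding bform_def by (subst sum.swap) (simp add: sum_negf)
  finally show ?thesis .
qed

lemma bform_self: "bform u u = 0"
proof -
  have "bform u u + bform u u = 0" using bform_skew[of u u] by (metis add.left_inverse)
  hence "2 * bform u u = 0" by simp
  thus ?thesis by (simp only: mult_eq_0_iff) simp
qed

lemma bform_lin:
  "bform u (\<lambda>a. v a - w a) = bform u v - bform u w"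
  "bform u (\<lambda>a. c * v a) = c * bform u v"
  "bform u (\<lambda>a. \<Sum>i<m. f i a) = (\<Sum>i<(m :: nat). bform u (f i))"
proof -
  show "bform u (\<lambda>a. v a - w a) = bform u v - bform u w"
    by (simp add: bform_def algebra_simps sum_subtractf)
  show "bform u (\<lambda>a. c * v a) = c * bform u v"
    by (simp add: bform_def sum_distrib_left mult_ac)
  have "bform u (\<lambda>a. \<Sum>i<m. f i a) = (\<Sum>a=0..<N. \<Sum>b=0..<N. \<Sum>i<m. u a * D a b * f i b)"
    by (simp add: bform_def sum_distrib_left)
  also have "\<dots> = (\<Sum>a=0..<N. \<Sum>i<m. \<Sum>b=0..<N. u a * D a b * f i b)"
    by (rule sum.cong[OF refl]) (rule sum.swap)
  also have "\<dots> = (\<Sum>i<m. bform u (f i))" unfolding bform_def by (rule sum.swap)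
  finally show "bform u (\<lambda>a. \<Sum>i<m. f i a) = (\<Sum>i<m. bform u (f i))" .
qed

lemma bform_orthogonal_exists:
  assumes "2 * m < N"
  shows "\<exists>u. (\<exists>a<N. u a \<noteq> 0) \<and> (\<forall>i<2*m. bform (s i) u = 0)"
proof -
  \<comment> \<open>The 2m < N linear conditions are padded by zero rows to a square system, which
    is therefore singular.\<close>
  define A where "A i b = (if i < 2*m then \<Sum>a=0..<N. s i a * D a b else 0)" for i b
  have "fdet N A = 0" by (rule fdet_zero_row[of "N - 1"]) (use assms in \<open>auto simp: A_def\<close>)
  then obtain u where u: "\<exists>i<N. u i \<noteq> 0" "\<And>i. i < N \<Longrightarrow> (\<Sum>j=0..<N. A i j * u j) = 0"
    by (auto simp: fdet_eq_0_iff)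
  have "bform (s i) u = 0" if "i < 2*m" for i
  proof -
    have "bform (s i) u = (\<Sum>b=0..<N. \<Sum>a=0..<N. s i a * D a b * u b)"
      unfolding bform_def by (rule sum.swap)
    also have "\<dots> = (\<Sum>b=0..<N. A i b * u b)" using that by (simp add: A_def sum_distrib_right)
    finally show ?thesis using u(2)[of i] that assms by simp
  qed
  thus ?thesis using u(1) by blast
qed

lemma bform_partner_exists:
  assumes "a < N" "u a \<noteq> 0"
  shows "\<exists>v. bform u v = 1"
proof -
  have "fdet N (\<lambda>i j. D j i) \<noteq> 0" using nd fdet_transpose[of N D] by metis
  then obtain b where b: "b < N" "(\<Sum>a=0..<N. D a b * u a) \<noteq> 0"
    using assms unfolding fdet_eq_0_iff by blast
  let ?c = "\<Sum>a=0..<N. D a b * u a"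
  \<comment> \<open>The witness is the b-th standard basis vector, scaled by the inverse of its
    pairing with u.\<close>
  have "bform u (\<lambda>j. if j = b then 1 / ?c else 0) = (\<Sum>a=0..<N. \<Sum>j=0..<N. if j = b then u a * D a b * (1 / ?c) else 0)"
    unfolding bform_def by (intro sum.cong refl) auto
  also have "\<dots> = (\<Sum>a=0..<N. u a * D a b * (1 / ?c))" using b(1) by (simp add: sum.delta)
  also have "\<dots> = ?c * (1 / ?c)" unfolding sum_distrib_right by (intro sum.cong refl) simp
  finally show ?thesis using b(2) by (intro exI) simp
qed

text \<open>Symplectic Gram-Schmidt: take a nonzero u orthogonal to the family so far and a v that
  pairs to 1 with u, then correct v to be orthogonal to the family without changing its pairing with
  u.\<close>

lemma symplectic_family:
  "2 * m \<le> N \<Longrightarrow> \<exists>x y. \<forall>i<m. \<forall>j<m. bform (x i) (x j) = 0 \<and> bform (y i) (y j) = 0 \<and>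
     bform (x i) (y j) = (if i = j then 1 else 0)"
proof (induction m)
  case (Suc m)
  then obtain x y where xy: "\<And>i j. i < m \<Longrightarrow> j < m \<Longrightarrow> bform (x i) (x j) = 0"
      "\<And>i j. i < m \<Longrightarrow> j < m \<Longrightarrow> bform (y i) (y j) = 0"
      "\<And>i j. i < m \<Longrightarrow> j < m \<Longrightarrow> bform (x i) (y j) = (if i = j then 1 else 0)" by auto
  obtain u a where u: "a < N" "u a \<noteq> 0" "\<And>i. i < 2*m \<Longrightarrow> bform ((\<lambda>i. if i < m then x i else y (i - m)) i) u = 0"
    using bform_orthogonal_exists[of m "\<lambda>i. if i < m then x i else y (i - m)"] Suc.prems by auto
  have ux: "bform (x i) u = 0" "bform (y i) u = 0" if "i < m" for i
    using u(3)[of i] u(3)[of "m + i"] that by auto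
  obtain v where v: "bform u v = 1" using bform_partner_exists[of a u, OF u(1,2)] by blast
  \<comment> \<open>The two terms have opposite signs because the pairing of y_j with x_j is
    -1.\<close>
  define v' where "v' a = v a - (\<Sum>j<m. bform (x j) v * y j a - bform (y j) v * x j a)" for a
  have bv: "bform w v' = bform w v - (\<Sum>j<m. bform (x j) v * bform w (y j) - bform (y j) v * bform w (x j))" for w
    unfolding v'_def[abs_def] by (simp add: bform_lin)
  have yx: "bform (y i) (x j) = (if i = j then -1 else 0)" if "i < m" "j < m" for i j
    using bform_skew[of "y i" "x j"] xy(3)[OF that(2,1)] by auto
  have d: "(\<Sum>j<m. if i = j then f j else 0) = f i" if "i < m" for i and f :: "nat \<Rightarrow> 'a"
    using that by (subst sum.delta') auto
  have xv: "bform (x i) v' = 0" if "i < m" for i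
  proof -
    have "(\<Sum>j<m. bform (x j) v * bform (x i) (y j) - bform (y j) v * bform (x i) (x j))
        = (\<Sum>j<m. if i = j then bform (x j) v else 0)"
      using that xy by (intro sum.cong refl) auto
    thus ?thesis using d[OF that] by (simp add: bv)
  qed
  have yv: "bform (y i) v' = 0" if "i < m" for i
  proof -
    have "(\<Sum>j<m. bform (x j) v * bform (y i) (y j) - bform (y j) v * bform (y i) (x j))
        = (\<Sum>j<m. if i = j then bform (y j) v else 0)"
      using that xy yx by (intro sum.cong refl) auto
    thus ?thesis using d[OF that] by (simp add: bv)
  qed
  have r1: "bform u (x i) = 0" "bform u (y i) = 0" if "i < m" for i
    using ux[OF that] bform_skew[of u "x i"] bform_skew[of u "y i"] by simp_all
  have uv: "bform u v' = 1"
  proof -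
    have "(\<Sum>j<m. bform (x j) v * bform u (y j) - bform (y j) v * bform u (x j)) = 0"
      using r1 by (intro sum.neutral) auto
    thus ?thesis using v by (simp add: bv)
  qed
  have r: "bform v' (x i) = 0" "bform v' (y i) = 0" if "i < m" for i
    using xv[OF that] yv[OF that] bform_skew[of v' "x i"] bform_skew[of v' "y i"] by simp_all
  show ?case
    by (rule exI[of _ "x(m := u)"], rule exI[of _ "y(m := v')"])
      (use xy ux xv yv uv r1 r bform_self in \<open>auto simp: less_Suc_eq\<close>)
qed simp

end

text \<open>In a symplectic basis \<open>D\<close> becomes the standard matrix, and by
  \<open>pfaff_congruence\<close> a vanishing Pfaffian of \<open>D\<close> would make the standard
  one vanish.\<close>

lemma pfaff_alternating_nonzero:
  fixes D :: "nat \<Rightarrow> nat \<Rightarrow> 'a :: field_char_0"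
  assumes alt: "\<And>i j. i < 2*n \<Longrightarrow> j < 2*n \<Longrightarrow> D i j = - D j i" and nd: "fdet (2*n) D \<noteq> 0"
  shows "pfaff n D \<noteq> 0"
proof
  assume 0: "pfaff n D = 0"
  let ?b = "bilin_form (2*n) D"
  obtain x y where xy: "\<And>i j. i < n \<Longrightarrow> j < n \<Longrightarrow> ?b (x i) (x j) = 0"
      "\<And>i j. i < n \<Longrightarrow> j < n \<Longrightarrow> ?b (y i) (y j) = 0"
      "\<And>i j. i < n \<Longrightarrow> j < n \<Longrightarrow> ?b (x i) (y j) = (if i = j then 1 else 0)"
    using symplectic_family[of "2*n" D n, OF alt nd] by auto
  have yx: "?b (y i) (x j) = (if i = j then -1 else 0)" if "i < n" "j < n" for i j
    using bform_skew[of "2*n" D "y i" "x j", OF alt nd] xy(3)[OF that(2,1)] by auto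
  define P where "P a i = (if i < n then x i a else y (i - n) a)" for a i
  have P: "(\<lambda>a. P a i) = (if i < n then x i else y (i - n))" for i by (auto simp: P_def)
  have "pfaff n (\<lambda>i j. \<Sum>a=0..<2*n. \<Sum>b=0..<2*n. P a i * D a b * P b j) = pfaff n (std_sympl n)"
  proof (rule pfaff_cong)
    fix i j assume ij: "i < 2*n" "j < 2*n"
    have "(\<Sum>a=0..<2*n. \<Sum>b=0..<2*n. P a i * D a b * P b j) = ?b (\<lambda>a. P a i) (\<lambda>a. P a j)"
      by (simp add: bilin_form_def)
    also have "\<dots> = std_sympl n i j"
      unfolding P using ij xy yx by (auto simp: std_sympl_def)
    finally show "(\<Sum>a=0..<2*n. \<Sum>b=0..<2*n. P a i * D a b * P b j) = std_sympl n i j" .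
  qed
  thus False using 0 pfaff_std_sympl_nonzero[of n, where 'a = 'a] by (simp add: pfaff_congruence)
qed

section \<open>The determinant identity for an isotropic graph, and ranks over a commutative
  ring\<close>

subsection \<open>Block matrices over a commutative ring\<close>

text \<open>The identity block is split off one row and column at a time.\<close>

lemma det_block_one_right:
  fixes A :: "'a :: comm_ring_1 mat"
  assumes A: "A \<in> carrier_mat n n"
  shows "det (four_block_mat A (0\<^sub>m n m) (0\<^sub>m m n) (1\<^sub>m m)) = det A"
proof (induction m)
  case 0
  have "four_block_mat A (0\<^sub>m n 0) (0\<^sub>m 0 n) (1\<^sub>m 0) = A" using A by (intro eq_matI) auto
  thus ?case by simp
next
  case (Suc m)
  let ?B = "four_block_mat A (0\<^sub>m n m) (0\<^sub>m m n) (1\<^sub>m m)"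
  have B: "?B \<in> carrier_mat (n + m) (n + m)" using A by (intro four_block_carrier_mat) auto
  have "four_block_mat A (0\<^sub>m n (Suc m)) (0\<^sub>m (Suc m) n) (1\<^sub>m (Suc m))
      = four_block_mat ?B (0\<^sub>m (n + m) 1) (0\<^sub>m 1 (n + m)) (1\<^sub>m 1)"
    using A by (intro eq_matI) auto
  also have "det \<dots> = det ?B * det (1\<^sub>m 1 :: 'a mat)"
    by (rule det_four_block_mat_upper_right_zero_col[OF B]) auto
  finally show ?case using Suc by simp
qed

lemma det_block_one_left:
  fixes K :: "'a :: comm_ring_1 mat"
  assumes K: "K \<in> carrier_mat m m"
  shows "det (four_block_mat (1\<^sub>m n) (0\<^sub>m n m) (0\<^sub>m m n) K) = det K"
proof (induction n)
  case 0
  have "four_block_mat (1\<^sub>m 0) (0\<^sub>m 0 m) (0\<^sub>m m 0) K = K" using K by (intro eq_matI) auto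
  thus ?case by simp
next
  case (Suc n)
  let ?B = "four_block_mat (1\<^sub>m n) (0\<^sub>m n m) (0\<^sub>m m n) K"
  have B: "?B \<in> carrier_mat (n + m) (n + m)" using K by (intro four_block_carrier_mat) auto
  have "four_block_mat (1\<^sub>m (Suc n)) (0\<^sub>m (Suc n) m) (0\<^sub>m m (Suc n)) K
      = four_block_mat (1\<^sub>m 1) (0\<^sub>m 1 (n + m)) (0\<^sub>m (n + m) 1) ?B"
    using K by (intro eq_matI) auto
  also have "det \<dots> = det (1\<^sub>m 1 :: 'a mat) * det ?B"
    by (rule det_four_block_mat_lower_left_zero_col[OF _ _ _ B]) auto
  finally show ?case using Suc by simp
qed

text \<open>As A is invertible, the matrix is the product of a unipotent lower triangular matrix
  with lower left block \<open>C * Ai\<close>, of diag(A, 1) and of diag(1, K).\<close>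

lemma det_block_lower_triangular:
  fixes A C K Ai :: "'a :: comm_ring_1 mat"
  assumes c: "A \<in> carrier_mat n n" "C \<in> carrier_mat n n" "K \<in> carrier_mat n n" "Ai \<in> carrier_mat n n"
    and inv: "Ai * A = 1\<^sub>m n"
  shows "det (four_block_mat A (0\<^sub>m n n) C K) = det A * det K"
proof -
  let ?O = "0\<^sub>m n n :: 'a mat" and ?I = "1\<^sub>m n :: 'a mat"
  let ?L = "four_block_mat ?I ?O (C * Ai) ?I" and ?M = "four_block_mat A ?O ?O ?I" and ?N = "four_block_mat ?I ?O ?O K"
  have CA: "C * Ai \<in> carrier_mat n n" using c by auto
  have d: "?L \<in> carrier_mat (n + n) (n + n)" "?M \<in> carrier_mat (n + n) (n + n)" "?N \<in> carrier_mat (n + n) (n + n)"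
    using c by (auto intro!: four_block_carrier_mat)
  have "C * Ai * A = C" using c inv by (simp add: assoc_mult_mat[of C n n Ai n A n])
  hence "?L * ?M = four_block_mat A ?O C ?I"
    using c CA by (subst mult_four_block_mat[of _ n n _ n _ n]) auto
  also have "\<dots> * ?N = four_block_mat A ?O C K"
    using c by (subst mult_four_block_mat[of _ n n _ n _ n]) auto
  finally have "four_block_mat A ?O C K = ?L * ?M * ?N" by simp
  hence "det (four_block_mat A ?O C K) = det ?L * det ?M * det ?N"
    using d by (simp add: det_mult[of _ "n + n"])
  moreover have "det ?L = prod_list (diag_mat ?L)"
    by (rule det_lower_triangular[OF _ d(1)]) (use c CA in auto)
  moreover have "diag_mat ?L = map (\<lambda>_. 1) [0..<n + n]" using CA by (auto simp: diag_mat_def)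
  hence "prod_list (diag_mat ?L) = 1" by (simp add: map_replicate_const)
  ultimately show ?thesis using det_block_one_right[OF c(1)] det_block_one_left[OF c(3)] by simp
qed

text \<open>Let \<open>F\<close> be spanned by the second half of the target basis.  The matrix \<open>\<phi> = A\<^sub>1\<^sup>-\<^sup>1 A\<^sub>2\<close> describes \<open>F\<close> as the
  graph \<open>x - \<phi> x\<close>, and \<open>K\<close> gives the coordinates of \<open>x - \<phi> x\<close> in \<open>F\<close>.  Pairing \<open>x - \<phi> x\<close> with the first
  half of the source basis in both bases compares \<open>K\<close> with \<open>\<phi>\<close>.\<close>

lemma det_isotropic_graph:
  fixes A1 A2 C1 C2 X Y Y' D1 Ai :: "'a :: comm_ring_1 mat"
  assumes c: "A1 \<in> carrier_mat n n" "A2 \<in> carrier_mat n n" "C1 \<in> carrier_mat n n" "C2 \<in> carrier_mat n n"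
      "X \<in> carrier_mat n n" "Y \<in> carrier_mat n n" "Y' \<in> carrier_mat n n" "D1 \<in> carrier_mat n n" "Ai \<in> carrier_mat n n"
    and inv: "A1 * Ai = 1\<^sub>m n" "Ai * A1 = 1\<^sub>m n"
    and e11: "(A1\<^sup>T * X + C1\<^sup>T * Y') * A1 + A1\<^sup>T * Y * C1 = lam \<cdot>\<^sub>m D1"
    and e21: "(A2\<^sup>T * X + C2\<^sup>T * Y') * A1 + A2\<^sup>T * Y * C1 = 0\<^sub>m n n"
  shows "det (four_block_mat A1 A2 C1 C2) * det Y' = (- lam) ^ n * det (Ai * A2) * det D1"
proof -
  let ?O = "0\<^sub>m n n :: 'a mat" and ?I = "1\<^sub>m n :: 'a mat"
  define f where "f = Ai * A2"
  define K where "K = C2 - C1 * f"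
  have f: "f \<in> carrier_mat n n" and K: "K \<in> carrier_mat n n" using c by (auto simp: f_def K_def)
  have A1f: "A1 * f = A2" unfolding f_def using c inv(1) assoc_mult_mat[of A1 n n Ai n A2 n] by simp
  \<comment> \<open>Multiplying by this unipotent matrix replaces each second-half source vector x
    by x - \<phi> x, where \<phi> is \<open>f\<close>. The image lies in F, hence the zero in the
    upper right block and K in the lower right one.\<close>
  let ?T = "four_block_mat ?I (- f) ?O ?I" and ?P = "four_block_mat A1 A2 C1 C2"
  have d: "?T \<in> carrier_mat (n + n) (n + n)" "?P \<in> carrier_mat (n + n) (n + n)"
    using c f by (auto intro!: four_block_carrier_mat)
  have neg: "A1 * - f = - A2" "C1 * - f = - (C1 * f)"
    using c f A1f by (auto simp: uminus_mult_right_mat)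
  have z: "- A2 + A2 = ?O" "- (C1 * f) + C2 = K"
    using c f by (auto intro!: eq_matI simp: K_def)
  have b: "A1 * ?I + A2 * ?O = A1" "A1 * - f + A2 * ?I = ?O" "C1 * ?I + C2 * ?O = C1" "C1 * - f + C2 * ?I = K"
    unfolding neg using z c(1-4) by simp_all
  have mf: "- f \<in> carrier_mat n n" using f by simp
  have PT: "?P * ?T = four_block_mat A1 ?O C1 K"
    unfolding mult_four_block_mat[OF c(1-4) one_carrier_mat mf zero_carrier_mat one_carrier_mat] b ..
  have "det ?T = prod_list (diag_mat ?T)"
    by (rule det_upper_triangular[OF _ d(1)]) (use f in \<open>auto simp: upper_triangular_def\<close>)
  moreover have "diag_mat ?T = map (\<lambda>_. 1) [0..<n + n]" using f by (auto simp: diag_mat_def)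
  ultimately have "det ?T = 1" by (simp add: map_replicate_const)
  hence "det ?P = det (?P * ?T)" using det_mult[OF d(2,1)] by simp
  hence detP: "det ?P = det A1 * det K"
    unfolding PT using det_block_lower_triangular[OF c(1,3) K c(9) inv(2)] by simp
  have fT: "f\<^sup>T * A1\<^sup>T = A2\<^sup>T" using transpose_mult[OF c(1) f] A1f by simp
  \<comment> \<open>Left multiplication of \<open>e11\<close> by the transpose of \<open>f\<close>
    turns the transpose of \<open>A1\<close> into that of \<open>A2\<close> in the terms with X and
    Y. These cancel when the result is subtracted from \<open>e21\<close>, and the terms with Y'
    combine to K.\<close>
  have main: "K\<^sup>T * Y' * A1 = - lam \<cdot>\<^sub>m (f\<^sup>T * D1)"
  proof -
    let ?S = "A2\<^sup>T * X * A1 + A2\<^sup>T * Y * C1" and ?U2 = "C2\<^sup>T * Y' * A1" and ?U1 = "f\<^sup>T * (C1\<^sup>T * Y' * A1)"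
    note t = transpose_carrier_mat
    have tc: "A1\<^sup>T \<in> carrier_mat n n" "A2\<^sup>T \<in> carrier_mat n n" "C1\<^sup>T \<in> carrier_mat n n" "C2\<^sup>T \<in> carrier_mat n n"
      "f\<^sup>T \<in> carrier_mat n n" using c f by auto
    note mc = mult_carrier_mat[of _ n n _ n]
    have U: "?U1 \<in> carrier_mat n n" "?U2 \<in> carrier_mat n n" "?S \<in> carrier_mat n n"
      using c tc by (auto intro!: mc)
    have KT: "K\<^sup>T = C2\<^sup>T - f\<^sup>T * C1\<^sup>T"
      unfolding K_def using c f by (subst transpose_minus[of _ n n]) (auto simp: transpose_mult[OF c(3) f])
    have "K\<^sup>T * Y' * A1 = (C2\<^sup>T * Y' - f\<^sup>T * C1\<^sup>T * Y') * A1"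
      unfolding KT using c tc by (subst minus_mult_distrib_mat[of _ n n]) (auto intro!: mc)
    also have "\<dots> = ?U2 - f\<^sup>T * C1\<^sup>T * Y' * A1"
      using c tc by (subst minus_mult_distrib_mat[of _ n n]) (auto intro!: mc)
    also have "f\<^sup>T * C1\<^sup>T * Y' * A1 = ?U1"
      using c tc by (simp add: assoc_mult_mat[of _ n n _ n _ n] mc)
    finally have KY: "K\<^sup>T * Y' * A1 = ?U2 - ?U1" .
    have "(A2\<^sup>T * X + C2\<^sup>T * Y') * A1 + A2\<^sup>T * Y * C1 = A2\<^sup>T * X * A1 + ?U2 + A2\<^sup>T * Y * C1"
      using c tc by (subst add_mult_distrib_mat[of _ n n]) (auto intro!: mc)
    hence e2: "A2\<^sup>T * X * A1 + ?U2 + A2\<^sup>T * Y * C1 = ?O" using e21 by simp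
    have "f\<^sup>T * ((A1\<^sup>T * X + C1\<^sup>T * Y') * A1 + A1\<^sup>T * Y * C1)
        = f\<^sup>T * (A1\<^sup>T * X * A1 + C1\<^sup>T * Y' * A1 + A1\<^sup>T * Y * C1)"
      using c tc by (subst add_mult_distrib_mat[of _ n n]) (auto intro!: mc)
    also have "\<dots> = f\<^sup>T * (A1\<^sup>T * X * A1) + ?U1 + f\<^sup>T * (A1\<^sup>T * Y * C1)"
      using c tc by (simp add: mult_add_distrib_mat[of _ n n _ n] mc)
    also have "f\<^sup>T * (A1\<^sup>T * X * A1) = A2\<^sup>T * X * A1"
      using c tc by (simp add: fT[symmetric] assoc_mult_mat[of _ n n _ n _ n] mc)
    also have "f\<^sup>T * (A1\<^sup>T * Y * C1) = A2\<^sup>T * Y * C1"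
      using c tc by (simp add: fT[symmetric] assoc_mult_mat[of _ n n _ n _ n] mc)
    finally have e1: "A2\<^sup>T * X * A1 + ?U1 + A2\<^sup>T * Y * C1 = lam \<cdot>\<^sub>m (f\<^sup>T * D1)"
      unfolding e11 using tc c by (simp add: mult_smult_distrib[of _ n n _ n])
    show ?thesis
    proof (rule eq_matI)
      fix i j assume "i < dim_row (- lam \<cdot>\<^sub>m (f\<^sup>T * D1))" "j < dim_col (- lam \<cdot>\<^sub>m (f\<^sup>T * D1))"
      hence ij: "i < n" "j < n" using tc c by auto
      have p: "A2\<^sup>T * X * A1 \<in> carrier_mat n n" "A2\<^sup>T * Y * C1 \<in> carrier_mat n n" "f\<^sup>T * D1 \<in> carrier_mat n n"
        using c tc by (auto intro!: mc)
      have ix: "(P + U + Q) $$ (i, j) = P $$ (i, j) + U $$ (i, j) + Q $$ (i, j)"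
        if "P \<in> carrier_mat n n" "Q \<in> carrier_mat n n" "U \<in> carrier_mat n n" for P Q U :: "'a mat"
        using that ij by simp
      have "(A2\<^sup>T * X * A1) $$ (i, j) + ?U2 $$ (i, j) + (A2\<^sup>T * Y * C1) $$ (i, j) = 0"
        using arg_cong[OF e2, of "\<lambda>M. M $$ (i, j)"] ix[OF p(1,2) U(2)] ij by simp
      moreover have "(A2\<^sup>T * X * A1) $$ (i, j) + ?U1 $$ (i, j) + (A2\<^sup>T * Y * C1) $$ (i, j) = lam * (f\<^sup>T * D1) $$ (i, j)"
        using arg_cong[OF e1, of "\<lambda>M. M $$ (i, j)"] ix[OF p(1,2) U(1)] index_smult_mat(1)[of i "f\<^sup>T * D1" j lam] ij p(3)
        by (metis carrier_matD)
      moreover have diff: "u - v = - w" if "x + u + y = 0" "x + v + y = w" for x u y v w :: 'a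
      proof -
        have "u - v = (x + u + y) - (x + v + y)" by simp
        thus ?thesis unfolding that by simp
      qed
      ultimately have "?U2 $$ (i, j) - ?U1 $$ (i, j) = - lam * (f\<^sup>T * D1) $$ (i, j)"
        using diff[of "(A2\<^sup>T * X * A1) $$ (i, j)" "?U2 $$ (i, j)" "(A2\<^sup>T * Y * C1) $$ (i, j)" "?U1 $$ (i, j)"] by simp
      moreover have "(?U2 - ?U1) $$ (i, j) = ?U2 $$ (i, j) - ?U1 $$ (i, j)" using U ij by (metis carrier_matD index_minus_mat(1))
      moreover have "(- lam \<cdot>\<^sub>m (f\<^sup>T * D1)) $$ (i, j) = - lam * (f\<^sup>T * D1) $$ (i, j)"
        using p(3) ij by (metis carrier_matD index_smult_mat(1))
      ultimately show "(K\<^sup>T * Y' * A1) $$ (i, j) = (- lam \<cdot>\<^sub>m (f\<^sup>T * D1)) $$ (i, j)" unfolding KY by simp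
    qed (use K tc c in auto)
  qed
  \<comment> \<open>Here det K and det \<open>A1\<close> appear exactly as in det P, so neither has
    to be divided out.\<close>
  have "det (K\<^sup>T * Y' * A1) = det K * det Y' * det A1"
    using K c by (simp add: det_mult[of _ n] det_transpose[of _ n])
  moreover have "det (- lam \<cdot>\<^sub>m (f\<^sup>T * D1)) = (- lam) ^ n * (det f * det D1)"
    using f c by (simp add: det_mult[of _ n] det_transpose[of _ n])
  ultimately show ?thesis unfolding detP main f_def[symmetric] by (simp add: mult_ac)
qed

text \<open>The traces of A Q and Q A agree and equal s and p. The argument needs characteristic
  zero but no field, so it applies over E \<otimes> \<complex>.\<close>

lemma rank_eq_of_inverse:
  fixes A Q :: "nat \<Rightarrow> nat \<Rightarrow> 'a :: {comm_ring_1, ring_char_0}"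
  assumes "\<And>i. i < s \<Longrightarrow> (\<Sum>j<p. A i j * Q j i) = 1" "\<And>j. j < p \<Longrightarrow> (\<Sum>i<s. Q j i * A i j) = 1"
  shows "s = p"
proof -
  have "(of_nat s :: 'a) = (\<Sum>i<s. \<Sum>j<p. A i j * Q j i)" using assms(1) by simp
  also have "\<dots> = (\<Sum>j<p. \<Sum>i<s. Q j i * A i j)" by (subst sum.swap) (simp add: mult.commute)
  also have "\<dots> = of_nat p" using assms(2) by simp
  finally show ?thesis by simp
qed

text \<open>The matrix of the inverse map is a two-sided inverse of that of \<open>f\<close>; this
  forces equal ranks, after which square matrices can be formed.\<close>

lemma frame_iso:
  fixes f :: "'a cx \<Rightarrow> 'b cx"
  assumes U: "frame U r b c" and V: "frame V s d e"
    and f: "f \<in> lin_hom (cxR U) (cxR V)" and bij: "bij_betw f (carrier (cxR U)) (carrier (cxR V))"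
  defines "A \<equiv> \<lambda>i j. coord (e i) (f (cx_elt U (b j) 1))"
  shows "r = s" and "\<exists>Q. mat s s (\<lambda>(i, j). A i j) * Q = 1\<^sub>m s \<and> Q * mat s s (\<lambda>(i, j). A i j) = 1\<^sub>m s \<and> Q \<in> carrier_mat s s"
proof -
  interpret U: framed U r b c by standard fact
  interpret V: framed V s d e by standard fact
  define g where "g = the_inv_into (carrier (cxR U)) f"
  have gf: "g (f X) = X" if "X \<in> carrier (cxR U)" for X
    unfolding g_def using bij that by (simp add: bij_betw_def the_inv_into_f_f)
  have fg: "f (g Y) = Y" if "Y \<in> carrier (cxR V)" for Y
    unfolding g_def using bij that by (simp add: bij_betw_def f_the_inv_into_f)
  have gc: "g Y \<in> carrier (cxR U)" if "Y \<in> carrier (cxR V)" for Y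
    unfolding g_def using bij that by (auto simp: bij_betw_def intro!: the_inv_into_into)
  have fc: "f X \<in> carrier (cxR V)" if "X \<in> carrier (cxR U)" for X using lin_hom_closed[OF f that] .
  have g: "g \<in> lin_hom (cxR V) (cxR U)"
  proof (rule lin_homI)
    fix X Y assume "X \<in> carrier (cxR V)" "Y \<in> carrier (cxR V)"
    thus "g (X \<oplus>\<^bsub>cxR V\<^esub> Y) = g X \<oplus>\<^bsub>cxR U\<^esub> g Y"
      using lin_hom_add[OF f gc gc, of X Y] gf[OF U.C.add_closed[OF gc gc], of X Y] fg by simp
  next
    fix k X assume "X \<in> carrier (cxR V)"
    thus "g (k \<odot>\<^bsub>cxR V\<^esub> X) = k \<odot>\<^bsub>cxR U\<^esub> g X"
      using lin_hom_smult[OF f gc, of X k] gf[OF U.C.smult_closed[OF gc], of X k] fg by simp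
  qed (rule gc)
  define Q where "Q j i = coord (c j) (g (cx_elt V (d i) 1))" for j i
  have AQ: "(\<Sum>j<r. A i j * Q j i') = (if i = i' then 1 else 0)" if i: "i < s" "i' < s" for i i'
  proof -
    have h: "(\<lambda>X. coord (e i) (f X)) \<in> lin_hom (cxR U) self_mod"
      by (rule lin_hom_comp[OF f coord_hom[OF V.V V.c_hom[OF i(1)]]])
    have "(\<Sum>j<r. Q j i' * A i j) = coord (e i) (f (g (V.e i')))"
      using U.hom_expand[OF rmod_self h gc, of "V.e i'"] i by (simp add: A_def Q_def)
    thus ?thesis using i fg V.coord_e by (simp add: mult.commute)
  qed
  have QA: "(\<Sum>i<s. Q j i * A i j') = (if j = j' then 1 else 0)" if j: "j < r" "j' < r" for j j'
  proof -
    have h: "(\<lambda>X. coord (c j) (g X)) \<in> lin_hom (cxR V) self_mod"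
      by (rule lin_hom_comp[OF g coord_hom[OF U.V U.c_hom[OF j(1)]]])
    have "(\<Sum>i<s. A i j' * Q j i) = coord (c j) (g (f (U.e j')))"
      using V.hom_expand[OF rmod_self h fc, of "U.e j'"] j by (simp add: A_def Q_def)
    thus ?thesis using j gf U.coord_e by (simp add: mult.commute)
  qed
  show rs: "r = s" by (rule sym, rule rank_eq_of_inverse[where s = s and p = r and A = A and Q = Q]) (use AQ QA in auto)
  show "\<exists>Q. mat s s (\<lambda>(i, j). A i j) * Q = 1\<^sub>m s \<and> Q * mat s s (\<lambda>(i, j). A i j) = 1\<^sub>m s \<and> Q \<in> carrier_mat s s"
    using AQ QA unfolding rs
    by (intro exI[of _ "mat s s (\<lambda>(i, j). Q i j)"])
      (auto intro!: eq_matI simp: scalar_prod_def lessThan_atLeast0)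
qed

section \<open>Existence of bases, and bases adapted to a subspace and its quotient\<close>

section \<open>Frames and bases\<close>

lemma frameI:
  assumes "lin_space V" "\<And>i. i < r \<Longrightarrow> b i \<in> carrier V" "\<And>i. i < r \<Longrightarrow> c i \<in> lin_hom V scalar_mod"
    "\<And>i j. i < r \<Longrightarrow> j < r \<Longrightarrow> c i (b j) = (if i = j then 1 else 0)"
    "\<And>x. x \<in> carrier V \<Longrightarrow> (\<And>i. i < r \<Longrightarrow> c i x = 0) \<Longrightarrow> x = \<zero>\<^bsub>V\<^esub>"
  shows "frame V r b c"
  using assms by (auto simp: frame_def)

lemma subspaceI:
  fixes V :: "('k :: field, 'v) module"
  assumes "lin_space V" "W \<subseteq> carrier V" "\<zero>\<^bsub>V\<^esub> \<in> W" "\<And>x y. x \<in> W \<Longrightarrow> y \<in> W \<Longrightarrow> x \<oplus>\<^bsub>V\<^esub> y \<in> W"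
    "\<And>c x. x \<in> W \<Longrightarrow> c \<odot>\<^bsub>V\<^esub> x \<in> W"
  shows "VectorSpace.subspace class_ring W V"
proof -
  interpret V: lin_space V by fact
  have "submodule class_ring W V"
    using assms by unfold_locales (auto simp: class_ring_simps)
  thus ?thesis using V.vs by (simp add: subspace_def)
qed

lemma lin_space_subspace:
  assumes "VectorSpace.subspace class_ring W V"
  shows "lin_space (V\<lparr>carrier := W\<rparr>)"
  using assms vectorspace.subspace_is_vs[of class_ring V W] by (auto simp: subspace_def intro: lin_space.intro)

lemma subspace_incl_hom: "W \<subseteq> carrier V \<Longrightarrow> (\<lambda>x. x) \<in> lin_hom (V\<lparr>carrier := W\<rparr>) V"
  by (rule lin_homI) auto

lemma lin_hom_subspace:
  "f \<in> lin_hom U V \<Longrightarrow> (\<And>x. x \<in> carrier U \<Longrightarrow> f x \<in> W) \<Longrightarrow> f \<in> lin_hom U (V\<lparr>carrier := W\<rparr>)"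
  by (rule lin_homI) (auto simp: lin_hom)

lemma subspace_hom_restrict: "f \<in> lin_hom V N \<Longrightarrow> W \<subseteq> carrier V \<Longrightarrow> f \<in> lin_hom (V\<lparr>carrier := W\<rparr>) N"
  by (rule lin_homI) (auto simp: lin_hom subset_iff)

context lin_space
begin

lemma lincomb_list:
  assumes "distinct bs" "set bs \<subseteq> carrier V"
  shows "M.lincomb a (set bs) = (\<Oplus>\<^bsub>V\<^esub>i\<in>{..<length bs}. a (bs ! i) \<odot>\<^bsub>V\<^esub> bs ! i)"
proof -
  have inj: "inj_on ((!) bs) {..<length bs}" using assms(1) by (simp add: inj_on_nth)
  have im: "(!) bs ` {..<length bs} = set bs" by (auto simp: set_conv_nth)
  have "(\<Oplus>\<^bsub>V\<^esub>v\<in>(!) bs ` {..<length bs}. a v \<odot>\<^bsub>V\<^esub> v) = (\<Oplus>\<^bsub>V\<^esub>i\<in>{..<length bs}. a (bs ! i) \<odot>\<^bsub>V\<^esub> bs ! i)"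
    by (rule M.finsum_reindex[OF _ inj]) (use assms im in \<open>auto simp: subset_iff\<close>)
  thus ?thesis unfolding M.lincomb_def im .
qed

lemma ordered_basis_imp_frame:
  assumes "ordered_basis V bs"
  shows "\<exists>c. frame V (length bs) ((!) bs) c"
proof -
  let ?B = "set bs"
  have d: "distinct bs" and b: "VS.basis ?B" and B: "?B \<subseteq> carrier V"
    using assms by (auto simp: ordered_basis_def VS.basis_def)
  have u: "\<forall>v\<in>carrier V. \<exists>!a. a \<in> ?B \<rightarrow>\<^sub>E UNIV \<and> M.lincomb a ?B = v"
    using VS.basis_criterion[of ?B] b B by (simp add: class_ring_simps)
  \<comment> \<open>The coefficients are taken extensional, so that their uniqueness concerns values
    on the basis only.\<close>
  define co where "co x = (THE a. a \<in> ?B \<rightarrow>\<^sub>E UNIV \<and> M.lincomb a ?B = x)" for x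
  have co: "co x \<in> ?B \<rightarrow>\<^sub>E UNIV" "M.lincomb (co x) ?B = x" if "x \<in> carrier V" for x
    using theI'[OF u[rule_format, OF that]] unfolding co_def by auto
  have uniq: "co (M.lincomb a ?B) v = a v" if "v \<in> ?B" for a v
  proof -
    have l: "M.lincomb a ?B \<in> carrier V" by (rule M.lincomb_closed) (use B in \<open>auto simp: class_ring_simps\<close>)
    have "M.lincomb (restrict a ?B) ?B = M.lincomb a ?B"
      by (rule M.lincomb_cong) (use B in \<open>auto simp: class_ring_simps\<close>)
    moreover have "restrict a ?B \<in> ?B \<rightarrow>\<^sub>E UNIV" by auto
    ultimately have "restrict a ?B = co (M.lincomb a ?B)"
      using u[rule_format, OF l] co[OF l] by (metis (no_types, lifting))
    thus ?thesis using that by (metis restrict_apply')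
  qed
  have cl: "M.lincomb a ?B \<in> carrier V" for a by (rule M.lincomb_closed) (use B in \<open>auto simp: class_ring_simps\<close>)
  show ?thesis
  proof (intro exI frameI)
    show "lin_space V" by (rule lin_space_axioms)
    fix i assume i: "i < length bs"
    hence ib: "bs ! i \<in> ?B" by simp
    show "bs ! i \<in> carrier V" using ib B by auto
    show "(\<lambda>x. co x (bs ! i)) \<in> lin_hom V scalar_mod"
    proof (rule lin_homI)
      fix x y assume xy: "x \<in> carrier V" "y \<in> carrier V"
      have "M.lincomb (\<lambda>v. co x v + co y v) ?B = x \<oplus>\<^bsub>V\<^esub> y"
        using M.lincomb_sum[of ?B "co x" "co y"] B co xy by (simp add: class_ring_simps)
      thus "co (x \<oplus>\<^bsub>V\<^esub> y) (bs ! i) = co x (bs ! i) \<oplus>\<^bsub>scalar_mod\<^esub> co y (bs ! i)"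
        using uniq[OF ib, of "\<lambda>v. co x v + co y v"] by simp
    next
      fix k x assume x: "x \<in> carrier V"
      have "M.lincomb (\<lambda>v. k * co x v) ?B = k \<odot>\<^bsub>V\<^esub> x"
        using M.lincomb_smult[of ?B "co x" k] B co x by (simp add: class_ring_simps)
      thus "co (k \<odot>\<^bsub>V\<^esub> x) (bs ! i) = k \<odot>\<^bsub>scalar_mod\<^esub> co x (bs ! i)"
        using uniq[OF ib, of "\<lambda>v. k * co x v"] by simp
    qed simp
    fix j assume j: "j < length bs"
    have "M.lincomb (\<lambda>v. if v = bs ! j then 1 else 0) ?B = (\<Oplus>\<^bsub>V\<^esub>i\<in>{..<length bs}. if i = j then bs ! j else \<zero>\<^bsub>V\<^esub>)"
      unfolding lincomb_list[OF d B] using d j B nth_eq_iff_index_eq[OF d]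
      by (intro M.finsum_cong') (auto simp: subset_iff)
    also have "\<dots> = bs ! j" using j B M.finsum_singleton[of j "{..<length bs}" "\<lambda>_. bs ! j"]
      by (simp add: subset_iff eq_commute[of _ j])
    finally show "co (bs ! j) (bs ! i) = (if i = j then 1 else 0)"
      using uniq[OF ib, of "\<lambda>v. if v = bs ! j then 1 else 0"] nth_eq_iff_index_eq[OF d i j] by simp
  next
    fix x assume x: "x \<in> carrier V" and 0: "\<And>i. i < length bs \<Longrightarrow> co x (bs ! i) = 0"
    have "x = (\<Oplus>\<^bsub>V\<^esub>i\<in>{..<length bs}. co x (bs ! i) \<odot>\<^bsub>V\<^esub> bs ! i)"
      using co(2)[OF x] lincomb_list[OF d B] by simp
    also have "\<dots> = (\<Oplus>\<^bsub>V\<^esub>i\<in>{..<length bs}. \<zero>\<^bsub>V\<^esub>)"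
      using 0 B by (intro M.finsum_cong') (auto simp: subset_iff)
    finally show "x = \<zero>\<^bsub>V\<^esub>" by simp
  qed
qed

end

lemma (in framed) frame_imp_ordered_basis: "ordered_basis V (map b [0..<r])"
proof -
  let ?bs = "map b [0..<r]"
  have inj: "i = j" if "b i = b j" "i < r" "j < r" for i j
    using c_b[OF that(2,2)] c_b[OF that(2,3)] that(1) by (simp split: if_splits)
  have d: "distinct ?bs" by (auto simp: distinct_map inj_on_def intro: inj)
  have B: "set ?bs \<subseteq> carrier V" by auto
  have l: "M.lincomb a (set ?bs) = (\<Oplus>\<^bsub>V\<^esub>i\<in>{..<r}. a (b i) \<odot>\<^bsub>V\<^esub> b i)" for a
    unfolding lincomb_list[OF d B] by (auto intro!: M.finsum_cong')
  have "VS.basis (set ?bs)"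
  proof (subst VS.basis_criterion)
    show "\<forall>v. v \<in> carrier V \<longrightarrow> (\<exists>!a. a \<in> set ?bs \<rightarrow>\<^sub>E carrier class_ring \<and> M.lincomb a (set ?bs) = v)"
    proof (intro allI impI ex1I conjI)
      fix v assume v: "v \<in> carrier V"
      define a where "a = restrict (\<lambda>x. c (SOME i. i < r \<and> b i = x) v) (set ?bs)"
      have ai: "a (b i) = c i v" if "i < r" for i
      proof -
        have "(SOME j. j < r \<and> b j = b i) = i" using that inj by (intro some_equality) auto
        thus ?thesis using that by (auto simp: a_def)
      qed
      show "a \<in> set ?bs \<rightarrow>\<^sub>E carrier class_ring" by (auto simp: a_def class_ring_simps)
      have "(\<Oplus>\<^bsub>V\<^esub>i\<in>{..<r}. a (b i) \<odot>\<^bsub>V\<^esub> b i) = (\<Oplus>\<^bsub>V\<^esub>i\<in>{..<r}. c i v \<odot>\<^bsub>V\<^esub> b i)"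
        by (intro M.finsum_cong') (auto simp: ai)
      thus "M.lincomb a (set ?bs) = v" unfolding l using expand[OF v] by simp
      fix a' assume a': "a' \<in> set ?bs \<rightarrow>\<^sub>E carrier class_ring \<and> M.lincomb a' (set ?bs) = v"
      have "a' (b i) = a (b i)" if "i < r" for i
        using a' c_sum[OF that, of "\<lambda>i. a' (b i)"] ai[OF that] unfolding l by simp
      thus "a' = a" using a' by (intro ext) (auto simp: a_def PiE_def extensional_def)
    qed
  qed (use B in auto)
  thus ?thesis using d by (simp add: ordered_basis_def)
qed

lemma fin_dim_frame:
  fixes V :: "('e :: field_char_0, 'v) module"
  assumes "lin_space V" "vectorspace.fin_dim class_ring V"
  shows "\<exists>b c. frame V (vectorspace.dim class_ring V) b c"
proof -
  interpret lin_space V by fact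
  obtain B where B: "finite B" "VS.basis B" using VS.finite_basis_exists[OF assms(2)] by blast
  obtain bs where bs: "set bs = B" "distinct bs" using finite_distinct_list[OF B(1)] by blast
  have "length bs = VS.dim" using VS.dim_basis[OF B] bs distinct_card by fastforce
  thus ?thesis using ordered_basis_imp_frame[of bs] bs B by (auto simp: ordered_basis_def)
qed

text \<open>Gaussian elimination: as long as \<open>F\<close> contains a nonzero vector whose coordinates beyond \<open>s\<close>
  vanish, it can replace one of the first \<open>s\<close> basis vectors.\<close>

lemma adapted_frame_step:
  fixes V :: "('e :: field_char_0, 'v) module"
  assumes "frame V r b c" "VectorSpace.subspace class_ring F V" "s \<le> r" "\<And>i. s \<le> i \<Longrightarrow> i < r \<Longrightarrow> b i \<in> F"
  shows "\<exists>s b c. s \<le> r \<and> frame V r b c \<and> (\<forall>i. s \<le> i \<longrightarrow> i < r \<longrightarrow> b i \<in> F) \<and>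
    F = {x \<in> carrier V. \<forall>i<s. c i x = 0}"
  using assms
proof (induction s arbitrary: b c)
  case 0
  interpret framed V r b c by standard (rule 0)
  note F = lin_space_submodule[OF 0(2)]
  interpret F: lin_space "V\<lparr>carrier := F\<rparr>" by (rule lin_space_subspace[OF 0(2)])
  have "x \<in> F" if "x \<in> carrier V" for x
  proof -
    have "(\<Oplus>\<^bsub>V\<^esub>j\<in>J. c j x \<odot>\<^bsub>V\<^esub> b j) \<in> F" if "finite J" "J \<subseteq> {..<r}" for J
      using that
    proof (induction rule: finite_induct)
      case (insert j J)
      hence "c j x \<odot>\<^bsub>V\<^esub> b j \<in> F" using 0 F(2) by auto
      thus ?case using insert F.add_closed by (subst M.finsum_insert) auto
    qed (use F in auto)
    from this[of "{..<r}"] show ?thesis using expand[OF that] by simp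
  qed
  hence "F = {x \<in> carrier V. \<forall>i<0. c i x = 0}" using F(3) by auto
  thus ?case using 0 by blast
next
  case (Suc s)
  interpret framed V r b c by standard (rule Suc)
  note F = lin_space_submodule[OF Suc.prems(2)]
  interpret F: lin_space "V\<lparr>carrier := F\<rparr>" by (rule lin_space_subspace[OF Suc.prems(2)])
  show ?case
  proof (cases "\<exists>x\<in>F. x \<noteq> \<zero>\<^bsub>V\<^esub> \<and> (\<forall>i. Suc s \<le> i \<longrightarrow> i < r \<longrightarrow> c i x = 0)")
    case False
    \<comment> \<open>No nonzero vector of F is supported on the first s + 1 basis vectors. Subtract
      from x in F its part along the later ones: that part lies in F, so the difference does too and
      must vanish.\<close>
    have "F = {x \<in> carrier V. \<forall>i<Suc s. c i x = 0}"
    proof (intro equalityI subsetI)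
      fix x assume x: "x \<in> F"
      hence xc: "x \<in> carrier V" using F(3) by auto
      let ?J = "{Suc s..<r}"
      let ?y = "\<Oplus>\<^bsub>V\<^esub>j\<in>?J. c j x \<odot>\<^bsub>V\<^esub> b j"
      have yF: "(\<Oplus>\<^bsub>V\<^esub>j\<in>J. c j x \<odot>\<^bsub>V\<^esub> b j) \<in> F" if "finite J" "J \<subseteq> ?J" for J
        using that
      proof (induction rule: finite_induct)
        case (insert j J)
        hence "c j x \<odot>\<^bsub>V\<^esub> b j \<in> F" using Suc.prems F(2) by auto
        thus ?case using insert F.add_closed by (subst M.finsum_insert) auto
      qed (use F in auto)
      have yF: "?y \<in> F" by (rule yF) auto
      hence yc: "?y \<in> carrier V" using F(3) by auto
      have cy: "c i ?y = (if i \<in> ?J then c i x else 0)" if "i < r" for i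
      proof -
        have "c i ?y = (\<Sum>j\<in>?J. c i (c j x \<odot>\<^bsub>V\<^esub> b j))"
          using that by (subst lin_hom_finsum[OF rmod_axioms lin_space.rmod[OF lin_space_scalar] c_hom]) auto
        also have "\<dots> = (\<Sum>j\<in>?J. if i = j then c j x else 0)"
          using that by (intro sum.cong) (auto simp: lin_hom_smult[OF c_hom] c_b)
        also have "\<dots> = (if i \<in> ?J then c i x else 0)" by (subst sum.delta') auto
        finally show ?thesis .
      qed
      let ?z = "x \<oplus>\<^bsub>V\<^esub> (-1) \<odot>\<^bsub>V\<^esub> ?y"
      have zF: "?z \<in> F" using x yF F(2) F.add_closed[of x "(-1) \<odot>\<^bsub>V\<^esub> ?y"] by simp
      have cz: "c i ?z = c i x - c i ?y" if "i < r" for i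
        using that xc yc by (simp add: lin_hom_add[OF c_hom] lin_hom_smult[OF c_hom])
      have "?z = \<zero>\<^bsub>V\<^esub>" using False zF cz cy by auto
      hence "c i x = 0" if "i < Suc s" for i
        using cz[of i] cy[of i] that Suc.prems(3) lin_hom_zero[OF V lin_space_scalar c_hom, of i] by auto
      thus "x \<in> {x \<in> carrier V. \<forall>i<Suc s. c i x = 0}" using xc by auto
    next
      fix x assume x: "x \<in> {x \<in> carrier V. \<forall>i<Suc s. c i x = 0}"
      have "(\<Oplus>\<^bsub>V\<^esub>j\<in>J. c j x \<odot>\<^bsub>V\<^esub> b j) \<in> F" if "finite J" "J \<subseteq> {..<r}" for J
        using that
      proof (induction rule: finite_induct)
        case (insert j J)
        have "c j x \<odot>\<^bsub>V\<^esub> b j \<in> F"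
          using insert Suc.prems F(2,4) x by (cases "j < Suc s") auto
        thus ?case using insert F.add_closed by (subst M.finsum_insert) auto
      qed (use F in auto)
      from this[of "{..<r}"] show "x \<in> F" using expand[of x] x by simp
    qed
    thus ?thesis using Suc.prems by blast
  next
    case True
    then obtain x where x: "x \<in> F" "x \<noteq> \<zero>\<^bsub>V\<^esub>" "\<And>i. Suc s \<le> i \<Longrightarrow> i < r \<Longrightarrow> c i x = 0" by auto
    have xc: "x \<in> carrier V" using x F(3) by auto
    obtain k where k: "k < Suc s" "c k x \<noteq> 0"
      using x c_zero[OF xc] by (metis not_less)
    have sr: "s < r" "k < r" using Suc.prems k by auto
    \<comment> \<open>Exchanging k and s moves the vector to be replaced to position s, where it
      joins the tail of vectors in F.\<close>
    define t where "t = Transposition.transpose k s"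
    have tt: "t i < r \<longleftrightarrow> i < r" "t (t i) = i" "t s = k" "i > s \<Longrightarrow> t i = i" for i
      using sr k by (auto simp: t_def Transposition.transpose_def)
    define b' where "b' i = (if i = s then x else b (t i))" for i
    \<comment> \<open>The dual basis after b_k is replaced by x: every other coordinate is corrected
      so that it vanishes at x.\<close>
    define c' where "c' i y = (if i = s then c k y / c k x else c (t i) y - c (t i) x / c k x * c k y)" for i y
    have fr': "frame V r b' c'"
    proof (rule frameI)
      show "lin_space V" by (rule V)
      fix i assume i: "i < r"
      show "b' i \<in> carrier V" using i xc tt by (simp add: b'_def)
      show "c' i \<in> lin_hom V scalar_mod"
      proof (cases "i = s")
        case True
        have "c' i = (\<lambda>y. c k y / c k x)" using True by (simp add: c'_def[abs_def])
        moreover have "(\<lambda>y. c k y / c k x) \<in> lin_hom V scalar_mod"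
          by (rule lin_homI) (auto simp: lin_hom[OF c_hom[OF sr(2)]] add_divide_distrib)
        ultimately show ?thesis by simp
      next
        case False
        define K where "K = c (t i) x / c k x"
        have ti: "t i < r" using i tt(1) by simp
        have "c' i = (\<lambda>y. c (t i) y - K * c k y)" using False by (simp add: c'_def[abs_def] K_def)
        moreover have "(\<lambda>y. c (t i) y - K * c k y) \<in> lin_hom V scalar_mod"
          by (rule lin_homI) (auto simp: lin_hom[OF c_hom[OF sr(2)]] lin_hom[OF c_hom[OF ti]] algebra_simps)
        ultimately show ?thesis by simp
      qed
      fix j assume j: "j < r"
      have ne: "t j \<noteq> k" if "j \<noteq> s" using that tt(2)[of j] tt(3) tt(2)[of s] by metis
      have ti: "t i = t j \<longleftrightarrow> i = j" using tt(2) by metis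
      show "c' i (b' j) = (if i = j then 1 else 0)"
      proof (cases "j = s")
        case True
        thus ?thesis using k(2) by (simp add: c'_def b'_def)
      next
        case False
        have tj: "t j < r" using j tt(1) by simp
        have "c k (b (t j)) = 0" using c_b[OF sr(2) tj] ne[OF False] by simp
        moreover have "c (t i) (b (t j)) = (if i = j then 1 else 0)" using c_b[of "t i" "t j"] tj i tt(1) ti by simp
        ultimately show ?thesis using False unfolding c'_def b'_def by (cases "i = j") simp_all
      qed
    next
      fix y assume y: "y \<in> carrier V" and 0: "\<And>i. i < r \<Longrightarrow> c' i y = 0"
      have ky: "c k y = 0" using 0[OF sr(1)] k by (simp add: c'_def)
      have "c i y = 0" if "i < r" for i
      proof (cases "i = k")
        case False
        hence "t i \<noteq> s" using tt(2)[of i] tt(3) by metis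
        thus ?thesis using 0[of "t i"] that tt ky by (simp add: c'_def)
      qed (use ky in simp)
      thus "y = \<zero>\<^bsub>V\<^esub>" by (rule c_zero[OF y])
    qed
    have "b' i \<in> F" if "s \<le> i" "i < r" for i
      using that x(1) Suc.prems(4)[of i] tt(4)[of i] by (cases "i = s") (auto simp: b'_def)
    from Suc.IH[OF fr' Suc.prems(2) _ this] sr show ?thesis by simp
  qed
qed

lemma adapted_frame:
  fixes V :: "('e :: field_char_0, 'v) module"
  assumes "frame V r b c" "VectorSpace.subspace class_ring F V"
  obtains s b' c' where "s \<le> r" "frame V r b' c'" "\<And>i. s \<le> i \<Longrightarrow> i < r \<Longrightarrow> b' i \<in> F"
    "F = {x \<in> carrier V. \<forall>i<s. c' i x = 0}"
  using adapted_frame_step[OF assms, of r] by auto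

lemma adapted_sub_frame:
  fixes V :: "('e :: field_char_0, 'v) module"
  assumes fr: "frame V r b c" and F: "VectorSpace.subspace class_ring F V" and s: "s \<le> r"
    and bF: "\<And>i. s \<le> i \<Longrightarrow> i < r \<Longrightarrow> b i \<in> F" and Fc: "F = {x \<in> carrier V. \<forall>i<s. c i x = 0}"
  shows "frame (V\<lparr>carrier := F\<rparr>) (r - s) (\<lambda>i. b (s + i)) (\<lambda>i. c (s + i))"
proof (rule frameI)
  interpret framed V r b c by standard (rule fr)
  show "lin_space (V\<lparr>carrier := F\<rparr>)" by (rule lin_space_subspace[OF F])
  fix i assume i: "i < r - s"
  show "b (s + i) \<in> carrier (V\<lparr>carrier := F\<rparr>)" using i bF by simp
  show "c (s + i) \<in> lin_hom (V\<lparr>carrier := F\<rparr>) scalar_mod"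
    by (rule subspace_hom_restrict[OF c_hom]) (use i Fc in auto)
  show "c (s + i) (b (s + j)) = (if i = j then 1 else 0)" if "j < r - s" for j
    using c_b[of "s + i" "s + j"] i that by auto
next
  interpret framed V r b c by standard (rule fr)
  fix x assume x: "x \<in> carrier (V\<lparr>carrier := F\<rparr>)" and 0: "\<And>i. i < r - s \<Longrightarrow> c (s + i) x = 0"
  have "x = \<zero>\<^bsub>V\<^esub>"
  proof (rule c_zero)
    fix i assume "i < r"
    thus "c i x = 0" using x Fc 0[of "i - s"] by (cases "i < s") auto
  qed (use x Fc in auto)
  thus "x = \<zero>\<^bsub>V\<lparr>carrier := F\<rparr>\<^esub>" by simp
qed

lemma adapted_quot_frame:
  fixes V :: "('e :: field_char_0, 'v) module"
  assumes fr: "frame V r b c" and F: "VectorSpace.subspace class_ring F V" and s: "s \<le> r"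
    and Fc: "F = {x \<in> carrier V. \<forall>i<s. c i x = 0}"
  obtains d where "frame (quot_mod V F) s (\<lambda>i. F +>\<^bsub>V\<^esub> b i) d"
    "\<And>i x. i < s \<Longrightarrow> x \<in> carrier V \<Longrightarrow> d i (F +>\<^bsub>V\<^esub> x) = c i x"
proof -
  interpret framed V r b c by standard (rule fr)
  \<comment> \<open>A representative is chosen arbitrarily; the coordinates below s vanish on F, so
    the choice does not affect the value.\<close>
  define d where "d i X = c i (SOME x. x \<in> X)" for i and X :: "'v set"
  have d: "d i (F +>\<^bsub>V\<^esub> x) = c i x" if i: "i < s" and x: "x \<in> carrier V" for i x
  proof -
    let ?y = "SOME y. y \<in> F +>\<^bsub>V\<^esub> x"
    have "x \<in> F +>\<^bsub>V\<^esub> x" using x lin_space_submodule(4)[OF F] by (simp add: quot_rep[OF F])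
    hence "?y \<in> F +>\<^bsub>V\<^esub> x" by (rule someI)
    hence y: "?y \<in> carrier V" "?y \<ominus>\<^bsub>V\<^esub> x \<in> F" using quot_rep[OF F x] by auto
    have "?y \<ominus>\<^bsub>V\<^esub> x = ?y \<oplus>\<^bsub>V\<^esub> (-1) \<odot>\<^bsub>V\<^esub> x" using x by (simp add: a_minus_def smult_neg_left)
    hence "c i (?y \<oplus>\<^bsub>V\<^esub> (-1) \<odot>\<^bsub>V\<^esub> x) = 0" using y(2) i Fc by auto
    thus ?thesis using x y(1) i s by (simp add: d_def lin_hom_add[OF c_hom] lin_hom_smult[OF c_hom])
  qed
  note car = quot_carrier[OF F]
  have "frame (quot_mod V F) s (\<lambda>i. F +>\<^bsub>V\<^esub> b i) d"
  proof (rule frameI)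
    show "lin_space (quot_mod V F)" by (rule lin_space_quot[OF F])
    fix i assume i: "i < s"
    show "F +>\<^bsub>V\<^esub> b i \<in> carrier (quot_mod V F)" using i s car by auto
    show "d i \<in> lin_hom (quot_mod V F) scalar_mod"
      using i s by (intro lin_homI) (auto simp: car quot_add[OF F] quot_smult[OF F] d lin_hom[OF c_hom])
    show "d i (F +>\<^bsub>V\<^esub> b j) = (if i = j then 1 else 0)" if "j < s" for j
      using i s that by (simp add: d c_b)
  next
    fix X assume "X \<in> carrier (quot_mod V F)" and 0: "\<And>i. i < s \<Longrightarrow> d i X = 0"
    then obtain x where x: "x \<in> carrier V" "X = F +>\<^bsub>V\<^esub> x" using car by auto
    have "x \<ominus>\<^bsub>V\<^esub> \<zero>\<^bsub>V\<^esub> = x" using x by (simp add: a_minus_def)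
    moreover have "x \<in> F" using x 0 d Fc by auto
    ultimately show "X = \<zero>\<^bsub>quot_mod V F\<^esub>"
      unfolding quot_zero[OF F] x(2) using quot_eq_iff[OF F x(1), of "\<zero>\<^bsub>V\<^esub>"] by simp
  qed
  thus ?thesis using d that by blast
qed

text \<open>A period determinant comes with some frame of the quotient. Making it the top part of a
  frame of the whole space turns the period matrix into a block of the full one.\<close>

lemma quot_frame_lift:
  fixes V :: "('e :: field_char_0, 'v) module"
  assumes fr: "frame V r b c" and F: "VectorSpace.subspace class_ring F V"
    and q: "frame (quot_mod V F) t d dc"
  obtains u b' c' where "frame V (t + u) b' c'" "\<And>i. t \<le> i \<Longrightarrow> i < t + u \<Longrightarrow> b' i \<in> F"
    "\<And>i x. i < t \<Longrightarrow> x \<in> carrier V \<Longrightarrow> c' i x = dc i (F +>\<^bsub>V\<^esub> x)"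
proof -
  obtain s b2 c2 where s: "s \<le> r" and fr2: "frame V r b2 c2" and bF: "\<And>i. s \<le> i \<Longrightarrow> i < r \<Longrightarrow> b2 i \<in> F"
    and Fc: "F = {x \<in> carrier V. \<forall>i<s. c2 i x = 0}"
    by (rule adapted_frame[OF fr F]) (rule that)
  interpret framed V r b2 c2 by standard (rule fr2)
  interpret Q: framed "quot_mod V F" t d dc by standard (rule q)
  note F' = lin_space_submodule[OF F] and ph = quot_proj_hom[OF F]
  \<comment> \<open>The lift is taken without component along the basis vectors of F, so the
    coordinates on F need no correction.\<close>
  have lift: "\<exists>x\<in>carrier V. F +>\<^bsub>V\<^esub> x = d i \<and> (\<forall>j. s \<le> j \<longrightarrow> j < r \<longrightarrow> c2 j x = 0)" if i: "i < t" for i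
  proof -
    obtain x where x: "x \<in> carrier V" "d i = F +>\<^bsub>V\<^esub> x" using Q.b_closed[OF i] quot_carrier[OF F] by auto
    let ?y = "\<Oplus>\<^bsub>V\<^esub>j\<in>{..<s}. c2 j x \<odot>\<^bsub>V\<^esub> b2 j"
    have yc: "?y \<in> carrier V" using s by (intro M.finsum_closed) auto
    have cy: "c2 i ?y = (if i < s then c2 i x else 0)" if "i < r" for i
    proof -
      have "c2 i ?y = (\<Sum>j<s. c2 i (c2 j x \<odot>\<^bsub>V\<^esub> b2 j))"
        using that s by (subst lin_hom_finsum[OF rmod_axioms lin_space.rmod[OF lin_space_scalar] c_hom]) auto
      also have "\<dots> = (\<Sum>j<s. if i = j then c2 j x else 0)"
        using that s by (intro sum.cong) (auto simp: lin_hom_smult[OF c_hom] c_b)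
      also have "\<dots> = (if i < s then c2 i x else 0)" by (subst sum.delta') auto
      finally show ?thesis .
    qed
    have "?y \<ominus>\<^bsub>V\<^esub> x = ?y \<oplus>\<^bsub>V\<^esub> (-1) \<odot>\<^bsub>V\<^esub> x" using x by (simp add: a_minus_def smult_neg_left)
    moreover have "c2 i (?y \<oplus>\<^bsub>V\<^esub> (-1) \<odot>\<^bsub>V\<^esub> x) = 0" if "i < s" for i
      using that s x yc cy[of i] by (simp add: lin_hom_add[OF c_hom] lin_hom_smult[OF c_hom])
    ultimately have "?y \<ominus>\<^bsub>V\<^esub> x \<in> F" using x yc unfolding Fc by simp
    hence "F +>\<^bsub>V\<^esub> ?y = d i" unfolding x(2) using quot_eq_iff[OF F yc x(1)] by simp
    thus ?thesis using yc cy by (intro bexI[of _ ?y]) auto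
  qed
  define l where "l i = (SOME x. x \<in> carrier V \<and> F +>\<^bsub>V\<^esub> x = d i \<and> (\<forall>j. s \<le> j \<longrightarrow> j < r \<longrightarrow> c2 j x = 0))" for i
  have l: "l i \<in> carrier V" "F +>\<^bsub>V\<^esub> l i = d i" "\<And>j. s \<le> j \<Longrightarrow> j < r \<Longrightarrow> c2 j (l i) = 0" if "i < t" for i
    using someI_ex[of "\<lambda>x. x \<in> carrier V \<and> F +>\<^bsub>V\<^esub> x = d i \<and> (\<forall>j. s \<le> j \<longrightarrow> j < r \<longrightarrow> c2 j x = 0)"] lift[OF that]
    unfolding l_def by blast+
  define b' where "b' i = (if i < t then l i else b2 (s + (i - t)))" for i
  define c' where "c' i x = (if i < t then dc i (F +>\<^bsub>V\<^esub> x) else c2 (s + (i - t)) x)" for i x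
  have projF: "F +>\<^bsub>V\<^esub> x = \<zero>\<^bsub>quot_mod V F\<^esub> \<longleftrightarrow> x \<in> F" if "x \<in> carrier V" for x
    unfolding quot_zero[OF F] using quot_eq_iff[OF F that, of "\<zero>\<^bsub>V\<^esub>"] that by (simp add: a_minus_def)
  have "frame V (t + (r - s)) b' c'"
  proof (rule frameI)
    show "lin_space V" by (rule V)
    fix i assume i: "i < t + (r - s)"
    show "b' i \<in> carrier V" using i l by (auto simp: b'_def)
    show "c' i \<in> lin_hom V scalar_mod"
    proof (cases "i < t")
      case True
      thus ?thesis using lin_hom_comp[OF ph Q.c_hom[OF True]] by (simp add: c'_def[abs_def])
    next
      case False
      hence "s + (i - t) < r" using i by auto
      from c_hom[OF this] False show ?thesis by (simp add: c'_def[abs_def])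
    qed
    fix j assume j: "j < t + (r - s)"
    have 1: "dc i (F +>\<^bsub>V\<^esub> b2 (s + (j - t))) = 0" if "i < t" "\<not> j < t"
    proof -
      have "b2 (s + (j - t)) \<in> F" using that j by (intro bF) auto
      hence "F +>\<^bsub>V\<^esub> b2 (s + (j - t)) = \<zero>\<^bsub>quot_mod V F\<^esub>" using projF F'(3) by blast
      thus ?thesis using lin_hom_zero[OF Q.V lin_space_scalar Q.c_hom[OF that(1)]] by simp
    qed
    show "c' i (b' j) = (if i = j then 1 else 0)"
      using i j 1 l Q.c_b[of i j] c_b[of "s + (i - t)" "s + (j - t)"]
      by (auto simp: c'_def b'_def)
  next
    fix x assume x: "x \<in> carrier V" and 0: "\<And>i. i < t + (r - s) \<Longrightarrow> c' i x = 0"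
    have "F +>\<^bsub>V\<^esub> x = \<zero>\<^bsub>quot_mod V F\<^esub>"
    proof (rule Q.c_zero)
      show "dc i (F +>\<^bsub>V\<^esub> x) = 0" if "i < t" for i using 0[of i] that by (simp add: c'_def)
    qed (use x quot_carrier[OF F] in auto)
    hence "x \<in> F" using projF x by simp
    moreover have "c2 i x = 0" if "s \<le> i" "i < r" for i 
    proof -
      define k where "k = i - s"
      have k: "i = s + k" using that by (simp add: k_def)
      have "c' (t + k) x = 0" by (rule 0) (use that k in auto)
      thus ?thesis by (simp add: c'_def k)
    qed
    ultimately have "c2 i x = 0" if "i < r" for i using that Fc by (cases "i < s") auto
    thus "x = \<zero>\<^bsub>V\<^esub>" by (rule c_zero[OF x])
  qed
  moreover have "b' i \<in> F" if "t \<le> i" "i < t + (r - s)" for i using that bF[of "s + (i - t)"] by (simp add: b'_def)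
  moreover have "c' i x = dc i (F +>\<^bsub>V\<^esub> x)" if "i < t" for i x using that by (simp add: c'_def)
  ultimately show ?thesis using that by blast
qed

section \<open>Bijectivity of the two period maps\<close>

section \<open>Hodge decomposition and period maps\<close>

lemma cxQ_smult:
  assumes V: "lin_space V" and X: "X \<in> carrier (cxR V)"
  shows "q \<odot>\<^bsub>cxQ V\<^esub> X = emb (of_rat q) \<odot>\<^bsub>cxR V\<^esub> X"
  using X
proof (induction rule: cxR_induct[OF V, consumes 1, case_names zero elt add])
  case zero
  show ?case using rmod.smult_zero_right[OF lin_space.rmod[OF lin_space_cxQ[OF V]]] rmod.smult_zero_right[OF rmod_cxR[OF V]] by simp
next
  case (elt x z)
  thus ?case using cx_elt_rat_left[OF V elt] by (simp add: emb_def tens_smult_elt[OF V])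
next
  case (add X Y)
  thus ?case using rmod.smult_add_right[OF lin_space.rmod[OF lin_space_cxQ[OF V]]] rmod.smult_add_right[OF rmod_cxR[OF V]]
    by simp
qed

definition conj_cx :: "('e :: field_char_0, 'v) module \<Rightarrow> 'v cx \<Rightarrow> 'v cx" where
  "conj_cx V = cx_map V (\<lambda>x. x) cnj"

lemma
  assumes V: "lin_space V"
  shows conj_cx_closed: "X \<in> carrier (cxR V) \<Longrightarrow> conj_cx V X \<in> carrier (cxR V)"
    and conj_cx_add: "X \<in> carrier (cxR V) \<Longrightarrow> Y \<in> carrier (cxR V) \<Longrightarrow>
      conj_cx V (X \<oplus>\<^bsub>cxR V\<^esub> Y) = conj_cx V X \<oplus>\<^bsub>cxR V\<^esub> conj_cx V Y"
    and conj_cx_rat: "X \<in> carrier (cxR V) \<Longrightarrow>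
      conj_cx V (emb (of_rat q) \<odot>\<^bsub>cxR V\<^esub> X) = emb (of_rat q) \<odot>\<^bsub>cxR V\<^esub> conj_cx V X"
    and conj_cx_zero: "conj_cx V \<zero>\<^bsub>cxR V\<^esub> = \<zero>\<^bsub>cxR V\<^esub>"
    and conj_cx_elt: "x \<in> carrier V \<Longrightarrow> conj_cx V (cx_elt V x z) = cx_elt V x (cnj z)"
    and conj_cx_conj: "X \<in> carrier (cxR V) \<Longrightarrow> conj_cx V (conj_cx V X) = X"
proof -
  note h = cx_map_hom[OF V V id_hom cnj_hom_complex]
  note VQ = lin_space_cxQ[OF V]
  show c: "X \<in> carrier (cxR V) \<Longrightarrow> conj_cx V X \<in> carrier (cxR V)" for X
    using lin_hom_closed[OF h, of X] by (simp add: conj_cx_def)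
  show "X \<in> carrier (cxR V) \<Longrightarrow> Y \<in> carrier (cxR V) \<Longrightarrow>
      conj_cx V (X \<oplus>\<^bsub>cxR V\<^esub> Y) = conj_cx V X \<oplus>\<^bsub>cxR V\<^esub> conj_cx V Y"
    using lin_hom_add[OF h, of X Y] by (simp add: conj_cx_def)
  show "X \<in> carrier (cxR V) \<Longrightarrow>
      conj_cx V (emb (of_rat q) \<odot>\<^bsub>cxR V\<^esub> X) = emb (of_rat q) \<odot>\<^bsub>cxR V\<^esub> conj_cx V X"
    using lin_hom_smult[OF h, of X q] c[of X] by (simp add: cxQ_smult[OF V] conj_cx_def)
  show "conj_cx V \<zero>\<^bsub>cxR V\<^esub> = \<zero>\<^bsub>cxR V\<^esub>"
    using lin_hom_zero[OF VQ VQ h] by (simp add: conj_cx_def)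
  show e: "x \<in> carrier V \<Longrightarrow> conj_cx V (cx_elt V x z) = cx_elt V x (cnj z)" for x z
    unfolding conj_cx_def by (rule cx_map_elt[OF V V id_hom cnj_hom_complex])
  assume X: "X \<in> carrier (cxR V)"
  show "conj_cx V (conj_cx V X) = X"
    using cx_hom_eqI[OF V VQ lin_hom_comp[OF h h] id_hom, of X] X e by (simp add: conj_cx_def)
qed

lemma conj_cx_map:
  assumes A: "lin_space A" and V: "lin_space V" and f: "f \<in> lin_hom A V" and X: "X \<in> carrier (cxR A)"
  shows "conj_cx V (cxm V f X) = cx_map V f cnj X" "cxm V f (conj_cx A X) = cx_map V f cnj X"
proof -
  note VQ = lin_space_cxQ[OF V] and fc = lin_hom_closed[OF f]
  have h1: "conj_cx V \<in> lin_hom (cxQ V) (cxQ V)" unfolding conj_cx_def by (rule cx_map_hom[OF V V id_hom cnj_hom_complex])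
  have h1': "conj_cx A \<in> lin_hom (cxQ A) (cxQ A)" unfolding conj_cx_def by (rule cx_map_hom[OF A A id_hom cnj_hom_complex])
  have h2: "cxm V f \<in> lin_hom (cxQ A) (cxQ V)" by (rule cx_map_hom[OF A V f id_hom_complex])
  have h3: "cx_map V f cnj \<in> lin_hom (cxQ A) (cxQ V)" by (rule cx_map_hom[OF A V f cnj_hom_complex])
  have e3: "x \<in> carrier A \<Longrightarrow> cx_map V f cnj (cx_elt A x z) = cx_elt V (f x) (cnj z)" for x z
    by (rule cx_map_elt[OF A V f cnj_hom_complex])
  show "conj_cx V (cxm V f X) = cx_map V f cnj X"
    by (rule cx_hom_eqI[OF A VQ lin_hom_comp[OF h2 h1] h3])
      (use X fc in \<open>auto simp: e3 cxm_elt[OF A V f] conj_cx_elt[OF V]\<close>)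
  show "cxm V f (conj_cx A X) = cx_map V f cnj X"
    by (rule cx_hom_eqI[OF A VQ lin_hom_comp[OF h1' h2] h3])
      (use X fc in \<open>auto simp: e3 cxm_elt[OF A V f] conj_cx_elt[OF A]\<close>)
qed

locale bdr_system =
  fixes N :: "('e :: number_field, 'b, 'd) bdr"
  assumes bdr: "betti_de_rham N"
begin

abbreviation "V \<equiv> betti N"
abbreviation "W \<equiv> derham N"
abbreviation "cmp \<equiv> comparison N"

lemma V: "lin_space V" and W: "lin_space W" and V_fin: "vectorspace.fin_dim class_ring V"
  and W_fin: "vectorspace.fin_dim class_ring W" and Finf_hom: "Finf N \<in> lin_hom V V"
  and Finf_Finf: "x \<in> carrier V \<Longrightarrow> Finf N (Finf N x) = x"
  and fil_sub: "VectorSpace.subspace class_ring (fil N p) W"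
  and fil_mono: "p \<le> q \<Longrightarrow> fil N q \<subseteq> fil N p"
  and cmp_hom: "cmp \<in> lin_hom (cxR V) (cxR W)"
  and cmp_bij: "bij_betw cmp (carrier (cxR V)) (carrier (cxR W))"
  and cmp_conj: "X \<in> carrier (cxR V) \<Longrightarrow> cmp (cx_map V (Finf N) cnj X) = conj_cx W (cmp X)"
  and hodge_dec: "hodge_decomposition N"
  using bdr by (auto simp: betti_de_rham_def lin_space_def conj_cx_def intro!: EC_hom_cxR)

sublocale V: lin_space V by (rule V)
sublocale W: lin_space W by (rule W)
sublocale VC: rmod "cxR V" by (rule rmod_cxR[OF V])
sublocale WC: rmod "cxR W" by (rule rmod_cxR[OF W])

lemmas fil_space = lin_space_subspace[OF fil_sub]
lemmas fil_subset = lin_space_submodule(3)[OF fil_sub]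
lemmas fil_incl = subspace_incl_hom[OF fil_subset]

lemma fil_cx_eq: "fil_cx N p = cxm W (\<lambda>x. x) ` carrier (cxR (W\<lparr>carrier := fil N p\<rparr>))"
  by (simp add: fil_cx_def)

lemma fil_cx_add: "X \<in> fil_cx N p \<Longrightarrow> Y \<in> fil_cx N p \<Longrightarrow> X \<oplus>\<^bsub>cxR W\<^esub> Y \<in> fil_cx N p"
proof -
  assume "X \<in> fil_cx N p" "Y \<in> fil_cx N p"
  then obtain X' Y' where xy: "X' \<in> carrier (cxR (W\<lparr>carrier := fil N p\<rparr>))" "Y' \<in> carrier (cxR (W\<lparr>carrier := fil N p\<rparr>))"
    "X = cxm W (\<lambda>x. x) X'" "Y = cxm W (\<lambda>x. x) Y'" by (auto simp: fil_cx_eq)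
  have "X \<oplus>\<^bsub>cxR W\<^esub> Y = cxm W (\<lambda>x. x) (X' \<oplus>\<^bsub>cxR (W\<lparr>carrier := fil N p\<rparr>)\<^esub> Y')"
    using lin_hom_add[OF cxm_hom[OF fil_space W fil_incl]] xy by simp
  thus ?thesis using xy rmod.add_closed[OF rmod_cxR[OF fil_space] xy(1,2)] by (auto simp: fil_cx_eq)
qed

lemma fil_cx_smult: "X \<in> fil_cx N p \<Longrightarrow> a \<odot>\<^bsub>cxR W\<^esub> X \<in> fil_cx N p"
proof -
  assume "X \<in> fil_cx N p"
  then obtain X' where x: "X' \<in> carrier (cxR (W\<lparr>carrier := fil N p\<rparr>))" "X = cxm W (\<lambda>x. x) X'" by (auto simp: fil_cx_eq)
  have "a \<odot>\<^bsub>cxR W\<^esub> X = cxm W (\<lambda>x. x) (a \<odot>\<^bsub>cxR (W\<lparr>carrier := fil N p\<rparr>)\<^esub> X')"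
    using lin_hom_smult[OF cxm_hom[OF fil_space W fil_incl]] x by simp
  thus ?thesis using x rmod.smult_closed[OF rmod_cxR[OF fil_space] x(1)] by (auto simp: fil_cx_eq)
qed

lemma fil_cx_elt: "x \<in> fil N p \<Longrightarrow> cx_elt W x z \<in> fil_cx N p"
  using cxm_elt[OF fil_space W fil_incl, of x p z] cxR_elt_closed[OF fil_space, of x p z]
  unfolding fil_cx_eq by (auto intro: rev_image_eqI)

lemma fil_cx_zero: "\<zero>\<^bsub>cxR W\<^esub> \<in> fil_cx N p"
proof -
  have "cx_elt W \<zero>\<^bsub>W\<^esub> 1 \<in> fil_cx N p" by (rule fil_cx_elt[OF lin_space_submodule(4)[OF fil_sub]])
  from fil_cx_smult[OF this, of 0] show ?thesis by (simp add: cxR_elt_closed[OF W])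
qed

lemma fil_cx_conj: "X \<in> fil_cx N p \<Longrightarrow> conj_cx W X \<in> fil_cx N p"
proof -
  assume "X \<in> fil_cx N p"
  then obtain X' where x: "X' \<in> carrier (cxR (W\<lparr>carrier := fil N p\<rparr>))" "X = cxm W (\<lambda>x. x) X'" by (auto simp: fil_cx_eq)
  have "conj_cx W X = cxm W (\<lambda>x. x) (conj_cx (W\<lparr>carrier := fil N p\<rparr>) X')"
    using conj_cx_map[OF fil_space W fil_incl x(1)] x by simp
  thus ?thesis using conj_cx_closed[OF fil_space x(1)] by (auto simp: fil_cx_eq)
qed

lemma fil_cx_mono: "p \<le> q \<Longrightarrow> fil_cx N q \<subseteq> fil_cx N p"
proof
  fix X assume pq: "p \<le> q" and "X \<in> fil_cx N q"
  then obtain X' where x: "X' \<in> carrier (cxR (W\<lparr>carrier := fil N q\<rparr>))" "X = cxm W (\<lambda>x. x) X'" by (auto simp: fil_cx_eq)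
  have h: "(\<lambda>x. x) \<in> lin_hom (W\<lparr>carrier := fil N q\<rparr>) (W\<lparr>carrier := fil N p\<rparr>)"
    using fil_mono[OF pq] by (intro lin_homI) auto
  have "X = cxm W (\<lambda>x. x) (cxm (W\<lparr>carrier := fil N p\<rparr>) (\<lambda>x. x) X')"
    using cxm_comp[OF fil_space fil_space W h fil_incl x(1)] x(2) by simp
  thus "X \<in> fil_cx N p" using lin_hom_closed[OF cxm_hom[OF fil_space fil_space h] x(1)] by (auto simp: fil_cx_eq)
qed

definition bf :: "int \<Rightarrow> 'b cx set" where "bf p = betti_fil N p"

lemma bf_iff: "X \<in> bf p \<longleftrightarrow> X \<in> carrier (cxR V) \<and> cmp X \<in> fil_cx N p"
  by (simp add: bf_def betti_fil_def)

lemma bf_add: "X \<in> bf p \<Longrightarrow> Y \<in> bf p \<Longrightarrow> X \<oplus>\<^bsub>cxR V\<^esub> Y \<in> bf p"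
  by (auto simp: bf_iff lin_hom_add[OF cmp_hom] fil_cx_add)

lemma bf_smult: "X \<in> bf p \<Longrightarrow> a \<odot>\<^bsub>cxR V\<^esub> X \<in> bf p"
  by (auto simp: bf_iff lin_hom_smult[OF cmp_hom] fil_cx_smult)

lemma bf_zero: "\<zero>\<^bsub>cxR V\<^esub> \<in> bf p"
  using rmod_hom_zero[OF rmod_cxR[OF V] rmod_cxR[OF W] cmp_hom] fil_cx_zero by (auto simp: bf_iff)

lemma bf_mono: "p \<le> q \<Longrightarrow> bf q \<subseteq> bf p"
  by (auto simp: bf_iff subsetD[OF fil_cx_mono])

lemma bf_Finf_conj: "X \<in> bf p \<Longrightarrow> cx_map V (Finf N) cnj X \<in> bf p"
  using cmp_conj fil_cx_conj lin_hom_closed[OF cx_map_hom[OF V V Finf_hom cnj_hom_complex], of X] by (auto simp: bf_iff)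

lemma hodge_eq: "hodge N p q = bf p \<inter> conj_cx V ` bf q"
  by (simp add: hodge_def bf_def conj_cx_def)

lemma zero_hodge: "\<zero>\<^bsub>cxR V\<^esub> \<in> hodge N p q"
  unfolding hodge_eq using bf_zero conj_cx_zero[OF V] by (metis IntI image_eqI)

text \<open>X would have two Hodge decompositions, one concentrated in p and one in q.\<close>

lemma hodge_unique:
  assumes X: "X \<in> hodge N p (weight N - p)" "X \<in> hodge N q (weight N - q)" and pq: "p \<noteq> q"
  shows "X = \<zero>\<^bsub>cxR V\<^esub>"
proof (rule ccontr)
  assume nz: "X \<noteq> \<zero>\<^bsub>cxR V\<^esub>"
  have Xc: "X \<in> carrier (cxR V)" using X(1) by (auto simp: hodge_eq bf_iff)
  define f where "f p i = (if i = p then X else \<zero>\<^bsub>cxR V\<^esub>)" for p i :: int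
  define P where "P g \<longleftrightarrow> (\<forall>i. g i \<in> hodge N i (weight N - i)) \<and> finite {i. g i \<noteq> \<zero>\<^bsub>cx V\<^esub>} \<and>
      X = (\<Oplus>\<^bsub>cx V\<^esub>i\<in>{i. g i \<noteq> \<zero>\<^bsub>cx V\<^esub>}. g i)" for g
  have Pf: "P (f p)" if "X \<in> hodge N p (weight N - p)" for p
  proof -
    have s: "{i. f p i \<noteq> \<zero>\<^bsub>cxR V\<^esub>} = {p}" using nz by (auto simp: f_def)
    have "(\<Oplus>\<^bsub>cxR V\<^esub>i\<in>{p}. f p i) = X" using Xc by (simp add: f_def)
    thus ?thesis using that zero_hodge s by (auto simp: f_def P_def)
  qed
  have "\<exists>!g. P g"
    unfolding P_def by (rule hodge_dec[unfolded hodge_decomposition_def, rule_format]) (simp add: Xc)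
  hence "f p = f q" using Pf[OF X(1)] Pf[OF X(2)] by auto
  hence "f p p = f q p" by simp
  thus False using nz pq by (simp add: f_def)
qed

text \<open>The least p with 2p greater than the weight.\<close>

definition mid :: int where "mid = weight N div 2 + 1"

text \<open>Every Hodge type (p, w - p) other than the middle one has p or w - p at least
  \<open>mid\<close>, so its component lies in this filtration step or in the conjugate of it; a
  middle component vanishes by assumption.\<close>

lemma hodge_sum:
  assumes vm: "even (weight N) \<longrightarrow> vanishing_middle N" and X: "X \<in> carrier (cxR V)"
  shows "\<exists>h\<in>bf mid. \<exists>h'\<in>bf mid. X = h \<oplus>\<^bsub>cxR V\<^esub> conj_cx V h'"
proof -
  define w where "w = weight N"
  obtain f where f: "\<And>p. f p \<in> hodge N p (w - p)" "finite {p. f p \<noteq> \<zero>\<^bsub>cxR V\<^esub>}"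
      "X = (\<Oplus>\<^bsub>cxR V\<^esub>p\<in>{p. f p \<noteq> \<zero>\<^bsub>cxR V\<^esub>}. f p)"
    using hodge_dec[unfolded hodge_decomposition_def, rule_format, of X] X unfolding w_def by auto
  have one: "\<exists>h\<in>bf mid. \<exists>h'\<in>bf mid. f p = h \<oplus>\<^bsub>cxR V\<^esub> conj_cx V h'" for p
  proof -
    have fp: "f p \<in> bf p" "f p \<in> conj_cx V ` bf (w - p)" using f(1)[of p] by (auto simp: hodge_eq)
    have fc: "f p \<in> carrier (cxR V)" using fp by (simp add: bf_iff)
    have "mid \<le> p \<or> mid \<le> w - p \<or> (even w \<and> p = w div 2 \<and> w - p = w div 2)"
      unfolding mid_def w_def[symmetric] by presburger
    then consider "mid \<le> p" | "mid \<le> w - p" | "even w" "p = w div 2" "w - p = w div 2" by auto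
    thus ?thesis
    proof cases
      case 1
      hence "f p \<in> bf mid" using bf_mono fp by blast
      moreover have "f p = f p \<oplus>\<^bsub>cxR V\<^esub> conj_cx V \<zero>\<^bsub>cxR V\<^esub>" using fc by (simp add: conj_cx_zero[OF V])
      ultimately show ?thesis using bf_zero by blast
    next
      case 2
      then obtain h' where h': "h' \<in> bf mid" "f p = conj_cx V h'" using bf_mono fp by blast
      have "f p = \<zero>\<^bsub>cxR V\<^esub> \<oplus>\<^bsub>cxR V\<^esub> conj_cx V h'" using fc h'(2) by simp
      thus ?thesis using bf_zero h'(1) by blast
    next
      case 3
      have "hodge N (w div 2) (w div 2) = {\<zero>\<^bsub>cxR V\<^esub>}"
        using vm 3(1) unfolding vanishing_middle_def w_def by auto
      hence "f p = \<zero>\<^bsub>cxR V\<^esub>" using f(1)[of p] 3 by auto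
      hence "f p = \<zero>\<^bsub>cxR V\<^esub> \<oplus>\<^bsub>cxR V\<^esub> conj_cx V \<zero>\<^bsub>cxR V\<^esub>" by (simp add: conj_cx_zero[OF V])
      thus ?thesis using bf_zero by blast
    qed
  qed
  have fcar: "f p \<in> carrier (cxR V)" for p using f(1)[of p] by (auto simp: hodge_eq bf_iff)
  have "\<exists>h\<in>bf mid. \<exists>h'\<in>bf mid. (\<Oplus>\<^bsub>cxR V\<^esub>p\<in>S. f p) = h \<oplus>\<^bsub>cxR V\<^esub> conj_cx V h'" if "finite S" for S
    using that
  proof (induction rule: finite_induct)
    case empty
    have "\<zero>\<^bsub>cxR V\<^esub> = \<zero>\<^bsub>cxR V\<^esub> \<oplus>\<^bsub>cxR V\<^esub> conj_cx V \<zero>\<^bsub>cxR V\<^esub>" by (simp add: conj_cx_zero[OF V])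
    thus ?case using bf_zero by auto
  next
    case (insert p S)
    then obtain a a' where a: "a \<in> bf mid" "a' \<in> bf mid" "(\<Oplus>\<^bsub>cxR V\<^esub>p\<in>S. f p) = a \<oplus>\<^bsub>cxR V\<^esub> conj_cx V a'" by auto
    obtain b b' where b: "b \<in> bf mid" "b' \<in> bf mid" "f p = b \<oplus>\<^bsub>cxR V\<^esub> conj_cx V b'" using one by blast
    have c: "a \<in> carrier (cxR V)" "a' \<in> carrier (cxR V)" "b \<in> carrier (cxR V)" "b' \<in> carrier (cxR V)"
      using a b by (auto simp: bf_iff)
    note cc = conj_cx_closed[OF V]
    have "(\<Oplus>\<^bsub>cxR V\<^esub>p\<in>insert p S. f p) = f p \<oplus>\<^bsub>cxR V\<^esub> (\<Oplus>\<^bsub>cxR V\<^esub>p\<in>S. f p)"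
      using insert fcar by (subst VC.M.finsum_insert) auto
    also have "\<dots> = (b \<oplus>\<^bsub>cxR V\<^esub> a) \<oplus>\<^bsub>cxR V\<^esub> conj_cx V (b' \<oplus>\<^bsub>cxR V\<^esub> a')"
      unfolding a(3) b(3) conj_cx_add[OF V c(4,2)] using c cc by (simp add: VC.M.a_ac)
    finally show ?case using bf_add[OF b(1) a(1)] bf_add[OF b(2) a(2)] by blast
  qed
  from this[OF f(2)] f(3) show ?thesis by auto
qed

text \<open>Since w - mid is at most mid, such an X has both of the distinct types (mid, w - mid)
  and (w - mid, mid).\<close>

lemma hodge_inter:
  assumes X: "X \<in> bf mid" "X \<in> conj_cx V ` bf mid"
  shows "X = \<zero>\<^bsub>cxR V\<^esub>"
proof (rule hodge_unique[of X mid "weight N - mid"])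
  have m: "weight N - mid \<le> mid" "mid \<noteq> weight N - mid" unfolding mid_def by presburger+
  have "bf mid \<subseteq> bf (weight N - mid)" by (rule bf_mono[OF m(1)])
  thus "X \<in> hodge N mid (weight N - mid)" "X \<in> hodge N (weight N - mid) (weight N - (weight N - mid))"
    using X by (auto simp: hodge_eq)
  show "mid \<noteq> weight N - mid" by (rule m)
qed

abbreviation "F \<equiv> fil N mid"

lemma middle_fil_eq: "middle_fil N = F" by (simp add: middle_fil_def mid_def)

lemma derham_quot_eq: "derham_quot N = quot_mod W F"
  by (simp add: derham_quot_def middle_fil_eq)

abbreviation "Wq \<equiv> quot_mod W F"
abbreviation "proj \<equiv> (\<lambda>y. F +>\<^bsub>W\<^esub> y)"

lemmas Wq = lin_space_quot[OF fil_sub[of mid]]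
lemmas proj_hom = quot_proj_hom[OF fil_sub[of mid]]

lemma W_frame: "\<exists>r b c. frame W r b c"
  using fin_dim_frame[OF W W_fin] by blast

text \<open>In a frame adapted to F, the coordinates of T outside F are its coordinates in the
  quotient; so taking the kernel commutes with base change.\<close>

lemma proj_kernel:
  assumes T: "T \<in> carrier (cxR W)"
  shows "cxm Wq proj T = \<zero>\<^bsub>cxR Wq\<^esub> \<longleftrightarrow> T \<in> fil_cx N mid"
proof
  obtain r0 b0 c0 where fr0: "frame W r0 b0 c0" using W_frame by blast
  obtain s b c where s: "s \<le> r0" and fr: "frame W r0 b c"
    and bF: "\<And>i. s \<le> i \<Longrightarrow> i < r0 \<Longrightarrow> b i \<in> F" and Fc: "F = {x \<in> carrier W. \<forall>i<s. c i x = 0}"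
    by (rule adapted_frame[OF fr0 fil_sub[of mid]]) (rule that)
  interpret W: framed W r0 b c by standard (rule fr)
  obtain d where d: "frame Wq s (\<lambda>i. F +>\<^bsub>W\<^esub> b i) d" "\<And>i x. i < s \<Longrightarrow> x \<in> carrier W \<Longrightarrow> d i (F +>\<^bsub>W\<^esub> x) = c i x"
    using adapted_quot_frame[OF fr fil_sub s Fc] by metis
  interpret Q: framed Wq s "\<lambda>i. F +>\<^bsub>W\<^esub> b i" d by standard (rule d(1))
  assume 0: "cxm Wq proj T = \<zero>\<^bsub>cxR Wq\<^esub>"
  have "coord (c i) T = 0" if i: "i < s" for i
  proof -
    have ir: "i < r0" using i s by simp
    have "coord (c i) T = coord (d i) (cxm Wq proj T)"
      by (rule cxR_hom_eqI[OF W rmod_self coord_hom[OF W W.c_hom[OF ir]]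
            lin_hom_comp[OF cxm_hom[OF W Wq proj_hom] coord_hom[OF Wq Q.c_hom[OF i]]] _ T])
        (use quot_carrier[OF fil_sub] in \<open>auto simp: coord_elt[OF W W.c_hom[OF ir]] cxm_elt[OF W Wq proj_hom]
          coord_elt[OF Wq Q.c_hom[OF i]] d(2)[OF i]\<close>)
    also have "\<dots> = 0" unfolding 0 using rmod_hom_zero[OF rmod_cxR[OF Wq] rmod_self coord_hom[OF Wq Q.c_hom[OF i]]] by simp
    finally show ?thesis .
  qed
  hence t: "coord (c j) T \<odot>\<^bsub>cxR W\<^esub> W.e j \<in> fil_cx N mid" if "j < r0" for j
    using that fil_cx_zero fil_cx_smult[OF fil_cx_elt[OF bF]] by (cases "j < s") auto
  have "(\<Oplus>\<^bsub>cxR W\<^esub>j\<in>J. coord (c j) T \<odot>\<^bsub>cxR W\<^esub> W.e j) \<in> fil_cx N mid" if "finite J" "J \<subseteq> {..<r0}" for J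
    using that
  proof (induction rule: finite_induct)
    case (insert j J)
    thus ?case using t fil_cx_add by (subst WC.M.finsum_insert) auto
  qed (use fil_cx_zero in simp)
  from this[of "{..<r0}"] show "T \<in> fil_cx N mid" using W.cx_expand[OF T] by simp
next
  assume "T \<in> fil_cx N mid"
  then obtain Y where Y: "Y \<in> carrier (cxR (W\<lparr>carrier := F\<rparr>))" "T = cxm W (\<lambda>x. x) Y" by (auto simp: fil_cx_eq)
  interpret QC: rmod "cxR Wq" by (rule rmod_cxR[OF Wq])
  have z: "(\<lambda>_. \<zero>\<^bsub>cxR Wq\<^esub>) \<in> lin_hom (cxR (W\<lparr>carrier := F\<rparr>)) (cxR Wq)" by (rule lin_homI) auto
  have pz: "F +>\<^bsub>W\<^esub> x = \<zero>\<^bsub>Wq\<^esub>" if "x \<in> F" for x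
    unfolding quot_zero[OF fil_sub] using quot_eq_iff[OF fil_sub[of mid], of x "\<zero>\<^bsub>W\<^esub>"] that subsetD[OF fil_subset that]
    by (simp add: a_minus_def)
  have h: "(\<lambda>x. F +>\<^bsub>W\<^esub> x) \<in> lin_hom (W\<lparr>carrier := F\<rparr>) Wq"
    by (rule subspace_hom_restrict[OF proj_hom fil_subset])
  have "cxm Wq proj T = cxm Wq proj Y"
    unfolding Y(2) by (rule cxm_comp[OF fil_space W Wq fil_incl proj_hom Y(1)])
  also have "\<dots> = \<zero>\<^bsub>cxR Wq\<^esub>"
    by (rule cxR_hom_eqI[OF fil_space rmod_cxR[OF Wq] cxm_hom[OF fil_space Wq h] z _ Y(1)])
      (simp add: cxm_elt[OF fil_space Wq h] pz cx_elt_zero_left[OF Wq])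
  finally show "cxm Wq proj T = \<zero>\<^bsub>cxR Wq\<^esub>" .
qed

lemma proj_surj:
  assumes "Y \<in> carrier (cxR Wq)"
  shows "\<exists>T\<in>carrier (cxR W). cxm Wq proj T = Y"
  using assms
proof (induction rule: cxR_induct[OF Wq, consumes 1, case_names zero elt add])
  case zero
  show ?case using rmod_hom_zero[OF rmod_cxR[OF W] rmod_cxR[OF Wq] cxm_hom[OF W Wq proj_hom]] by auto
next
  case (elt y z)
  then obtain x where x: "x \<in> carrier W" "y = F +>\<^bsub>W\<^esub> x" using quot_carrier[OF fil_sub] by auto
  show ?case by (rule bexI[of _ "cx_elt W x z"]) (use x in \<open>auto simp: cxm_elt[OF W Wq proj_hom] cxR_elt_closed[OF W]\<close>)
next
  case (add X Y)
  then obtain S T where "S \<in> carrier (cxR W)" "cxm Wq proj S = X" "T \<in> carrier (cxR W)" "cxm Wq proj T = Y" by auto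
  thus ?case using lin_hom_add[OF cxm_hom[OF W Wq proj_hom]] by (intro bexI[of _ "S \<oplus>\<^bsub>cxR W\<^esub> T"]) auto
qed

definition eig :: "'e \<Rightarrow> 'b set" where "eig s = {x \<in> carrier V. Finf N x = s \<odot>\<^bsub>V\<^esub> x}"

lemma betti_eigen_eq: "betti_eigen N s = V\<lparr>carrier := eig s\<rparr>"
  by (simp add: betti_eigen_def eig_def)

lemma eig_sub: "VectorSpace.subspace class_ring (eig s) V"
proof (rule subspaceI[OF V])
  show "\<zero>\<^bsub>V\<^esub> \<in> eig s" using lin_hom_zero[OF V V Finf_hom] by (simp add: eig_def)
qed (auto simp: eig_def lin_hom_add[OF Finf_hom] lin_hom_smult[OF Finf_hom] V.smult_add_right V.smult_smult mult.commute)

lemmas eig_space = lin_space_subspace[OF eig_sub]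
lemmas eig_subset = lin_space_submodule(3)[OF eig_sub]
lemmas eig_incl = subspace_incl_hom[OF eig_subset]

text \<open>For s = 1 and s = -1 this is 2s times the projection onto the s-eigenspace.\<close>

definition eproj :: "'e \<Rightarrow> 'b \<Rightarrow> 'b" where "eproj s x = s \<odot>\<^bsub>V\<^esub> x \<oplus>\<^bsub>V\<^esub> Finf N x"

lemma eproj_hom_V: "eproj s \<in> lin_hom V V"
  unfolding eproj_def[abs_def] using lin_hom[OF Finf_hom]
  by (intro lin_homI) (auto simp: V.smult_add_right V.smult_smult mult.commute V.M.a_ac)

lemma eproj_eig:
  assumes s: "s * s = 1" and x: "x \<in> carrier V"
  shows "eproj s x \<in> eig s"
proof -
  have Fx: "Finf N x \<in> carrier V" using lin_hom_closed[OF Finf_hom x] .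
  have "Finf N (eproj s x) = s \<odot>\<^bsub>V\<^esub> Finf N x \<oplus>\<^bsub>V\<^esub> x"
    unfolding eproj_def using x Fx by (simp add: lin_hom_add[OF Finf_hom] lin_hom_smult[OF Finf_hom] Finf_Finf)
  also have "\<dots> = s \<odot>\<^bsub>V\<^esub> eproj s x"
    unfolding eproj_def using x Fx s by (simp add: V.smult_add_right V.smult_smult V.M.a_comm)
  finally show ?thesis using lin_hom_closed[OF eproj_hom_V x] by (simp add: eig_def)
qed

lemma eproj_hom: "s * s = 1 \<Longrightarrow> eproj s \<in> lin_hom V (V\<lparr>carrier := eig s\<rparr>)"
  by (rule lin_hom_subspace[OF eproj_hom_V eproj_eig])

definition pmap :: "'e \<Rightarrow> 'b cx \<Rightarrow> 'd set cx" where
  "pmap s X = cxm Wq proj (cmp (cxm V (\<lambda>x. x) X))"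

lemma period_map_eq: "period_map N X = pmap s X"
  by (simp add: period_map_def pmap_def derham_quot_eq middle_fil_eq)

lemma pmap_hom: "pmap s \<in> lin_hom (cxR (V\<lparr>carrier := eig s\<rparr>)) (cxR Wq)"
  unfolding pmap_def[abs_def]
  by (rule lin_hom_comp[OF lin_hom_comp[OF cxm_hom[OF eig_space V eig_incl] cmp_hom] cxm_hom[OF W Wq proj_hom]])

lemma pmap_elt: "x \<in> eig s \<Longrightarrow> pmap s (cx_elt (V\<lparr>carrier := eig s\<rparr>) x 1) = cxm Wq proj (cmp (cx_elt V x 1))"
  unfolding pmap_def using cxm_elt[OF eig_space V eig_incl] by simp

lemma Finf_incl:
  assumes X: "X \<in> carrier (cxR (V\<lparr>carrier := eig s\<rparr>))"
  shows "cxm V (Finf N) (cxm V (\<lambda>x. x) X) = emb s \<odot>\<^bsub>cxR V\<^esub> cxm V (\<lambda>x. x) X"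
proof -
  note i = cxm_hom[OF eig_space V eig_incl]
  have h: "(\<lambda>X. emb s \<odot>\<^bsub>cxR V\<^esub> cxm V (\<lambda>x. x) X) \<in> lin_hom (cxR (V\<lparr>carrier := eig s\<rparr>)) (cxR V)"
    using lin_hom[OF i] by (intro lin_homI) (auto simp: VC.smult_add_right VC.smult_smult mult.commute)
  show ?thesis
  proof (rule cxR_hom_eqI[OF eig_space rmod_cxR[OF V] lin_hom_comp[OF i cxm_hom[OF V V Finf_hom]] h _ X])
    fix x assume "x \<in> carrier (V\<lparr>carrier := eig s\<rparr>)"
    hence x: "x \<in> eig s" "x \<in> carrier V" "Finf N x = s \<odot>\<^bsub>V\<^esub> x" by (auto simp: eig_def)
    thus "cxm V (Finf N) (cxm V (\<lambda>x. x) (cx_elt (V\<lparr>carrier := eig s\<rparr>) x 1))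
        = emb s \<odot>\<^bsub>cxR V\<^esub> cxm V (\<lambda>x. x) (cx_elt (V\<lparr>carrier := eig s\<rparr>) x 1)"
      by (simp add: cxm_elt[OF eig_space V eig_incl] cxm_elt[OF V V Finf_hom] emb_smult_elt[OF V])
  qed
qed

text \<open>The base change of \<open>eproj s\<close> is a left inverse of the inclusion up to the
  invertible factor 2s, so injectivity survives base change.\<close>

lemma eig_incl_inj:
  assumes s: "s * s = 1" and X: "X \<in> carrier (cxR (V\<lparr>carrier := eig s\<rparr>))"
    and 0: "cxm V (\<lambda>x. x) X = \<zero>\<^bsub>cxR V\<^esub>"
  shows "X = \<zero>\<^bsub>cxR (V\<lparr>carrier := eig s\<rparr>)\<^esub>"
proof -
  let ?E = "V\<lparr>carrier := eig s\<rparr>"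
  note E = eig_space[of s]
  interpret E: rmod "cxR ?E" by (rule rmod_cxR[OF E])
  have snz: "s \<noteq> 0" using s by auto
  have h: "(\<lambda>X. emb (2 * s) \<odot>\<^bsub>cxR ?E\<^esub> X) \<in> lin_hom (cxR ?E) (cxR ?E)"
    by (intro lin_homI) (auto simp: E.smult_add_right E.smult_smult mult.commute)
  have "cxm ?E (eproj s) (cxm V (\<lambda>x. x) X) = emb (2 * s) \<odot>\<^bsub>cxR ?E\<^esub> X"
  proof (rule cxR_hom_eqI[OF E rmod_cxR[OF E] lin_hom_comp[OF cxm_hom[OF E V eig_incl] cxm_hom[OF V E eproj_hom[OF s]]] h _ X])
    fix x assume "x \<in> carrier ?E"
    hence x: "x \<in> eig s" "x \<in> carrier V" using eig_subset by auto
    have "eproj s x = (2 * s) \<odot>\<^bsub>V\<^esub> x" using x V.smult_add_left[of x s s] by (simp add: eproj_def eig_def)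
    thus "cxm ?E (eproj s) (cxm V (\<lambda>x. x) (cx_elt ?E x 1)) = emb (2 * s) \<odot>\<^bsub>cxR ?E\<^esub> cx_elt ?E x 1"
      using x emb_smult_elt[OF E, of x "2 * s"]
      by (simp add: cxm_elt[OF E V eig_incl] cxm_elt[OF V E eproj_hom[OF s]])
  qed
  hence "emb (2 * s) \<odot>\<^bsub>cxR ?E\<^esub> X = \<zero>\<^bsub>cxR ?E\<^esub>"
    unfolding 0 using rmod_hom_zero[OF rmod_cxR[OF V] rmod_cxR[OF E] cxm_hom[OF V E eproj_hom[OF s]]] by simp
  hence "emb (1 / (2 * s)) \<odot>\<^bsub>cxR ?E\<^esub> (emb (2 * s) \<odot>\<^bsub>cxR ?E\<^esub> X) = \<zero>\<^bsub>cxR ?E\<^esub>" by simp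
  thus ?thesis using X snz by (simp add: E.smult_smult flip: emb_mult)
qed

text \<open>The involution composed with conjugation corresponds to conjugation on the de Rham side
  and so preserves F. Hence the involution exchanges F with its conjugate, which is a complement of
  F. An s-eigenvector in F therefore lies in both and vanishes, and modulo F every vector can be
  moved into the s-eigenspace.\<close>

lemma pmap_bij:
  assumes vm: "even (weight N) \<longrightarrow> vanishing_middle N" and s: "s = 1 \<or> s = -1"
  shows "bij_betw (pmap s) (carrier (cxR (V\<lparr>carrier := eig s\<rparr>))) (carrier (cxR Wq))"
proof -
  let ?E = "V\<lparr>carrier := eig s\<rparr>"
  let ?i = "cxm V (\<lambda>x. x)" and ?Fi = "cxm V (Finf N)"
  have ss: "s * s = 1" and sr: "s = of_rat (if s = 1 then 1 else -1)" using s by auto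
  \<comment> \<open>Rational scalars can be moved through conjugation, so s is written as a rational
    number.\<close>
  define q :: rat where "q = (if s = 1 then 1 else -1)"
  have sq: "s = of_rat q" using sr by (simp only: q_def)
  note i = cxm_hom[OF eig_space V eig_incl, of s] and Fi = cxm_hom[OF V V Finf_hom] and pr = cxm_hom[OF W Wq proj_hom]
  interpret E: rmod "cxR ?E" by (rule rmod_cxR[OF eig_space])
  interpret Q: rmod "cxR Wq" by (rule rmod_cxR[OF Wq])
  have FF: "?Fi (?Fi X) = X" if "X \<in> carrier (cxR V)" for X
    unfolding cxm_comp[OF V V V Finf_hom Finf_hom that]
    by (rule cxm_cong_id[OF V lin_hom_comp[OF Finf_hom Finf_hom] _ that]) (rule Finf_Finf)
  have ker: "X = \<zero>\<^bsub>cxR ?E\<^esub>" if X: "X \<in> carrier (cxR ?E)" and 0: "pmap s X = \<zero>\<^bsub>cxR Wq\<^esub>" for X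
  proof -
    define Z where "Z = ?i X"
    have Z: "Z \<in> carrier (cxR V)" unfolding Z_def by (rule lin_hom_closed[OF i X])
    have ZH: "Z \<in> bf mid"
      using 0 proj_kernel[OF lin_hom_closed[OF cmp_hom Z]] Z by (simp add: pmap_def Z_def[symmetric] bf_iff)
    define Y where "Y = cx_map V (Finf N) cnj Z"
    have Y: "Y \<in> bf mid" unfolding Y_def by (rule bf_Finf_conj[OF ZH])
    have "conj_cx V Y = conj_cx V (conj_cx V (?Fi Z))" unfolding Y_def conj_cx_map(1)[OF V V Finf_hom Z] ..
    also have "\<dots> = ?Fi Z" by (rule conj_cx_conj[OF V lin_hom_closed[OF Fi Z]])
    also have "\<dots> = emb s \<odot>\<^bsub>cxR V\<^esub> Z" unfolding Z_def by (rule Finf_incl[OF X])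
    finally have "emb s \<odot>\<^bsub>cxR V\<^esub> conj_cx V Y = Z"
      using Z ss by (simp add: VC.smult_smult flip: emb_mult)
    moreover have "emb s \<odot>\<^bsub>cxR V\<^esub> conj_cx V Y = conj_cx V (emb s \<odot>\<^bsub>cxR V\<^esub> Y)"
      unfolding sq using Y by (subst conj_cx_rat[OF V]) (auto simp: bf_iff)
    ultimately have "Z \<in> conj_cx V ` bf mid" using bf_smult[OF Y] by (metis image_eqI)
    from hodge_inter[OF ZH this] show ?thesis using eig_incl_inj[OF ss X] by (simp add: Z_def)
  qed
  have inj: "inj_on (pmap s) (carrier (cxR ?E))"
  proof (rule inj_onI)
    fix X Y assume XY: "X \<in> carrier (cxR ?E)" "Y \<in> carrier (cxR ?E)" "pmap s X = pmap s Y"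
    have c: "pmap s Y \<in> carrier (cxR Wq)" by (rule lin_hom_closed[OF pmap_hom XY(2)])
    have "pmap s (X \<oplus>\<^bsub>cxR ?E\<^esub> (-1) \<odot>\<^bsub>cxR ?E\<^esub> Y) = pmap s Y \<oplus>\<^bsub>cxR Wq\<^esub> (-1) \<odot>\<^bsub>cxR Wq\<^esub> pmap s Y"
      using XY by (simp add: lin_hom_add[OF pmap_hom] lin_hom_smult[OF pmap_hom])
    also have "\<dots> = \<zero>\<^bsub>cxR Wq\<^esub>" using c Q.smult_neg_left[of "pmap s Y" 1] by (simp add: Q.M.r_neg)
    finally have "X \<oplus>\<^bsub>cxR ?E\<^esub> (-1) \<odot>\<^bsub>cxR ?E\<^esub> Y = \<zero>\<^bsub>cxR ?E\<^esub>" using XY by (intro ker) auto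
    thus "X = Y" using E.minus_eq_zero_iff[OF XY(1,2)] E.smult_neg_left[OF XY(2), of 1] XY by (simp add: a_minus_def)
  qed
  have "\<exists>X\<in>carrier (cxR ?E). pmap s X = Y" if Y: "Y \<in> carrier (cxR Wq)" for Y
  proof -
    obtain T where T: "T \<in> carrier (cxR W)" "cxm Wq proj T = Y" using proj_surj[OF Y] by blast
    obtain Z where Z: "Z \<in> carrier (cxR V)" "cmp Z = T" using bij_betw_imp_surj_on[OF cmp_bij] T(1) by (metis imageE)
    obtain h h' where h: "h \<in> bf mid" "h' \<in> bf mid" "Z = h \<oplus>\<^bsub>cxR V\<^esub> conj_cx V h'"
      using hodge_sum[OF vm Z(1)] by blast
    define g where "g = cx_map V (Finf N) cnj h'"
    have g: "g \<in> bf mid" unfolding g_def by (rule bf_Finf_conj[OF h(2)])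
    have c: "h \<in> carrier (cxR V)" "h' \<in> carrier (cxR V)" "g \<in> carrier (cxR V)" using h g by (auto simp: bf_iff)
    have "?Fi g = ?Fi (?Fi (conj_cx V h'))" unfolding g_def conj_cx_map(2)[OF V V Finf_hom c(2)] ..
    also have "\<dots> = conj_cx V h'" by (rule FF[OF conj_cx_closed[OF V c(2)]])
    finally have Fg: "conj_cx V h' = ?Fi g" ..
    \<comment> \<open>As conj h' is the image of g under the involution, s g plus that image is an
      s-eigenvector that differs from Z by an element of F.\<close>
    define X where "X = cxm ?E (eproj s) g"
    have X: "X \<in> carrier (cxR ?E)" unfolding X_def by (rule lin_hom_closed[OF cxm_hom[OF V eig_space eproj_hom[OF ss]] c(3)])
    have h2: "(\<lambda>g. emb s \<odot>\<^bsub>cxR V\<^esub> g \<oplus>\<^bsub>cxR V\<^esub> ?Fi g) \<in> lin_hom (cxR V) (cxR V)"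
      using lin_hom[OF Fi] by (intro lin_homI) (auto simp: VC.smult_add_right VC.smult_smult mult.commute VC.M.a_ac)
    have "?i X = cxm V (eproj s) g" unfolding X_def by (rule cxm_comp[OF V eig_space V eproj_hom[OF ss] eig_incl c(3)])
    also have "\<dots> = emb s \<odot>\<^bsub>cxR V\<^esub> g \<oplus>\<^bsub>cxR V\<^esub> ?Fi g"
      by (rule cxR_hom_eqI[OF V rmod_cxR[OF V] cxm_hom[OF V V eproj_hom_V] h2 _ c(3)])
        (use lin_hom_closed[OF Finf_hom] cx_elt_add_left[OF V] in
          \<open>simp add: cxm_elt[OF V V eproj_hom_V] cxm_elt[OF V V Finf_hom] emb_smult_elt[OF V] eproj_def\<close>)
    finally have iX: "?i X = emb s \<odot>\<^bsub>cxR V\<^esub> g \<oplus>\<^bsub>cxR V\<^esub> ?Fi g" .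
    define k where "k = h \<oplus>\<^bsub>cxR V\<^esub> emb (- s) \<odot>\<^bsub>cxR V\<^esub> g"
    have k: "k \<in> bf mid" unfolding k_def by (intro bf_add bf_smult h g)
    have kc: "k \<in> carrier (cxR V)" using k by (simp add: bf_iff)
    have Fgc: "?Fi g \<in> carrier (cxR V)" by (rule lin_hom_closed[OF Fi c(3)])
    have "emb (- s) \<odot>\<^bsub>cxR V\<^esub> g = \<ominus>\<^bsub>cxR V\<^esub> (emb s \<odot>\<^bsub>cxR V\<^esub> g)"
      using VC.smult_neg_left[OF c(3), of "emb s"] by (simp add: emb.hom_uminus)
    hence "k \<oplus>\<^bsub>cxR V\<^esub> ?i X = Z"
      unfolding k_def iX h(3) Fg using c Fgc
      by (simp add: VC.M.a_assoc VC.M.r_neg1 VC.M.r_neg2)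
    hence "cxm Wq proj (cmp k) \<oplus>\<^bsub>cxR Wq\<^esub> pmap s X = Y"
      using kc lin_hom_closed[OF i X] lin_hom_closed[OF cmp_hom] T Z
      by (simp add: pmap_def lin_hom_add[OF cmp_hom, symmetric] lin_hom_add[OF pr, symmetric])
    moreover have "cxm Wq proj (cmp k) = \<zero>\<^bsub>cxR Wq\<^esub>"
      using k proj_kernel[of "cmp k"] lin_hom_closed[OF cmp_hom kc] by (simp add: bf_iff)
    ultimately have "pmap s X = Y" using lin_hom_closed[OF pmap_hom X] by simp
    thus ?thesis using X by blast
  qed
  thus ?thesis unfolding bij_betw_def using inj lin_hom_closed[OF pmap_hom] by (auto simp: image_iff)
qed

end

section \<open>From \<open>is_det\<close> and the carrier of \<open>EC\<close> to determinants with
  entries of type \<open>ec\<close>\<close>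

section \<open>Determinants over \<open>E \<otimes> \<complex>\<close>\<close>

lemma EC_Rep:
  "carrier (EC :: ('e :: field_char_0) cx ring) = range Rep_ec" "\<zero>\<^bsub>EC\<^esub> = Rep_ec 0" "\<one>\<^bsub>EC\<^esub> = Rep_ec 1"
  "Rep_ec a \<oplus>\<^bsub>EC\<^esub> Rep_ec b = Rep_ec (a + b)" "Rep_ec a \<otimes>\<^bsub>EC\<^esub> Rep_ec b = Rep_ec (a * b)"
proof -
  show "carrier (EC :: 'e cx ring) = range Rep_ec"
    using type_definition.Rep_range[OF type_definition_ec, symmetric] by (simp add: EC_def)
qed (simp_all add: EC_def zero_ec.rep_eq one_ec.rep_eq plus_ec.rep_eq times_ec.rep_eq)

lemma cring_EC: "cring (EC :: ('e :: field_char_0) cx ring)"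
proof (rule cringI)
  show "abelian_group (EC :: 'e cx ring)"
  proof (rule abelian_groupI)
    fix x :: "'e cx" assume "x \<in> carrier EC"
    then obtain a where x: "x = Rep_ec a" by (auto simp: EC_Rep)
    have "Rep_ec (- a) \<oplus>\<^bsub>EC\<^esub> x = \<zero>\<^bsub>EC\<^esub>" unfolding x EC_Rep by simp
    thus "\<exists>y\<in>carrier EC. y \<oplus>\<^bsub>EC\<^esub> x = \<zero>\<^bsub>EC\<^esub>" by (auto simp: EC_Rep(1))
  qed (auto simp: EC_Rep ac_simps)
  show "comm_monoid (EC :: 'e cx ring)"
    by (rule comm_monoidI) (auto simp: EC_Rep ac_simps)
qed (auto simp: EC_Rep algebra_simps)

lemma finsum_EC: "finsum EC (\<lambda>i. Rep_ec (f i)) A = Rep_ec (sum f A)"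
proof -
  interpret cring EC by (rule cring_EC)
  show ?thesis by (induction A rule: infinite_finite_induct) (auto simp: EC_Rep)
qed

lemma finprod_EC: "finprod EC (\<lambda>i. Rep_ec (f i)) A = Rep_ec (prod f A)"
proof -
  interpret cring EC by (rule cring_EC)
  show ?thesis by (induction A rule: infinite_finite_induct) (auto simp: EC_Rep)
qed

lemma a_inv_EC: "\<ominus>\<^bsub>EC\<^esub> Rep_ec a = Rep_ec (- a)"
proof -
  interpret cring EC by (rule cring_EC)
  show ?thesis by (rule minus_equality) (auto simp: EC_Rep)
qed

lemma ring_det_EC: "ring_det EC r (\<lambda>i j. Rep_ec (A i j)) = Rep_ec (fdet r A)"
proof -
  have "(let t = \<Otimes>\<^bsub>EC\<^esub>i\<in>{..<r}. Rep_ec (A i (\<sigma> i)) in if evenperm \<sigma> then t else \<ominus>\<^bsub>EC\<^esub> t)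
      = Rep_ec (of_int (sign \<sigma>) * (\<Prod>i<r. A i (\<sigma> i)))" for \<sigma>
    by (simp add: Let_def finprod_EC a_inv_EC sign_def)
  thus ?thesis by (simp add: ring_det_def finsum_EC fdet_leibniz lessThan_atLeast0)
qed

lemma ring_det_EC_Abs:
  assumes "\<And>i j. i < r \<Longrightarrow> j < r \<Longrightarrow> A i j = Rep_ec (A' i j)"
  shows "ring_det EC r A = Rep_ec (fdet r A')"
proof -
  interpret cring EC by (rule cring_EC)
  have "(\<Otimes>\<^bsub>EC\<^esub>i\<in>{..<r}. A i (\<sigma> i)) = (\<Otimes>\<^bsub>EC\<^esub>i\<in>{..<r}. Rep_ec (A' i (\<sigma> i)))" if "\<sigma> permutes {..<r}" for \<sigma>
    by (rule finprod_cong') (use that assms permutes_in_image[OF that] in \<open>auto simp: EC_Rep\<close>)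
  hence "ring_det EC r A = ring_det EC r (\<lambda>i j. Rep_ec (A' i j))"
    unfolding ring_det_def by (intro finsum_cong') (auto simp: Let_def finprod_EC a_inv_EC EC_Rep)
  thus ?thesis by (simp add: ring_det_EC)
qed

lemma fdet_emb: "fdet k (\<lambda>i j. emb (A i j)) = emb (fdet k A)"
  by (simp add: fdet_leibniz emb.hom_sum emb.hom_mult emb.hom_prod emb.hom_of_int)

text \<open>The matrix in \<open>is_det\<close> is determined by the bases: its entries are the
  coordinates of the images of the source basis.\<close>

lemma is_det_frames:
  assumes d: "is_det U Q f \<delta>" and U: "lin_space U" and Q: "lin_space Q" and f: "f \<in> lin_hom (cxR U) (cxR Q)"
  obtains r b c d dc where "frame U r b c" "frame Q r d dc"
    "\<delta> = Rep_ec (fdet r (\<lambda>i j. coord (dc i) (f (cx_elt U (b j) 1))))"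
proof -
  obtain bs ds A where bd: "ordered_basis U bs" "ordered_basis Q ds" "length bs = length ds"
      and A: "\<And>i j. i < length ds \<Longrightarrow> j < length bs \<Longrightarrow> A i j \<in> carrier EC"
      and fA: "\<And>j. j < length bs \<Longrightarrow> f (cx_elt U (bs ! j) 1) = (\<Oplus>\<^bsub>cx Q\<^esub>i\<in>{..<length ds}. A i j \<odot>\<^bsub>cx Q\<^esub> cx_elt Q (ds ! i) 1)"
      and \<delta>: "\<delta> = ring_det EC (length bs) A"
    using d unfolding is_det_def by blast
  obtain c where c: "frame U (length bs) ((!) bs) c" using lin_space.ordered_basis_imp_frame[OF U bd(1)] by blast
  obtain dc where dc: "frame Q (length ds) ((!) ds) dc" using lin_space.ordered_basis_imp_frame[OF Q bd(2)] by blast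
  interpret Q: framed Q "length ds" "(!) ds" dc by standard (rule dc)
  have Ac: "A i j \<in> carrier (cxR scalarE)" if "i < length ds" "j < length bs" for i j using A[OF that] by (simp add: EC_def)
  have "A i j = Rep_ec (coord (dc i) (f (cx_elt U (bs ! j) 1)))" if ij: "i < length bs" "j < length bs" for i j
  proof -
    have "f (cx_elt U (bs ! j) 1) = (\<Oplus>\<^bsub>cxR Q\<^esub>i\<in>{..<length ds}. Abs_ec (A i j) \<odot>\<^bsub>cxR Q\<^esub> cx_elt Q (ds ! i) 1)"
      unfolding fA[OF ij(2)] finsum_cx
      by (rule Q.C.M.finsum_cong') (use Ac ij in \<open>auto simp: cx_smult_Abs cx_def\<close>)
    hence "coord (dc i) (f (cx_elt U (bs ! j) 1)) = Abs_ec (A i j)"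
      using Q.coord_sum[of i "\<lambda>i. Abs_ec (A i j)"] ij bd(3) by simp
    thus ?thesis using Ac[of i j] ij bd(3) by (simp add: Abs_ec_inverse)
  qed
  hence "\<delta> = Rep_ec (fdet (length bs) (\<lambda>i j. coord (dc i) (f (cx_elt U (bs ! j) 1))))"
    unfolding \<delta> by (rule ring_det_EC_Abs)
  thus ?thesis using that[OF c] dc bd(3) by simp
qed

text \<open>Existence makes the choice by \<open>SOME\<close> in \<open>period_class\<close> return
  an actual determinant.\<close>

lemma is_det_exists:
  assumes b: "frame U r b c" and d: "frame Q r d dc" and f: "f \<in> lin_hom (cxR U) (cxR Q)"
  shows "\<exists>\<delta>. is_det U Q f \<delta>"
proof -
  interpret U: framed U r b c by standard (rule b)
  interpret Q: framed Q r d dc by standard (rule d)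
  let ?bs = "map b [0..<r]" and ?ds = "map d [0..<r]"
  let ?A = "\<lambda>i j. Rep_ec (coord (dc i) (f (U.e j)))"
  have "f (cx_elt U (?bs ! j) 1) = (\<Oplus>\<^bsub>cx Q\<^esub>i\<in>{..<length ?ds}. ?A i j \<odot>\<^bsub>cx Q\<^esub> cx_elt Q (?ds ! i) 1)"
    if j: "j < length ?bs" for j
  proof -
    have "f (U.e j) = (\<Oplus>\<^bsub>cxR Q\<^esub>i\<in>{..<r}. coord (dc i) (f (U.e j)) \<odot>\<^bsub>cxR Q\<^esub> Q.e i)"
      using j by (intro Q.cx_expand lin_hom_closed[OF f]) simp
    also have "\<dots> = (\<Oplus>\<^bsub>cxR Q\<^esub>i\<in>{..<length ?ds}. ?A i j \<odot>\<^bsub>cx Q\<^esub> cx_elt Q (?ds ! i) 1)"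
    proof (rule Q.C.M.finsum_cong')
      fix i assume "i \<in> {..<length ?ds}"
      thus "coord (dc i) (f (U.e j)) \<odot>\<^bsub>cxR Q\<^esub> Q.e i = ?A i j \<odot>\<^bsub>cx Q\<^esub> cx_elt Q (?ds ! i) 1"
        by (simp add: cx_def cxR_smult)
    next
      have "?A i j \<odot>\<^bsub>cx Q\<^esub> cx_elt Q (?ds ! i) 1 = coord (dc i) (f (U.e j)) \<odot>\<^bsub>cxR Q\<^esub> Q.e i" if "i < r" for i
        using that by (simp add: cx_def cxR_smult)
      thus "(\<lambda>i. ?A i j \<odot>\<^bsub>cx Q\<^esub> cx_elt Q (?ds ! i) 1) \<in> {..<length ?ds} \<rightarrow> carrier (cxR Q)" by auto
    qed simp
    finally show ?thesis using j by simp
  qed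
  thus ?thesis
    unfolding is_det_def using U.frame_imp_ordered_basis Q.frame_imp_ordered_basis
    by (intro exI[of _ "ring_det EC (length ?bs) ?A"] exI[of _ ?bs] exI[of _ ?ds] exI[of _ ?A]) (auto simp: EC_Rep)
qed

text \<open>The factor e is absorbed by substituting h / e for h in the description of the
  coset.\<close>

lemma units_coset_eq:
  fixes a b :: "'e :: field_char_0 ec"
  assumes "b = emb e * a" "e \<noteq> 0"
  shows "E_units #>\<^bsub>units_of EC\<^esub> Rep_ec a = E_units #>\<^bsub>units_of EC\<^esub> Rep_ec b"
proof -
  have E: "E_units = {Rep_ec (emb h) | h :: 'e. h \<noteq> 0}"
    by (simp add: E_units_def emb_def tens.rep_eq)
  have c: "E_units #>\<^bsub>units_of EC\<^esub> Rep_ec x = {Rep_ec (emb h * x) | h :: 'e. h \<noteq> 0}" for x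
  proof -
    have "E_units #>\<^bsub>units_of EC\<^esub> Rep_ec x = (\<Union>y\<in>E_units. {y \<otimes>\<^bsub>EC\<^esub> Rep_ec x})"
      by (simp only: r_coset_def units_of_def monoid.simps)
    also have "\<dots> = {Rep_ec (emb h) \<otimes>\<^bsub>EC\<^esub> Rep_ec x | h :: 'e. h \<noteq> 0}" unfolding E by blast
    also have "\<dots> = {Rep_ec (emb h * x) | h :: 'e. h \<noteq> 0}" by (simp only: EC_Rep)
    finally show ?thesis .
  qed
  show ?thesis unfolding c assms(1)
  proof (intro equalityI subsetI; clarsimp)
    fix h :: 'e assume "h \<noteq> 0"
    thus "\<exists>k. Rep_ec (emb h * a) = Rep_ec (emb k * (emb e * a)) \<and> k \<noteq> 0"
      using assms(2) by (intro exI[of _ "h / e"]) (simp add: emb_mult[symmetric] mult.assoc[symmetric])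
  next
    fix h :: 'e assume "h \<noteq> 0"
    thus "\<exists>k. Rep_ec (emb h * (emb e * a)) = Rep_ec (emb k * a) \<and> k \<noteq> 0"
      using assms(2) by (intro exI[of _ "h * e"]) (simp add: emb_mult mult.assoc)
  qed
qed

section \<open>Comparison isomorphisms of tensor products\<close>

lemma cxR_hom_cxE: "f \<in> lin_hom (cxR A) (cxR V) \<Longrightarrow> f \<in> lin_hom (cxE A) (cxE V)"
  by (rule lin_homI) (auto simp: lin_hom)

lemma cmp_elt_hom:
  assumes "lin_space V" "c \<in> lin_hom (cxR V) (cxR W)"
  shows "(\<lambda>x. c (cx_elt V x 1)) \<in> lin_hom V (cxE W)"
  by (rule lin_hom_comp[OF cx_elt_hom_cxE[OF assms(1)] cxR_hom_cxE[OF assms(2)]])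

text \<open>The comparison of a tensor product is defined by two nested extensions. Bilinearity of
  \<open>cx_tensor\<close> shows that they respect the relations, so the comparison can be evaluated
  on pure tensors.\<close>

lemma tensor_sys_cmp_elt:
  assumes sp: "lin_space (betti M)" "lin_space (derham M)" "lin_space (betti N)" "lin_space (derham N)"
    and c: "comparison M \<in> lin_hom (cxR (betti M)) (cxR (derham M))" "comparison N \<in> lin_hom (cxR (betti N)) (cxR (derham N))"
    and x: "x \<in> carrier (betti M)" and y: "y \<in> carrier (betti N)"
  shows "comparison (tensor_sys M N) (cx_elt (tensor_mod (betti M) (betti N)) (tensor_elt (betti M) (betti N) x y) 1)
      = cx_tensor (derham M) (derham N) (comparison M (cx_elt (betti M) x 1)) (comparison N (cx_elt (betti N) y 1))"
proof -
  let ?T = "tensor_mod (derham M) (derham N)" and ?TB = "tensor_mod (betti M) (betti N)"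
  have T: "lin_space ?T" "lin_space ?TB" using sp by (auto intro: lin_space_tensor)
  let ?f = "\<lambda>x y. cx_tensor (derham M) (derham N) (comparison M (cx_elt (betti M) x 1)) (comparison N (cx_elt (betti N) y 1))"
  have b: "bilin (betti M) (betti N) (cxE ?T) ?f"
  proof (rule bilinI)
    fix x assume "x \<in> carrier (betti M)"
    hence "comparison M (cx_elt (betti M) x 1) \<in> carrier (cxR (derham M))"
      by (intro lin_hom_closed[OF c(1)] cxR_elt_closed sp)
    from lin_hom_comp[OF cmp_elt_hom[OF sp(3) c(2)] cxR_hom_cxE[OF cx_tensor_hom_right[OF sp(2,4) this]]]
    show "?f x \<in> lin_hom (betti N) (cxE ?T)" .
  next
    fix y assume "y \<in> carrier (betti N)"
    hence "comparison N (cx_elt (betti N) y 1) \<in> carrier (cxR (derham N))"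
      by (intro lin_hom_closed[OF c(2)] cxR_elt_closed sp)
    from lin_hom_comp[OF cmp_elt_hom[OF sp(1) c(1)] cxR_hom_cxE[OF cx_tensor_hom_left[OF sp(2,4) this]]]
    show "(\<lambda>x. ?f x y) \<in> lin_hom (betti M) (cxE ?T)" .
  qed
  note h = tensor_lift_hom[OF sp(1,3) lin_space_cxE[OF T(1)] b] and e = tensor_lift_elt[OF sp(1,3) lin_space_cxE[OF T(1)] b]
  have eq: "comparison (tensor_sys M N) = cx_extend ?T (extend_lin (cxE ?T) (\<lambda>(x, y). ?f x y))"
    by (simp add: tensor_sys_def)
  show ?thesis
    unfolding eq using cx_extend_elt[OF T(2,1) h tensor_elt_closed[OF sp(1,3) x y]] e[OF x y] by simp
qed

lemma cx_tensor_expand: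
  assumes V: "frame V r b c" and W: "frame W s d e" and f: "f \<in> lin_hom (cxR (tensor_mod V W)) N" and N: "rmod N"
    and X: "X \<in> carrier (cxR V)" and Y: "Y \<in> carrier (cxR W)" and g: "g \<in> lin_hom N self_mod"
  shows "g (f (cx_tensor V W X Y)) = (\<Sum>i<r. \<Sum>k<s. coord (c i) X * coord (e k) Y *
    g (f (cx_elt (tensor_mod V W) (tensor_elt V W (b i) (d k)) 1)))"
proof -
  interpret V: framed V r b c by standard (rule V)
  interpret W: framed W s d e by standard (rule W)
  note gf = lin_hom_comp[OF f g]
  have "g (f (cx_tensor V W X Y)) = (\<Sum>i<r. coord (c i) X * g (f (cx_tensor V W (V.e i) Y)))"
    using V.hom_expand[OF rmod_self lin_hom_comp[OF cx_tensor_hom_left[OF V.V W.V Y] gf] X] by simp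
  also have "\<dots> = (\<Sum>i<r. coord (c i) X * (\<Sum>k<s. coord (e k) Y * g (f (cx_tensor V W (V.e i) (W.e k)))))"
  proof (rule sum.cong[OF refl])
    fix i assume "i \<in> {..<r}"
    hence "V.e i \<in> carrier (cxR V)" by simp
    from W.hom_expand[OF rmod_self lin_hom_comp[OF cx_tensor_hom_right[OF V.V W.V this] gf] Y]
    show "coord (c i) X * g (f (cx_tensor V W (V.e i) Y))
        = coord (c i) X * (\<Sum>k<s. coord (e k) Y * g (f (cx_tensor V W (V.e i) (W.e k))))" by simp
  qed
  also have "\<dots> = (\<Sum>i<r. \<Sum>k<s. coord (c i) X * coord (e k) Y *
      g (f (cx_elt (tensor_mod V W) (tensor_elt V W (b i) (d k)) 1)))"
    by (simp add: sum_distrib_left mult.assoc cx_tensor_elt[OF V.V W.V])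
  finally show ?thesis .
qed

section \<open>Consequences of a pairing: orthogonality, isotropy and the Gram relation\<close>

section \<open>Paired systems\<close>

text \<open>Apply \<open>frame_iso\<close> to the identity of V \<otimes> \<complex>.\<close>

lemma frame_rank_unique:
  fixes V :: "('e :: field_char_0, 'v) module"
  assumes "frame V r b c" "frame V s d e"
  shows "r = s"
proof (rule frame_iso(1)[OF assms])
  show "(\<lambda>x. x) \<in> lin_hom (cxR V) (cxR V)" by (rule lin_homI) auto
qed (simp add: bij_betw_def)

lemma sum_double:
  fixes f :: "nat \<Rightarrow> 'a :: comm_monoid_add"
  shows "(\<Sum>i<2*n. f i) = (\<Sum>i<n. f i) + (\<Sum>i<n. f (n + i))"
proof -
  have "(\<Sum>i<n+m. f i) = (\<Sum>i<n. f i) + (\<Sum>i<m. f (n + i))" for m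
    by (induction m) (simp_all add: add.assoc)
  from this[of n] show ?thesis by (simp add: mult_2)
qed

lemma bdr_hom_components:
  assumes "bdr_hom M N f g"
  shows "f \<in> lin_hom (betti M) (betti N)" "g \<in> lin_hom (derham M) (derham N)"
    "\<And>x. x \<in> carrier (betti M) \<Longrightarrow> f (Finf M x) = Finf N (f x)"
    "\<And>p. g ` fil M p \<subseteq> fil N p"
    "\<And>X. X \<in> carrier (cxR (betti M)) \<Longrightarrow> comparison N (cxm (betti N) f X) = cxm (derham N) g (comparison M X)"
    "weight M \<noteq> weight N \<Longrightarrow> y \<in> carrier (derham M) \<Longrightarrow> g y = \<zero>\<^bsub>derham N\<^esub>"
  using assms unfolding bdr_hom_def by auto

text \<open>On a line, a nonzero vector in the filtration step makes the step everything. Then the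
  whole Betti space has type (p, w - p) and, as p > w - p, also type (w - p, p), so it vanishes,
  against rank one.\<close>

lemma (in bdr_system) rank_one_fil:
  assumes fr: "frame W 1 w g" and p: "2 * p > weight N" and x: "x \<in> fil N p"
  shows "x = \<zero>\<^bsub>W\<^esub>"
proof (rule ccontr)
  assume nz: "x \<noteq> \<zero>\<^bsub>W\<^esub>"
  interpret W1: framed W 1 w g by standard (rule fr)
  have xc: "x \<in> carrier W" using x fil_subset by auto
  have gx: "g 0 x \<noteq> 0" using W1.c_zero[OF xc] nz by auto
  have all: "y \<in> fil N p" if y: "y \<in> carrier W" for y
  proof -
    have "y = (g 0 y / g 0 x) \<odot>\<^bsub>W\<^esub> x"
      by (rule W1.eqI) (use y xc gx lin_hom_smult[OF W1.c_hom] in auto)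
    thus ?thesis using lin_space_submodule(2)[OF fil_sub x] by metis
  qed
  have fcx: "T \<in> fil_cx N p" if "T \<in> carrier (cxR W)" for T
    using that
  proof (induction rule: cxR_induct[OF W, consumes 1, case_names zero elt add])
    case zero show ?case by (rule fil_cx_zero)
  next
    case (elt x z) show ?case by (rule fil_cx_elt[OF all[OF elt]])
  next
    case (add X Y) show ?case by (rule fil_cx_add[OF add(3,4)])
  qed
  have bfp: "X \<in> bf p" if "X \<in> carrier (cxR V)" for X
    using that fcx lin_hom_closed[OF cmp_hom that] by (simp add: bf_iff)
  have bfq: "X \<in> bf (weight N - p)" if "X \<in> carrier (cxR V)" for X
    using bf_mono[of "weight N - p" p] bfp[OF that] p by auto
  have "X \<in> conj_cx V ` bf q" if X: "X \<in> carrier (cxR V)" and q: "\<And>X. X \<in> carrier (cxR V) \<Longrightarrow> X \<in> bf q" for X q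
    using conj_cx_conj[OF V X] q[OF conj_cx_closed[OF V X]] by (metis image_eqI)
  hence "X \<in> hodge N p (weight N - p)" "X \<in> hodge N (weight N - p) (weight N - (weight N - p))"
    if "X \<in> carrier (cxR V)" for X
    using that bfp bfq by (auto simp: hodge_eq)
  hence V0: "X = \<zero>\<^bsub>cxR V\<^esub>" if "X \<in> carrier (cxR V)" for X
    using hodge_unique[of X p "weight N - p"] that p by auto
  have "W1.e 0 \<in> carrier (cxR W)" by simp
  then obtain Z where Z: "Z \<in> carrier (cxR V)" "cmp Z = W1.e 0" using bij_betw_imp_surj_on[OF cmp_bij] by (metis imageE)
  have "W1.e 0 = \<zero>\<^bsub>cxR W\<^esub>" using Z V0[OF Z(1)] rmod_hom_zero[OF rmod_cxR[OF V] rmod_cxR[OF W] cmp_hom] by simp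
  moreover have "coord (g 0) \<zero>\<^bsub>cxR W\<^esub> = 0"
    using rmod_hom_zero[OF rmod_cxR[OF W] rmod_self coord_hom[OF W W1.c_hom[of 0]]] by simp
  ultimately show False using W1.coord_e[of 0 0] by simp
qed

text \<open>Frames of both realizations of L are fixed so that the two pairings take values in E;
  the comparison of L is then the single scalar \<open>lam\<close>.\<close>

locale bdr_pairing = M: bdr_system M + L: bdr_system L
  for M :: "('e :: number_field, 'b, 'd) bdr" and L :: "('e, 'l, 'm) bdr" +
  fixes B :: "('b \<times> 'b \<Rightarrow>\<^sub>0 'e) set \<Rightarrow> 'l" and BdR :: "('d \<times> 'd \<Rightarrow>\<^sub>0 'e) set \<Rightarrow> 'm"
    and n :: nat and l0 :: "nat \<Rightarrow> 'l" and l1 :: "nat \<Rightarrow> 'l \<Rightarrow> 'e" and m0 :: "nat \<Rightarrow> 'm" and m1 :: "nat \<Rightarrow> 'm \<Rightarrow> 'e"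
  assumes B: "bdr_hom (tensor_sys M M) L B BdR"
    and nd: "nondegenerate_form (betti M) (betti L) B"
    and FL: "\<And>x. x \<in> carrier (betti L) \<Longrightarrow> Finf L x = x"
    and l: "frame (betti L) 1 l0 l1" and m: "frame (derham L) 1 m0 m1"
begin

sublocale l: framed "betti L" 1 l0 l1 by standard (rule l)
sublocale m: framed "derham L" 1 m0 m1 by standard (rule m)

definition bB :: "'b \<Rightarrow> 'b \<Rightarrow> 'e" where "bB x y = l1 0 (B (tensor_elt M.V M.V x y))"
definition bD :: "'d \<Rightarrow> 'd \<Rightarrow> 'e" where "bD x y = m1 0 (BdR (tensor_elt M.W M.W x y))"
definition lam :: "'e ec" where "lam = coord (m1 0) (L.cmp (cx_elt L.V (l0 0) 1))"

lemma tensor_sys_simps [simp]: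
  "betti (tensor_sys M M) = tensor_mod M.V M.V" "derham (tensor_sys M M) = tensor_mod M.W M.W"
  "weight (tensor_sys M M) = 2 * weight M"
  "Finf (tensor_sys M M) = tensor_map M.V M.V (Finf M) (Finf M)"
  by (simp_all add: tensor_sys_def)

lemmas B_hom = bdr_hom_components(1)[OF B, simplified]
lemmas BdR_hom = bdr_hom_components(2)[OF B, simplified]
lemmas TB = lin_space_tensor[OF M.V M.V] and TD = lin_space_tensor[OF M.W M.W]

lemma B_closed: "x \<in> carrier M.V \<Longrightarrow> y \<in> carrier M.V \<Longrightarrow> B (tensor_elt M.V M.V x y) \<in> carrier L.V"
  by (rule lin_hom_closed[OF B_hom tensor_elt_closed[OF M.V M.V]])

lemma bB_lin_left: "y \<in> carrier M.V \<Longrightarrow> (\<lambda>x. bB x y) \<in> lin_hom M.V scalar_mod"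
  unfolding bB_def by (rule lin_hom_comp[OF lin_hom_comp[OF tensor_elt_lin_left[OF M.V M.V] B_hom] l.c_hom]) simp_all

lemma bB_lin_right: "x \<in> carrier M.V \<Longrightarrow> bB x \<in> lin_hom M.V scalar_mod"
  unfolding bB_def[abs_def] by (rule lin_hom_comp[OF lin_hom_comp[OF tensor_elt_lin_right[OF M.V M.V] B_hom] l.c_hom]) simp_all

lemma bB_eq_0_iff: "x \<in> carrier M.V \<Longrightarrow> y \<in> carrier M.V \<Longrightarrow> bB x y = 0 \<longleftrightarrow> pairing M.V B x y = \<zero>\<^bsub>L.V\<^esub>"
  using l.c_zero[OF B_closed, of x y] lin_hom_zero[OF L.V lin_space_scalar l.c_hom[of 0]] by (auto simp: bB_def pairing_def)

lemma bB_nondegenerate: "y \<in> carrier M.V \<Longrightarrow> (\<And>x. x \<in> carrier M.V \<Longrightarrow> bB x y = 0) \<Longrightarrow> y = \<zero>\<^bsub>M.V\<^esub>"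
  using nd bB_eq_0_iff unfolding nondegenerate_form_def by blast

text \<open>The comparison of L is surjective, so some multiple of the image of the source generator
  is the target generator.\<close>

lemma lam_unit: "\<exists>mu. mu * lam = 1"
proof -
  have "m.e 0 \<in> L.cmp ` carrier (cxR L.V)" unfolding bij_betw_imp_surj_on[OF L.cmp_bij] by simp
  then obtain Z where Z: "Z \<in> carrier (cxR L.V)" "L.cmp Z = m.e 0" by (elim imageE) simp
  have h: "(\<lambda>Z. coord (m1 0) (L.cmp Z)) \<in> lin_hom (cxR L.V) self_mod"
    by (rule lin_hom_comp[OF L.cmp_hom coord_hom[OF L.W m.c_hom]]) simp
  have "coord (m1 0) (L.cmp Z) = coord (l1 0) Z * lam"
    using l.hom_expand[OF rmod_self h Z(1)] by (simp add: lam_def)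
  thus ?thesis using Z(2) m.coord_e[of 0 0] by (intro exI[of _ "coord (l1 0) Z"]) simp
qed

lemma eigen_orthogonal:
  assumes x: "x \<in> M.eig 1" and y: "y \<in> M.eig (-1)"
  shows "bB x y = 0" "bB y x = 0"
proof -
  have c: "x \<in> carrier M.V" "y \<in> carrier M.V" using x y by (auto simp: M.eig_def)
  have Fx: "Finf M x = x" "Finf M y = (-1) \<odot>\<^bsub>M.V\<^esub> y" using x y c by (auto simp: M.eig_def)
  have b: "bilin M.V M.V (tensor_mod M.V M.V) (\<lambda>x y. tensor_elt M.V M.V (Finf M x) (Finf M y))"
    by (rule bilinI)
      (auto intro!: lin_hom_comp[OF M.Finf_hom tensor_elt_lin_right[OF M.V M.V]] lin_hom_comp[OF M.Finf_hom tensor_elt_lin_left[OF M.V M.V]]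
        lin_hom_closed[OF M.Finf_hom])
  \<comment> \<open>The involution fixes L, so it is an isometry of the pairing; for eigenvectors of
    opposite sign this makes their pairing equal to its negative.\<close>
  have F: "bB (Finf M u) (Finf M v) = bB u v" if "u \<in> carrier M.V" "v \<in> carrier M.V" for u v
  proof -
    have "tensor_map M.V M.V (Finf M) (Finf M) (tensor_elt M.V M.V u v) = tensor_elt M.V M.V (Finf M u) (Finf M v)"
      unfolding tensor_map_def by (rule tensor_lift_elt[OF M.V M.V TB b that])
    thus ?thesis
      using bdr_hom_components(3)[OF B, of "tensor_elt M.V M.V u v"] tensor_elt_closed[OF M.V M.V that] FL[OF B_closed[OF that]]
      by (simp add: bB_def)
  qed
  have "bB x y = - bB x y" using F[OF c] Fx lin_hom_smult[OF bB_lin_right[OF c(1)] c(2), of "-1"] by simp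
  hence "2 * bB x y = 0" by (metis add.right_inverse mult_2)
  thus "bB x y = 0" by (simp only: mult_eq_0_iff) simp
  have "bB y x = - bB y x" using F[OF c(2,1)] Fx lin_hom_smult[OF bB_lin_left[OF c(1)] c(2), of "-1"] by simp
  hence "2 * bB y x = 0" by (metis add.right_inverse mult_2)
  thus "bB y x = 0" by (simp only: mult_eq_0_iff) simp
qed

text \<open>The product of two elements of F lies in step 2 mid of the filtration of M \<otimes> M.
  For L of weight 2w, that step of L is zero by \<open>rank_one_fil\<close>, because 4 mid exceeds
  2w.\<close>

lemma isotropic:
  assumes x: "x \<in> M.F" and y: "y \<in> M.F"
  shows "bD x y = 0"
proof -
  have c: "x \<in> carrier M.W" "y \<in> carrier M.W" using x y M.fil_subset by auto
  let ?t = "tensor_elt M.W M.W x y"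
  have tc: "?t \<in> carrier (tensor_mod M.W M.W)" by (rule tensor_elt_closed[OF M.W M.W c])
  have "BdR ?t = \<zero>\<^bsub>L.W\<^esub>"
  proof (cases "weight L = 2 * weight M")
    \<comment> \<open>A morphism between systems of different weights is zero.\<close>
    case False
    thus ?thesis using bdr_hom_components(6)[OF B, of ?t] tc by simp
  next
    case True
    interpret TD: lin_space "tensor_mod M.W M.W" by (rule TD)
    have "?t \<in> fil (tensor_sys M M) (2 * M.mid)"
    proof -
      let ?S = "{tensor_elt M.W M.W x y | x y p q. x \<in> fil M p \<and> y \<in> fil M q \<and> p + q = 2 * M.mid}"
      have "?S \<subseteq> carrier (tensor_mod M.W M.W)"
        by (auto intro!: tensor_elt_closed[OF M.W M.W] dest: subsetD[OF M.fil_subset])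
      moreover have "?t \<in> ?S" using x y by force
      ultimately have "?t \<in> TD.M.span ?S" by (rule subsetD[OF TD.M.in_own_span])
      thus ?thesis by (simp add: tensor_sys_def)
    qed
    hence "BdR ?t \<in> fil L (2 * M.mid)" using bdr_hom_components(4)[OF B] by blast
    moreover have "2 * (2 * M.mid) > weight L" unfolding True M.mid_def by presburger
    ultimately show ?thesis by (intro L.rank_one_fil[OF m])
  qed
  thus ?thesis using lin_hom_zero[OF L.W lin_space_scalar m.c_hom[of 0]] by (simp add: bD_def)
qed

text \<open>Compatibility of B with the comparisons, evaluated at the pure tensor of x and y: the de
  Rham side gives the double sum, the comparison of L the factor \<open>lam\<close>. On basis
  vectors this is the matrix relation between P, G and D.\<close>

lemma gram_relation:
  assumes W: "frame M.W r w cw" and x: "x \<in> carrier M.V" and y: "y \<in> carrier M.V"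
  shows "(\<Sum>i<r. \<Sum>k<r. coord (cw i) (M.cmp (cx_elt M.V x 1)) * coord (cw k) (M.cmp (cx_elt M.V y 1)) * emb (bD (w i) (w k)))
    = lam * emb (bB x y)"
proof -
  interpret W: framed M.W r w cw by standard (rule W)
  let ?X = "M.cmp (cx_elt M.V x 1)" and ?Y = "M.cmp (cx_elt M.V y 1)"
  let ?t = "tensor_elt M.V M.V x y" and ?T = "tensor_mod M.V M.V"
  have XY: "?X \<in> carrier (cxR M.W)" "?Y \<in> carrier (cxR M.W)"
    by (auto intro!: lin_hom_closed[OF M.cmp_hom] cxR_elt_closed[OF M.V] x y)
  have tc: "?t \<in> carrier ?T" by (rule tensor_elt_closed[OF M.V M.V x y])
  note g = coord_hom[OF L.W m.c_hom[of 0, simplified]]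
  have "coord (m1 0) (L.cmp (cxm L.V B (cx_elt ?T ?t 1))) = coord (m1 0) (cxm L.W BdR (comparison (tensor_sys M M) (cx_elt ?T ?t 1)))"
    using bdr_hom_components(5)[OF B, of "cx_elt ?T ?t 1"] cxR_elt_closed[OF TB tc] by simp
  also have "comparison (tensor_sys M M) (cx_elt ?T ?t 1) = cx_tensor M.W M.W ?X ?Y"
    by (rule tensor_sys_cmp_elt[OF M.V M.W M.V M.W M.cmp_hom M.cmp_hom x y])
  also have "coord (m1 0) (cxm L.W BdR (cx_tensor M.W M.W ?X ?Y)) = (\<Sum>i<r. \<Sum>k<r. coord (cw i) ?X * coord (cw k) ?Y *
      coord (m1 0) (cxm L.W BdR (cx_elt (tensor_mod M.W M.W) (tensor_elt M.W M.W (w i) (w k)) 1)))"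
    by (rule cx_tensor_expand[OF W W cxm_hom[OF TD L.W BdR_hom] rmod_cxR[OF L.W] XY g])
  also have "\<dots> = (\<Sum>i<r. \<Sum>k<r. coord (cw i) ?X * coord (cw k) ?Y * emb (bD (w i) (w k)))"
  proof (intro sum.cong refl arg_cong2[of _ _ _ _ "(*)"])
    fix i k assume "i \<in> {..<r}" "k \<in> {..<r}"
    hence t: "tensor_elt M.W M.W (w i) (w k) \<in> carrier (tensor_mod M.W M.W)" by (auto intro: tensor_elt_closed[OF M.W M.W])
    show "coord (m1 0) (cxm L.W BdR (cx_elt (tensor_mod M.W M.W) (tensor_elt M.W M.W (w i) (w k)) 1)) = emb (bD (w i) (w k))"
      unfolding cxm_elt[OF TD L.W BdR_hom t] using coord_elt[OF L.W m.c_hom[of 0] lin_hom_closed[OF BdR_hom t], of 1]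
      by (simp add: emb_def bD_def)
  qed
  also have "coord (m1 0) (L.cmp (cxm L.V B (cx_elt ?T ?t 1))) = lam * emb (bB x y)"
  proof -
    have h: "(\<lambda>Z. coord (m1 0) (L.cmp Z)) \<in> lin_hom (cxR L.V) self_mod" by (rule lin_hom_comp[OF L.cmp_hom g])
    have "cxm L.V B (cx_elt ?T ?t 1) = cx_elt L.V (B ?t) 1" by (rule cxm_elt[OF TB L.V B_hom tc])
    moreover have "coord (m1 0) (L.cmp (cx_elt L.V (B ?t) 1)) = coord (l1 0) (cx_elt L.V (B ?t) 1) * lam"
      using l.hom_expand[OF rmod_self h cxR_elt_closed[OF L.V B_closed[OF x y]]] by (simp add: lam_def)
    moreover have "coord (l1 0) (cx_elt L.V (B ?t) 1) = emb (bB x y)"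
      using coord_elt[OF L.V l.c_hom[of 0] B_closed[OF x y], of 1] by (simp add: emb_def bB_def)
    ultimately show ?thesis by (simp add: mult.commute)
  qed
  finally show ?thesis by simp
qed

text \<open>A kernel vector of the Gram matrix gives a vector in the right radical of the
  pairing.\<close>

lemma gram_nonsingular:
  assumes V: "frame M.V r v cv"
  shows "fdet r (\<lambda>i j. bB (v i) (v j)) \<noteq> 0"
proof
  interpret V: framed M.V r v cv by standard (rule V)
  assume "fdet r (\<lambda>i j. bB (v i) (v j)) = 0"
  then obtain u i where u: "i < r" "u i \<noteq> 0" "\<And>i. i < r \<Longrightarrow> (\<Sum>j=0..<r. bB (v i) (v j) * u j) = 0"
    unfolding fdet_eq_0_iff by blast
  define y where "y = (\<Oplus>\<^bsub>M.V\<^esub>j\<in>{..<r}. u j \<odot>\<^bsub>M.V\<^esub> v j)"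
  have y: "y \<in> carrier M.V" unfolding y_def by (rule M.V.M.finsum_closed) auto
  have b: "bB (v i) y = 0" if i: "i < r" for i
  proof -
    have "bB (v i) y = (\<Sum>j<r. bB (v i) (u j \<odot>\<^bsub>M.V\<^esub> v j))"
      unfolding y_def using i by (subst lin_hom_finsum[OF M.V.rmod_axioms lin_space.rmod[OF lin_space_scalar] bB_lin_right]) auto
    also have "\<dots> = (\<Sum>j=0..<r. bB (v i) (v j) * u j)"
      using i by (intro sum.cong) (auto simp: lin_hom_smult[OF bB_lin_right] mult.commute)
    finally show ?thesis using u(3)[OF i] by simp
  qed
  have "bB x y = 0" if x: "x \<in> carrier M.V" for x
  proof -
    have "bB x y = bB (\<Oplus>\<^bsub>M.V\<^esub>j\<in>{..<r}. cv j x \<odot>\<^bsub>M.V\<^esub> v j) y" using V.expand[OF x] by simp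
    also have "\<dots> = (\<Sum>j<r. bB (cv j x \<odot>\<^bsub>M.V\<^esub> v j) y)"
      using y by (subst lin_hom_finsum[OF M.V.rmod_axioms lin_space.rmod[OF lin_space_scalar] bB_lin_left]) auto
    also have "\<dots> = 0" using b y by (intro sum.neutral) (auto simp: lin_hom_smult[OF bB_lin_left])
    finally show ?thesis .
  qed
  hence "y = \<zero>\<^bsub>M.V\<^esub>" by (rule bB_nondegenerate[OF y])
  hence "cv i y = 0" using lin_hom_zero[OF M.V lin_space_scalar V.c_hom[OF u(1)]] by simp
  thus False using V.c_sum[OF u(1), of u] u(2) by (simp add: y_def)
qed

end

section \<open>Reduction of the theorem to rationality of the full period determinant\<close>

section \<open>Comparison of the two period determinants\<close>

lemma fdet_mult: "fdet k (\<lambda>i j. \<Sum>l=0..<k. A i l * B l j) = fdet k A * fdet k B"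
proof -
  have "mat k k (\<lambda>(i, j). \<Sum>l=0..<k. A i l * B l j) = mat k k (\<lambda>(i, j). A i j) * mat k k (\<lambda>(i, j). B i j)"
    by (rule eq_matI) (auto simp: scalar_prod_def)
  thus ?thesis unfolding fdet_def using det_mult[of "mat k k (\<lambda>(i, j). A i j)" k "mat k k (\<lambda>(i, j). B i j)"] by simp
qed

lemma fdet_cong: "(\<And>i j. i < k \<Longrightarrow> j < k \<Longrightarrow> A i j = B i j) \<Longrightarrow> fdet k A = fdet k B"
  unfolding fdet_def by (rule arg_cong[of _ _ det]) (rule eq_matI, auto)

lemma fdet_one: "fdet k (\<lambda>i j. if i = j then 1 else 0) = (1 :: 'a :: comm_ring_1)"
proof -
  have "mat k k (\<lambda>(i, j). if i = j then 1 else 0) = (1\<^sub>m k :: 'a mat)" by (rule eq_matI) auto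
  thus ?thesis by (simp add: fdet_def)
qed

text \<open>The transition matrix has entries in E, and its determinant times that of the reverse
  transition is 1.\<close>

lemma frame_change_det:
  fixes Q :: "('e :: field_char_0, 'q) module"
  assumes d: "frame Q n d dc" and d': "frame Q n d' dc'"
  obtains t where "t \<noteq> 0" "\<And>f. (\<And>j. j < n \<Longrightarrow> f j \<in> carrier (cxR Q)) \<Longrightarrow>
    fdet n (\<lambda>i j. coord (dc' i) (f j)) = emb t * fdet n (\<lambda>i j. coord (dc i) (f j))"
proof -
  interpret d: framed Q n d dc by standard (rule d)
  interpret d': framed Q n d' dc' by standard (rule d')
  have ex: "h x = (\<Sum>l=0..<n. h (b l) * c l x)" if "framed Q n b c" "h \<in> lin_hom Q scalar_mod" "x \<in> carrier Q" for h b c x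
  proof -
    interpret b: framed Q n b c by (rule that(1))
    have "h x = h (\<Oplus>\<^bsub>Q\<^esub>l\<in>{..<n}. c l x \<odot>\<^bsub>Q\<^esub> b l)" using b.expand[OF that(3)] by simp
    also have "\<dots> = (\<Sum>l<n. h (c l x \<odot>\<^bsub>Q\<^esub> b l))"
      by (subst lin_hom_finsum[OF d.rmod_axioms lin_space.rmod[OF lin_space_scalar] that(2)]) auto
    also have "\<dots> = (\<Sum>l=0..<n. h (b l) * c l x)"
      unfolding lessThan_atLeast0 by (intro sum.cong) (auto simp: lin_hom_smult[OF that(2)])
    finally show ?thesis .
  qed
  let ?t = "fdet n (\<lambda>i l. dc' i (d l))" and ?t' = "fdet n (\<lambda>i l. dc i (d' l))"
  have "?t * ?t' = fdet n (\<lambda>i j. \<Sum>l=0..<n. dc' i (d l) * dc l (d' j))" by (rule fdet_mult[symmetric])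
  also have "\<dots> = fdet n (\<lambda>i j. dc' i (d' j))"
    by (rule fdet_cong) (rule ex[OF d.framed_axioms d'.c_hom, symmetric], simp_all)
  also have "\<dots> = fdet n (\<lambda>i j. if i = j then 1 else 0)"
    by (rule fdet_cong) (simp add: d'.c_b)
  finally have t: "?t * ?t' = 1" by (simp add: fdet_one)
  show ?thesis
  proof (rule that)
    show "?t \<noteq> 0" using t by auto
    fix f :: "nat \<Rightarrow> 'q cx" assume f: "\<And>j. j < n \<Longrightarrow> f j \<in> carrier (cxR Q)"
    have c: "coord (dc' i) (f j) = (\<Sum>l=0..<n. emb (dc' i (d l)) * coord (dc l) (f j))" if "i < n" "j < n" for i j
    proof -
      have "coord (dc' i) (f j) = (\<Sum>l<n. coord (dc l) (f j) * coord (dc' i) (d.e l))"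
        using d.hom_expand[OF rmod_self coord_hom[OF d'.V d'.c_hom[OF that(1)]] f[OF that(2)]] by simp
      also have "\<dots> = (\<Sum>l=0..<n. emb (dc' i (d l)) * coord (dc l) (f j))"
        unfolding lessThan_atLeast0 using that
        by (intro sum.cong) (auto simp: coord_elt[OF d'.V d'.c_hom] mult.commute simp flip: emb_def)
      finally show ?thesis .
    qed
    have "fdet n (\<lambda>i j. coord (dc' i) (f j)) = fdet n (\<lambda>i j. \<Sum>l=0..<n. emb (dc' i (d l)) * coord (dc l) (f j))"
      by (rule fdet_cong) (rule c)
    thus "fdet n (\<lambda>i j. coord (dc' i) (f j)) = emb ?t * fdet n (\<lambda>i j. coord (dc i) (f j))"
      by (simp add: fdet_mult fdet_emb)
  qed
qed

text \<open>This is \<open>det_isotropic_graph\<close> for the four blocks of a 2n by 2n matrix: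
  \<open>G0\<close> expresses that F is isotropic and \<open>D0\<close> that the two eigenspaces are
  orthogonal.\<close>

lemma isotropic_gram_det:
  fixes P G D :: "nat \<Rightarrow> nat \<Rightarrow> 'a :: comm_ring_1"
  assumes rel: "\<And>j l. j < 2*n \<Longrightarrow> l < n \<Longrightarrow> (\<Sum>i<2*n. \<Sum>k<2*n. P i j * P k l * G i k) = lam * D j l"
    and D0: "\<And>j l. j < n \<Longrightarrow> l < n \<Longrightarrow> D (n + j) l = 0"
    and G0: "\<And>i k. i < n \<Longrightarrow> k < n \<Longrightarrow> G (n + i) (n + k) = 0"
    and Q: "mat n n (\<lambda>(i, j). P i j) * Q = 1\<^sub>m n" "Q * mat n n (\<lambda>(i, j). P i j) = 1\<^sub>m n" "Q \<in> carrier_mat n n"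
  shows "fdet (2*n) P * fdet n (\<lambda>i k. G (n + i) k)
    = (- lam) ^ n * det (Q * mat n n (\<lambda>(i, j). P i (n + j))) * fdet n D"
proof -
  let ?A1 = "mat n n (\<lambda>(i, j). P i j)" and ?A2 = "mat n n (\<lambda>(i, j). P i (n + j))"
  let ?C1 = "mat n n (\<lambda>(i, j). P (n + i) j)" and ?C2 = "mat n n (\<lambda>(i, j). P (n + i) (n + j))"
  let ?X = "mat n n (\<lambda>(i, k). G i k)" and ?Y = "mat n n (\<lambda>(i, k). G i (n + k))" and ?Y' = "mat n n (\<lambda>(i, k). G (n + i) k)"
  let ?D = "mat n n (\<lambda>(j, l). D j l)"
  \<comment> \<open>The part with both indices in the lower half is absent because of
    \<open>G0\<close>; the rest is arranged as the matrix products in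
    \<open>det_isotropic_graph\<close>.\<close>
  have entry: "(\<Sum>k=0..<n. ((\<Sum>i=0..<n. P i j * G i k) + (\<Sum>i=0..<n. P (n + i) j * G (n + i) k)) * P k l)
      + (\<Sum>k=0..<n. (\<Sum>i=0..<n. P i j * G i (n + k)) * P (n + k) l) = lam * D j l" if "j < 2*n" "l < n" for j l
  proof -
    have "(\<Sum>i<2*n. \<Sum>k<2*n. P i j * P k l * G i k)
      = (\<Sum>i<n. \<Sum>k<n. P i j * P k l * G i k) + (\<Sum>i<n. \<Sum>k<n. P i j * P (n + k) l * G i (n + k))
        + (\<Sum>i<n. \<Sum>k<n. P (n + i) j * P k l * G (n + i) k)"
      by (simp add: sum_double sum.distrib G0)
    also have "(\<Sum>i<n. \<Sum>k<n. P i j * P k l * G i k) = (\<Sum>k<n. (\<Sum>i<n. P i j * G i k) * P k l)"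
      by (subst sum.swap) (simp add: sum_distrib_left sum_distrib_right mult_ac)
    also have "(\<Sum>i<n. \<Sum>k<n. P i j * P (n + k) l * G i (n + k)) = (\<Sum>k<n. (\<Sum>i<n. P i j * G i (n + k)) * P (n + k) l)"
      by (subst sum.swap) (simp add: sum_distrib_left sum_distrib_right mult_ac)
    also have "(\<Sum>i<n. \<Sum>k<n. P (n + i) j * P k l * G (n + i) k) = (\<Sum>k<n. (\<Sum>i<n. P (n + i) j * G (n + i) k) * P k l)"
      by (subst sum.swap) (simp add: sum_distrib_left sum_distrib_right mult_ac)
    finally show ?thesis using rel[OF that] by (simp add: lessThan_atLeast0 distrib_right sum.distrib add_ac)
  qed
  have blk: "mat (2*n) (2*n) (\<lambda>(i, j). P i j) = four_block_mat ?A1 ?A2 ?C1 ?C2"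
    by (rule eq_matI) auto
  have "det (four_block_mat ?A1 ?A2 ?C1 ?C2) * det ?Y' = (- lam) ^ n * det (Q * ?A2) * det ?D"
  proof (rule det_isotropic_graph[OF _ _ _ _ _ _ _ _ Q(3,1,2)])
    show "(?A1\<^sup>T * ?X + ?C1\<^sup>T * ?Y') * ?A1 + ?A1\<^sup>T * ?Y * ?C1 = lam \<cdot>\<^sub>m ?D"
    proof (rule eq_matI)
      fix j l assume "j < dim_row (lam \<cdot>\<^sub>m ?D)" "l < dim_col (lam \<cdot>\<^sub>m ?D)"
      hence jl: "j < n" "l < n" by auto
      thus "((?A1\<^sup>T * ?X + ?C1\<^sup>T * ?Y') * ?A1 + ?A1\<^sup>T * ?Y * ?C1) $$ (j, l) = (lam \<cdot>\<^sub>m ?D) $$ (j, l)"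
        using entry[of j l] by (simp add: scalar_prod_def)
    qed auto
    show "(?A2\<^sup>T * ?X + ?C2\<^sup>T * ?Y') * ?A1 + ?A2\<^sup>T * ?Y * ?C1 = 0\<^sub>m n n"
    proof (rule eq_matI)
      fix j l assume "j < dim_row (0\<^sub>m n n)" "l < dim_col (0\<^sub>m n n)"
      hence jl: "j < n" "l < n" by auto
      thus "((?A2\<^sup>T * ?X + ?C2\<^sup>T * ?Y') * ?A1 + ?A2\<^sup>T * ?Y * ?C1) $$ (j, l) = 0\<^sub>m n n $$ (j, l)"
        using entry[of "n + j" l] by (simp add: scalar_prod_def D0)
    qed auto
  qed auto
  thus ?thesis unfolding fdet_def blk .
qed

lemma (in bdr_system) eigen_frame:
  assumes b: "frame (V\<lparr>carrier := eig 1\<rparr>) p b c" and b': "frame (V\<lparr>carrier := eig (-1)\<rparr>) q b' c'"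
  obtains cv where "frame V (p + q) (\<lambda>j. if j < p then b j else b' (j - p)) cv"
proof -
  let ?P = "V\<lparr>carrier := eig 1\<rparr>" and ?M = "V\<lparr>carrier := eig (-1)\<rparr>"
  interpret b: framed ?P p b c by standard (rule b)
  interpret b': framed ?M q b' c' by standard (rule b')
  have one: "(1 :: 'e) * 1 = 1" "(-1 :: 'e) * (-1) = 1" by simp_all
  note h = eproj_hom[OF one(1)] and h' = eproj_hom[OF one(2)]
  have bx: "b i \<in> eig 1" if "i < p" for i using b.b_closed[OF that] by simp
  have bx': "b' i \<in> eig (-1)" if "i < q" for i using b'.b_closed[OF that] by simp
  have e: "eproj 1 x = 2 \<odot>\<^bsub>V\<^esub> x" "eproj (-1) x = \<zero>\<^bsub>V\<^esub>" if "x \<in> eig 1" for x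
    using that V.smult_add_left[of x 1 1] V.smult_add_left[of x "-1" 1] by (auto simp: eproj_def eig_def)
  have e': "eproj (-1) x = (-2) \<odot>\<^bsub>V\<^esub> x" "eproj 1 x = \<zero>\<^bsub>V\<^esub>" if "x \<in> eig (-1)" for x
    using that V.smult_add_left[of x "-1" "-1"] V.smult_add_left[of x 1 "-1"] by (auto simp: eproj_def eig_def)
  \<comment> \<open>The divisors 2 and -2 arise because \<open>eproj s\<close> is multiplication by
    2s on the s-eigenspace and zero on the other one.\<close>
  define cv where "cv i x = (if i < p then c i (eproj 1 x) / 2 else c' (i - p) (eproj (-1) x) / (-2))" for i x
  have z: "c i \<zero>\<^bsub>V\<^esub> = 0" if "i < p" for i using lin_hom_zero[OF b.V lin_space_scalar b.c_hom[OF that]] by simp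
  have z': "c' i \<zero>\<^bsub>V\<^esub> = 0" if "i < q" for i using lin_hom_zero[OF b'.V lin_space_scalar b'.c_hom[OF that]] by simp
  have s: "c i (k \<odot>\<^bsub>V\<^esub> x) = k * c i x" if "i < p" "x \<in> eig 1" for i x k using lin_hom_smult[OF b.c_hom[OF that(1)], of x k] that by simp
  have s': "c' i (k \<odot>\<^bsub>V\<^esub> x) = k * c' i x" if "i < q" "x \<in> eig (-1)" for i x k using lin_hom_smult[OF b'.c_hom[OF that(1)], of x k] that by simp
  have sc: "(\<lambda>x. f x / k) \<in> lin_hom V scalar_mod" if "f \<in> lin_hom V scalar_mod" for f k
    by (rule lin_homI) (auto simp: lin_hom_add[OF that] lin_hom_smult[OF that] add_divide_distrib)
  have "frame V (p + q) (\<lambda>j. if j < p then b j else b' (j - p)) cv"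
  proof (rule frameI[OF V])
    fix i assume i: "i < p + q"
    show "(if i < p then b i else b' (i - p)) \<in> carrier V" using i bx[of i] bx'[of "i - p"] by (auto simp: eig_def)
    show "cv i \<in> lin_hom V scalar_mod"
    proof (cases "i < p")
      case True
      thus ?thesis unfolding cv_def[abs_def] using sc[OF lin_hom_comp[OF h b.c_hom]] by simp
    next
      case False
      hence "i - p < q" using i by auto
      thus ?thesis unfolding cv_def[abs_def] using False sc[OF lin_hom_comp[OF h' b'.c_hom[of "i - p"]], of "-2"] by simp
    qed
    fix j assume j: "j < p + q"
    have "cv i (if j < p then b j else b' (j - p)) = (if i < p then if j < p then c i (b j) else 0 else if j < p then 0 else c' (i - p) (b' (j - p)))"
    proof (cases "j < p")
      case True
      thus ?thesis using i bx[OF True] by (auto simp: cv_def e s z')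
    next
      case False
      hence "j - p < q" using j by auto
      thus ?thesis using False i bx'[of "j - p"] by (auto simp: cv_def e' s' z)
    qed
    also have "\<dots> = (if i = j then 1 else 0)" using i j b.c_b[of i j] b'.c_b[of "i - p" "j - p"] by auto
    finally show "cv i (if j < p then b j else b' (j - p)) = (if i = j then 1 else 0)" .
  next
    fix x assume x: "x \<in> carrier V" and 0: "\<And>i. i < p + q \<Longrightarrow> cv i x = 0"
    have "eproj 1 x = \<zero>\<^bsub>V\<^esub>"
    proof -
      have "c i (eproj 1 x) = 0" if "i < p" for i using 0[of i] that by (simp add: cv_def)
      thus ?thesis using b.c_zero[of "eproj 1 x"] eproj_eig[OF one(1) x] by simp
    qed
    moreover have "eproj (-1) x = \<zero>\<^bsub>V\<^esub>"
    proof -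
      have "c' i (eproj (-1) x) = 0" if "i < q" for i using 0[of "p + i"] that by (simp add: cv_def)
      thus ?thesis using b'.c_zero[of "eproj (-1) x"] eproj_eig[OF one(2) x] by simp
    qed
    ultimately have F: "x \<oplus>\<^bsub>V\<^esub> Finf N x = \<zero>\<^bsub>V\<^esub>" "(-1) \<odot>\<^bsub>V\<^esub> x \<oplus>\<^bsub>V\<^esub> Finf N x = \<zero>\<^bsub>V\<^esub>" using x by (auto simp: eproj_def)
    have Fx: "Finf N x \<in> carrier V" by (rule lin_hom_closed[OF Finf_hom x])
    have "x = (-1) \<odot>\<^bsub>V\<^esub> x" using F V.M.add.right_cancel[of "Finf N x" x "(-1) \<odot>\<^bsub>V\<^esub> x"] x Fx by simp
    hence "x \<oplus>\<^bsub>V\<^esub> x = (-1) \<odot>\<^bsub>V\<^esub> x \<oplus>\<^bsub>V\<^esub> 1 \<odot>\<^bsub>V\<^esub> x" using x by simp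
    hence "(2 :: 'e) \<odot>\<^bsub>V\<^esub> x = \<zero>\<^bsub>V\<^esub>" using x V.smult_add_left[of x 1 1] V.smult_add_left[of x "-1" 1] by simp
    hence "(1/2 :: 'e) \<odot>\<^bsub>V\<^esub> ((2 :: 'e) \<odot>\<^bsub>V\<^esub> x) = \<zero>\<^bsub>V\<^esub>" by simp
    thus "x = \<zero>\<^bsub>V\<^esub>" using x by (simp add: V.smult_smult)
  qed
  thus ?thesis by (rule that)
qed

lemma det_unit:
  assumes "A * Q = 1\<^sub>m n" "A \<in> carrier_mat n n" "Q \<in> carrier_mat n n"
  shows "det A * det Q = 1"
  using det_mult[OF assms(2,3)] assms(1) by simp

lemma subspace_frame:
  fixes V :: "('e :: field_char_0, 'v) module"
  assumes fr: "frame V r b c" and U: "VectorSpace.subspace class_ring U V"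
  obtains s b' c' where "frame (V\<lparr>carrier := U\<rparr>) s b' c'"
proof -
  obtain s b' c' where s: "s \<le> r" "frame V r b' c'" "\<And>i. s \<le> i \<Longrightarrow> i < r \<Longrightarrow> b' i \<in> U" "U = {x \<in> carrier V. \<forall>i<s. c' i x = 0}"
    by (rule adapted_frame[OF fr U]) (rule that)
  show thesis by (rule that[OF adapted_sub_frame[OF s(2) U s(1,3,4)]])
qed

lemma quot_frame:
  fixes V :: "('e :: field_char_0, 'v) module"
  assumes fr: "frame V r b c" and U: "VectorSpace.subspace class_ring U V"
  obtains s d dc where "frame (quot_mod V U) s d dc"
proof -
  obtain s b' c' where s: "s \<le> r" "frame V r b' c'" "\<And>i. s \<le> i \<Longrightarrow> i < r \<Longrightarrow> b' i \<in> U" "U = {x \<in> carrier V. \<forall>i<s. c' i x = 0}"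
    by (rule adapted_frame[OF fr U]) (rule that)
  show thesis by (rule adapted_quot_frame[OF s(2) U s(1,4)]) (rule that)
qed

text \<open>The bases behind the chosen determinant are unknown. They are recovered as frames once
  \<open>pmap_bij\<close> guarantees equal ranks, and with them the existence of a
  determinant.\<close>

lemma (in bdr_system) period_class_frames:
  assumes vm: "even (weight N) \<longrightarrow> vanishing_middle N" and s: "s = 1 \<or> s = -1"
  obtains r b c d dc where "frame (V\<lparr>carrier := eig s\<rparr>) r b c" "frame Wq r d dc"
    "period_class N s = E_units #>\<^bsub>units_of EC\<^esub>
      Rep_ec (fdet r (\<lambda>i j. coord (dc i) (pmap s (cx_elt (V\<lparr>carrier := eig s\<rparr>) (b j) 1))))"
proof -
  let ?U = "V\<lparr>carrier := eig s\<rparr>"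
  obtain r0 b0 c0 where fV: "frame V r0 b0 c0" using fin_dim_frame[OF V V_fin] by blast
  obtain r1 b1 c1 where fW: "frame W r1 b1 c1" using W_frame by blast
  obtain p b c where b: "frame ?U p b c" by (rule subspace_frame[OF fV eig_sub])
  obtain q d dc where d: "frame Wq q d dc" by (rule quot_frame[OF fW fil_sub])
  have "p = q" by (rule frame_iso(1)[OF b d pmap_hom pmap_bij[OF vm s]])
  from is_det_exists[OF b d[folded this] pmap_hom]
  have "is_det ?U Wq (pmap s) (SOME \<delta>. is_det ?U Wq (pmap s) \<delta>)" by (rule someI_ex)
  then obtain r b c d dc where fr: "frame ?U r b c" "frame Wq r d dc"
    "(SOME \<delta>. is_det ?U Wq (pmap s) \<delta>) = Rep_ec (fdet r (\<lambda>i j. coord (dc i) (pmap s (cx_elt ?U (b j) 1))))"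
    by (rule is_det_frames[OF _ eig_space Wq pmap_hom])
  have pm: "period_map N = pmap s" by (rule ext) (rule period_map_eq)
  show thesis by (rule that[OF fr(1,2)]) (simp only: period_class_def betti_eigen_eq derham_quot_eq pm fr(3))
qed

context bdr_pairing
begin

text \<open>The full Gram matrix is block diagonal by orthogonality of the eigenspaces, so a kernel
  vector of the first block, extended by zeros, is one of the whole matrix.\<close>

lemma eigen_gram_nonsingular:
  assumes b: "frame (M.V\<lparr>carrier := M.eig 1\<rparr>) p b c" and b': "frame (M.V\<lparr>carrier := M.eig (-1)\<rparr>) q b' c'"
  shows "fdet p (\<lambda>i j. bB (b i) (b j)) \<noteq> 0"
proof
  interpret b: framed "M.V\<lparr>carrier := M.eig 1\<rparr>" p b c by standard (rule b)
  interpret b': framed "M.V\<lparr>carrier := M.eig (-1)\<rparr>" q b' c' by standard (rule b')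
  assume "fdet p (\<lambda>i j. bB (b i) (b j)) = 0"
  then obtain u i where u: "i < p" "u i \<noteq> 0" "\<And>i. i < p \<Longrightarrow> (\<Sum>j=0..<p. bB (b i) (b j) * u j) = 0"
    unfolding fdet_eq_0_iff by blast
  obtain cv where cv: "frame M.V (p + q) (\<lambda>j. if j < p then b j else b' (j - p)) cv" by (rule M.eigen_frame[OF b b'])
  let ?v = "\<lambda>j. if j < p then b j else b' (j - p)" and ?u = "\<lambda>j. if j < p then u j else 0"
  have "(\<Sum>j=0..<p+q. bB (?v k) (?v j) * ?u j) = 0" if k: "k < p + q" for k
  proof -
    have "(\<Sum>j=0..<p+q. bB (?v k) (?v j) * ?u j) = (\<Sum>j=0..<p. bB (?v k) (?v j) * ?u j)"
      by (rule sum.mono_neutral_right) auto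
    also have "\<dots> = (\<Sum>j=0..<p. bB (?v k) (b j) * u j)" by (rule sum.cong) auto
    also have "\<dots> = 0"
    proof (cases "k < p")
      case True
      thus ?thesis using u(3) by simp
    next
      case False
      hence "bB (b' (k - p)) (b j) = 0" if "j < p" for j
        using k b.b_closed[OF that] b'.b_closed[of "k - p"] by (intro eigen_orthogonal(2)) auto
      thus ?thesis using False by simp
    qed
    finally show ?thesis .
  qed
  moreover have "i < p + q" "?u i \<noteq> 0" using u by auto
  ultimately have "fdet (p + q) (\<lambda>i j. bB (?v i) (?v j)) = 0"
    unfolding fdet_eq_0_iff by (intro exI[of _ ?u] conjI exI[of _ i] allI impI)
  thus False using gram_nonsingular[OF cv] by simp
qed

definition pdet :: "(nat \<Rightarrow> 'b) \<Rightarrow> (nat \<Rightarrow> 'd \<Rightarrow> 'e) \<Rightarrow> 'e ec" where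
  "pdet v cw = fdet (2 * n) (\<lambda>i j. coord (cw i) (M.cmp (cx_elt M.V (v j) 1)))"

text \<open>Membership of the full period determinant in \<open>\<lambda>\<^sup>n E\<^sup>*\<close>,
  stated without division in E \<otimes> \<complex>. The symplectic and orthogonal cases differ only
  in how this is proved.\<close>

definition rational_pdet :: bool where
  "rational_pdet \<longleftrightarrow> (\<forall>v cv w cw. frame M.V (2 * n) v cv \<longrightarrow> frame M.W (2 * n) w cw \<longrightarrow>
     (\<exists>\<alpha> \<beta>. \<alpha> \<noteq> 0 \<and> \<beta> \<noteq> 0 \<and> pdet v cw * emb \<alpha> = lam ^ n * emb \<beta>))"

lemma coord_quot:
  assumes c: "c \<in> lin_hom M.W scalar_mod" and d: "d \<in> lin_hom M.Wq scalar_mod"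
    and cd: "\<And>x. x \<in> carrier M.W \<Longrightarrow> c x = d (M.proj x)" and Y: "Y \<in> carrier (cxR M.W)"
  shows "coord c Y = coord d (cxm M.Wq M.proj Y)"
proof (rule cxR_hom_eqI[OF M.W rmod_self coord_hom[OF M.W c] _ _ Y])
  show "(\<lambda>Y. coord d (cxm M.Wq M.proj Y)) \<in> lin_hom (cxR M.W) self_mod"
    by (rule lin_hom_comp[OF cxm_hom[OF M.W M.Wq M.proj_hom] coord_hom[OF M.Wq d]])
  fix x assume x: "x \<in> carrier M.W"
  show "coord c (cx_elt M.W x 1) = coord d (cxm M.Wq M.proj (cx_elt M.W x 1))"
    using lin_hom_closed[OF M.proj_hom x]
    by (simp add: cxm_elt[OF M.W M.Wq M.proj_hom x] coord_elt[OF M.W c x] coord_elt[OF M.Wq d] cd[OF x])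
qed

text \<open>The basis of \<open>M\<^sub>B\<close> consists of eigenvectors, and that of
  \<open>M\<^sub>d\<^sub>R\<close> extends the frame of the quotient by vectors of F, so the upper
  half of P consists of the two period matrices. The block identity and \<open>rational_pdet\<close>
  then put the ratio of their determinants into E.\<close>

lemma period_dets:
  assumes vm: "even (weight M) \<longrightarrow> vanishing_middle M" and rp: "rational_pdet"
    and b: "frame (M.V\<lparr>carrier := M.eig 1\<rparr>) n b c" and b': "frame (M.V\<lparr>carrier := M.eig (-1)\<rparr>) n b' c'"
    and d: "frame M.Wq n d dc"
  obtains e where "e \<noteq> 0"
    "fdet n (\<lambda>i j. coord (dc i) (M.pmap (-1) (cx_elt (M.V\<lparr>carrier := M.eig (-1)\<rparr>) (b' j) 1)))
      = emb e * fdet n (\<lambda>i j. coord (dc i) (M.pmap 1 (cx_elt (M.V\<lparr>carrier := M.eig 1\<rparr>) (b j) 1)))"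
proof -
  let ?U = "M.V\<lparr>carrier := M.eig 1\<rparr>" and ?U' = "M.V\<lparr>carrier := M.eig (-1)\<rparr>"
  interpret b: framed ?U n b c by standard (rule b)
  interpret b': framed ?U' n b' c' by standard (rule b')
  interpret d: framed M.Wq n d dc by standard (rule d)
  define v where "v j = (if j < n then b j else b' (j - n))" for j
  obtain cv where "frame M.V (n + n) v cv" unfolding v_def by (rule M.eigen_frame[OF b b'])
  hence v: "frame M.V (2 * n) v cv" by (simp add: mult_2)
  interpret v: framed M.V "2 * n" v cv by standard (rule v)
  obtain r1 b1 c1 where "frame M.W r1 b1 c1" using M.W_frame by blast
  then obtain u w cw where w0: "frame M.W (n + u) w cw" and wF: "\<And>i. n \<le> i \<Longrightarrow> i < n + u \<Longrightarrow> w i \<in> M.F"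
    and cw: "\<And>i x. i < n \<Longrightarrow> x \<in> carrier M.W \<Longrightarrow> cw i x = dc i (M.proj x)"
    using quot_frame_lift[OF _ M.fil_sub d] by blast
  \<comment> \<open>The comparison isomorphism equates the Betti rank 2n with n + u, so F has rank
    n.\<close>
  have un: "u = n" using frame_iso(1)[OF v w0 M.cmp_hom M.cmp_bij] by simp
  have w: "frame M.W (2 * n) w cw" using w0 un by (simp add: mult_2)
  interpret w: framed M.W "2 * n" w cw by standard (rule w)
  define P where "P i j = coord (cw i) (M.cmp (cx_elt M.V (v j) 1))" for i j
  have Yc: "M.cmp (cx_elt M.V x 1) \<in> carrier (cxR M.W)" if "x \<in> carrier M.V" for x
    by (rule lin_hom_closed[OF M.cmp_hom cxR_elt_closed[OF M.V that]])
  have bx: "b j \<in> M.eig 1" "b' j \<in> M.eig (-1)" if "j < n" for j using b.b_closed[OF that] b'.b_closed[OF that] by auto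
  have P1: "P i j = coord (dc i) (M.pmap 1 (cx_elt ?U (b j) 1))" if "i < n" "j < n" for i j
    unfolding P_def M.pmap_elt[OF bx(1)[OF that(2)]] using that
    by (simp add: v_def) (intro coord_quot w.c_hom d.c_hom cw Yc, use bx(1)[OF that(2)] in \<open>auto simp: M.eig_def\<close>)
  have P2: "P i (n + j) = coord (dc i) (M.pmap (-1) (cx_elt ?U' (b' j) 1))" if "i < n" "j < n" for i j
    unfolding P_def M.pmap_elt[OF bx(2)[OF that(2)]] using that
    by (simp add: v_def) (intro coord_quot w.c_hom d.c_hom cw Yc, use bx(2)[OF that(2)] in \<open>auto simp: M.eig_def\<close>)
  let ?A = "mat n n (\<lambda>(i, j). P i j)" and ?A' = "mat n n (\<lambda>(i, j). P i (n + j))"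
  have A: "?A = mat n n (\<lambda>(i, j). coord (dc i) (M.pmap 1 (cx_elt ?U (b j) 1)))" using P1 by (intro eq_matI) auto
  have A': "?A' = mat n n (\<lambda>(i, j). coord (dc i) (M.pmap (-1) (cx_elt ?U' (b' j) 1)))" using P2 by (intro eq_matI) auto
  obtain Q where Q: "?A * Q = 1\<^sub>m n" "Q * ?A = 1\<^sub>m n" "Q \<in> carrier_mat n n"
    unfolding A using frame_iso(2)[OF b d M.pmap_hom M.pmap_bij[OF vm]] by auto
  obtain Q' where Q': "?A' * Q' = 1\<^sub>m n" "Q' \<in> carrier_mat n n"
    unfolding A' using frame_iso(2)[OF b' d M.pmap_hom M.pmap_bij[OF vm]] by auto
  define G where "G i k = bD (w i) (w k)" for i k
  let ?y = "fdet n (\<lambda>i k. G (n + i) k)" and ?g = "fdet n (\<lambda>i j. bB (b i) (b j))"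
  have main: "fdet (2*n) P * fdet n (\<lambda>i k. emb (G (n + i) k))
    = (- lam) ^ n * det (Q * ?A') * fdet n (\<lambda>i j. emb (bB (v i) (v j)))"
  proof (rule isotropic_gram_det[OF _ _ _ Q])
    fix j l assume jl: "j < 2 * n" "l < n"
    show "(\<Sum>i<2*n. \<Sum>k<2*n. P i j * P k l * emb (G i k)) = lam * emb (bB (v j) (v l))"
      unfolding P_def G_def by (rule gram_relation[OF w]) (use jl in auto)
  next
    fix j l assume jl: "j < n" "l < n"
    thus "emb (bB (v (n + j)) (v l)) = 0" using eigen_orthogonal(2)[of "b l" "b' j"] bx by (simp add: v_def)
  next
    fix i k assume "i < n" "k < n"
    thus "emb (G (n + i) (n + k)) = 0" using isotropic[of "w (n + i)" "w (n + k)"] wF un by (simp add: G_def)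
  qed
  have "fdet n (\<lambda>i j. emb (bB (v i) (v j))) = emb ?g"
    unfolding fdet_emb[symmetric] by (rule fdet_cong) (simp add: v_def)
  hence main: "fdet (2*n) P * emb ?y = (- lam) ^ n * det (Q * ?A') * emb ?g" using main by (simp add: fdet_emb)
  have g: "?g \<noteq> 0" by (rule eigen_gram_nonsingular[OF b b'])
  obtain \<alpha> \<beta> where ab: "\<alpha> \<noteq> 0" "\<beta> \<noteq> 0" "fdet (2*n) P * emb \<alpha> = lam ^ n * emb \<beta>"
    using rp v w unfolding rational_pdet_def pdet_def P_def by blast
  obtain mu where mu: "mu * lam = 1" using lam_unit by blast
  define z where "z = det (Q * ?A')"
  have "lam ^ n * (emb \<beta> * emb ?y) = fdet (2*n) P * emb \<alpha> * emb ?y" using ab(3) by (simp add: mult_ac)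
  also have "\<dots> = (fdet (2*n) P * emb ?y) * emb \<alpha>" by (simp add: mult_ac)
  also have "\<dots> = lam ^ n * ((-1) ^ n * z * emb ?g * emb \<alpha>)" unfolding main z_def[symmetric] by (simp add: mult_ac power_minus[of lam])
  finally have "mu ^ n * lam ^ n * (emb \<beta> * emb ?y) = mu ^ n * lam ^ n * ((-1) ^ n * z * emb ?g * emb \<alpha>)" by (simp add: mult.assoc)
  \<comment> \<open>The power of \<lambda> is cancelled through the inverse \<open>mu\<close>, since
    E \<otimes> \<complex> may have zero divisors.\<close>
  hence eq: "emb (\<beta> * ?y) = (-1) ^ n * z * emb (?g * \<alpha>)"
    unfolding power_mult_distrib[symmetric] mu by (simp add: emb_mult mult_ac)
  \<comment> \<open>The preceding equation solved for z; the sign is its own inverse.\<close>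
  define e where "e = (-1) ^ n * (\<beta> * ?y) / (?g * \<alpha>)"
  have em1: "emb ((-1) ^ n :: 'e) = (-1) ^ n" by (simp add: emb.hom_power emb.hom_uminus)
  have "emb e = emb ((-1) ^ n) * emb (\<beta> * ?y) * emb (1 / (?g * \<alpha>))" unfolding emb_mult[symmetric] e_def by simp
  also have "\<dots> = (-1) ^ n * (-1) ^ n * z * (emb (?g * \<alpha>) * emb (1 / (?g * \<alpha>)))" unfolding eq em1 by (simp add: mult_ac)
  also have "\<dots> = z" using g ab(1) by (simp flip: emb_mult power_mult_distrib)
  finally have ez: "emb e = z" .
  have det: "det ?A' = emb e * det ?A"
  proof -
    have "?A' = ?A * (Q * ?A')" using Q assoc_mult_mat[of ?A n n Q n ?A' n] by simp
    hence "det ?A' = det ?A * z" unfolding z_def using det_mult[of ?A n "Q * ?A'"] Q(3) by simp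
    thus ?thesis by (simp add: ez mult.commute)
  qed
  \<comment> \<open>The second period matrix is invertible, so its determinant cannot vanish; this
    also covers the factor \<open>?y\<close> of e.\<close>
  have "e \<noteq> 0"
  proof
    assume "e = 0"
    hence "det ?A' = 0" using det by simp
    thus False using det_unit[OF Q'(1) _ Q'(2)] by simp
  qed
  thus thesis using that det A A' unfolding fdet_def by simp
qed

theorem c_plus_eq_c_minus:
  assumes vm: "even (weight M) \<longrightarrow> vanishing_middle M" and rp: "rational_pdet"
    and V: "frame M.V (2 * n) v cv"
  shows "c_plus M = c_minus M"
proof -
  obtain r b c d dc where p: "frame (M.V\<lparr>carrier := M.eig 1\<rparr>) r b c" "frame M.Wq r d dc"
    "period_class M 1 = E_units #>\<^bsub>units_of EC\<^esub>
      Rep_ec (fdet r (\<lambda>i j. coord (dc i) (M.pmap 1 (cx_elt (M.V\<lparr>carrier := M.eig 1\<rparr>) (b j) 1))))"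
    by (rule M.period_class_frames[OF vm, of 1]) simp
  obtain r' b' c' d' dc' where q: "frame (M.V\<lparr>carrier := M.eig (-1)\<rparr>) r' b' c'" "frame M.Wq r' d' dc'"
    "period_class M (-1) = E_units #>\<^bsub>units_of EC\<^esub>
      Rep_ec (fdet r' (\<lambda>i j. coord (dc' i) (M.pmap (-1) (cx_elt (M.V\<lparr>carrier := M.eig (-1)\<rparr>) (b' j) 1))))"
    by (rule M.period_class_frames[OF vm, of "-1"]) simp
  \<comment> \<open>Both eigenspaces have the rank of the common quotient, and their ranks add up to
    2n.\<close>
  have rr: "r' = r" by (rule frame_rank_unique[OF q(2) p(2)])
  obtain cv where "frame M.V (r + r') (\<lambda>j. if j < r then b j else b' (j - r)) cv" by (rule M.eigen_frame[OF p(1) q(1)])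
  from frame_rank_unique[OF this V] have rn: "r = n" "r' = n" unfolding rr by simp_all
  note p = p[unfolded rn] and q = q[unfolded rn]
  let ?x = "\<lambda>j. M.pmap (-1) (cx_elt (M.V\<lparr>carrier := M.eig (-1)\<rparr>) (b' j) 1)"
  interpret b': framed "M.V\<lparr>carrier := M.eig (-1)\<rparr>" n b' c' by standard (rule q(1))
  \<comment> \<open>The two classes come with possibly different frames of the quotient; t accounts
    for the change between them.\<close>
  obtain t where t: "t \<noteq> 0" "fdet n (\<lambda>i j. coord (dc' i) (?x j)) = emb t * fdet n (\<lambda>i j. coord (dc i) (?x j))"
  proof (rule frame_change_det[OF p(2) q(2)])
    fix t assume t: "t \<noteq> 0" "\<And>f. (\<And>j. j < n \<Longrightarrow> f j \<in> carrier (cxR M.Wq)) \<Longrightarrow>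
      fdet n (\<lambda>i j. coord (dc' i) (f j)) = emb t * fdet n (\<lambda>i j. coord (dc i) (f j))"
    show thesis by (rule that[OF t(1)]) (rule t(2), rule lin_hom_closed[OF M.pmap_hom b'.e_closed])
  qed
  obtain e where e: "e \<noteq> 0" "fdet n (\<lambda>i j. coord (dc i) (?x j))
      = emb e * fdet n (\<lambda>i j. coord (dc i) (M.pmap 1 (cx_elt (M.V\<lparr>carrier := M.eig 1\<rparr>) (b j) 1)))"
    by (rule period_dets[OF vm rp p(1) q(1) p(2)])
  show ?thesis unfolding c_plus_def c_minus_def p(3) q(3)
    by (rule units_coset_eq[of _ "t * e"]) (use t e in \<open>simp_all add: emb_mult mult.assoc\<close>)
qed

end

section \<open>Rationality of the full period determinant in the symplectic case\<close>

lemma pfaff_smult: "pfaff n (\<lambda>i j. k * A i j) = k ^ n * pfaff n A"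
  by (simp add: pfaff_def prod.distrib sum_distrib_left mult_ac)

lemma pfaff_emb: "pfaff n (\<lambda>i j. emb (A i j)) = emb (pfaff n A)"
  by (simp add: pfaff_def emb.hom_sum emb.hom_mult emb.hom_prod emb.hom_of_int)

text \<open>As \<open>lam\<close> is a unit and \<open>emb\<close> is injective, \<beta> \<noteq> 0
  rules out \<alpha> = 0.\<close>

lemma (in bdr_pairing) rational_pdetI:
  assumes "\<And>v cv w cw. frame M.V (2 * n) v cv \<Longrightarrow> frame M.W (2 * n) w cw \<Longrightarrow>
    \<exists>\<alpha> \<beta>. \<beta> \<noteq> 0 \<and> pdet v cw * emb \<alpha> = lam ^ n * emb \<beta>"
  shows rational_pdet
  unfolding rational_pdet_def
proof (intro allI impI)
  fix v cv w cw assume "frame M.V (2 * n) v cv" "frame M.W (2 * n) w cw"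
  from assms[OF this] obtain \<alpha> \<beta> where ab: "\<beta> \<noteq> 0" "pdet v cw * emb \<alpha> = lam ^ n * emb \<beta>" by blast
  have "\<alpha> \<noteq> 0"
  proof
    assume "\<alpha> = 0"
    hence 0: "lam ^ n * emb \<beta> = 0" using ab(2) by simp
    obtain mu where mu: "mu * lam = 1" using lam_unit by blast
    have "emb \<beta> = (mu * lam) ^ n * emb \<beta>" unfolding mu by simp
    also have "\<dots> = mu ^ n * (lam ^ n * emb \<beta>)" by (simp add: power_mult_distrib mult.assoc)
    finally show False using 0 ab(1) by (simp add: emb_eq_0_iff)
  qed
  thus "\<exists>\<alpha> \<beta>. \<alpha> \<noteq> 0 \<and> \<beta> \<noteq> 0 \<and> pdet v cw * emb \<alpha> = lam ^ n * emb \<beta>" using ab by blast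
qed

text \<open>The Betti Pfaffian, nonzero by nondegeneracy of the form, serves as \<beta>, and the de
  Rham Pfaffian as \<alpha>.\<close>

lemma (in bdr_pairing) symplectic_rational_pdet:
  assumes alt: "alternating_form M.V L.V B"
  shows rational_pdet
proof (rule rational_pdetI)
  fix v cv w cw assume v: "frame M.V (2 * n) v cv" and w: "frame M.W (2 * n) w cw"
  interpret v: framed M.V "2 * n" v cv by standard (rule v)
  define P where "P i j = coord (cw i) (M.cmp (cx_elt M.V (v j) 1))" for i j
  let ?G = "\<lambda>i k. bD (w i) (w k)" and ?D = "\<lambda>j l. bB (v j) (v l)"
  have xx: "bB x x = 0" if "x \<in> carrier M.V" for x
    using alt that bB_eq_0_iff by (simp add: alternating_form_def)
  have skew: "bB x y = - bB y x" if x: "x \<in> carrier M.V" and y: "y \<in> carrier M.V" for x y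
  proof -
    have xy: "x \<oplus>\<^bsub>M.V\<^esub> y \<in> carrier M.V" using x y by simp
    have "0 = bB (x \<oplus>\<^bsub>M.V\<^esub> y) (x \<oplus>\<^bsub>M.V\<^esub> y)" using xx[OF xy] by simp
    also have "\<dots> = bB x (x \<oplus>\<^bsub>M.V\<^esub> y) + bB y (x \<oplus>\<^bsub>M.V\<^esub> y)" using lin_hom_add[OF bB_lin_left[OF xy] x y] by simp
    also have "\<dots> = bB x y + bB y x"
      using lin_hom_add[OF bB_lin_right[OF x] x y] lin_hom_add[OF bB_lin_right[OF y] x y] xx[OF x] xx[OF y] by simp
    finally show ?thesis by (simp add: eq_neg_iff_add_eq_0)
  qed
  have D: "pfaff n ?D \<noteq> 0"
    by (rule pfaff_alternating_nonzero) (use gram_nonsingular[OF v] in \<open>auto intro: xx skew\<close>)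
  have "fdet (2 * n) P * emb (pfaff n ?G) = pfaff n (\<lambda>j l. \<Sum>a=0..<2*n. \<Sum>b=0..<2*n. P a j * emb (?G a b) * P b l)"
    by (simp add: pfaff_congruence pfaff_emb)
  also have "\<dots> = pfaff n (\<lambda>j l. lam * emb (?D j l))"
  proof (rule pfaff_cong)
    fix j l assume "j < 2 * n" "l < 2 * n"
    thus "(\<Sum>a=0..<2*n. \<Sum>b=0..<2*n. P a j * emb (?G a b) * P b l) = lam * emb (?D j l)"
      using gram_relation[OF w, of "v j" "v l"] by (simp add: P_def lessThan_atLeast0 mult_ac)
  qed
  also have "\<dots> = lam ^ n * emb (pfaff n ?D)" by (simp add: pfaff_smult pfaff_emb)
  finally show "\<exists>\<alpha> \<beta>. \<beta> \<noteq> 0 \<and> pdet v cw * emb \<alpha> = lam ^ n * emb \<beta>" using D unfolding pdet_def P_def by blast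
qed

section \<open>Top exterior powers, tensor powers of a line and duals in coordinates\<close>

section \<open>Comparison isomorphisms of powers and duals\<close>

text \<open>\<open>evl r s [C\<^sub>1, \<dots>, C\<^sub>k]\<close> is the value of the multilinear form with values \<open>s [i\<^sub>1, \<dots>, i\<^sub>k]\<close> on the
  basis vectors, at the vectors with coordinates \<open>C\<^sub>1, \<dots>, C\<^sub>k\<close>.\<close>

primrec evl :: "nat \<Rightarrow> (nat list \<Rightarrow> 'a :: comm_ring_1) \<Rightarrow> (nat \<Rightarrow> 'a) list \<Rightarrow> 'a" where
  "evl r s [] = s []"
| "evl r s (C # Cs) = (\<Sum>i<r. C i * evl r (\<lambda>is. s (i # is)) Cs)"

lemma evl_smult: "evl r (\<lambda>is. a * s is) Cs = a * evl r s Cs"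
  by (induction Cs arbitrary: s) (simp_all add: sum_distrib_left mult_ac)

lemma evl_sum: "evl r (\<lambda>is. \<Sum>i<m. t i is) Cs = (\<Sum>i<m. evl r (t i) Cs)"
proof (induction Cs arbitrary: t)
  case (Cons C Cs)
  have "evl r (\<lambda>is. \<Sum>i<m. t i is) (C # Cs) = (\<Sum>j<r. \<Sum>i<m. C j * evl r (\<lambda>is. t i (j # is)) Cs)"
    by (simp add: Cons.IH sum_distrib_left)
  also have "\<dots> = (\<Sum>i<m. evl r (t i) (C # Cs))" by (subst sum.swap) simp
  finally show ?case .
qed simp

lemma evl_emb: "emb (evl r s Cs) = evl r (\<lambda>is. emb (s is)) (map (\<lambda>C i. emb (C i)) Cs)"
  by (induction Cs arbitrary: s) (simp_all add: emb.hom_sum emb_mult)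

lemma evl_update_add: "m < length Cs \<Longrightarrow>
  evl r s (Cs[m := \<lambda>i. C i + C' i]) = evl r s (Cs[m := C]) + evl r s (Cs[m := C'])"
proof (induction Cs arbitrary: m s)
  case (Cons D Cs)
  thus ?case by (cases m) (simp_all add: distrib_left distrib_right sum.distrib)
qed simp

lemma evl_update_smult: "m < length Cs \<Longrightarrow> evl r s (Cs[m := \<lambda>i. a * C i]) = a * evl r s (Cs[m := C])"
proof (induction Cs arbitrary: m s)
  case (Cons D Cs)
  thus ?case by (cases m) (simp_all add: sum_distrib_left mult_ac)
qed simp

lemma evl_sum_lists:
  "evl r s Cs = (\<Sum>is | set is \<subseteq> {..<r} \<and> length is = length Cs. s is * (\<Prod>j=0..<length Cs. (Cs ! j) (is ! j)))"
proof (induction Cs arbitrary: s)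
  case Nil
  have "{is. set is \<subseteq> {..<r} \<and> length is = 0} = {[]}" by auto
  thus ?case by simp
next
  case (Cons C Cs)
  let ?L = "{is. set is \<subseteq> {..<r} \<and> length is = length Cs}"
  have "(\<Sum>is | set is \<subseteq> {..<r} \<and> length is = length (C # Cs). s is * (\<Prod>j=0..<length (C # Cs). ((C # Cs) ! j) (is ! j)))
    = (\<Sum>(is, i) \<in> ?L \<times> {..<r}. s (i # is) * (C i * (\<Prod>j=0..<length Cs. (Cs ! j) (is ! j))))"
    by (rule sum.reindex_bij_witness[of _ "\<lambda>(is, i). i # is" "\<lambda>is. (tl is, hd is)"])
      (auto simp: length_Suc_conv prod.atLeast0_lessThan_Suc_shift simp del: prod.op_ivl_Suc)
  also have "\<dots> = (\<Sum>is\<in>?L. \<Sum>i<r. s (i # is) * (C i * (\<Prod>j=0..<length Cs. (Cs ! j) (is ! j))))"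
    by (rule sum.cartesian_product[symmetric])
  also have "\<dots> = (\<Sum>i<r. \<Sum>is\<in>?L. s (i # is) * (C i * (\<Prod>j=0..<length Cs. (Cs ! j) (is ! j))))"
    by (rule sum.swap)
  also have "\<dots> = evl r s (C # Cs)" by (simp add: Cons.IH sum_distrib_left mult_ac)
  finally show ?case by (rule sym)
qed

text \<open>Continued by the identity beyond the list, so that it is a permutation of all natural
  numbers when the list enumerates \<open>{..<k}\<close>.\<close>

definition list_perm :: "nat list \<Rightarrow> nat \<Rightarrow> nat" where
  "list_perm is j = (if j < length is then is ! j else j)"

text \<open>For a list of k indices below k, the coefficient of the wedge of the listed basis
  vectors with respect to the wedge in standard order.\<close>

definition list_sign :: "nat list \<Rightarrow> 'a :: comm_ring_1" where
  "list_sign is = (if distinct is then of_int (sign (list_perm is)) else 0)"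

lemma list_perm_permutes:
  assumes "distinct is" "set is \<subseteq> {..<k}" "length is = k"
  shows "list_perm is permutes {..<k}"
proof (rule bij_imp_permutes)
  have "inj_on (list_perm is) {..<k}" using assms by (auto simp: inj_on_def list_perm_def nth_eq_iff_index_eq)
  moreover have "is ! j < k" if "j < k" for j using subsetD[OF assms(2) nth_mem[of j "is"]] that assms(3) by simp
  hence "list_perm is ` {..<k} \<subseteq> {..<k}" using assms(3) by (auto simp: list_perm_def)
  ultimately show "bij_betw (list_perm is) {..<k} {..<k}" by (simp add: bij_betw_def endo_inj_surj)
qed (use assms in \<open>auto simp: list_perm_def\<close>)

text \<open>The Leibniz formula, once the lists are read as index functions; vectors become
  rows.\<close>

lemma evl_list_sign:
  assumes "length Cs = k"
  shows "evl k list_sign Cs = fdet k (\<lambda>j i. (Cs ! j) i)"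
proof -
  let ?T = "\<lambda>f. list_sign (map f [0..<k]) * (\<Prod>j=0..<k. (Cs ! j) (f j))"
  have "evl k list_sign Cs = (\<Sum>f\<in>{0..<k} \<rightarrow>\<^sub>E {0..<k}. ?T f)"
    unfolding evl_sum_lists assms
  proof (rule sum.reindex_bij_witness[of _ "\<lambda>f. map f [0..<k]" "\<lambda>is. \<lambda>j\<in>{0..<k}. is ! j"])
    fix "is" assume i: "is \<in> {is. set is \<subseteq> {..<k} \<and> length is = k}"
    show m: "map (\<lambda>j\<in>{0..<k}. is ! j) [0..<k] = is" using i by (intro nth_equalityI) auto
    have "is ! j < k" if "j < k" for j using i that subsetD[OF _ nth_mem[of j "is"], of "{..<k}"] by simp
    thus "(\<lambda>j\<in>{0..<k}. is ! j) \<in> {0..<k} \<rightarrow>\<^sub>E {0..<k}" by auto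
    show "?T (\<lambda>j\<in>{0..<k}. is ! j) = list_sign is * (\<Prod>j=0..<k. (Cs ! j) (is ! j))" unfolding m by simp
  next
    fix f assume f: "f \<in> {0..<k} \<rightarrow>\<^sub>E {0..<k}"
    show "(\<lambda>j\<in>{0..<k}. map f [0..<k] ! j) = f" using f by (auto simp: PiE_def extensional_def restrict_def)
    show "map f [0..<k] \<in> {is. set is \<subseteq> {..<k} \<and> length is = k}" using f by auto
  qed
  also have "\<dots> = (\<Sum>p | p permutes {0..<k}. ?T (restrict p {0..<k}))"
    by (rule sum_PiE_permutes) (auto simp: list_sign_def distinct_map)
  also have "\<dots> = (\<Sum>p | p permutes {0..<k}. of_int (sign p) * (\<Prod>j=0..<k. (Cs ! j) (p j)))"
  proof (rule sum.cong[OF refl])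
    fix p assume "p \<in> {p. p permutes {0..<k}}"
    hence p: "p permutes {0..<k}" by simp
    have m: "map (restrict p {0..<k}) [0..<k] = map p [0..<k]" by auto
    have "distinct (map p [0..<k])" using permutes_inj_on[OF p] by (simp add: distinct_map)
    moreover have "list_perm (map p [0..<k]) = p" using permutes_not_in[OF p] by (auto simp: list_perm_def)
    ultimately show "?T (restrict p {0..<k}) = of_int (sign p) * (\<Prod>j=0..<k. (Cs ! j) (p j))"
      unfolding m by (simp add: list_sign_def)
  qed
  finally show ?thesis by (simp add: fdet_leibniz)
qed

lemma evl_list_sign_eq_0:
  assumes "length Cs = k" "\<not> distinct Cs"
  shows "evl k list_sign Cs = 0"
proof -
  obtain i j where ij: "i < k" "j < k" "i \<noteq> j" "Cs ! i = Cs ! j" using assms by (auto simp: distinct_conv_nth)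
  show ?thesis unfolding evl_list_sign[OF assms(1)] fdet_def
    by (rule det_identical_rows[of _ k i j]) (use ij in \<open>auto simp: row_def\<close>)
qed

lemma evl_one: "evl 1 (\<lambda>_. 1) Cs = prod_list (map (\<lambda>C. C 0) Cs)"
  by (induction Cs) simp_all

lemma multilin_Cons:
  assumes V: "lin_space V" and f: "multilin V (Suc k) N f"
  shows "x \<in> carrier V \<Longrightarrow> multilin V k N (\<lambda>ys. f (x # ys))"
    and "ys \<in> tuples V k \<Longrightarrow> (\<lambda>x. f (x # ys)) \<in> lin_hom V N"
proof -
  interpret lin_space V by (rule V)
  have t: "ys \<in> tuples V k \<Longrightarrow> x \<in> carrier V \<Longrightarrow> x # ys \<in> tuples V (Suc k)" for x ys by (simp add: tuples_def)
  show "multilin V k N (\<lambda>ys. f (x # ys))" if x: "x \<in> carrier V"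
    unfolding multilin_def
  proof (intro conjI ballI allI impI)
    fix ys assume ys: "ys \<in> tuples V k"
    show "f (x # ys) \<in> carrier N" using f t[OF ys x] by (auto simp: multilin_def)
    fix i assume "i < k"
    hence "Suc i < Suc k" by simp
    hence "(\<lambda>a. f ((x # ys)[Suc i := a])) \<in> lin_hom V N" using f t[OF ys x] unfolding multilin_def by blast
    thus "(\<lambda>a. f (x # ys[i := a])) \<in> lin_hom V N" by simp
  qed
  show "(\<lambda>x. f (x # ys)) \<in> lin_hom V N" if ys: "ys \<in> tuples V k"
  proof -
    have "(\<lambda>a. f ((\<zero>\<^bsub>V\<^esub> # ys)[0 := a])) \<in> lin_hom V N" using f t[OF ys, of "\<zero>\<^bsub>V\<^esub>"] unfolding multilin_def by blast
    thus ?thesis by simp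
  qed
qed

text \<open>Made for one-dimensional powers: the values on basis tuples are all multiples of one
  generator Z, so only scalar coefficients have to be carried through the recursion.\<close>

lemma multilin_expand:
  fixes W :: "('e :: field_char_0, 'v) module"
  assumes W: "frame W r w cw" and T: "lin_space T" and f: "multilin W (length xs) T f" and Z: "Z \<in> carrier T"
    and s: "\<And>is. set is \<subseteq> {..<r} \<Longrightarrow> length is = length xs \<Longrightarrow> f (map w is) = s is \<odot>\<^bsub>T\<^esub> Z"
    and xs: "set xs \<subseteq> carrier W"
  shows "f xs = evl r s (map (\<lambda>x i. cw i x) xs) \<odot>\<^bsub>T\<^esub> Z"
  using f s xs
proof (induction xs arbitrary: f s)
  case Nil
  thus ?case using Nil.prems(2)[of "[]"] by simp
next
  case (Cons x xs)
  interpret W: framed W r w cw by standard (rule W)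
  interpret T: lin_space T by (rule T)
  have x: "x \<in> carrier W" and xs: "set xs \<subseteq> carrier W" "xs \<in> tuples W (length xs)" using Cons.prems(3) by (auto simp: tuples_def)
  note f = Cons.prems(1)[simplified]
  note l = multilin_Cons(2)[OF W.V f xs(2)]
  have sc: "(\<lambda>a. a \<odot>\<^bsub>T\<^esub> Z) \<in> lin_hom scalar_mod T"
    by (rule lin_homI) (auto simp: Z T.smult_add_left T.smult_smult)
  have IH: "f (w i # xs) = evl r (\<lambda>is. s (i # is)) (map (\<lambda>x i. cw i x) xs) \<odot>\<^bsub>T\<^esub> Z" if "i < r" for i
  proof (rule Cons.IH[OF multilin_Cons(1)[OF W.V f] _ xs(1)])
    show "w i \<in> carrier W" using that by simp
    fix "is" assume "set is \<subseteq> {..<r}" "length is = length xs"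
    thus "f (w i # map w is) = s (i # is) \<odot>\<^bsub>T\<^esub> Z" using Cons.prems(2)[of "i # is"] that by simp
  qed
  have "f (x # xs) = f ((\<Oplus>\<^bsub>W\<^esub>i\<in>{..<r}. cw i x \<odot>\<^bsub>W\<^esub> w i) # xs)" using W.expand[OF x] by simp
  also have "\<dots> = (\<Oplus>\<^bsub>T\<^esub>i\<in>{..<r}. f ((cw i x \<odot>\<^bsub>W\<^esub> w i) # xs))"
    by (rule lin_hom_finsum[OF W.rmod_axioms T.rmod_axioms l]) auto
  also have "\<dots> = (\<Oplus>\<^bsub>T\<^esub>i\<in>{..<r}. (cw i x * evl r (\<lambda>is. s (i # is)) (map (\<lambda>x i. cw i x) xs)) \<odot>\<^bsub>T\<^esub> Z)"
    by (rule T.M.finsum_cong') (auto simp: lin_hom_smult[OF l] IH T.smult_smult Z)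
  also have "\<dots> = (\<Sum>i<r. cw i x * evl r (\<lambda>is. s (i # is)) (map (\<lambda>x i. cw i x) xs)) \<odot>\<^bsub>T\<^esub> Z"
    using lin_hom_finsum[OF lin_space.rmod[OF lin_space_scalar] T.rmod_axioms sc, of "{..<r}"] by simp
  finally show ?case by simp
qed

text \<open>\<open>expand_list\<close> consumes one vector at a time. The complex factor and the
  coordinates of the consumed vector are absorbed into the coefficient function, hence
  \<open>G\<close> and \<open>s\<close> are arbitrary in the induction.\<close>

lemma expand_list_eq:
  fixes W :: "('e :: field_char_0, 'v) module" and T :: "('e, 't) module"
  assumes W: "frame W r w cw" and T: "lin_space T" and Z: "Z \<in> carrier (cxR T)"
    and G: "\<And>ys z. ys \<in> tuples W (length Ys) \<Longrightarrow>
      G ys z = tens 1 z \<odot>\<^bsub>cxR T\<^esub> (evl r s (map (\<lambda>x i. emb (cw i x)) ys) \<odot>\<^bsub>cxR T\<^esub> Z)"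
    and Ys: "set Ys \<subseteq> carrier (cxR W)"
  shows "expand_list (cxQ T) G Ys = evl r s (map (\<lambda>Y i. coord (cw i) Y) Ys) \<odot>\<^bsub>cxR T\<^esub> Z"
  using G Ys
proof (induction Ys arbitrary: G s)
  case Nil
  interpret T: rmod "cxR T" by (rule rmod_cxR[OF T])
  show ?case using Nil.prems(1)[of "[]" 1] Z by (simp add: tuples_def flip: emb_def)
next
  case (Cons Y Ys)
  interpret W: framed W r w cw by standard (rule W)
  interpret T: rmod "cxR T" by (rule rmod_cxR[OF T])
  have Y: "Y \<in> carrier (cxR W)" "set Ys \<subseteq> carrier (cxR W)" using Cons.prems(2) by auto
  let ?c = "\<lambda>Y i. coord (cw i) Y" and ?m = "\<lambda>x i. emb (cw i x)"
  let ?q = "\<lambda>i. evl r (\<lambda>is. s (i # is)) (map ?c Ys)"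
  define F where "F x z = expand_list (cxQ T) (\<lambda>ys u. G (x # ys) (z * u)) Ys" for x z
  define h where "h x = (\<Sum>i<r. emb (cw i x) * ?q i) \<odot>\<^bsub>cxR T\<^esub> Z" for x
  have F: "F x z = tens 1 z \<odot>\<^bsub>cxR T\<^esub> h x" if x: "x \<in> carrier W" for x z
  proof -
    let ?s = "\<lambda>is. tens 1 z * (\<Sum>i<r. emb (cw i x) * s (i # is))"
    have e: "evl r ?s Cs = tens 1 z * (\<Sum>i<r. emb (cw i x) * evl r (\<lambda>is. s (i # is)) Cs)" for Cs
      by (simp add: evl_smult evl_sum)
    have "F x z = evl r ?s (map ?c Ys) \<odot>\<^bsub>cxR T\<^esub> Z" unfolding F_def
    proof (rule Cons.IH[OF _ Y(2)])
      fix ys u assume "ys \<in> tuples W (length Ys)"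
      hence "x # ys \<in> tuples W (length (Y # Ys))" using x by (simp add: tuples_def)
      from Cons.prems(1)[OF this, of "z * u"] Z
      show "G (x # ys) (z * u) = tens 1 u \<odot>\<^bsub>cxR T\<^esub> (evl r ?s (map ?m ys) \<odot>\<^bsub>cxR T\<^esub> Z)"
        unfolding e by (simp add: T.smult_smult tens_mult mult.assoc[symmetric] mult.commute[of z u])
    qed
    thus ?thesis unfolding e h_def using Z by (simp add: T.smult_smult)
  qed
  have hh: "h \<in> lin_hom W (cxE T)"
  proof (rule lin_homI)
    fix x y assume xy: "x \<in> carrier W" "y \<in> carrier W"
    have "(\<Sum>i<r. emb (cw i (x \<oplus>\<^bsub>W\<^esub> y)) * ?q i) = (\<Sum>i<r. emb (cw i x) * ?q i) + (\<Sum>i<r. emb (cw i y) * ?q i)"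
      unfolding sum.distrib[symmetric] using xy by (intro sum.cong) (auto simp: lin_hom_add[OF W.c_hom] emb.hom_add distrib_right)
    thus "h (x \<oplus>\<^bsub>W\<^esub> y) = h x \<oplus>\<^bsub>cxE T\<^esub> h y" unfolding h_def using Z by (simp add: T.smult_add_left)
  next
    fix a x assume x: "x \<in> carrier W"
    have "(\<Sum>i<r. emb (cw i (a \<odot>\<^bsub>W\<^esub> x)) * ?q i) = emb a * (\<Sum>i<r. emb (cw i x) * ?q i)"
      unfolding sum_distrib_left using x by (intro sum.cong) (auto simp: lin_hom_smult[OF W.c_hom] emb_mult mult_ac)
    thus "h (a \<odot>\<^bsub>W\<^esub> x) = a \<odot>\<^bsub>cxE T\<^esub> h x" unfolding h_def using Z by (simp add: T.smult_smult)
  qed (simp add: h_def Z)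
  have R: "(\<lambda>Y. (\<Sum>i<r. coord (cw i) Y * ?q i) \<odot>\<^bsub>cxR T\<^esub> Z) \<in> lin_hom (cxR W) (cxR T)"
  proof (rule lin_homI)
    fix A C assume "A \<in> carrier (cxR W)" "C \<in> carrier (cxR W)"
    hence "(\<Sum>i<r. coord (cw i) (A \<oplus>\<^bsub>cxR W\<^esub> C) * ?q i) = (\<Sum>i<r. coord (cw i) A * ?q i) + (\<Sum>i<r. coord (cw i) C * ?q i)"
      unfolding sum.distrib[symmetric] by (intro sum.cong) (auto simp: lin_hom_add[OF coord_hom[OF W.V W.c_hom]] distrib_right)
    thus "(\<Sum>i<r. coord (cw i) (A \<oplus>\<^bsub>cxR W\<^esub> C) * ?q i) \<odot>\<^bsub>cxR T\<^esub> Z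
      = (\<Sum>i<r. coord (cw i) A * ?q i) \<odot>\<^bsub>cxR T\<^esub> Z \<oplus>\<^bsub>cxR T\<^esub> (\<Sum>i<r. coord (cw i) C * ?q i) \<odot>\<^bsub>cxR T\<^esub> Z"
      using Z by (simp add: T.smult_add_left)
  next
    fix a A assume "A \<in> carrier (cxR W)"
    hence "(\<Sum>i<r. coord (cw i) (a \<odot>\<^bsub>cxR W\<^esub> A) * ?q i) = a * (\<Sum>i<r. coord (cw i) A * ?q i)"
      unfolding sum_distrib_left by (intro sum.cong) (auto simp: lin_hom_smult[OF coord_hom[OF W.V W.c_hom]] mult_ac)
    thus "(\<Sum>i<r. coord (cw i) (a \<odot>\<^bsub>cxR W\<^esub> A) * ?q i) \<odot>\<^bsub>cxR T\<^esub> Z = a \<odot>\<^bsub>cxR T\<^esub> ((\<Sum>i<r. coord (cw i) A * ?q i) \<odot>\<^bsub>cxR T\<^esub> Z)"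
      using Z by (simp add: T.smult_smult)
  qed (simp add: Z)
  have "extend_lin (cxQ T) (\<lambda>(x, z). F x z) Y = (\<Sum>i<r. coord (cw i) Y * ?q i) \<odot>\<^bsub>cxR T\<^esub> Z"
  proof (rule cxR_hom_eqI[OF W.V T.rmod_axioms cxR_lift_hom[OF W.V T hh F] R _ Y(1)])
    fix x assume x: "x \<in> carrier W"
    have "h x \<in> carrier (cxR T)" using lin_hom_closed[OF hh x] by simp
    moreover have "(\<Sum>i<r. coord (cw i) (cx_elt W x 1) * ?q i) = (\<Sum>i<r. emb (cw i x) * ?q i)"
      using x by (intro sum.cong) (auto simp: coord_elt[OF W.V W.c_hom] simp flip: emb_def)
    ultimately show "extend_lin (cxQ T) (\<lambda>(x, z). F x z) (cx_elt W x 1) = (\<Sum>i<r. coord (cw i) (cx_elt W x 1) * ?q i) \<odot>\<^bsub>cxR T\<^esub> Z"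
      using cxR_lift_elt[OF W.V T hh F x, of 1] by (simp add: h_def flip: emb_def)
  qed
  thus ?case by (simp add: F_def)
qed

text \<open>A list with a repetition gives zero, and any other list is a permutation of the standard
  one.\<close>

lemma exterior_power_elt_basis:
  assumes W: "lin_space W" and w: "\<And>i. i < k \<Longrightarrow> w i \<in> carrier W" and i: "set is \<subseteq> {..<k}" "length is = k"
  shows "power_elt True W k (map w is) = list_sign is \<odot>\<^bsub>power_mod True W k\<^esub> power_elt True W k (map w [0..<k])"
proof -
  interpret T: lin_space "power_mod True W k" by (rule lin_space_power[OF W])
  have Z: "power_elt True W k (map w [0..<k]) \<in> carrier (power_mod True W k)"
    by (rule power_elt_closed[OF W]) (use w in \<open>auto simp: tuples_def\<close>)
  show ?thesis
  proof (cases "distinct is")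
    case True
    note p = list_perm_permutes[OF True i]
    have "map (w \<circ> list_perm is) [0..<k] = map w is" using i(2) by (intro nth_equalityI) (auto simp: list_perm_def)
    moreover have "power_elt True W k (map (w \<circ> list_perm is) [0..<k])
        = of_int (sign (list_perm is)) \<odot>\<^bsub>power_mod True W k\<^esub> power_elt True W k (map w [0..<k])"
      by (rule alternating_permute[OF W lin_space_power[OF W] power_elt_multilin[OF W] power_elt_alternating[OF W] p w])
    ultimately show ?thesis using True by (simp add: list_sign_def)
  next
    case False
    have "map w is \<in> tuples W k" "\<not> distinct (map w is)"
      using w i False by (auto simp: tuples_def distinct_map subset_iff)
    hence "power_elt True W k (map w is) = \<zero>\<^bsub>power_mod True W k\<^esub>"
      using power_elt_alternating[OF W, of k] by (simp add: alternating_def)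
    thus ?thesis using False Z by (simp add: list_sign_def)
  qed
qed

lemma cx_power_eq:
  assumes W: "frame W r w cw" and Z: "Z \<in> carrier (power_mod alt W k)"
    and s: "\<And>is. set is \<subseteq> {..<r} \<Longrightarrow> length is = k \<Longrightarrow> power_elt alt W k (map w is) = s is \<odot>\<^bsub>power_mod alt W k\<^esub> Z"
    and Ys: "set Ys \<subseteq> carrier (cxR W)" "length Ys = k"
  shows "cx_power alt W k Ys = evl r (\<lambda>is. emb (s is)) (map (\<lambda>Y i. coord (cw i) Y) Ys) \<odot>\<^bsub>cxR (power_mod alt W k)\<^esub>
    cx_elt (power_mod alt W k) Z 1"
proof -
  let ?T = "power_mod alt W k"
  interpret W: framed W r w cw by standard (rule W)
  have T: "lin_space ?T" by (rule lin_space_power[OF W.V])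
  show ?thesis unfolding cx_power_def
  proof (rule expand_list_eq[OF W T cxR_elt_closed[OF T Z] _ Ys(1)])
    fix ys z assume "ys \<in> tuples W (length Ys)"
    hence ys: "ys \<in> tuples W k" "length ys = k" "set ys \<subseteq> carrier W" using Ys(2) by (auto simp: tuples_def)
    let ?a = "evl r s (map (\<lambda>x i. cw i x) ys)"
    have "power_elt alt W k ys = ?a \<odot>\<^bsub>?T\<^esub> Z"
      by (rule multilin_expand[OF W T _ Z _ ys(3)]) (use power_elt_multilin[OF W.V] s ys(2) in auto)
    moreover have "emb ?a = evl r (\<lambda>is. emb (s is)) (map (\<lambda>x i. emb (cw i x)) ys)"
      by (simp add: evl_emb comp_def)
    ultimately show "cx_elt ?T (power_elt alt W k ys) z = tens 1 z \<odot>\<^bsub>cxR ?T\<^esub>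
        (evl r (\<lambda>is. emb (s is)) (map (\<lambda>x i. emb (cw i x)) ys) \<odot>\<^bsub>cxR ?T\<^esub> cx_elt ?T Z 1)"
      using cx_elt_eq[OF T power_elt_closed[OF W.V ys(1)], of z] emb_smult_elt[OF T Z, of ?a] by metis
  qed
qed

lemma evl_update_cong:
  assumes "\<And>i. i < r \<Longrightarrow> C i = D i"
  shows "evl r s (Cs[m := C]) = evl r s (Cs[m := D])"
proof (induction Cs arbitrary: m s)
  case (Cons E Cs)
  thus ?case using assms by (cases m) simp_all
qed simp

text \<open>\<open>K\<close> and \<open>\<phi>\<close> abstract the target: with \<open>K\<close>
  the action on a fixed element and \<open>\<phi>\<close> the embedding \<open>emb\<close> this
  serves comparison maps, with both the identity it serves functionals over E.\<close>

lemma evl_multilin: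
  assumes V: "lin_space V" and K: "\<And>a. K a \<in> carrier N" "\<And>a b. K (a + b) = K a \<oplus>\<^bsub>N\<^esub> K b"
      "\<And>e a. K (\<phi> e * a) = e \<odot>\<^bsub>N\<^esub> K a"
    and C: "\<And>x y i. x \<in> carrier V \<Longrightarrow> y \<in> carrier V \<Longrightarrow> i < r \<Longrightarrow> C (x \<oplus>\<^bsub>V\<^esub> y) i = C x i + C y i"
      "\<And>e x i. x \<in> carrier V \<Longrightarrow> i < r \<Longrightarrow> C (e \<odot>\<^bsub>V\<^esub> x) i = \<phi> e * C x i"
  shows "multilin V k N (\<lambda>xs. K (evl r s (map C xs)))"
  unfolding multilin_def
proof (intro conjI ballI allI impI)
  fix xs i assume xs: "xs \<in> tuples V k" and i: "i < k"
  have len: "i < length (map C xs)" using xs i by (simp add: tuples_def)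
  show "(\<lambda>a. K (evl r s (map C (xs[i := a])))) \<in> lin_hom V N"
  proof (rule lin_homI)
    fix x y assume xy: "x \<in> carrier V" "y \<in> carrier V"
    have "evl r s ((map C xs)[i := C (x \<oplus>\<^bsub>V\<^esub> y)]) = evl r s ((map C xs)[i := \<lambda>j. C x j + C y j])"
      by (rule evl_update_cong) (rule C(1)[OF xy])
    thus "K (evl r s (map C (xs[i := x \<oplus>\<^bsub>V\<^esub> y]))) = K (evl r s (map C (xs[i := x]))) \<oplus>\<^bsub>N\<^esub> K (evl r s (map C (xs[i := y])))"
      by (simp only: map_update evl_update_add[OF len] K)
  next
    fix e x assume x: "x \<in> carrier V"
    have "evl r s ((map C xs)[i := C (e \<odot>\<^bsub>V\<^esub> x)]) = evl r s ((map C xs)[i := \<lambda>j. \<phi> e * C x j])"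
      by (rule evl_update_cong) (rule C(2)[OF x])
    thus "K (evl r s (map C (xs[i := e \<odot>\<^bsub>V\<^esub> x]))) = e \<odot>\<^bsub>N\<^esub> K (evl r s (map C (xs[i := x])))"
      by (simp only: map_update evl_update_smult[OF len] K)
  qed (rule K)
qed (rule K)

lemma multilin_cong:
  assumes V: "lin_space V" and g: "multilin V k N g" and eq: "\<And>xs. xs \<in> tuples V k \<Longrightarrow> f xs = g xs"
  shows "multilin V k N f"
  unfolding multilin_def
proof (intro conjI ballI allI impI)
  interpret lin_space V by (rule V)
  fix xs i assume xs: "xs \<in> tuples V k" and i: "i < k"
  have h: "(\<lambda>a. g (xs[i := a])) \<in> lin_hom V N" using g xs i by (simp add: multilin_def)
  show "(\<lambda>a. f (xs[i := a])) \<in> lin_hom V N"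
    using lin_hom[OF h] by (intro lin_homI) (simp_all add: eq tuples_update[OF xs])
qed (use g eq in \<open>simp add: multilin_def\<close>)

text \<open>The hypotheses fit a power that is a line with generator Z: a top exterior power with
  signs as coefficients, or a tensor power of a line with all coefficients 1. The comparison then
  multiplies by a single value of \<open>evl\<close>.\<close>

lemma
  fixes N :: "('e :: number_field, 'b, 'd) bdr"
  assumes V: "lin_space (betti N)" and c: "comparison N \<in> lin_hom (cxR (betti N)) (cxR (derham N))"
    and W: "frame (derham N) r w cw" and Z: "Z \<in> carrier (power_mod alt (derham N) k)"
    and s: "\<And>is. set is \<subseteq> {..<r} \<Longrightarrow> length is = k \<Longrightarrow>
      power_elt alt (derham N) k (map w is) = s is \<odot>\<^bsub>power_mod alt (derham N) k\<^esub> Z"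
    and alt: "\<And>Cs :: (nat \<Rightarrow> 'e ec) list. alt \<Longrightarrow> length Cs = k \<Longrightarrow> \<not> distinct Cs \<Longrightarrow> evl r (\<lambda>is. emb (s is)) Cs = 0"
  shows power_sys_cmp_hom: "comparison (power_sys alt k N) \<in>
      lin_hom (cxR (power_mod alt (betti N) k)) (cxR (power_mod alt (derham N) k))"
    and power_sys_cmp_elt: "xs \<in> tuples (betti N) k \<Longrightarrow>
      comparison (power_sys alt k N) (cx_elt (power_mod alt (betti N) k) (power_elt alt (betti N) k xs) 1)
      = evl r (\<lambda>is. emb (s is)) (map (\<lambda>x i. coord (cw i) (comparison N (cx_elt (betti N) x 1))) xs)
        \<odot>\<^bsub>cxR (power_mod alt (derham N) k)\<^esub> cx_elt (power_mod alt (derham N) k) Z 1"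
proof -
  let ?V = "betti N" and ?W = "derham N" and ?T = "power_mod alt (derham N) k"
  interpret W: framed ?W r w cw by standard (rule W)
  have T: "lin_space ?T" by (rule lin_space_power[OF W.V])
  interpret TC: rmod "cxR ?T" by (rule rmod_cxR[OF T])
  have Zc: "cx_elt ?T Z 1 \<in> carrier (cxR ?T)" by (rule cxR_elt_closed[OF T Z])
  let ?C = "\<lambda>x i. coord (cw i) (comparison N (cx_elt ?V x 1))"
  let ?e = "\<lambda>Cs. evl r (\<lambda>is. emb (s is)) Cs"
  let ?h = "\<lambda>xs. cx_power alt ?W k (map (\<lambda>x. comparison N (cx_elt ?V x 1)) xs)"
  have h: "?h xs = ?e (map ?C xs) \<odot>\<^bsub>cxR ?T\<^esub> cx_elt ?T Z 1" if "xs \<in> tuples ?V k" for xs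
  proof -
    have "set (map (\<lambda>x. comparison N (cx_elt ?V x 1)) xs) \<subseteq> carrier (cxR ?W)" "length xs = k"
      using that lin_hom_closed[OF c cxR_elt_closed[OF V]] by (auto simp: tuples_def)
    thus ?thesis using cx_power_eq[OF W Z s, of "map (\<lambda>x. comparison N (cx_elt ?V x 1)) xs"] by (simp add: comp_def)
  qed
  have Cadd: "?C (x \<oplus>\<^bsub>?V\<^esub> y) i = ?C x i + ?C y i" if "x \<in> carrier ?V" "y \<in> carrier ?V" "i < r" for x y i
    using that lin_hom_add[OF cmp_elt_hom[OF V c] that(1,2)] lin_hom_closed[OF c cxR_elt_closed[OF V]]
    by (simp add: lin_hom_add[OF coord_hom[OF W.V W.c_hom]])
  have Csm: "?C (a \<odot>\<^bsub>?V\<^esub> x) i = emb a * ?C x i" if "x \<in> carrier ?V" "i < r" for x a i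
    using that lin_hom_smult[OF cmp_elt_hom[OF V c] that(1)] lin_hom_closed[OF c cxR_elt_closed[OF V]]
    by (simp add: lin_hom_smult[OF coord_hom[OF W.V W.c_hom]])
  have "multilin ?V k (cxE ?T) (\<lambda>xs. ?e (map ?C xs) \<odot>\<^bsub>cxR ?T\<^esub> cx_elt ?T Z 1)"
    by (rule evl_multilin[OF V, where \<phi> = emb]) (use Zc Cadd Csm in \<open>auto simp: TC.smult_add_left TC.smult_smult\<close>)
  hence m: "multilin ?V k (cxE ?T) ?h" by (rule multilin_cong[OF V]) (rule h)
  have a: "alternating ?V k (cxE ?T) ?h" if alt
    unfolding alternating_def
  proof (intro ballI impI)
    fix xs assume xs: "xs \<in> tuples ?V k" and nd: "\<not> distinct xs"
    have "\<not> distinct (map ?C xs)" using nd by (simp add: distinct_map)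
    moreover have "length (map ?C xs) = k" using xs by (simp add: tuples_def)
    ultimately show "?h xs = \<zero>\<^bsub>cxE ?T\<^esub>" unfolding h[OF xs] using alt[OF that] Zc by simp
  qed
  have l: "extend_lin (cxE ?T) ?h \<in> lin_hom (power_mod alt ?V k) (cxE ?T)"
    by (rule power_lift_hom[OF V lin_space_cxE[OF T] m a])
  have e: "extend_lin (cxE ?T) ?h (power_elt alt ?V k xs) = ?h xs" if "xs \<in> tuples ?V k" for xs
    by (rule power_lift_elt[OF V lin_space_cxE[OF T] m a that])
  have eq: "comparison (power_sys alt k N) = cx_extend ?T (extend_lin (cxE ?T) ?h)" by (simp add: power_sys_def)
  show "comparison (power_sys alt k N) \<in> lin_hom (cxR (power_mod alt ?V k)) (cxR ?T)"
    unfolding eq by (rule cx_extend_hom[OF lin_space_power[OF V] T l])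
  show "comparison (power_sys alt k N) (cx_elt (power_mod alt ?V k) (power_elt alt ?V k xs) 1)
      = ?e (map ?C xs) \<odot>\<^bsub>cxR ?T\<^esub> cx_elt ?T Z 1" if xs: "xs \<in> tuples ?V k"
    unfolding eq cx_extend_elt[OF lin_space_power[OF V] T l power_elt_closed[OF V xs]] e[OF xs] by (rule h[OF xs])
qed

lemma dual_frame:
  fixes V :: "('e :: field_char_0, 'v) module"
  assumes "frame V 1 b c"
  shows "frame (dual_mod V) 1 (\<lambda>_. restrict (c 0) (carrier V)) (\<lambda>_ f. f (b 0))"
proof -
  interpret V: framed V 1 b c by standard (rule assms)
  have c: "c 0 \<in> lin_hom V scalar_mod" by (rule V.c_hom) simp
  have b: "b 0 \<in> carrier V" by simp
  show ?thesis
  proof (rule frameI[OF lin_space_dual[OF V.V]])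
    fix f assume f: "f \<in> carrier (dual_mod V)" and 0: "\<And>i :: nat. i < 1 \<Longrightarrow> f (b 0) = 0"
    have "f x = 0" if x: "x \<in> carrier V" for x
    proof -
      have "f x = f (c 0 x \<odot>\<^bsub>V\<^esub> b 0)" using V.expand[OF x] by (simp add: b lessThan_Suc)
      also have "\<dots> = 0" using f 0[of 0] lin_hom_smult[of f V scalar_mod "b 0" "c 0 x"] b by simp
      finally show ?thesis .
    qed
    thus "f = \<zero>\<^bsub>dual_mod V\<^esub>" using f by (auto simp: fun_eq_iff extensional_def)
  qed (use dual_restrict[OF c V.V] V.c_b[of 0 0] b in \<open>auto intro!: lin_homI\<close>)
qed

text \<open>In rank one a functional is its value at the generator times the coordinate, so
  evaluation is a product of two coordinates.\<close>

lemma cx_eval_eq: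
  fixes V :: "('e :: field_char_0, 'v) module"
  assumes V: "frame V 1 b c" and G: "G \<in> carrier (cxR (dual_mod V))" and X: "X \<in> carrier (cxR V)"
  shows "cx_eval G X = (coord (\<lambda>f. f (b 0)) G * coord (c 0) X) \<odot>\<^bsub>cxR scalarE\<^esub> cx_elt scalarE 1 1"
proof -
  interpret V: framed V 1 b c by standard (rule V)
  note D = dual_frame[OF V] and S = lin_space_scalar
  interpret D: framed "dual_mod V" 1 "\<lambda>_. restrict (c 0) (carrier V)" "\<lambda>_ f. f (b 0)" by standard (rule D)
  interpret SC: rmod "cxR scalarE" by (rule rmod_cxR[OF S])
  have c: "c 0 \<in> lin_hom V scalar_mod" and b: "b 0 \<in> carrier V" using V.c_hom[of 0] by simp_all
  have ev: "(\<lambda>f. f (b 0)) \<in> lin_hom (dual_mod V) scalar_mod" using D.c_hom[of 0] by simp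
  let ?u = "cx_elt scalarE 1 1 :: 'e cx"
  have u: "?u \<in> carrier (cxR scalarE)" by (rule cxR_elt_closed[OF S]) simp
  have se: "cx_elt scalarE e z = (tens 1 z * emb e) \<odot>\<^bsub>cxR scalarE\<^esub> ?u" for e :: 'e and z
    using tens_smult_elt[OF S, of 1 e z 1] by (simp add: emb_def tens_mult)
  have line: "(\<lambda>x. (a * k x) \<odot>\<^bsub>cxR scalarE\<^esub> ?u) \<in> lin_hom (cxR U) (cxR scalarE)" if "k \<in> lin_hom (cxR U) self_mod"
    for a and k :: "'u cx \<Rightarrow> 'e ec" and U :: "('e, 'u) module"
    using u by (intro lin_homI) (auto simp: lin_hom_add[OF that] lin_hom_smult[OF that] distrib_left SC.smult_add_left SC.smult_smult mult_ac)
  have inner: "extend_lin (cxQ scalarE) (\<lambda>(x, w). cx_elt scalarE (f x) (z * w)) X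
      = (tens 1 z * emb (f (b 0)) * coord (c 0) X) \<odot>\<^bsub>cxR scalarE\<^esub> ?u" if f: "f \<in> carrier (dual_mod V)" for f z
  proof -
    have fh: "f \<in> lin_hom V scalar_mod" using f by simp
    have h: "(\<lambda>x. (tens 1 z * emb (f x)) \<odot>\<^bsub>cxR scalarE\<^esub> ?u) \<in> lin_hom V (cxE scalarE)"
      using u by (intro lin_homI)
        (auto simp: lin_hom_add[OF fh] lin_hom_smult[OF fh] emb_add emb_mult distrib_left SC.smult_add_left SC.smult_smult mult_ac)
    have F: "cx_elt scalarE (f x) (z * w) = tens 1 w \<odot>\<^bsub>cxR scalarE\<^esub> ((tens 1 z * emb (f x)) \<odot>\<^bsub>cxR scalarE\<^esub> ?u)" for x w
      unfolding se[of "f x" "z * w"] using u by (simp add: SC.smult_smult tens_mult mult.assoc[symmetric] mult.commute[of w z])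
    show ?thesis
    proof (rule cxR_hom_eqI[OF V.V SC.rmod_axioms cxR_lift_hom[OF V.V S h F] line[OF coord_hom[OF V.V c]] _ X])
      fix x assume x: "x \<in> carrier V"
      have "f x = f (c 0 x \<odot>\<^bsub>V\<^esub> b 0)" using V.expand[OF x] b by (simp add: lessThan_Suc)
      hence fx: "f x = c 0 x * f (b 0)" using lin_hom_smult[OF fh b] by simp
      show "extend_lin (cxQ scalarE) (\<lambda>(x, w). cx_elt scalarE (f x) (z * w)) (cx_elt V x 1)
          = (tens 1 z * emb (f (b 0)) * coord (c 0) (cx_elt V x 1)) \<odot>\<^bsub>cxR scalarE\<^esub> ?u"
        using cxR_lift_elt[OF V.V S h F x, of 1] u
        by (simp add: coord_elt[OF V.V c x] fx emb_mult mult_ac flip: emb_def)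
    qed
  qed
  define H where "H f = (emb (f (b 0)) * coord (c 0) X) \<odot>\<^bsub>cxR scalarE\<^esub> ?u" for f :: "'v \<Rightarrow> 'e"
  have h': "H \<in> lin_hom (dual_mod V) (cxE scalarE)"
    unfolding H_def[abs_def] using u by (intro lin_homI)
      (auto simp: lin_hom_add[OF ev, simplified] lin_hom_smult[OF ev, simplified] b emb_add emb_mult distrib_left distrib_right SC.smult_add_left SC.smult_smult mult_ac)
  define K where "K f z = extend_lin (cxQ scalarE) (\<lambda>(x, w). cx_elt scalarE (f x) (z * w)) X" for f :: "'v \<Rightarrow> 'e" and z
  have F': "K f z = tens 1 z \<odot>\<^bsub>cxR scalarE\<^esub> H f" if "f \<in> carrier (dual_mod V)" for f z
    unfolding K_def H_def using inner[OF that] u by (simp add: SC.smult_smult mult.assoc)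
  have "cx_eval G X = (coord (c 0) X * coord (\<lambda>f. f (b 0)) G) \<odot>\<^bsub>cxR scalarE\<^esub> ?u"
    unfolding cx_eval_def K_def[symmetric]
  proof (rule cxR_hom_eqI[OF D.V SC.rmod_axioms cxR_lift_hom[OF D.V S h' F'] line[OF coord_hom[OF D.V ev]] _ G])
    fix f assume f: "f \<in> carrier (dual_mod V)"
    show "extend_lin (cxQ scalarE) (\<lambda>(f, z). K f z) (cx_elt (dual_mod V) f 1)
        = (coord (c 0) X * coord (\<lambda>f. f (b 0)) (cx_elt (dual_mod V) f 1)) \<odot>\<^bsub>cxR scalarE\<^esub> ?u"
      using cxR_lift_elt[OF D.V S h' F' f, of 1] u
      by (simp add: H_def coord_elt[OF D.V ev f] mult_ac flip: emb_def)
  qed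
  thus ?thesis by (simp add: mult.commute)
qed

context bdr_pairing
begin

definition lstar where "lstar = restrict (l1 0) (carrier L.V)"
definition mstar where "mstar = restrict (m1 0) (carrier L.W)"

abbreviation "Vd \<equiv> dual_mod L.V"
abbreviation "Wd \<equiv> dual_mod L.W"

lemmas Vd_frame = dual_frame[OF l, folded lstar_def]
lemmas Wd_frame = dual_frame[OF m, folded mstar_def]

text \<open>The condition behind \<open>THE\<close> becomes g \<lambda> = a for the coordinates g
  and a on the two dual lines. As \<lambda> is a unit with inverse \<open>mu\<close>, there is
  exactly one solution.\<close>

lemma dual_sys_cmp:
  assumes mu: "mu * lam = 1" and F: "F \<in> carrier (cxR Vd)"
  shows "comparison (dual_sys L) F = (mu * coord (\<lambda>f. f (l0 0)) F) \<odot>\<^bsub>cxR Wd\<^esub> cx_elt Wd mstar 1"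
proof -
  interpret Vd: framed Vd 1 "\<lambda>_. lstar" "\<lambda>_ f. f (l0 0)" by standard (rule Vd_frame)
  interpret Wd: framed Wd 1 "\<lambda>_. mstar" "\<lambda>_ f. f (m0 0)" by standard (rule Wd_frame)
  interpret SC: rmod "cxR scalarE" by (rule rmod_cxR[OF lin_space_scalar])
  let ?u = "cx_elt scalarE 1 1 :: 'e cx"
  have u: "?u \<in> carrier (cxR scalarE)" by (rule cxR_elt_closed[OF lin_space_scalar]) simp
  have inj: "a \<odot>\<^bsub>cxR scalarE\<^esub> ?u = b \<odot>\<^bsub>cxR scalarE\<^esub> ?u \<longleftrightarrow> a = b" for a b
  proof
    assume "a \<odot>\<^bsub>cxR scalarE\<^esub> ?u = b \<odot>\<^bsub>cxR scalarE\<^esub> ?u"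
    hence "Abs_ec (a \<odot>\<^bsub>cxR scalarE\<^esub> ?u) = Abs_ec (b \<odot>\<^bsub>cxR scalarE\<^esub> ?u)" by simp
    thus "a = b" using lin_hom_smult[OF self_hom_scalarE u] by (simp add: Abs_cx_elt)
  qed simp
  have mh: "m1 0 \<in> lin_hom L.W scalar_mod" and evm: "(\<lambda>f. f (m0 0)) \<in> lin_hom Wd scalar_mod"
    using m.c_hom[of 0] Wd.c_hom[of 0] by simp_all
  let ?a = "coord (\<lambda>f. f (l0 0)) F" and ?g = "coord (\<lambda>f. f (m0 0))"
  have char: "(\<forall>X\<in>carrier (cx L.V). cx_eval G (L.cmp X) = cx_eval F X) \<longleftrightarrow> ?g G = mu * ?a"
    if G: "G \<in> carrier (cxR Wd)" for G
  proof -
    have e: "cx_eval G (L.cmp X) = cx_eval F X \<longleftrightarrow> ?g G * (coord (l1 0) X * lam) = ?a * coord (l1 0) X"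
      if X: "X \<in> carrier (cxR L.V)" for X
    proof -
      have h: "(\<lambda>Z. coord (m1 0) (L.cmp Z)) \<in> lin_hom (cxR L.V) self_mod" by (rule lin_hom_comp[OF L.cmp_hom coord_hom[OF L.W mh]])
      have "coord (m1 0) (L.cmp X) = coord (l1 0) X * lam" using l.hom_expand[OF rmod_self h X] by (simp add: lam_def lessThan_Suc)
      thus ?thesis unfolding cx_eval_eq[OF m G lin_hom_closed[OF L.cmp_hom X]] cx_eval_eq[OF l F X] inj by simp
    qed
    have "?g G = mu * ?a" if "\<forall>X\<in>carrier (cx L.V). cx_eval G (L.cmp X) = cx_eval F X"
    proof -
      have "?g G * lam = ?a" using that e[of "l.e 0"] l.coord_e[of 0 0] by simp
      hence "mu * ?a = ?g G * (mu * lam)" by (simp add: mult_ac)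
      thus ?thesis using mu by simp
    qed
    moreover have "?g G * (coord (l1 0) X * lam) = ?a * coord (l1 0) X" if "?g G = mu * ?a" for X
    proof -
      have "?g G * (coord (l1 0) X * lam) = (mu * lam) * (?a * coord (l1 0) X)" unfolding that by (simp only: mult_ac)
      thus ?thesis using mu by simp
    qed
    ultimately show ?thesis using e by auto
  qed
  have mc: "mstar \<in> carrier Wd" using Wd.b_closed[of 0] by simp
  let ?G = "(mu * ?a) \<odot>\<^bsub>cxR Wd\<^esub> cx_elt Wd mstar 1"
  have Gc: "?G \<in> carrier (cxR Wd)" using cxR_elt_closed[OF Wd.V mc] by simp
  have gG: "?g ?G = mu * ?a"
    using lin_hom_smult[OF coord_hom[OF Wd.V evm] cxR_elt_closed[OF Wd.V mc]] Wd.coord_e[of 0 0] by simp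
  have "(THE G. G \<in> carrier (cx Wd) \<and> (\<forall>X\<in>carrier (cx L.V). cx_eval G (L.cmp X) = cx_eval F X)) = ?G"
  proof (rule the_equality)
    show "?G \<in> carrier (cx Wd) \<and> (\<forall>X\<in>carrier (cx L.V). cx_eval ?G (L.cmp X) = cx_eval F X)"
      using char[OF Gc] gG Gc by simp
    fix G assume "G \<in> carrier (cx Wd) \<and> (\<forall>X\<in>carrier (cx L.V). cx_eval G (L.cmp X) = cx_eval F X)"
    hence G: "G \<in> carrier (cxR Wd)" "?g G = mu * ?a" using char[of G] by auto
    show "G = ?G" by (rule Wd.cx_eqI[OF G(1) Gc]) (simp add: G(2) gG)
  qed
  thus ?thesis by (simp add: dual_sys_def)
qed

lemma dual_sys_cmp_hom:
  assumes mu: "mu * lam = 1"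
  shows "comparison (dual_sys L) \<in> lin_hom (cxR Vd) (cxR Wd)"
proof -
  interpret Vd: framed Vd 1 "\<lambda>_. lstar" "\<lambda>_ f. f (l0 0)" by standard (rule Vd_frame)
  interpret Wd: framed Wd 1 "\<lambda>_. mstar" "\<lambda>_ f. f (m0 0)" by standard (rule Wd_frame)
  have ev: "(\<lambda>f. f (l0 0)) \<in> lin_hom Vd scalar_mod" using Vd.c_hom[of 0] by simp
  have mc: "cx_elt Wd mstar 1 \<in> carrier (cxR Wd)" using Wd.e_closed[of 0] by simp
  note h = coord_hom[OF Vd.V ev]
  show ?thesis
    by (rule lin_homI) (auto simp: dual_sys_cmp[OF mu] mc lin_hom_add[OF h] lin_hom_smult[OF h] Vd.C.add_closed Vd.C.smult_closed
      distrib_left Wd.C.smult_add_left Wd.C.smult_smult mult_ac)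
qed

end

lemma evl_coord_multilin:
  assumes V: "lin_space V" and c: "\<And>i. i < r \<Longrightarrow> c i \<in> lin_hom V scalar_mod"
  shows "multilin V k scalar_mod (\<lambda>xs. evl r s (map (\<lambda>x i. c i x) xs))"
  by (rule evl_multilin[OF V, where \<phi> = "\<lambda>a. a" and K = "\<lambda>a. a"]) (auto simp: lin_hom_add[OF c] lin_hom_smult[OF c])

text \<open>The determinant form on the top exterior power times the product of coordinates on the
  tensor power gives a functional with value 1 at this element.\<close>

lemma top_power_tensor_nonzero:
  fixes V :: "('e :: field_char_0, 'v) module" and D :: "('e, 'd) module"
  assumes V: "frame V k v cv" and D: "frame D 1 b c"
  shows "tensor_elt (power_mod True V k) (power_mod False D n) (power_elt True V k (map v [0..<k]))
      (power_elt False D n (replicate n (b 0))) \<noteq> \<zero>\<^bsub>tensor_mod (power_mod True V k) (power_mod False D n)\<^esub>"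
    (is "tensor_elt ?T1 ?T2 ?a ?b \<noteq> _")
proof
  interpret V: framed V k v cv by standard (rule V)
  interpret D: framed D 1 b c by standard (rule D)
  note S = lin_space_scalar and T1 = lin_space_power[OF V.V, of True k] and T2 = lin_space_power[OF D.V, of False n]
  let ?f = "\<lambda>xs. evl k list_sign (map (\<lambda>x i. cv i x) xs)" and ?g = "\<lambda>xs. evl 1 (\<lambda>_. 1) (map (\<lambda>x i. c i x) xs)"
  have mf: "multilin V k scalar_mod ?f" by (rule evl_coord_multilin[OF V.V V.c_hom])
  have af: "alternating V k scalar_mod ?f"
    by (auto simp: alternating_def tuples_def distinct_map intro!: evl_list_sign_eq_0)
  have mg: "multilin D n scalar_mod ?g" by (rule evl_coord_multilin[OF D.V D.c_hom])
  let ?F = "extend_lin scalar_mod ?f" and ?G = "extend_lin scalar_mod ?g"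
  have F: "?F \<in> lin_hom ?T1 scalar_mod" by (rule power_lift_hom[OF V.V S mf af])
  have G: "?G \<in> lin_hom ?T2 scalar_mod" by (rule power_lift_hom[OF D.V S mg]) simp
  have at: "map v [0..<k] \<in> tuples V k" and bt: "replicate n (b 0) \<in> tuples D n" by (auto simp: tuples_def)
  have a: "?F ?a = 1"
  proof -
    have "?F ?a = ?f (map v [0..<k])" by (rule power_lift_elt[OF V.V S mf af at])
    also have "\<dots> = fdet k (\<lambda>j i. cv i (v j))" unfolding evl_list_sign[of _ k, simplified] by (simp add: evl_list_sign) (rule fdet_cong, simp)
    also have "\<dots> = fdet k (\<lambda>j i. if j = i then 1 else 0)" by (rule fdet_cong) (auto simp: V.c_b)
    finally show ?thesis by (simp add: fdet_one)
  qed
  have b: "?G ?b = 1"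
  proof -
    have "?G ?b = ?g (replicate n (b 0))" by (rule power_lift_elt[OF D.V S mg _ bt]) simp
    thus ?thesis unfolding evl_one using D.c_b[of 0 0] by (simp add: comp_def)
  qed
  have bl: "bilin ?T1 ?T2 scalar_mod (\<lambda>x y. F x * G y)"
    if F: "F \<in> lin_hom ?T1 scalar_mod" and G: "G \<in> lin_hom ?T2 scalar_mod" for F G
    by (rule bilinI; rule lin_homI) (auto simp: lin_hom_add[OF F] lin_hom_smult[OF F] lin_hom_add[OF G] lin_hom_smult[OF G] algebra_simps)
  note bl = bl[OF F G]
  let ?H = "extend_lin scalar_mod (\<lambda>(x, y). ?F x * ?G y)"
  have "?H (tensor_elt ?T1 ?T2 ?a ?b) = ?F ?a * ?G ?b"
    by (rule tensor_lift_elt[OF T1 T2 S bl power_elt_closed[OF V.V at] power_elt_closed[OF D.V bt]])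
  moreover assume "tensor_elt ?T1 ?T2 ?a ?b = \<zero>\<^bsub>tensor_mod ?T1 ?T2\<^esub>"
  moreover have "?H \<zero>\<^bsub>tensor_mod ?T1 ?T2\<^esub> = 0"
    using lin_hom_zero[OF lin_space_tensor[OF T1 T2] S tensor_lift_hom[OF T1 T2 S bl]] by simp
  ultimately show False using a b by simp
qed

section \<open>Rationality of the full period determinant in the orthogonal case, and the
  conclusion\<close>

lemma sys_simps:
  "betti (tensor_sys M N) = tensor_mod (betti M) (betti N)" "derham (tensor_sys M N) = tensor_mod (derham M) (derham N)"
  "betti (power_sys alt k M) = power_mod alt (betti M) k" "derham (power_sys alt k M) = power_mod alt (derham M) k"
  "betti (dual_sys M) = dual_mod (betti M)" "derham (dual_sys M) = dual_mod (derham M)"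
  "betti unit_sys = scalar_mod" "derham unit_sys = scalar_mod" "comparison unit_sys X = X"
  by (simp_all add: tensor_sys_def power_sys_def dual_sys_def unit_sys_def)

text \<open>Compatibility of \<tau> and \<tau>' with the comparisons is evaluated at the generator
  built from \<open>v\<close> and the dual generator of L. The Betti value of \<tau> equals det P
  times \<open>mu\<^sup>n\<close> times the de Rham value of \<tau>'; multiplying by
  \<open>\<lambda>\<^sup>n\<close> gives the claim, with the Betti value as \<beta>.\<close>

lemma (in bdr_pairing) orthogonal_rational_pdet:
  assumes iso: "bdr_iso (tensor_sys (ext_power_sys (2 * n) M) (tensor_power_sys n (dual_sys L))) unit_sys \<tau> \<tau>'"
  shows rational_pdet
proof (rule rational_pdetI)
  fix v cv w cw assume v: "frame M.V (2 * n) v cv" and w: "frame M.W (2 * n) w cw"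
  interpret v: framed M.V "2 * n" v cv by standard (rule v)
  interpret w: framed M.W "2 * n" w cw by standard (rule w)
  interpret Vd: framed Vd 1 "\<lambda>_. lstar" "\<lambda>_ f. f (l0 0)" by standard (rule Vd_frame)
  interpret Wd: framed Wd 1 "\<lambda>_. mstar" "\<lambda>_ f. f (m0 0)" by standard (rule Wd_frame)
  obtain mu where mu: "mu * lam = 1" using lam_unit by blast
  let ?T1 = "power_mod True M.V (2 * n)" and ?S1 = "power_mod True M.W (2 * n)"
  let ?T2 = "power_mod False Vd n" and ?S2 = "power_mod False Wd n"
  let ?M1 = "ext_power_sys (2 * n) M" and ?M2 = "tensor_power_sys n (dual_sys L)"
  note T1 = lin_space_power[OF M.V, of True "2 * n"] and S1 = lin_space_power[OF M.W, of True "2 * n"]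
    and T2 = lin_space_power[OF Vd.V, of False n] and S2 = lin_space_power[OF Wd.V, of False n]
  note T = lin_space_tensor[OF T1 T2] and S = lin_space_tensor[OF S1 S2] and E = lin_space_scalar
  have tup: "map v [0..<2*n] \<in> tuples M.V (2*n)" "map w [0..<2*n] \<in> tuples M.W (2*n)"
    "replicate n lstar \<in> tuples Vd n" "replicate n mstar \<in> tuples Wd n"
    using Vd.b_closed[of 0] Wd.b_closed[of 0] by (auto simp: tuples_def simp del: dual_mod_simps)
  let ?a = "power_elt True M.V (2*n) (map v [0..<2*n])" and ?Z1 = "power_elt True M.W (2*n) (map w [0..<2*n])"
  let ?b = "power_elt False Vd n (replicate n lstar)" and ?Z2 = "power_elt False Wd n (replicate n mstar)"
  have cl: "?a \<in> carrier ?T1" "?Z1 \<in> carrier ?S1" "?b \<in> carrier ?T2" "?Z2 \<in> carrier ?S2"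
    by (intro power_elt_closed M.V M.W Vd.V Wd.V tup)+
  have ls: "(\<lambda>is. emb (list_sign is)) = (list_sign :: nat list \<Rightarrow> 'e ec)"
    by (auto simp: list_sign_def emb.hom_of_int)
  have s1: "power_elt True M.W (2*n) (map w is) = list_sign is \<odot>\<^bsub>?S1\<^esub> ?Z1"
    if "set is \<subseteq> {..<2*n}" "length is = 2*n" for "is"
    by (rule exterior_power_elt_basis[OF M.W w.b_closed that])
  have a1: "evl (2*n) (\<lambda>is. emb (list_sign is)) Cs = 0" if "length Cs = 2*n" "\<not> distinct Cs" for Cs :: "(nat \<Rightarrow> 'e ec) list"
    unfolding ls by (rule evl_list_sign_eq_0[OF that])
  have s2: "power_elt False Wd n (map (\<lambda>_. mstar) is) = 1 \<odot>\<^bsub>?S2\<^esub> ?Z2" if "set is \<subseteq> {..<1}" "length is = n" for "is" :: "nat list"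
  proof -
    have "map (\<lambda>_. mstar) is = replicate n mstar" using that(2) by (simp add: map_replicate_const)
    thus ?thesis using cl(4) rmod.smult_one[OF lin_space.rmod[OF S2]] by simp
  qed
  have c1: "comparison ?M1 \<in> lin_hom (cxR ?T1) (cxR ?S1)"
    by (rule power_sys_cmp_hom[OF M.V M.cmp_hom w cl(2) s1 a1])
  have d: "lin_space (betti (dual_sys L))" "comparison (dual_sys L) \<in> lin_hom (cxR (betti (dual_sys L))) (cxR (derham (dual_sys L)))"
    "frame (derham (dual_sys L)) 1 (\<lambda>_. mstar) (\<lambda>_ f. f (m0 0))"
    using Vd.V dual_sys_cmp_hom[OF mu] Wd_frame by (simp_all only: sys_simps)
  have c2: "comparison ?M2 \<in> lin_hom (cxR ?T2) (cxR ?S2)"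
    using power_sys_cmp_hom[OF d, of ?Z2 False n "\<lambda>_. 1"] cl(4) s2 by (simp add: sys_simps del: dual_mod_simps)
  let ?p = "pdet v cw"
  have e1: "comparison ?M1 (cx_elt ?T1 ?a 1) = ?p \<odot>\<^bsub>cxR ?S1\<^esub> cx_elt ?S1 ?Z1 1"
  proof -
    let ?Cs = "map (\<lambda>x i. coord (cw i) (M.cmp (cx_elt M.V x 1))) (map v [0..<2*n])"
    have "comparison ?M1 (cx_elt ?T1 ?a 1) = evl (2*n) (\<lambda>is. emb (list_sign is)) ?Cs \<odot>\<^bsub>cxR ?S1\<^esub> cx_elt ?S1 ?Z1 1"
      by (rule power_sys_cmp_elt[OF M.V M.cmp_hom w cl(2) s1 a1 tup(1)])
    also have "evl (2*n) (\<lambda>is. emb (list_sign is)) ?Cs = fdet (2*n) (\<lambda>j i. (?Cs ! j) i)"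
      unfolding ls by (rule evl_list_sign) simp
    also have "\<dots> = fdet (2*n) (\<lambda>j i. coord (cw i) (M.cmp (cx_elt M.V (v j) 1)))" by (rule fdet_cong) simp
    \<comment> \<open>\<open>evl_list_sign\<close> puts the source vectors in rows,
      \<open>pdet\<close> in columns.\<close>
    also have "\<dots> = ?p" unfolding pdet_def by (rule fdet_transpose)
    finally show ?thesis .
  qed
  have e2: "comparison ?M2 (cx_elt ?T2 ?b 1) = mu ^ n \<odot>\<^bsub>cxR ?S2\<^esub> cx_elt ?S2 ?Z2 1"
  proof -
    let ?C = "\<lambda>f i. coord (\<lambda>f. f (m0 0)) (comparison (dual_sys L) (cx_elt Vd f 1))"
    have C: "?C lstar i = mu" for i :: nat
      using dual_sys_cmp[OF mu, of "cx_elt Vd lstar 1"] Vd.e_closed[of 0] Wd.e_closed[of 0] Vd.coord_e[of 0 0] Wd.coord_e[of 0 0]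
        lin_hom_smult[OF coord_hom[OF Wd.V Wd.c_hom[of 0]], of "cx_elt Wd mstar 1"] by simp
    have "comparison ?M2 (cx_elt ?T2 ?b 1) = evl 1 (\<lambda>_. emb 1) (map ?C (replicate n lstar)) \<odot>\<^bsub>cxR ?S2\<^esub> cx_elt ?S2 ?Z2 1"
      using power_sys_cmp_elt[OF d, of ?Z2 False n "\<lambda>_. 1" "replicate n lstar"] cl(4) s2 tup(3) by (simp add: sys_simps del: dual_mod_simps)
    also have "evl 1 (\<lambda>_. emb 1) (map ?C (replicate n lstar)) = mu ^ n"
      using evl_one[of "replicate n (\<lambda>_. mu)"] by (simp add: C emb_def)
    finally show ?thesis .
  qed
  have h: "bdr_hom (tensor_sys ?M1 ?M2) unit_sys \<tau> \<tau>'" using iso by (simp add: bdr_iso_def)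
  have \<tau>: "\<tau> \<in> lin_hom (tensor_mod ?T1 ?T2) scalar_mod" "\<tau>' \<in> lin_hom (tensor_mod ?S1 ?S2) scalar_mod"
    using bdr_hom_components(1,2)[OF h] by (simp_all only: sys_simps)
  let ?ab = "tensor_elt ?T1 ?T2 ?a ?b" and ?ZZ = "tensor_elt ?S1 ?S2 ?Z1 ?Z2"
  have abc: "?ab \<in> carrier (tensor_mod ?T1 ?T2)" by (rule tensor_elt_closed[OF T1 T2 cl(1,3)])
  have ZZc: "?ZZ \<in> carrier (tensor_mod ?S1 ?S2)" by (rule tensor_elt_closed[OF S1 S2 cl(2,4)])
  have "cx_elt scalarE (\<tau> ?ab) 1 = cxm scalarE \<tau>' (comparison (tensor_sys ?M1 ?M2) (cx_elt (tensor_mod ?T1 ?T2) ?ab 1))"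
    using bdr_hom_components(5)[OF h, unfolded sys_simps, OF cxR_elt_closed[OF T abc]] cxm_elt[OF T E \<tau>(1) abc] by simp
  also have "comparison (tensor_sys ?M1 ?M2) (cx_elt (tensor_mod ?T1 ?T2) ?ab 1)
      = cx_tensor ?S1 ?S2 (comparison ?M1 (cx_elt ?T1 ?a 1)) (comparison ?M2 (cx_elt ?T2 ?b 1))"
    using tensor_sys_cmp_elt[of ?M1 ?M2 ?a ?b, unfolded sys_simps, OF T1 S1 T2 S2 c1 c2 cl(1,3)] .
  also have "\<dots> = cx_tensor ?S1 ?S2 (?p \<odot>\<^bsub>cxR ?S1\<^esub> cx_elt ?S1 ?Z1 1) (mu ^ n \<odot>\<^bsub>cxR ?S2\<^esub> cx_elt ?S2 ?Z2 1)"
    unfolding e1 e2 ..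
  also have "\<dots> = (?p * mu ^ n) \<odot>\<^bsub>cxR (tensor_mod ?S1 ?S2)\<^esub> cx_elt (tensor_mod ?S1 ?S2) ?ZZ 1"
  proof -
    interpret SC: rmod "cxR (tensor_mod ?S1 ?S2)" by (rule rmod_cxR[OF S])
    have z: "cx_elt ?S1 ?Z1 1 \<in> carrier (cxR ?S1)" "cx_elt ?S2 ?Z2 1 \<in> carrier (cxR ?S2)"
      by (intro cxR_elt_closed S1 S2 cl)+
    have qz: "mu ^ n \<odot>\<^bsub>cxR ?S2\<^esub> cx_elt ?S2 ?Z2 1 \<in> carrier (cxR ?S2)" by (rule rmod.smult_closed[OF rmod_cxR[OF S2] z(2)])
    show ?thesis
      unfolding lin_hom_smult[OF cx_tensor_hom_left[OF S1 S2 qz] z(1)] lin_hom_smult[OF cx_tensor_hom_right[OF S1 S2 z(1)] z(2)]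
        cx_tensor_elt[OF S1 S2 cl(2,4)]
      by (rule SC.smult_smult[OF cxR_elt_closed[OF S ZZc]])
  qed
  also have "cxm scalarE \<tau>' \<dots> = (?p * mu ^ n) \<odot>\<^bsub>cxR scalarE\<^esub> cx_elt scalarE (\<tau>' ?ZZ) 1"
    unfolding lin_hom_smult[OF cxm_hom[OF S E \<tau>(2)] cxR_elt_closed[OF S ZZc]] cxm_elt[OF S E \<tau>(2) ZZc] ..
  finally have "Abs_ec (cx_elt scalarE (\<tau> ?ab) 1) = Abs_ec ((?p * mu ^ n) \<odot>\<^bsub>cxR scalarE\<^esub> cx_elt scalarE (\<tau>' ?ZZ) 1)"
    by simp
  hence eq: "emb (\<tau> ?ab) = ?p * mu ^ n * emb (\<tau>' ?ZZ)"
    using lin_hom_smult[OF self_hom_scalarE cxR_elt_closed[OF E, of "\<tau>' ?ZZ" 1]] by (simp add: Abs_cx_elt emb_def)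
  have "lam ^ n * emb (\<tau> ?ab) = (mu * lam) ^ n * (?p * emb (\<tau>' ?ZZ))"
    unfolding eq by (simp only: power_mult_distrib mult_ac)
  hence "?p * emb (\<tau>' ?ZZ) = lam ^ n * emb (\<tau> ?ab)" unfolding mu by simp
  \<comment> \<open>An isomorphism kills no nonzero element, and the generator is nonzero.\<close>
  moreover have "\<tau> ?ab \<noteq> 0"
  proof
    assume 0: "\<tau> ?ab = 0"
    have "\<exists>f' g'. bdr_hom unit_sys (tensor_sys ?M1 ?M2) f' g' \<and>
        (\<forall>x\<in>carrier (betti (tensor_sys ?M1 ?M2)). f' (\<tau> x) = x) \<and>
        (\<forall>x\<in>carrier (betti unit_sys). \<tau> (f' x) = x) \<and>
        (\<forall>y\<in>carrier (derham (tensor_sys ?M1 ?M2)). g' (\<tau>' y) = y) \<and>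
        (\<forall>y\<in>carrier (derham unit_sys). \<tau>' (g' y) = y)"
      using iso unfolding bdr_iso_def by (rule conjunct2)
    then obtain f' g' where f': "bdr_hom unit_sys (tensor_sys ?M1 ?M2) f' g'"
      and inv: "\<forall>x\<in>carrier (betti (tensor_sys ?M1 ?M2)). f' (\<tau> x) = x"
      by (elim exE conjE) (rule that)
    have f'h: "f' \<in> lin_hom scalar_mod (tensor_mod ?T1 ?T2)" using bdr_hom_components(1)[OF f'] by (simp only: sys_simps)
    have "f' (\<tau> ?ab) = ?ab" using inv abc by (simp only: sys_simps)
    hence "?ab = \<zero>\<^bsub>tensor_mod ?T1 ?T2\<^esub>" unfolding 0 using lin_hom_zero[OF E T f'h] by simp
    thus False using top_power_tensor_nonzero[OF v Vd_frame, of n] by simp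
  qed
  ultimately show "\<exists>\<alpha> \<beta>. \<beta> \<noteq> 0 \<and> pdet v cw * emb \<alpha> = lam ^ n * emb \<beta>" by (intro exI conjI)
qed

theorem theorem3p7p1:
  fixes M :: "('e :: number_field, 'b, 'd) bdr"
    and L :: "('e, 'l, 'm) bdr"
    and n :: nat
    and B :: "('b \<times> 'b \<Rightarrow>\<^sub>0 'e) set \<Rightarrow> 'l"
    and BdR :: "('d \<times> 'd \<Rightarrow>\<^sub>0 'e) set \<Rightarrow> 'm"
  assumes "betti_de_rham M"
    and "vectorspace.dim class_ring (betti M) = 2 * n"
    and "even (weight M) \<longrightarrow> vanishing_middle M"
    and "betti_de_rham L"
    and "vectorspace.dim class_ring (betti L) = 1"
    and "symplectic_structure M L B BdR \<or> orthogonal_structure n M L B BdR"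
    and "\<forall>x \<in> carrier (betti L). Finf L x = x"
  shows "c_plus M = c_minus M"
proof -
  interpret M: bdr_system M by standard (rule assms(1))
  interpret L: bdr_system L by standard (rule assms(4))
  obtain v cv where v: "frame M.V (2 * n) v cv" using fin_dim_frame[OF M.V M.V_fin] assms(2) by metis
  obtain l0 l1 where l: "frame L.V 1 l0 l1" using fin_dim_frame[OF L.V L.V_fin] assms(5) by metis
  obtain r m0 m1 where m: "frame L.W r m0 m1" using L.W_frame by blast
  \<comment> \<open>The rank of \<open>L\<^sub>d\<^sub>R\<close> follows from that of
    \<open>L\<^sub>B\<close> through the comparison isomorphism.\<close>
  have "r = 1" using frame_iso(1)[OF l m L.cmp_hom L.cmp_bij] by simp
  note m = m[unfolded this]
  have s: "bdr_hom (tensor_sys M M) L B BdR" "nondegenerate_form M.V L.V B"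
    using assms(6) by (auto simp: symplectic_structure_def orthogonal_structure_def)
  interpret bdr_pairing M L B BdR n l0 l1 m0 m1
    by standard (use s l m assms(7) in auto)
  have rational_pdet using assms(6)
  proof
    assume "symplectic_structure M L B BdR"
    thus ?thesis by (intro symplectic_rational_pdet) (simp add: symplectic_structure_def)
  next
    assume "orthogonal_structure n M L B BdR"
    thus ?thesis by (auto simp: orthogonal_structure_def intro: orthogonal_rational_pdet)
  qed
  thus ?thesis by (rule c_plus_eq_c_minus[OF assms(3) _ v])
qed

end
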